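(* Let $T>0$, $x_0\in\mathbb{R}$, let $\gamma>0$ be such that $2\gamma$ is a positive integer, and let $F,G:[0,\infty)\times\mathbb{R}\to\mathbb{R}$ be jointly continuous. With the multi-index notation $f_\alpha$, $\mathcal{A}_\gamma$, $\mathcal{R}(\mathcal{A}_\gamma)$, $v$, $-\alpha$ of the context, assume that there exist families of continuous, nondecreasing functions $\{h_\alpha:[0,\infty)\to[0,\infty):\alpha\in\mathcal{A}_\gamma\setminus\{v\}\}$ and $\{k_\alpha:[0,\infty)\to(0,\infty):\alpha\in\mathcal{R}(\mathcal{A}_\gamma)\}$ such that for all $u\ge0$ and $x,y\in\mathbb{R}$: - $f_{-\alpha}\in C^{1,2}$ for $\alpha\in(\mathcal{A}_\gamma\cup\mathcal{R}(\mathcal{A}_\gamma))\setminus\{v\}$; - $|f_\alpha(u,x)-f_\alpha(u,y)|\le h_\alpha(u)|x-y|$ for $\alpha\in\mathcal{A}_\gamma\setminus\{v\}$; - $|f_\alpha(u,x)|\le h_\alpha(u)(1+|x|)$ for $\alpha\in\mathcal{A}_\gamma\setminus\{v\}$; - $|f_\alpha(u,x)|\le k_\alpha(u)(1+|x|)$ for $\alpha\in\mathcal{R}(\mathcal{A}_\gamma)$. Let $X$ be the solution of the SDE $$X_t=x_0+\int_0^tF(E_r,X_r)\,\mathrm{d}E_r+\int_0^tG(E_r,X_r)\,\mathrm{d}B_{E_r},\qquad t\in[0,T],$$ assume that the Laplace exponent $\psi$ of $D$ is regularly varying at $\infty$ with index $\beta\in(0,1)$, and for $\delta\in(0,1)$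 let $X^\delta=(X^\delta_t)_{t\in[0,T]}$ be the Itô--Taylor-type approximation process (for the given $\gamma$) with step size $\delta$ and continuous interpolation defined in the context. If $h_\alpha$ ($\alpha\in\mathcal{A}_\gamma\setminus\{v\}$) and $\log k_\alpha$ ($\alpha\in\mathcal{R}(\mathcal{A}_\gamma)$) are regularly varying at $\infty$ with indices $q_\alpha\ge0$ and $\tilde q_\alpha\ge0$, respectively, and $\beta\in\left(\frac{q_{***}-1}{q_{***}},1\right)$, where $$q_{***}:=\max\Big\{\max_{\alpha\in\mathcal{A}_\gamma\setminus\{v\}}(2q_\alpha+2),\ \max_{\alpha\in\mathcal{R}(\mathcal{A}_\gamma)}\tilde q_\alpha\Big\},$$ then there exists a constant $C>0$ not depending on $\delta$ such that for all $\delta\in(0,1)$, $$\mathbb{E}\Big[\sup_{0\le s\le T}|X_s-X^\delta_s|\Big]\le C\,\delta^\gamma.$$ Thus, $X^\delta$ converges strongly to $X$ uniformly on $[0,T]$ with order $\gamma$. Moreover, if $h_\alpha$ is constant for all $\alpha\in\mathcal{A}_\gamma\setminus\{v\}$ and $k_\alpha$ is constant for all $\alpha\in\mathcal{R}(\mathcal{A}_\gamma)$, the same conclusion holds as long as $\beta\in(1/2,1)$.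
   Context: Setting. $(\Omega,\mathcal{F},\mathbb{P})$ is a complete probability space with a filtration $(\mathcal{F}_t)_{t\ge0}$ satisfying the usual conditions; $B$ is a one-dimensional $(\mathcal{F}_t)$-adapted Brownian motion, independent of an $(\mathcal{F}_t)$-adapted subordinator $D$ with $D_0=0$, killing rate $0$, drift $0$ and infinite Lévy measure $\nu$. Its Laplace exponent is $\psi(s)=\int_0^\infty(1-e^{-sy})\,\nu(\mathrm{d}y)$, so $\mathbb{E}[e^{-sD_t}]=e^{-t\psi(s)}$. The probability space is the product $(\Omega_B\times\Omega_D,\mathcal{F}_B\times\mathcal{F}_D,\mathbb{P}_B\times\mathbb{P}_D)$, with $B$ depending only on the first coordinate and $D$ only on the second. The inverse of $D$ is $E_t:=\inf\{u>0:D_u>t\}$, which has continuous nondecreasing paths; $B\circ E=(B_{E_t})$ is a continuous $(\mathcal{F}_{E_t})$-martingale, and SDEs are understood as driven by continuous $(\mathcal{F}_{E_t})$-semimartingales. Under the stated assumptions the SDE has a unique strong solution, which is continuous. A function $f:(0,\infty)\to(0,\infty)$ is regularly varying at $\infty$ with index $p\in\mathbb{R}$ if $\lim_{s\to\infty}f(cs)/f(s)=c^p$ for every $c>0$. $C^{1,2}$ means $C^1$ in the first variable $u$ and $C^2$ in the second variable $x$. Multi-indices. Let $$L^0:=\frac{\partial}{\partial u}+F\frac{\partial}{\partial x}+\frac12G^2\frac{\partial^2}{\partial x^2},\qquad L^1:=G\frac{\partial}{\partial x},\qquad G^0:=F,\quad G^1:=G.$$ A multi-index is $\alpha=(j_1,\dots,j_\ell)$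 with $j_i\in\{0,1\}$ and $\ell\ge1$, or the multi-index $v$ of length $0$. Set $f_\alpha:=L^{j_1}\cdots L^{j_{\ell-1}}G^{j_\ell}$ if $\ell\ge2$, $f_\alpha:=G^{j_1}$ if $\ell=1$, and $f_v(u,x):=x$. Let $\ell(\alpha)$ be the length of $\alpha$, $n(\alpha)$ the number of its zero components, and for $\ell(\alpha)\ge1$ let $-\alpha:=(j_2,\dots,j_\ell)$ (equal to $v$ if $\ell(\alpha)=1$). Put $$\mathcal{A}_\gamma:=\Big\{\alpha:\ \ell(\alpha)+n(\alpha)\le2\gamma\ \text{ or }\ \ell(\alpha)=n(\alpha)=\gamma+\tfrac12\Big\},\qquad \mathcal{R}(\mathcal{A}_\gamma):=\{\alpha\notin\mathcal{A}_\gamma:\ -\alpha\in\mathcal{A}_\gamma\}.$$ With $\mathrm{d}B^{(0)}_{E_r}:=\mathrm{d}E_r$ and $\mathrm{d}B^{(1)}_{E_r}:=\mathrm{d}B_{E_r}$, define for $\ell=\ell(\alpha)\ge1$ the multiple (iterated stochastic) integral $$I_\alpha(f_\alpha(E_\cdot,X_\cdot))_{a,b}:=\int_{a\le r_1\le\cdots\le r_\ell\le b}f_\alpha(E_{r_1},X_{r_1})\,\mathrm{d}B^{(j_1)}_{E_{r_1}}\cdots\mathrm{d}B^{(j_\ell)}_{E_{r_\ell}};$$ $I_\alpha(f_\alpha(E_{\tau_n},X^\delta_{\tau_n}))_{a,b}$ denotes the same integral with the integrand replaced by the value $f_\alpha(E_{\tau_n},X^\delta_{\tau_n})$, which is constant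 in the integration variables. Approximation. Fix $\delta\in(0,1)$. Put $\tau_n:=D_{n\delta}$, $n=0,1,2,\dots$, and let $N$ be the random nonnegative integer with $T\in[D_{N\delta},D_{(N+1)\delta})$. Note $E_{\tau_n}=n\delta$ a.s. Set $X^\delta_0:=x_0$ and for $n=0,\dots,N-1$, $$X^\delta_{\tau_{n+1}}:=X^\delta_{\tau_n}+\sum_{\alpha\in\mathcal{A}_\gamma\setminus\{v\}}I_\alpha\big(f_\alpha(E_{\tau_n},X^\delta_{\tau_n})\big)_{\tau_n,\tau_{n+1}}.$$ Continuous interpolation: for $s\in[\tau_n,\tau_{n+1})$, $X^\delta_s:=X^\delta_{\tau_n}+\sum_{\alpha\in\mathcal{A}_\gamma\setminus\{v\}}I_\alpha(f_\alpha(E_{\tau_n},X^\delta_{\tau_n}))_{\tau_n,s}$. Strong convergence: $X^\delta$ converges strongly to $X$ uniformly on $[0,T]$ with order $\eta\in(0,\infty)$ if there exist finite positive constants $C,\delta_0$ such that $\mathbb{E}[\sup_{0\le t\le T}|X_t-X^\delta_t|]\le C\delta^\eta$ for all $\delta\in(0,\delta_0)$. *)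

theory Defs
  imports "HOL-Probability.Probability"
begin

section \<open>Filtrations and driving processes\<close>

text \<open>
  Time is real-valued, so that the library's \<^const>\<open>filtration\<close>, \<^const>\<open>stopping_time\<close> and
  \<open>pre_sigma\<close> apply; only times \<open>t \<ge> 0\<close> carry content.  All stopping times below are
  almost surely nonnegative.  Null sets are also placed in the dummy \<open>\<sigma>\<close>-algebras at
  negative times, so that an exceptional null set of paths never spoils the stopping time property.
\<close>

definition usual_filtration :: "'a measure \<Rightarrow> (real \<Rightarrow> 'a measure) \<Rightarrow> bool" where
  "usual_filtration M \<F> \<longleftrightarrow>
     filtration (space M) \<F> \<and>
     (\<forall>t. subalgebra M (\<F> t)) \<and>
     (\<forall>t. null_sets M \<subseteq> sets (\<F> t)) \<and>
     (\<forall>t\<ge>0. sets (\<F> t) = (\<Inter>s\<in>{t<..}. sets (\<F> s)))"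

definition adapted_on :: "real set \<Rightarrow> (real \<Rightarrow> 'a measure) \<Rightarrow> (real \<Rightarrow> 'a \<Rightarrow> real) \<Rightarrow> bool" where
  "adapted_on I \<F> Y \<longleftrightarrow> (\<forall>t\<in>I. Y t \<in> borel_measurable (\<F> t))"

text \<open>Brownian motion relative to the filtration: increments after \<open>s\<close> are independent of the
  whole of \<open>\<F> s\<close>.\<close>

definition brownian_motion ::
    "'a measure \<Rightarrow> (real \<Rightarrow> 'a measure) \<Rightarrow> (real \<Rightarrow> 'a \<Rightarrow> real) \<Rightarrow> bool" where
  "brownian_motion M \<F> B \<longleftrightarrow>
     adapted_on {0..} \<F> B \<and>
     (AE \<omega> in M. B 0 \<omega> = 0) \<and>
     (AE \<omega> in M. continuous_on {0..} (\<lambda>t. B t \<omega>)) \<and>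
     (\<forall>s t. 0 \<le> s \<longrightarrow> s < t \<longrightarrow>
        distributed M lborel (\<lambda>\<omega>. B t \<omega> - B s \<omega>) (\<lambda>x. ennreal (normal_density 0 (sqrt (t - s)) x)) \<and>
        prob_space.indep_set M (sets (\<F> s))
          (sets (vimage_algebra (space M) (\<lambda>\<omega>. B t \<omega> - B s \<omega>) borel)))"

text \<open>A real-valued (killing rate \<open>0\<close>) subordinator started at \<open>0\<close>.\<close>

definition subordinator ::
    "'a measure \<Rightarrow> (real \<Rightarrow> 'a measure) \<Rightarrow> (real \<Rightarrow> 'a \<Rightarrow> real) \<Rightarrow> bool" where
  "subordinator M \<F> D \<longleftrightarrow>
     adapted_on {0..} \<F> D \<and>
     (AE \<omega> in M. D 0 \<omega> = 0) \<and>
     (AE \<omega> in M. mono_on {0..} (\<lambda>t. D t \<omega>)) \<and>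
     (AE \<omega> in M. \<forall>t\<ge>0. continuous (at_right t) (\<lambda>u. D u \<omega>)) \<and>
     (\<forall>s t. 0 \<le> s \<longrightarrow> s < t \<longrightarrow>
        distr M borel (\<lambda>\<omega>. D t \<omega> - D s \<omega>) = distr M borel (\<lambda>\<omega>. D (t - s) \<omega> - D 0 \<omega>)) \<and>
     (\<forall>(n::nat) r. 0 \<le> r 0 \<longrightarrow> (\<forall>i<n. r i \<le> r (Suc i)) \<longrightarrow>
        prob_space.indep_vars M (\<lambda>_. borel) (\<lambda>i \<omega>. D (r (Suc i)) \<omega> - D (r i) \<omega>) {..<n})"

definition levy_measure :: "real measure \<Rightarrow> bool" where
  "levy_measure \<nu> \<longleftrightarrow>
     sets \<nu> = sets borel \<and> emeasure \<nu> {..0} = 0 \<and>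
     (\<integral>\<^sup>+ y. ennreal (min 1 y) \<partial>\<nu>) < \<infinity>"

text \<open>Laplace exponent of the driftless, unkilled subordinator with Levy measure \<open>\<nu>\<close>.\<close>

definition laplace_exponent :: "real measure \<Rightarrow> real \<Rightarrow> real" where
  "laplace_exponent \<nu> s = (\<integral>y. 1 - exp (- (s * y)) \<partial>\<nu>)"

definition first_passage :: "(real \<Rightarrow> 'a \<Rightarrow> real) \<Rightarrow> real \<Rightarrow> 'a \<Rightarrow> real" where
  "first_passage D t \<omega> = Inf {u. 0 < u \<and> t < D u \<omega>}"

text \<open>
  The underlying space is the completion of the product (the product of two complete
  spaces need not be complete).  The processes \<open>B\<close> and \<open>D\<close> are functions of the first and of the
  second coordinate, respectively; in particular they are independent.
\<close>

definition product_setting ::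
    "'b measure \<Rightarrow> 'd measure \<Rightarrow> ('b \<times> 'd) measure \<Rightarrow> (real \<Rightarrow> 'b \<times> 'd \<Rightarrow> real)
      \<Rightarrow> (real \<Rightarrow> 'b \<times> 'd \<Rightarrow> real) \<Rightarrow> bool" where
  "product_setting MB MD M B D \<longleftrightarrow>
     prob_space MB \<and> prob_space MD \<and> M = completion (MB \<Otimes>\<^sub>M MD) \<and>
     (\<forall>t\<ge>0. \<exists>b\<in>borel_measurable MB. \<forall>\<omega>\<in>space M. B t \<omega> = b (fst \<omega>)) \<and>
     (\<forall>t\<ge>0. \<exists>d\<in>borel_measurable MD. \<forall>\<omega>\<in>space M. D t \<omega> = d (snd \<omega>))"

definition driven_setting ::
    "'b measure \<Rightarrow> 'd measure \<Rightarrow> ('b \<times> 'd) measure \<Rightarrow> (real \<Rightarrow> ('b \<times> 'd) measure)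
      \<Rightarrow> (real \<Rightarrow> 'b \<times> 'd \<Rightarrow> real) \<Rightarrow> (real \<Rightarrow> 'b \<times> 'd \<Rightarrow> real) \<Rightarrow> real measure \<Rightarrow> bool" where
  "driven_setting MB MD M \<F> B D \<nu> \<longleftrightarrow>
     product_setting MB MD M B D \<and>
     usual_filtration M \<F> \<and>
     brownian_motion M \<F> B \<and>
     subordinator M \<F> D \<and>
     levy_measure \<nu> \<and> emeasure \<nu> {0<..} = \<infinity> \<and>
     (\<forall>s>0. \<forall>t\<ge>0. (\<integral>\<omega>. exp (- (s * D t \<omega>)) \<partial>M) = exp (- (t * laplace_exponent \<nu> s)))"

definition time_changed_filtration ::
    "'a measure \<Rightarrow> (real \<Rightarrow> 'a measure) \<Rightarrow> (real \<Rightarrow> 'a \<Rightarrow> real) \<Rightarrow> real \<Rightarrow> 'a measure" where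
  "time_changed_filtration M \<F> E t = filtration.pre_sigma (space M) \<F> (E t)"

text \<open>The two integrators: \<open>driver B E 0 = E\<close> and \<open>driver B E 1 = B \<circ> E\<close>.\<close>

definition driver ::
    "(real \<Rightarrow> 'a \<Rightarrow> real) \<Rightarrow> (real \<Rightarrow> 'a \<Rightarrow> real) \<Rightarrow> nat \<Rightarrow> real \<Rightarrow> 'a \<Rightarrow> real" where
  "driver B E j = (if j = 0 then E else (\<lambda>t \<omega>. B (E t \<omega>) \<omega>))"


section \<open>Stochastic integrals with respect to continuous semimartingales\<close>

text \<open>
  The integral \<open>\<integral>\<^sub>0\<^sup>t H dZ\<close>, \<open>t \<in> [0,T]\<close>, of an adapted left-continuous process with right
  limits is the extension by continuity, for uniform convergence in probability, of the
  elementary integral of simple predictable processes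
  \<open>\<Sum>i<n. K i \<cdot> 1\<^bsub>(S i, S (i+1)]\<^esub>\<close> with stopping times \<open>S i\<close> and \<open>\<G>\<^bsub>S i\<^esub>\<close>-measurable
  \<open>K i\<close>.  Integrals are over \<open>(0,t]\<close>.
\<close>

definition simple_predictable ::
    "'a measure \<Rightarrow> (real \<Rightarrow> 'a measure) \<Rightarrow> nat \<times> (nat \<Rightarrow> 'a \<Rightarrow> real) \<times> (nat \<Rightarrow> 'a \<Rightarrow> real) \<Rightarrow> bool" where
  "simple_predictable M \<G> = (\<lambda>(n, S, K).
     (\<forall>i\<le>n. stopping_time \<G> (S i) \<and> (\<forall>\<omega>\<in>space M. 0 \<le> S i \<omega>)) \<and>
     (\<forall>i<n. \<forall>\<omega>\<in>space M. S i \<omega> \<le> S (Suc i) \<omega>) \<and>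
     (\<forall>i<n. K i \<in> borel_measurable (filtration.pre_sigma (space M) \<G> (S i))))"

definition simple_process ::
    "nat \<times> (nat \<Rightarrow> 'a \<Rightarrow> real) \<times> (nat \<Rightarrow> 'a \<Rightarrow> real) \<Rightarrow> real \<Rightarrow> 'a \<Rightarrow> real" where
  "simple_process = (\<lambda>(n, S, K) t \<omega>. \<Sum>i<n. K i \<omega> * indicator {S i \<omega><..S (Suc i) \<omega>} t)"

definition simple_integral ::
    "(real \<Rightarrow> 'a \<Rightarrow> real) \<Rightarrow> nat \<times> (nat \<Rightarrow> 'a \<Rightarrow> real) \<times> (nat \<Rightarrow> 'a \<Rightarrow> real) \<Rightarrow> real \<Rightarrow> 'a \<Rightarrow> real" where
  "simple_integral Z = (\<lambda>(n, S, K) t \<omega>.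
     \<Sum>i<n. K i \<omega> * (Z (min t (S (Suc i) \<omega>)) \<omega> - Z (min t (S i \<omega>)) \<omega>))"

text \<open>
  Convergence in probability of \<open>sup\<^bsub>t \<in> I\<^esub> |Y k t - Y' t|\<close> to \<open>0\<close>, with outer probabilities
  (the exceptional event is only required to be covered by a measurable set of small measure).
\<close>

definition uniform_conv_in_prob ::
    "'a measure \<Rightarrow> real set \<Rightarrow> (nat \<Rightarrow> real \<Rightarrow> 'a \<Rightarrow> real) \<Rightarrow> (real \<Rightarrow> 'a \<Rightarrow> real) \<Rightarrow> bool" where
  "uniform_conv_in_prob M I Y Y' \<longleftrightarrow>
     (\<forall>\<epsilon>>0. \<forall>\<eta>>0. \<exists>k0. \<forall>k\<ge>k0. \<exists>A\<in>sets M. measure M A < \<eta> \<and>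
        (\<forall>\<omega>\<in>space M - A. \<forall>t\<in>I. \<bar>Y k t \<omega> - Y' t \<omega>\<bar> \<le> \<epsilon>))"

text \<open>
  \<open>stoch_integral M \<G> T Z H Y\<close>: \<open>Y\<close> is (a version of) the integral process of \<open>H\<close> against the
  continuous \<open>\<G>\<close>-semimartingale \<open>Z\<close> on \<open>[0,T]\<close>.
\<close>

definition stoch_integral ::
    "'a measure \<Rightarrow> (real \<Rightarrow> 'a measure) \<Rightarrow> real \<Rightarrow> (real \<Rightarrow> 'a \<Rightarrow> real) \<Rightarrow> (real \<Rightarrow> 'a \<Rightarrow> real)
      \<Rightarrow> (real \<Rightarrow> 'a \<Rightarrow> real) \<Rightarrow> bool" where
  "stoch_integral M \<G> T Z H Y \<longleftrightarrow>
     adapted_on {0<..T} \<G> H \<and>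
     (AE \<omega> in M. (\<forall>t\<in>{0<..T}. ((\<lambda>r. H r \<omega>) \<longlongrightarrow> H t \<omega>) (at_left t)) \<and>
                 (\<forall>t\<in>{0..<T}. \<exists>l. ((\<lambda>r. H r \<omega>) \<longlongrightarrow> l) (at_right t))) \<and>
     adapted_on {0..T} \<G> Y \<and>
     (AE \<omega> in M. continuous_on {0..T} (\<lambda>t. Y t \<omega>)) \<and>
     (\<exists>\<sigma>. (\<forall>k. simple_predictable M \<G> (\<sigma> k)) \<and>
          uniform_conv_in_prob M {0<..T} (\<lambda>k. simple_process (\<sigma> k)) H) \<and>
     (\<forall>\<sigma>. (\<forall>k. simple_predictable M \<G> (\<sigma> k)) \<longrightarrow>
          uniform_conv_in_prob M {0<..T} (\<lambda>k. simple_process (\<sigma> k)) H \<longrightarrow>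
          uniform_conv_in_prob M {0..T} (\<lambda>k. simple_integral Z (\<sigma> k)) Y)"

text \<open>
  \<open>multiple_integral M \<G> T Z a \<alpha> H Y\<close>: on \<open>[a,T]\<close>, \<open>Y b\<close> is the iterated integral
  \<open>\<integral>\<^bsub>a \<le> r\<^sub>1 \<le> \<dots> \<le> r\<^sub>\<ell> \<le> b\<^esub> H r\<^sub>1 dZ j\<^sub>1 r\<^sub>1 \<dots> dZ j\<^sub>\<ell> r\<^sub>\<ell>\<close> for \<open>\<alpha> = [j\<^sub>1, \<dots>, j\<^sub>\<ell>]\<close>; the first index of
  \<open>\<alpha>\<close> belongs to the innermost, the last one to the outermost integral.  The lower limit \<open>a\<close> is
  random and is implemented by the left-continuous indicator of \<open>(a,\<infinity>)\<close>.
\<close>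

inductive multiple_integral ::
    "'a measure \<Rightarrow> (real \<Rightarrow> 'a measure) \<Rightarrow> real \<Rightarrow> (nat \<Rightarrow> real \<Rightarrow> 'a \<Rightarrow> real) \<Rightarrow> ('a \<Rightarrow> real)
      \<Rightarrow> nat list \<Rightarrow> (real \<Rightarrow> 'a \<Rightarrow> real) \<Rightarrow> (real \<Rightarrow> 'a \<Rightarrow> real) \<Rightarrow> bool"
  for M \<G> T Z a where
  empty: "multiple_integral M \<G> T Z a [] H H"
| snoc: "multiple_integral M \<G> T Z a \<alpha> H Y \<Longrightarrow>
         stoch_integral M \<G> T (Z j) (\<lambda>r \<omega>. indicator {a \<omega><..} r * Y r \<omega>) Y' \<Longrightarrow>
         multiple_integral M \<G> T Z a (\<alpha> @ [j]) H Y'"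


section \<open>Multi-indices and coefficient functions\<close>

text \<open>Functions on \<open>[0,\<infinity>) \<times> \<real>\<close> are curried; the time derivative is one-sided at \<open>u = 0\<close>.\<close>

definition D_u :: "(real \<Rightarrow> real \<Rightarrow> real) \<Rightarrow> real \<Rightarrow> real \<Rightarrow> real" where
  "D_u f u x = vector_derivative (\<lambda>v. f v x) (at u within {0..})"

definition D_x :: "(real \<Rightarrow> real \<Rightarrow> real) \<Rightarrow> real \<Rightarrow> real \<Rightarrow> real" where
  "D_x f u x = deriv (f u) x"

definition jointly_continuous :: "(real \<Rightarrow> real \<Rightarrow> real) \<Rightarrow> bool" where
  "jointly_continuous f \<longleftrightarrow> continuous_on ({0..} \<times> UNIV) (\<lambda>(u, x). f u x)"

definition C12 :: "(real \<Rightarrow> real \<Rightarrow> real) \<Rightarrow> bool" where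
  "C12 f \<longleftrightarrow>
     (\<forall>u\<ge>0. \<forall>x. (\<lambda>v. f v x) differentiable (at u within {0..}) \<and>
        f u differentiable (at x) \<and> D_x f u differentiable (at x)) \<and>
     jointly_continuous f \<and> jointly_continuous (D_u f) \<and>
     jointly_continuous (D_x f) \<and> jointly_continuous (D_x (D_x f))"

definition L_op ::
    "(real \<Rightarrow> real \<Rightarrow> real) \<Rightarrow> (real \<Rightarrow> real \<Rightarrow> real) \<Rightarrow> nat
      \<Rightarrow> (real \<Rightarrow> real \<Rightarrow> real) \<Rightarrow> real \<Rightarrow> real \<Rightarrow> real" where
  "L_op F G j f u x =
     (if j = 0 then D_u f u x + F u x * D_x f u x + 1 / 2 * (G u x)\<^sup>2 * D_x (D_x f) u x
      else G u x * D_x f u x)"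

fun f_coeff ::
    "(real \<Rightarrow> real \<Rightarrow> real) \<Rightarrow> (real \<Rightarrow> real \<Rightarrow> real) \<Rightarrow> nat list \<Rightarrow> real \<Rightarrow> real \<Rightarrow> real" where
  "f_coeff F G [] = (\<lambda>u x. x)"
| "f_coeff F G [j] = (if j = 0 then F else G)"
| "f_coeff F G (j # i # \<alpha>) = L_op F G j (f_coeff F G (i # \<alpha>))"

definition multi_indices :: "nat list set" where
  "multi_indices = {\<alpha>. set \<alpha> \<subseteq> {0, 1}}"

definition A_set :: "real \<Rightarrow> nat list set" where
  "A_set \<gamma> = {\<alpha> \<in> multi_indices.
     real (length \<alpha> + count_list \<alpha> 0) \<le> 2 * \<gamma> \<or>
     (length \<alpha> = count_list \<alpha> 0 \<and> real (length \<alpha>) = \<gamma> + 1 / 2)}"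

text \<open>The remainder set; \<open>- \<alpha>\<close> is \<open>tl \<alpha>\<close>.\<close>

definition R_set :: "real \<Rightarrow> nat list set" where
  "R_set \<gamma> = {\<alpha> \<in> multi_indices. \<alpha> \<notin> A_set \<gamma> \<and> \<alpha> \<noteq> [] \<and> tl \<alpha> \<in> A_set \<gamma>}"

text \<open>Regular variation at infinity of a function from \<open>(0,\<infinity>)\<close> to \<open>(0,\<infinity>)\<close>.\<close>

definition regularly_varying :: "(real \<Rightarrow> real) \<Rightarrow> real \<Rightarrow> bool" where
  "regularly_varying f p \<longleftrightarrow>
     (\<forall>s>0. 0 < f s) \<and> (\<forall>c>0. ((\<lambda>s. f (c * s) / f s) \<longlongrightarrow> c powr p) at_top)"

definition q_star :: "real \<Rightarrow> (nat list \<Rightarrow> real) \<Rightarrow> (nat list \<Rightarrow> real) \<Rightarrow> real" where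
  "q_star \<gamma> q q' =
     max (Max ((\<lambda>\<alpha>. 2 * q \<alpha> + 2) ` (A_set \<gamma> - {[]}))) (Max (q' ` R_set \<gamma>))"

definition coefficient_bounds ::
    "real \<Rightarrow> (real \<Rightarrow> real \<Rightarrow> real) \<Rightarrow> (real \<Rightarrow> real \<Rightarrow> real)
      \<Rightarrow> (nat list \<Rightarrow> real \<Rightarrow> real) \<Rightarrow> (nat list \<Rightarrow> real \<Rightarrow> real) \<Rightarrow> bool" where
  "coefficient_bounds \<gamma> F G h k \<longleftrightarrow>
     (\<forall>\<alpha>\<in>A_set \<gamma> - {[]}. continuous_on {0..} (h \<alpha>) \<and> mono_on {0..} (h \<alpha>) \<and> (\<forall>u\<ge>0. 0 \<le> h \<alpha> u)) \<and>
     (\<forall>\<alpha>\<in>R_set \<gamma>. continuous_on {0..} (k \<alpha>) \<and> mono_on {0..} (k \<alpha>) \<and> (\<forall>u\<ge>0. 0 < k \<alpha> u)) \<and>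
     (\<forall>\<alpha>\<in>(A_set \<gamma> \<union> R_set \<gamma>) - {[]}. C12 (f_coeff F G (tl \<alpha>))) \<and>
     (\<forall>\<alpha>\<in>A_set \<gamma> - {[]}. \<forall>u\<ge>0. \<forall>x y.
        \<bar>f_coeff F G \<alpha> u x - f_coeff F G \<alpha> u y\<bar> \<le> h \<alpha> u * \<bar>x - y\<bar>) \<and>
     (\<forall>\<alpha>\<in>A_set \<gamma> - {[]}. \<forall>u\<ge>0. \<forall>x. \<bar>f_coeff F G \<alpha> u x\<bar> \<le> h \<alpha> u * (1 + \<bar>x\<bar>)) \<and>
     (\<forall>\<alpha>\<in>R_set \<gamma>. \<forall>u\<ge>0. \<forall>x. \<bar>f_coeff F G \<alpha> u x\<bar> \<le> k \<alpha> u * (1 + \<bar>x\<bar>))"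


section \<open>The equation and its approximation\<close>

definition solves_SDE ::
    "'a measure \<Rightarrow> (real \<Rightarrow> 'a measure) \<Rightarrow> (real \<Rightarrow> 'a \<Rightarrow> real) \<Rightarrow> (real \<Rightarrow> 'a \<Rightarrow> real) \<Rightarrow> real
      \<Rightarrow> (real \<Rightarrow> real \<Rightarrow> real) \<Rightarrow> (real \<Rightarrow> real \<Rightarrow> real) \<Rightarrow> real \<Rightarrow> (real \<Rightarrow> 'a \<Rightarrow> real) \<Rightarrow> bool" where
  "solves_SDE M \<G> B E T F G x0 X \<longleftrightarrow>
     adapted_on {0..T} \<G> X \<and>
     (AE \<omega> in M. continuous_on {0..T} (\<lambda>t. X t \<omega>)) \<and>
     (\<exists>I0 I1.
        stoch_integral M \<G> T (driver B E 0) (\<lambda>r \<omega>. F (E r \<omega>) (X r \<omega>)) I0 \<and>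
        stoch_integral M \<G> T (driver B E 1) (\<lambda>r \<omega>. G (E r \<omega>) (X r \<omega>)) I1 \<and>
        (AE \<omega> in M. \<forall>t\<in>{0..T}. X t \<omega> = x0 + I0 t \<omega> + I1 t \<omega>))"

text \<open>
  \<open>\<tau> n = D (n \<delta>)\<close>, and \<open>J n \<alpha>\<close> is the multiple integral, started at \<open>\<tau> n\<close>, of
  the integrand frozen at \<open>\<tau> n\<close>.  Its values matter only where \<open>\<tau> n \<le> T\<close>.
\<close>

definition ito_taylor_approx ::
    "'a measure \<Rightarrow> (real \<Rightarrow> 'a measure) \<Rightarrow> (real \<Rightarrow> 'a \<Rightarrow> real) \<Rightarrow> (real \<Rightarrow> 'a \<Rightarrow> real)
      \<Rightarrow> (real \<Rightarrow> 'a \<Rightarrow> real) \<Rightarrow> real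
      \<Rightarrow> (real \<Rightarrow> real \<Rightarrow> real) \<Rightarrow> (real \<Rightarrow> real \<Rightarrow> real) \<Rightarrow> real \<Rightarrow> real \<Rightarrow> real
      \<Rightarrow> (real \<Rightarrow> 'a \<Rightarrow> real) \<Rightarrow> bool" where
  "ito_taylor_approx M \<G> B D E T F G x0 \<gamma> \<delta> X\<delta> \<longleftrightarrow>
     (let \<tau> = (\<lambda>n::nat. D (real n * \<delta>)) in
      (AE \<omega> in M. X\<delta> 0 \<omega> = x0) \<and>
      (\<exists>J.
        (\<forall>n. \<forall>\<alpha>\<in>A_set \<gamma> - {[]}.
           multiple_integral M \<G> T (driver B E) (\<tau> n) \<alpha>
             (\<lambda>r \<omega>. f_coeff F G \<alpha> (E (\<tau> n \<omega>) \<omega>) (X\<delta> (\<tau> n \<omega>) \<omega>)) (J n \<alpha>)) \<and>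
        (AE \<omega> in M. \<forall>N. T \<in> {\<tau> N \<omega>..<\<tau> (Suc N) \<omega>} \<longrightarrow>
           (\<forall>n<N. X\<delta> (\<tau> (Suc n) \<omega>) \<omega> =
              X\<delta> (\<tau> n \<omega>) \<omega> + (\<Sum>\<alpha>\<in>A_set \<gamma> - {[]}. J n \<alpha> (\<tau> (Suc n) \<omega>) \<omega>)) \<and>
           (\<forall>n\<le>N. \<forall>s\<in>{\<tau> n \<omega>..<\<tau> (Suc n) \<omega>} \<inter> {0..T}. X\<delta> s \<omega> =
              X\<delta> (\<tau> n \<omega>) \<omega> + (\<Sum>\<alpha>\<in>A_set \<gamma> - {[]}. J n \<alpha> s \<omega>)))))"

text \<open>Expectation of the supremum of the error, as an extended nonnegative number.\<close>

definition strong_error ::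
    "'a measure \<Rightarrow> real \<Rightarrow> (real \<Rightarrow> 'a \<Rightarrow> real) \<Rightarrow> (real \<Rightarrow> 'a \<Rightarrow> real) \<Rightarrow> ennreal" where
  "strong_error M T X X\<delta> = (\<integral>\<^sup>+ \<omega>. (SUP t\<in>{0..T}. ennreal \<bar>X t \<omega> - X\<delta> t \<omega>\<bar>) \<partial>M)"

definition converges_strongly ::
    "'a measure \<Rightarrow> real \<Rightarrow> (real \<Rightarrow> 'a \<Rightarrow> real) \<Rightarrow> (real \<Rightarrow> real \<Rightarrow> 'a \<Rightarrow> real) \<Rightarrow> real \<Rightarrow> bool" where
  "converges_strongly M T X Xd \<eta> \<longleftrightarrow>
     (\<exists>C>0. \<exists>\<delta>0>0. \<forall>\<delta>\<in>{0<..<\<delta>0}. strong_error M T X (Xd \<delta>) \<le> ennreal (C * \<delta> powr \<eta>))"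

end

(*
  The inverse subordinator satisfies E(D u) = u. On the time grid D(u_i) with u_i = i delta / 2^p,
  simple integrals against E and B o E are therefore exact sums with the increments delta / 2^p and
  B(u_(i+1)) - B(u_i), and neither a construction of stochastic integrals nor conditioning on D is
  needed. The Euler process on this fine grid has a discrete Ito-Taylor expansion over the index set
  A_gamma, up to an Ito remainder that vanishes in probability as p grows. Doob's inequality and a
  Gronwall argument over the cells of length delta bound its mean square distance to the coarse Taylor
  scheme on [0, U] by C(U) delta^(2 gamma). Fatou's lemma carries the bound over to the solution X and
  the approximation, whose paths are continuous and constant wherever E is constant.

  It remains to sum over the value of E_T. On n < E_T <= n + 1, AM-GM with weight a_n delta^gamma
  bounds the expected error by (a_n P(D_n <= T) / 2 + C(n + 2) / a_n) delta^gamma. The Chernoff bound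
  gives P(D_n <= T) <= exp(-c n^p) for every p < 1 / (1 - beta), whereas C(n) is at most
  exp(c' n^r) for every r > q_***; the condition on beta says exactly that q_*** < 1 / (1 - beta).
*)
theory Submission
  imports Defs
begin

section \<open>Second moments and a maximal inequality\<close>

text \<open>The obstacle is that \<open>stoch_integral\<close> gives no formula for an integral: it
  only says that simple integrals converge to it along every approximating sequence. The proof may
  choose the sequence, and the stopping times \<open>D u\<close> with \<open>u\<close> on a
  deterministic grid turn the time-changed problem into one about a Gaussian random walk. An a
  priori moment bound is proved for the Euler process only; the Gronwall sums live in
  \<open>ennreal\<close>, where infinite values are harmless. Single derivatives of the
  \<open>f \<alpha>\<close> are continuous but of uncontrolled growth, so the Ito remainder is small
  in probability only. The mean square estimate is therefore restricted to an event that is known at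
  the start of each cell, which keeps the martingale structure. The Gronwall exponent at horizon U
  is of order h(U)^2 U^2, that is U^(2q+2) for h of index q, and k(U)^2 is a factor, so that log k
  competes with the same power. This is the origin of \<open>q_star\<close>. For constant bounds the
  power is 2, and 2 < 1/(1 - \<beta>) means \<beta> > 1/2.\<close>

definition sup2 :: "'a measure \<Rightarrow> 'i set \<Rightarrow> ('i \<Rightarrow> 'a \<Rightarrow> real) \<Rightarrow> ennreal" where
  "sup2 M I S = (\<integral>\<^sup>+\<omega>. (SUP i\<in>I. ennreal ((S i \<omega>)\<^sup>2)) \<partial>M)"

lemma sup2_le_nn:
  assumes "\<And>\<omega> i. \<omega> \<in> space M \<Longrightarrow> i \<in> I \<Longrightarrow> ennreal ((S i \<omega>)\<^sup>2) \<le> b \<omega>"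
  shows "sup2 M I S \<le> (\<integral>\<^sup>+\<omega>. b \<omega> \<partial>M)"
  unfolding sup2_def by (intro nn_integral_mono SUP_least assms)

lemma sup2_mono:
  assumes "\<And>\<omega> i. \<omega> \<in> space M \<Longrightarrow> i \<in> I \<Longrightarrow> \<exists>j\<in>J. \<bar>S i \<omega>\<bar> \<le> \<bar>R j \<omega>\<bar>"
  shows "sup2 M I S \<le> sup2 M J R"
  unfolding sup2_def
proof (intro nn_integral_mono SUP_mono)
  fix \<omega> i assume "\<omega> \<in> space M" "i \<in> I"
  with assms obtain j where "j \<in> J" "\<bar>S i \<omega>\<bar> \<le> \<bar>R j \<omega>\<bar>" by blast
  then show "\<exists>m\<in>J. ennreal ((S i \<omega>)\<^sup>2) \<le> ennreal ((R m \<omega>)\<^sup>2)"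
    by (intro bexI[of _ j] ennreal_leI) (auto simp: abs_le_square_iff)
qed

lemma nn_le_sup2: "i \<in> I \<Longrightarrow> (\<integral>\<^sup>+\<omega>. ennreal ((S i \<omega>)\<^sup>2) \<partial>M) \<le> sup2 M I S"
  unfolding sup2_def by (intro nn_integral_mono SUP_upper)

lemma measurable_sup2 [measurable]:
  fixes S :: "'i \<Rightarrow> 'a \<Rightarrow> real"
  assumes "countable I" "\<And>i. i \<in> I \<Longrightarrow> S i \<in> borel_measurable M"
  shows "(\<lambda>\<omega>. SUP i\<in>I. ennreal ((S i \<omega>)\<^sup>2)) \<in> borel_measurable M"
  using assms by (intro borel_measurable_SUP) auto

text \<open>Cauchy-Schwarz against the constant vector 1 turns the square of a sum into
  \<open>card A\<close> times a sum of squares, pointwise in \<omega>.\<close>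

lemma sup2_sum:
  assumes A: "finite A" and I: "countable I"
    and S: "\<And>a i. a \<in> A \<Longrightarrow> i \<in> I \<Longrightarrow> S a i \<in> borel_measurable M"
  shows "sup2 M I (\<lambda>i \<omega>. \<Sum>a\<in>A. S a i \<omega>) \<le> of_nat (card A) * (\<Sum>a\<in>A. sup2 M I (S a))"
proof -
  have "sup2 M I (\<lambda>i \<omega>. \<Sum>a\<in>A. S a i \<omega>)
      \<le> (\<integral>\<^sup>+\<omega>. of_nat (card A) * (\<Sum>a\<in>A. SUP i\<in>I. ennreal ((S a i \<omega>)\<^sup>2)) \<partial>M)"
  proof (rule sup2_le_nn)
    fix \<omega> i assume i: "i \<in> I"
    have "(\<Sum>a\<in>A. S a i \<omega>)\<^sup>2 \<le> real (card A) * (\<Sum>a\<in>A. (S a i \<omega>)\<^sup>2)"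
      using Cauchy_Schwarz_ineq_sum[of "\<lambda>_. 1" "\<lambda>a. S a i \<omega>" A] by simp
    then have "ennreal ((\<Sum>a\<in>A. S a i \<omega>)\<^sup>2) \<le> ennreal (real (card A) * (\<Sum>a\<in>A. (S a i \<omega>)\<^sup>2))"
      by (rule ennreal_leI)
    also have "\<dots> = of_nat (card A) * (\<Sum>a\<in>A. ennreal ((S a i \<omega>)\<^sup>2))"
      by (simp add: ennreal_mult sum_nonneg ennreal_of_nat_eq_real_of_nat flip: sum_ennreal)
    also have "\<dots> \<le> of_nat (card A) * (\<Sum>a\<in>A. SUP i\<in>I. ennreal ((S a i \<omega>)\<^sup>2))"
      by (intro mult_left_mono sum_mono SUP_upper i) auto
    finally show "ennreal ((\<Sum>a\<in>A. S a i \<omega>)\<^sup>2) \<le> of_nat (card A) * (\<Sum>a\<in>A. SUP i\<in>I. ennreal ((S a i \<omega>)\<^sup>2))" .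
  qed
  also have "\<dots> = of_nat (card A) * (\<Sum>a\<in>A. sup2 M I (S a))"
    unfolding sup2_def using I S
    by (subst nn_integral_cmult) (auto intro!: borel_measurable_sum measurable_sup2 simp: nn_integral_sum)
  finally show ?thesis .
qed

lemma sup2_add:
  assumes I: "countable I"
    and S: "\<And>i. i \<in> I \<Longrightarrow> S i \<in> borel_measurable M" "\<And>i. i \<in> I \<Longrightarrow> R i \<in> borel_measurable M"
  shows "sup2 M I (\<lambda>i \<omega>. S i \<omega> + R i \<omega>) \<le> 2 * (sup2 M I S + sup2 M I R)"
proof -
  \<comment> \<open>Two summands are a sum over \<open>bool\<close>, so the general bound
    applies.\<close>
  have "sup2 M I (\<lambda>i \<omega>. \<Sum>a\<in>UNIV. case_bool S R a i \<omega>)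
      \<le> of_nat (card (UNIV :: bool set)) * (\<Sum>a\<in>UNIV. sup2 M I (case_bool S R a))"
    by (rule sup2_sum[OF _ I]) (auto split: bool.split intro: S)
  then show ?thesis by (simp add: UNIV_bool add.commute)
qed

lemma sup2_UN:
  assumes A: "finite A" and I: "\<And>a. a \<in> A \<Longrightarrow> countable (I a)"
    and S: "\<And>a i. a \<in> A \<Longrightarrow> i \<in> I a \<Longrightarrow> S i \<in> borel_measurable M"
  shows "sup2 M (\<Union>a\<in>A. I a) S \<le> (\<Sum>a\<in>A. sup2 M (I a) S)"
proof -
  have "sup2 M (\<Union>a\<in>A. I a) S \<le> (\<integral>\<^sup>+\<omega>. (\<Sum>a\<in>A. SUP i\<in>I a. ennreal ((S i \<omega>)\<^sup>2)) \<partial>M)"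
  proof (rule sup2_le_nn)
    fix \<omega> i assume "i \<in> (\<Union>a\<in>A. I a)"
    then obtain a where a: "a \<in> A" "i \<in> I a" by blast
    have "ennreal ((S i \<omega>)\<^sup>2) \<le> (SUP i\<in>I a. ennreal ((S i \<omega>)\<^sup>2))" by (intro SUP_upper a)
    also have "\<dots> \<le> (\<Sum>a\<in>A. SUP i\<in>I a. ennreal ((S i \<omega>)\<^sup>2))"
      using A a(1) by (intro member_le_sum) auto
    finally show "ennreal ((S i \<omega>)\<^sup>2) \<le> (\<Sum>a\<in>A. SUP i\<in>I a. ennreal ((S i \<omega>)\<^sup>2))" .
  qed
  also have "\<dots> = (\<Sum>a\<in>A. sup2 M (I a) S)"
    unfolding sup2_def using I S by (intro nn_integral_sum measurable_sup2) auto
  finally show ?thesis .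
qed

section \<open>Square-integrable functions\<close>

definition l2 :: "'a measure \<Rightarrow> ('a \<Rightarrow> real) \<Rightarrow> bool" where
  "l2 M f \<longleftrightarrow> f \<in> borel_measurable M \<and> (\<integral>\<^sup>+\<omega>. ennreal ((f \<omega>)\<^sup>2) \<partial>M) < \<infinity>"

lemma l2D: "l2 M f \<Longrightarrow> f \<in> borel_measurable M" "l2 M f \<Longrightarrow> (\<integral>\<^sup>+\<omega>. ennreal ((f \<omega>)\<^sup>2) \<partial>M) < \<infinity>"
  by (auto simp: l2_def)

lemmas l2_meas [measurable_dest] = l2D(1)

lemma l2_integrable_sq [simp]: "l2 M f \<Longrightarrow> integrable M (\<lambda>\<omega>. (f \<omega>)\<^sup>2)"
  unfolding l2_def by (auto simp: integrable_iff_bounded)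

lemma l2_bound:
  assumes "f \<in> borel_measurable M" "integrable M g" "\<And>\<omega>. \<omega> \<in> space M \<Longrightarrow> (f \<omega>)\<^sup>2 \<le> g \<omega>"
  shows "l2 M f"
proof -
  have "integrable M (\<lambda>\<omega>. (f \<omega>)\<^sup>2)"
    using assms by (intro Bochner_Integration.integrable_bound[OF assms(2)]) (auto intro!: AE_I2 order_trans[OF _ abs_ge_self])
  then show ?thesis using assms(1) by (auto simp: l2_def integrable_iff_bounded)
qed

lemma l2_add: "l2 M f \<Longrightarrow> l2 M g \<Longrightarrow> l2 M (\<lambda>\<omega>. f \<omega> + g \<omega>)"
proof (rule l2_bound[where g="\<lambda>\<omega>. 2 * (f \<omega>)\<^sup>2 + 2 * (g \<omega>)\<^sup>2"])
  show "(f \<omega> + g \<omega>)\<^sup>2 \<le> 2 * (f \<omega>)\<^sup>2 + 2 * (g \<omega>)\<^sup>2" for \<omega>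
    using sum_squares_bound[of "f \<omega>" "g \<omega>"] by (simp add: power2_sum)
qed auto

lemma l2_cmult: "l2 M f \<Longrightarrow> l2 M (\<lambda>\<omega>. c * f \<omega>)"
  by (rule l2_bound[where g="\<lambda>\<omega>. c\<^sup>2 * (f \<omega>)\<^sup>2"]) (auto simp: power_mult_distrib)

lemma l2_zero: "l2 M (\<lambda>\<omega>. 0)" by (simp add: l2_def)

lemma l2_sum: "(\<And>i. i \<in> A \<Longrightarrow> l2 M (f i)) \<Longrightarrow> l2 M (\<lambda>\<omega>. \<Sum>i\<in>A. f i \<omega>)"
  by (induction A rule: infinite_finite_induct) (auto intro: l2_add l2_zero)

lemma l2_max: assumes "l2 M f" "l2 M g" shows "l2 M (\<lambda>\<omega>. max (f \<omega>) (g \<omega>))"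
proof (rule l2_bound[where g="\<lambda>\<omega>. (f \<omega>)\<^sup>2 + (g \<omega>)\<^sup>2"])
  show "(max (f \<omega>) (g \<omega>))\<^sup>2 \<le> (f \<omega>)\<^sup>2 + (g \<omega>)\<^sup>2" for \<omega> by (auto simp: max_def)
qed (use assms in auto)

lemma l2_mult_integrable: assumes "l2 M f" "l2 M g" shows "integrable M (\<lambda>\<omega>. f \<omega> * g \<omega>)"
proof (rule Bochner_Integration.integrable_bound[where f="\<lambda>\<omega>. (f \<omega>)\<^sup>2 + (g \<omega>)\<^sup>2"])
  show "AE \<omega> in M. norm (f \<omega> * g \<omega>) \<le> norm ((f \<omega>)\<^sup>2 + (g \<omega>)\<^sup>2)"
  proof (rule AE_I2)
    fix \<omega> show "norm (f \<omega> * g \<omega>) \<le> norm ((f \<omega>)\<^sup>2 + (g \<omega>)\<^sup>2)"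
      using sum_squares_bound[of "\<bar>f \<omega>\<bar>" "\<bar>g \<omega>\<bar>"] mult_nonneg_nonneg[of "\<bar>f \<omega>\<bar>" "\<bar>g \<omega>\<bar>"]
      by (simp add: abs_mult del: mult_nonneg_nonneg zero_le_mult_iff)
  qed
qed (use assms in auto)

lemma nn_sq_eq_integral: "l2 M f \<Longrightarrow> (\<integral>\<^sup>+\<omega>. ennreal ((f \<omega>)\<^sup>2) \<partial>M) = ennreal (\<integral>\<omega>. (f \<omega>)\<^sup>2 \<partial>M)"
  by (intro nn_integral_eq_integral l2_integrable_sq) auto

section \<open>Doob's maximal inequality in mean square\<close>

primrec runmax :: "(nat \<Rightarrow> real) \<Rightarrow> nat \<Rightarrow> real" where
  "runmax s 0 = 0"
| "runmax s (Suc i) = max (runmax s i) (s (Suc i))"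

lemma runmax_ge: "s 0 = 0 \<Longrightarrow> i \<le> n \<Longrightarrow> s i \<le> runmax s n"
  by (induction n) (auto simp: le_Suc_eq max_def)

lemma runmax_nonneg: "0 \<le> runmax s n"
  by (induction n) auto

text \<open>Pathwise form of Doob's inequality: taking expectations makes the last sum vanish.\<close>

lemma runmax_doob:
  assumes "s 0 = 0"
  shows "(runmax s n)\<^sup>2 \<le> 4 * (s n)\<^sup>2 - 4 * (\<Sum>i<n. runmax s i * (s (Suc i) - s i))"
proof -
  \<comment> \<open>At a new maximum the right-hand side grows by the squared increase of the
    maximum, otherwise it does not change. The factor 4 comes from 4 M s <= M^2 + 4 s^2, applied to
    twice this inequality.\<close>
  have "0 \<le> 2 * runmax s n * s n - 2 * (\<Sum>i<n. runmax s i * (s (Suc i) - s i)) - (runmax s n)\<^sup>2"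
  proof (induction n)
    case (Suc n)
    let ?S = "\<Sum>i<n. runmax s i * (s (Suc i) - s i)"
    show ?case
    proof (cases "runmax s n \<le> s (Suc n)")
      case True
      have "2 * runmax s (Suc n) * s (Suc n) - 2 * (\<Sum>i<Suc n. runmax s i * (s (Suc i) - s i)) - (runmax s (Suc n))\<^sup>2
        = (s (Suc n) - runmax s n)\<^sup>2 + (2 * runmax s n * s n - 2 * ?S - (runmax s n)\<^sup>2)"
        using True by (simp add: max_def power2_eq_square algebra_simps)
      moreover have "0 \<le> (s (Suc n) - runmax s n)\<^sup>2" by simp
      ultimately show ?thesis using Suc by linarith
    next
      case False
      have "2 * runmax s (Suc n) * s (Suc n) - 2 * (\<Sum>i<Suc n. runmax s i * (s (Suc i) - s i)) - (runmax s (Suc n))\<^sup>2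
        = (2 * runmax s n * s n - 2 * ?S - (runmax s n)\<^sup>2)"
        using False by (simp add: max_def power2_eq_square algebra_simps)
      with Suc show ?thesis by simp
    qed
  qed (simp add: assms)
  moreover have "4 * runmax s n * s n \<le> (runmax s n)\<^sup>2 + 4 * (s n)\<^sup>2"
    using sum_squares_bound[of "runmax s n" "2 * s n"] by (simp add: power_mult_distrib)
  ultimately show ?thesis by simp
qed

text \<open>A martingale difference without conditional expectations: \<open>d\<close> is orthogonal
  to every square-integrable \<open>G\<close>-measurable \<open>W\<close>. This is all that
  Pythagoras and Doob's inequality use, and it follows directly from independence.\<close>

definition mdiff :: "'a measure \<Rightarrow> 'a measure \<Rightarrow> ('a \<Rightarrow> real) \<Rightarrow> bool" where
  "mdiff M G d \<longleftrightarrow> l2 M d \<and> (\<forall>W\<in>borel_measurable G. l2 M W \<longrightarrow> (\<integral>\<omega>. W \<omega> * d \<omega> \<partial>M) = 0)"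

text \<open>The constant 8 is twice Doob's 4: the running maximum starts from 0 and is one-sided, so
  it is applied to the partial sums and to their negatives.\<close>

lemma maximal_inequality:
  fixes d :: "nat \<Rightarrow> 'a \<Rightarrow> real"
  assumes G: "\<And>n. subalgebra M (G n)" "\<And>n. sets (G n) \<subseteq> sets (G (Suc n))"
    and d: "\<And>n. n < N \<Longrightarrow> d n \<in> borel_measurable (G (Suc n))" "\<And>n. n < N \<Longrightarrow> mdiff M (G n) (d n)"
  shows "sup2 M {..N} (\<lambda>n \<omega>. \<Sum>l<n. d l \<omega>) \<le> 8 * (\<Sum>l<N. \<integral>\<^sup>+\<omega>. ennreal ((d l \<omega>)\<^sup>2) \<partial>M)"
proof -
  have sp: "space (G n) = space M" for n using G(1) by (simp add: subalgebra_def)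
  have Gm: "f \<in> borel_measurable (G n) \<Longrightarrow> f \<in> borel_measurable (G m)" if "n \<le> m" for n m and f :: "'a \<Rightarrow> real"
  proof -
    have "sets (G n) \<subseteq> sets (G m)" using that G(2) by (rule lift_Suc_mono_le[rotated])
    then show "f \<in> borel_measurable (G n) \<Longrightarrow> f \<in> borel_measurable (G m)"
      by (metis measurable_from_subalg sp subalgebra_def)
  qed
  have dl2: "l2 M (d n)" if "n < N" for n using d(2)[OF that] by (simp add: mdiff_def)
  let ?S = "\<lambda>n \<omega>. \<Sum>l<n. d l \<omega>"
  have S_G: "?S n \<in> borel_measurable (G n)" if "n \<le> N" for n
  proof (rule borel_measurable_sum)
    fix l assume "l \<in> {..<n}"
    then show "d l \<in> borel_measurable (G n)" using that Gm[OF _ d(1)[of l], of n] by auto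
  qed
  have S_l2: "l2 M (?S n)" if "n \<le> N" for n using that by (intro l2_sum dl2) auto
  \<comment> \<open>Pythagoras: the mixed term vanishes because the partial sum is measurable before
    the next difference.\<close>
  have isom: "(\<integral>\<^sup>+\<omega>. ennreal ((?S n \<omega>)\<^sup>2) \<partial>M) = (\<Sum>l<n. \<integral>\<^sup>+\<omega>. ennreal ((d l \<omega>)\<^sup>2) \<partial>M)" if "n \<le> N" for n
    using that
  proof (induction n)
    case (Suc n)
    then have n: "n < N" by simp
    have "(\<integral>\<omega>. (?S (Suc n) \<omega>)\<^sup>2 \<partial>M) = (\<integral>\<omega>. (?S n \<omega>)\<^sup>2 + 2 * (?S n \<omega> * d n \<omega>) + (d n \<omega>)\<^sup>2 \<partial>M)"
      by (intro Bochner_Integration.integral_cong) (auto simp: power2_eq_square algebra_simps)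
    also have "\<dots> = (\<integral>\<omega>. (?S n \<omega>)\<^sup>2 \<partial>M) + 2 * (\<integral>\<omega>. ?S n \<omega> * d n \<omega> \<partial>M) + (\<integral>\<omega>. (d n \<omega>)\<^sup>2 \<partial>M)"
      using n by (simp add: l2_integrable_sq l2_mult_integrable S_l2 dl2)
    also have "(\<integral>\<omega>. ?S n \<omega> * d n \<omega> \<partial>M) = 0"
      using d(2)[OF n] S_G[of n] S_l2[of n] n by (simp add: mdiff_def)
    finally have "(\<integral>\<omega>. (?S (Suc n) \<omega>)\<^sup>2 \<partial>M) = (\<integral>\<omega>. (?S n \<omega>)\<^sup>2 \<partial>M) + (\<integral>\<omega>. (d n \<omega>)\<^sup>2 \<partial>M)" by simp
    then have "ennreal (\<integral>\<omega>. (?S (Suc n) \<omega>)\<^sup>2 \<partial>M) = ennreal (\<integral>\<omega>. (?S n \<omega>)\<^sup>2 \<partial>M) + ennreal (\<integral>\<omega>. (d n \<omega>)\<^sup>2 \<partial>M)"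
      by simp
    then show ?case
      using Suc nn_sq_eq_integral[OF S_l2[OF Suc.prems]] nn_sq_eq_integral[OF S_l2[of n]] nn_sq_eq_integral[OF dl2[OF n]] n
      by simp
  qed simp
  \<comment> \<open>The coefficients in the last sum of \<open>runmax_doob\<close> are running
    maxima, hence square-integrable and measurable at the right time, so that sum has mean zero for
    either sign \<open>c\<close>.\<close>
  have one: "(\<integral>\<^sup>+\<omega>. ennreal ((runmax (\<lambda>n. c * ?S n \<omega>) N)\<^sup>2) \<partial>M) \<le> 4 * (\<integral>\<^sup>+\<omega>. ennreal ((?S N \<omega>)\<^sup>2) \<partial>M)" if c: "c = 1 \<or> c = -1" for c :: real
  proof -
    let ?R = "\<lambda>n \<omega>. runmax (\<lambda>n. c * ?S n \<omega>) n"
    have R: "?R n \<in> borel_measurable (G n) \<and> l2 M (?R n)" if "n \<le> N" for n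
      using that
    proof (induction n)
      case (Suc n)
      have "(\<lambda>\<omega>. c * ?S (Suc n) \<omega>) \<in> borel_measurable (G (Suc n))" "l2 M (\<lambda>\<omega>. c * ?S (Suc n) \<omega>)"
        using S_G[of "Suc n"] S_l2[of "Suc n"] Suc.prems by (auto intro: l2_cmult simp del: sum.lessThan_Suc)
      moreover have "?R n \<in> borel_measurable (G (Suc n))" "l2 M (?R n)" using Suc by (auto intro: Gm[of n])
      ultimately show ?case by (auto simp del: sum.lessThan_Suc intro: l2_max)
    qed (simp add: l2_zero)
    have "(\<integral>\<omega>. (?R N \<omega>)\<^sup>2 \<partial>M) \<le> (\<integral>\<omega>. 4 * (?S N \<omega>)\<^sup>2 - 4 * (\<Sum>i<N. c * (?R i \<omega> * d i \<omega>)) \<partial>M)"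
    proof (rule integral_mono)
      show "integrable M (\<lambda>\<omega>. (?R N \<omega>)\<^sup>2)" using R by (simp add: l2_integrable_sq)
      show "integrable M (\<lambda>\<omega>. 4 * (?S N \<omega>)\<^sup>2 - 4 * (\<Sum>i<N. c * (?R i \<omega> * d i \<omega>)))"
        using R S_l2[of N] by (auto intro!: Bochner_Integration.integrable_diff integrable_mult_right Bochner_Integration.integrable_sum l2_integrable_sq l2_mult_integrable dl2)
      show "(?R N \<omega>)\<^sup>2 \<le> 4 * (?S N \<omega>)\<^sup>2 - 4 * (\<Sum>i<N. c * (?R i \<omega> * d i \<omega>))" for \<omega>
        using runmax_doob[of "\<lambda>n. c * ?S n \<omega>" N] c by (auto simp: algebra_simps power_mult_distrib)
    qed
    also have "\<dots> = 4 * (\<integral>\<omega>. (?S N \<omega>)\<^sup>2 \<partial>M) - 4 * (\<Sum>i<N. c * (\<integral>\<omega>. ?R i \<omega> * d i \<omega> \<partial>M))"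
    proof -
      have i: "integrable M (\<lambda>\<omega>. c * (?R i \<omega> * d i \<omega>))" if "i < N" for i
        using R[of i] that by (auto intro!: integrable_mult_right l2_mult_integrable dl2)
      have "(\<integral>\<omega>. (\<Sum>i<N. c * (?R i \<omega> * d i \<omega>)) \<partial>M) = (\<Sum>i<N. \<integral>\<omega>. c * (?R i \<omega> * d i \<omega>) \<partial>M)"
        using i by (intro Bochner_Integration.integral_sum) auto
      moreover have "integrable M (\<lambda>\<omega>. \<Sum>i<N. c * (?R i \<omega> * d i \<omega>))"
        using i by (intro Bochner_Integration.integrable_sum) auto
      moreover have "integrable M (\<lambda>\<omega>. (?S N \<omega>)\<^sup>2)" using S_l2[of N] by simp
      ultimately show ?thesis by (simp add: Bochner_Integration.integral_diff)
    qed
    also have "(\<Sum>i<N. c * (\<integral>\<omega>. ?R i \<omega> * d i \<omega> \<partial>M)) = 0"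
      using R d(2) by (intro sum.neutral) (auto simp: mdiff_def)
    finally have "(\<integral>\<omega>. (?R N \<omega>)\<^sup>2 \<partial>M) \<le> 4 * (\<integral>\<omega>. (?S N \<omega>)\<^sup>2 \<partial>M)" by simp
    then have "ennreal (\<integral>\<omega>. (?R N \<omega>)\<^sup>2 \<partial>M) \<le> ennreal (4 * (\<integral>\<omega>. (?S N \<omega>)\<^sup>2 \<partial>M))" by (rule ennreal_leI)
    then show ?thesis using R S_l2[of N] by (simp add: nn_sq_eq_integral ennreal_mult')
  qed
  have "sup2 M {..N} ?S \<le> (\<integral>\<^sup>+\<omega>. ennreal ((runmax (\<lambda>n. 1 * ?S n \<omega>) N)\<^sup>2) + ennreal ((runmax (\<lambda>n. - 1 * ?S n \<omega>) N)\<^sup>2) \<partial>M)"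
  proof (rule sup2_le_nn)
    fix \<omega> i assume i: "i \<in> {..N}"
    have "?S i \<omega> \<le> runmax (\<lambda>n. 1 * ?S n \<omega>) N" using runmax_ge[of "\<lambda>n. 1 * ?S n \<omega>" i N] i by simp
    moreover have "- ?S i \<omega> \<le> runmax (\<lambda>n. - 1 * ?S n \<omega>) N" using runmax_ge[of "\<lambda>n. - 1 * ?S n \<omega>" i N] i by simp
    moreover note runmax_nonneg[of "\<lambda>n. 1 * ?S n \<omega>" N] runmax_nonneg[of "\<lambda>n. -1 * ?S n \<omega>" N]
    ultimately have "\<bar>?S i \<omega>\<bar> \<le> \<bar>runmax (\<lambda>n. 1 * ?S n \<omega>) N\<bar> \<or> \<bar>?S i \<omega>\<bar> \<le> \<bar>runmax (\<lambda>n. - 1 * ?S n \<omega>) N\<bar>"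
      by linarith
    then have "(?S i \<omega>)\<^sup>2 \<le> (runmax (\<lambda>n. 1 * ?S n \<omega>) N)\<^sup>2 + (runmax (\<lambda>n. - 1 * ?S n \<omega>) N)\<^sup>2"
      unfolding abs_le_square_iff by (meson add_increasing add_increasing2 zero_le_power2)
    then show "ennreal ((?S i \<omega>)\<^sup>2) \<le> ennreal ((runmax (\<lambda>n. 1 * ?S n \<omega>) N)\<^sup>2) + ennreal ((runmax (\<lambda>n. - 1 * ?S n \<omega>) N)\<^sup>2)"
      by (simp add: ennreal_plus[symmetric] ennreal_leI del: ennreal_plus)
  qed
  also have "\<dots> = (\<integral>\<^sup>+\<omega>. ennreal ((runmax (\<lambda>n. 1 * ?S n \<omega>) N)\<^sup>2) \<partial>M) + (\<integral>\<^sup>+\<omega>. ennreal ((runmax (\<lambda>n. - 1 * ?S n \<omega>) N)\<^sup>2) \<partial>M)"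
  proof (rule nn_integral_add)
    have "(\<lambda>\<omega>. runmax (\<lambda>n. c * ?S n \<omega>) n) \<in> borel_measurable M" if "n \<le> N" for c n
      using that by (induction n) (auto intro!: borel_measurable_max borel_measurable_times l2D(1)[OF S_l2] simp del: sum.lessThan_Suc)
    from this[of N 1] this[of N "-1"] show "(\<lambda>\<omega>. ennreal ((runmax (\<lambda>n. 1 * ?S n \<omega>) N)\<^sup>2)) \<in> borel_measurable M"
      "(\<lambda>\<omega>. ennreal ((runmax (\<lambda>n. - 1 * ?S n \<omega>) N)\<^sup>2)) \<in> borel_measurable M" by auto
  qed
  also have "\<dots> \<le> 4 * (\<integral>\<^sup>+\<omega>. ennreal ((?S N \<omega>)\<^sup>2) \<partial>M) + 4 * (\<integral>\<^sup>+\<omega>. ennreal ((?S N \<omega>)\<^sup>2) \<partial>M)"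
    by (intro add_mono one) auto
  also have "\<dots> = 8 * (\<Sum>l<N. \<integral>\<^sup>+\<omega>. ennreal ((d l \<omega>)\<^sup>2) \<partial>M)"
    unfolding isom[OF order_refl] by (simp flip: distrib_right)
  finally show ?thesis .
qed

section \<open>Gaussian random walks\<close>

text \<open>\<open>\<H> l\<close> is not generated by the walk. It will be \<open>\<F>\<close> at a
  grid time, which also contains the subordinator up to that time; the next increment is independent
  of the whole of it.\<close>

locale gaussian_walk = prob_space M for M :: "'a measure" +
  fixes \<H> :: "nat \<Rightarrow> 'a measure" and \<xi> :: "nat \<Rightarrow> 'a \<Rightarrow> real" and \<epsilon> :: real
  assumes eps: "0 < \<epsilon>"
    and sub: "subalgebra M (\<H> l)"
    and H_mono: "l \<le> l' \<Longrightarrow> sets (\<H> l) \<subseteq> sets (\<H> l')"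
    and xi_meas: "\<xi> l \<in> borel_measurable (\<H> (Suc l))"
    and xi_dist: "distributed M lborel (\<xi> l) (\<lambda>x. ennreal (normal_density 0 (sqrt \<epsilon>) x))"
    and xi_indep: "indep_set (sets (\<H> l)) (sets (vimage_algebra (space M) (\<xi> l) borel))"
begin

lemma H_space: "space (\<H> l) = space M" using sub by (simp add: subalgebra_def)

lemma H_meas_mono: "f \<in> borel_measurable (\<H> l) \<Longrightarrow> l \<le> l' \<Longrightarrow> f \<in> borel_measurable (\<H> l')"
  using H_mono[of l l'] by (metis measurable_from_subalg H_space subalgebra_def)

lemma H_meas_M: "f \<in> borel_measurable (\<H> l) \<Longrightarrow> f \<in> borel_measurable M"
  by (rule measurable_from_subalg[OF sub])

lemma xi_M [measurable]: "\<xi> l \<in> borel_measurable M" using xi_meas by (rule H_meas_M)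

lemma xi_indep_var: assumes U: "U \<in> borel_measurable (\<H> l)" shows "indep_var borel U borel (\<xi> l)"
  unfolding indep_var_eq
proof (intro conjI)
  show "random_variable borel U" "random_variable borel (\<xi> l)" using U H_meas_M by auto
  have s1: "sigma_sets (space M) {U -` A \<inter> space M |A. A \<in> sets borel} \<subseteq> sets (\<H> l)"
    using sets.sigma_sets_subset[of "{U -` A \<inter> space (\<H> l) |A. A \<in> sets borel}" "\<H> l"] measurable_sets[OF U]
    unfolding H_space by blast
  have s2: "sigma_sets (space M) {\<xi> l -` A \<inter> space M |A. A \<in> sets borel} \<subseteq> sets (vimage_algebra (space M) (\<xi> l) borel)"
    by (simp add: sets_vimage_algebra)
  show "indep_set (sigma_sets (space M) {U -` A \<inter> space M |A. A \<in> sets borel})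
     (sigma_sets (space M) {\<xi> l -` A \<inter> space M |A. A \<in> sets borel})"
    using xi_indep[of l] s1 s2 unfolding indep_sets2_eq by blast
qed

text \<open>Independence survives composition with \<open>g\<close>; the cases used are x, x^2 and
  x^2 - \<epsilon>.\<close>

lemma xi_product:
  fixes U :: "'a \<Rightarrow> real" and g :: "real \<Rightarrow> real"
  assumes U: "U \<in> borel_measurable (\<H> l)" "integrable M U" and g: "g \<in> borel_measurable borel" "integrable M (\<lambda>\<omega>. g (\<xi> l \<omega>))"
  shows "integrable M (\<lambda>\<omega>. U \<omega> * g (\<xi> l \<omega>))" "(\<integral>\<omega>. U \<omega> * g (\<xi> l \<omega>) \<partial>M) = (\<integral>\<omega>. U \<omega> \<partial>M) * (\<integral>\<omega>. g (\<xi> l \<omega>) \<partial>M)"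
proof -
  have "indep_var borel (id \<circ> U) borel (g \<circ> \<xi> l)"
    by (rule indep_var_compose[OF xi_indep_var[OF U(1)]]) (use g in auto)
  then have "indep_var borel U borel (\<lambda>\<omega>. g (\<xi> l \<omega>))" by (simp add: comp_def id_def)
  from indep_var_integrable[OF this U(2) g(2)] indep_var_lebesgue_integral[OF this U(2) g(2)]
  show "integrable M (\<lambda>\<omega>. U \<omega> * g (\<xi> l \<omega>))" "(\<integral>\<omega>. U \<omega> * g (\<xi> l \<omega>) \<partial>M) = (\<integral>\<omega>. U \<omega> \<partial>M) * (\<integral>\<omega>. g (\<xi> l \<omega>) \<partial>M)"
    by auto
qed

lemma xi_moments:
  "integrable M (\<lambda>\<omega>. \<xi> l \<omega> ^ k)"
  "(\<integral>\<omega>. \<xi> l \<omega> \<partial>M) = 0" "(\<integral>\<omega>. (\<xi> l \<omega>)\<^sup>2 \<partial>M) = \<epsilon>" "(\<integral>\<omega>. \<xi> l \<omega> ^ 4 \<partial>M) = 3 * \<epsilon>\<^sup>2"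
proof -
  have s: "0 < sqrt \<epsilon>" using eps by simp
  have tr: "integrable M (\<lambda>\<omega>. \<xi> l \<omega> ^ k) \<longleftrightarrow> integrable lborel (\<lambda>x. normal_density 0 (sqrt \<epsilon>) x * x ^ k)" for k
    using distributed_integrable[OF xi_dist, of "\<lambda>x. x ^ k"] by simp
  have tr2: "(\<integral>\<omega>. \<xi> l \<omega> ^ k \<partial>M) = (\<integral>x. normal_density 0 (sqrt \<epsilon>) x * x ^ k \<partial>lborel)" for k
    using distributed_integral[OF xi_dist, of "\<lambda>x. x ^ k"] by simp
  show "integrable M (\<lambda>\<omega>. \<xi> l \<omega> ^ k)"
    using integrable_normal_moment[OF s, of 0 k] tr by simp
  show "(\<integral>\<omega>. \<xi> l \<omega> \<partial>M) = 0"
    using tr2[of 1] integral_normal_moment_odd[OF s, of 0 0] by simp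
  show "(\<integral>\<omega>. (\<xi> l \<omega>)\<^sup>2 \<partial>M) = \<epsilon>"
    using tr2[of 2] integral_normal_moment_even[OF s, of 0 1] eps by (simp add: numeral_2_eq_2[symmetric] power2_eq_square)
  show "(\<integral>\<omega>. \<xi> l \<omega> ^ 4 \<partial>M) = 3 * \<epsilon>\<^sup>2"
    using tr2[of 4] integral_normal_moment_even[OF s, of 0 2] eps
    by (simp add: fact_numeral power2_eq_square field_simps)
qed

text \<open>No integrability of \<open>U\<close> is assumed: if \<open>U\<close> is not
  square-integrable, the right-hand side is infinite, as \<epsilon> > 0.\<close>

lemma xi_mult_sq:
  assumes U: "U \<in> borel_measurable (\<H> l)"
  shows "(\<integral>\<^sup>+\<omega>. ennreal ((U \<omega> * \<xi> l \<omega>)\<^sup>2) \<partial>M) \<le> ennreal \<epsilon> * (\<integral>\<^sup>+\<omega>. ennreal ((U \<omega>)\<^sup>2) \<partial>M)"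
proof (cases "l2 M U")
  case True
  have p: "integrable M (\<lambda>\<omega>. (U \<omega>)\<^sup>2 * (\<xi> l \<omega>)\<^sup>2)" "(\<integral>\<omega>. (U \<omega>)\<^sup>2 * (\<xi> l \<omega>)\<^sup>2 \<partial>M) = (\<integral>\<omega>. (U \<omega>)\<^sup>2 \<partial>M) * (\<integral>\<omega>. (\<xi> l \<omega>)\<^sup>2 \<partial>M)"
    using xi_product[where g="\<lambda>x. x\<^sup>2" and U="\<lambda>\<omega>. (U \<omega>)\<^sup>2" and l=l] U True xi_moments(1)[of l 2]
    by (auto dest: l2_integrable_sq)
  have "(\<integral>\<^sup>+\<omega>. ennreal ((U \<omega> * \<xi> l \<omega>)\<^sup>2) \<partial>M) = ennreal (\<integral>\<omega>. (U \<omega>)\<^sup>2 * (\<xi> l \<omega>)\<^sup>2 \<partial>M)"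
    by (subst nn_integral_eq_integral[symmetric]) (auto simp: p power_mult_distrib)
  then show ?thesis using p(2) xi_moments(3)[of l] True eps
    by (simp add: nn_sq_eq_integral ennreal_mult' mult.commute)
next
  case False
  then have "(\<integral>\<^sup>+\<omega>. ennreal ((U \<omega>)\<^sup>2) \<partial>M) = \<infinity>" using H_meas_M[OF U] unfolding l2_def
    by (metis infinity_ennreal_def top.not_eq_extremum)
  then show ?thesis using eps by (simp add: ennreal_mult_top)
qed

lemma xi_mdiff:
  assumes U: "U \<in> borel_measurable (\<H> l)" "l2 M U"
  shows "mdiff M (\<H> l) (\<lambda>\<omega>. U \<omega> * \<xi> l \<omega>)"
  unfolding mdiff_def
proof (intro conjI ballI impI)
  show "l2 M (\<lambda>\<omega>. U \<omega> * \<xi> l \<omega>)"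
    unfolding l2_def
  proof
    have "(\<integral>\<^sup>+\<omega>. ennreal ((U \<omega> * \<xi> l \<omega>)\<^sup>2) \<partial>M) \<le> ennreal \<epsilon> * (\<integral>\<^sup>+\<omega>. ennreal ((U \<omega>)\<^sup>2) \<partial>M)"
      by (rule xi_mult_sq[OF U(1)])
    also have "\<dots> < \<infinity>" using l2D(2)[OF U(2)] by (simp add: ennreal_mult_less_top)
    finally show "(\<integral>\<^sup>+\<omega>. ennreal ((U \<omega> * \<xi> l \<omega>)\<^sup>2) \<partial>M) < \<infinity>" .
  qed (use U H_meas_M in auto)
  fix W assume W: "W \<in> borel_measurable (\<H> l)" "l2 M W"
  have "(\<integral>\<omega>. (W \<omega> * U \<omega>) * \<xi> l \<omega> \<partial>M) = (\<integral>\<omega>. W \<omega> * U \<omega> \<partial>M) * (\<integral>\<omega>. \<xi> l \<omega> \<partial>M)"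
  proof (rule xi_product(2)[where g="\<lambda>x. x"])
    show "(\<lambda>\<omega>. W \<omega> * U \<omega>) \<in> borel_measurable (\<H> l)" using U(1) W(1) by (rule borel_measurable_times[rotated])
    show "integrable M (\<lambda>\<omega>. W \<omega> * U \<omega>)" by (rule l2_mult_integrable[OF W(2) U(2)])
    show "integrable M (\<xi> l)" using xi_moments(1)[of l 1] by simp
  qed simp
  then have "(\<integral>\<omega>. (W \<omega> * U \<omega>) * \<xi> l \<omega> \<partial>M) = 0" by (simp add: xi_moments(2))
  then show "(\<integral>\<omega>. W \<omega> * (U \<omega> * \<xi> l \<omega>) \<partial>M) = 0" by (simp add: mult.assoc)
qed

text \<open>Maximal inequality for a sum with predictable coefficients. An infinite second moment of
  some \<open>Q l\<close> makes the right-hand side infinite, so the caller has no integrability to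
  check.\<close>

lemma xi_maximal:
  assumes Q: "\<And>l. l < N \<Longrightarrow> Q l \<in> borel_measurable (\<H> l)"
  shows "sup2 M {..N} (\<lambda>n \<omega>. \<Sum>l<n. Q l \<omega> * \<xi> l \<omega>) \<le> 8 * ennreal \<epsilon> * (\<Sum>l<N. \<integral>\<^sup>+\<omega>. ennreal ((Q l \<omega>)\<^sup>2) \<partial>M)"
proof (cases "\<forall>l<N. l2 M (Q l)")
  case True
  have "sup2 M {..N} (\<lambda>n \<omega>. \<Sum>l<n. Q l \<omega> * \<xi> l \<omega>) \<le> 8 * (\<Sum>l<N. \<integral>\<^sup>+\<omega>. ennreal ((Q l \<omega> * \<xi> l \<omega>)\<^sup>2) \<partial>M)"
  proof (rule maximal_inequality[where G=\<H>])
    show "(\<lambda>\<omega>. Q n \<omega> * \<xi> n \<omega>) \<in> borel_measurable (\<H> (Suc n))" if "n < N" for n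
      using H_meas_mono[OF Q[OF that], of "Suc n"] xi_meas by auto
  qed (use sub H_mono True xi_mdiff Q in auto)
  also have "\<dots> \<le> 8 * (\<Sum>l<N. ennreal \<epsilon> * (\<integral>\<^sup>+\<omega>. ennreal ((Q l \<omega>)\<^sup>2) \<partial>M))"
    by (intro mult_left_mono sum_mono xi_mult_sq Q) auto
  finally show ?thesis by (simp add: sum_distrib_left mult.assoc)
next
  case False
  then obtain l where l: "l < N" "\<not> l2 M (Q l)" by blast
  then have "(\<integral>\<^sup>+\<omega>. ennreal ((Q l \<omega>)\<^sup>2) \<partial>M) = \<infinity>" using H_meas_M[OF Q[OF l(1)]] unfolding l2_def
    by (metis infinity_ennreal_def top.not_eq_extremum)
  then have "(\<Sum>l<N. \<integral>\<^sup>+\<omega>. ennreal ((Q l \<omega>)\<^sup>2) \<partial>M) = \<infinity>"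
    using l(1) member_le_sum[of l "{..<N}" "\<lambda>l. \<integral>\<^sup>+\<omega>. ennreal ((Q l \<omega>)\<^sup>2) \<partial>M"] by (simp add: top_unique)
  then have "8 * ennreal \<epsilon> * (\<Sum>l<N. \<integral>\<^sup>+\<omega>. ennreal ((Q l \<omega>)\<^sup>2) \<partial>M) = top"
    using eps unfolding infinity_ennreal_def by (metis ennreal_eq_0_iff ennreal_mult_top mult_eq_0_iff not_le zero_neq_numeral)
  then show ?thesis by simp
qed

text \<open>Sums against time have no cancellation; Cauchy-Schwarz costs the number \<open>N\<close>
  of summands, which together with \<epsilon>^2 leaves N \<epsilon> times \<epsilon>.\<close>

lemma dt_maximal:
  fixes N :: nat
  assumes Q: "\<And>l. l < N \<Longrightarrow> Q l \<in> borel_measurable M"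
  shows "sup2 M {..N} (\<lambda>n \<omega>. \<Sum>l<n. Q l \<omega> * \<epsilon>) \<le> ennreal (\<epsilon>\<^sup>2 * N) * (\<Sum>l<N. \<integral>\<^sup>+\<omega>. ennreal ((Q l \<omega>)\<^sup>2) \<partial>M)"
proof -
  have "sup2 M {..N} (\<lambda>n \<omega>. \<Sum>l<n. Q l \<omega> * \<epsilon>) \<le> (\<integral>\<^sup>+\<omega>. ennreal (\<epsilon>\<^sup>2 * N) * (\<Sum>l<N. ennreal ((Q l \<omega>)\<^sup>2)) \<partial>M)"
  proof (rule sup2_le_nn)
    fix \<omega> n assume n: "n \<in> {..N}"
    have "(\<Sum>l<n. Q l \<omega> * \<epsilon>)\<^sup>2 = \<epsilon>\<^sup>2 * (\<Sum>l<n. Q l \<omega>)\<^sup>2" by (simp flip: sum_distrib_right add: power_mult_distrib)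
    also have "\<dots> \<le> \<epsilon>\<^sup>2 * (n * (\<Sum>l<n. (Q l \<omega>)\<^sup>2))"
      using Cauchy_Schwarz_ineq_sum[of "\<lambda>_. 1" "\<lambda>l. Q l \<omega>" "{..<n}"] by (intro mult_left_mono) auto
    also have "\<dots> \<le> \<epsilon>\<^sup>2 * (N * (\<Sum>l<N. (Q l \<omega>)\<^sup>2))"
      using n by (intro mult_left_mono mult_mono sum_mono2) (auto intro: sum_nonneg)
    finally show "ennreal ((\<Sum>l<n. Q l \<omega> * \<epsilon>)\<^sup>2) \<le> ennreal (\<epsilon>\<^sup>2 * N) * (\<Sum>l<N. ennreal ((Q l \<omega>)\<^sup>2))"
      by (simp add: ennreal_leI sum_nonneg flip: ennreal_mult' mult.assoc)
  qed
  also have "\<dots> = ennreal (\<epsilon>\<^sup>2 * N) * (\<Sum>l<N. \<integral>\<^sup>+\<omega>. ennreal ((Q l \<omega>)\<^sup>2) \<partial>M)"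
  proof -
    have "(\<integral>\<^sup>+\<omega>. ennreal (\<epsilon>\<^sup>2 * N) * (\<Sum>l<N. ennreal ((Q l \<omega>)\<^sup>2)) \<partial>M)
        = ennreal (\<epsilon>\<^sup>2 * N) * (\<integral>\<^sup>+\<omega>. (\<Sum>l<N. ennreal ((Q l \<omega>)\<^sup>2)) \<partial>M)"
      using Q by (intro nn_integral_cmult borel_measurable_sum) auto
    also have "(\<integral>\<^sup>+\<omega>. (\<Sum>l<N. ennreal ((Q l \<omega>)\<^sup>2)) \<partial>M) = (\<Sum>l<N. \<integral>\<^sup>+\<omega>. ennreal ((Q l \<omega>)\<^sup>2) \<partial>M)"
      using Q by (intro nn_integral_sum) auto
    finally show ?thesis .
  qed
  finally show ?thesis .
qed

end

section \<open>Discrete multiple sums\<close>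

lemma discrete_gronwall:
  fixes \<phi> :: "nat \<Rightarrow> ennreal"
  assumes "\<And>n. n \<le> N \<Longrightarrow> \<phi> n \<le> b + c * (\<Sum>l<n. \<phi> l)" "n \<le> N"
  shows "\<phi> n \<le> b * (1 + c) ^ n"
  using assms(2)
proof (induction n rule: less_induct)
  case (less n)
  \<comment> \<open>b (1 + c)^n solves the recursion with equality.\<close>
  have id: "b + c * (\<Sum>l<n. b * (1 + c) ^ l) = b * (1 + c) ^ n" for n
  proof (induction n)
    case (Suc n)
    have "b + c * (\<Sum>l<Suc n. b * (1 + c) ^ l) = (b + c * (\<Sum>l<n. b * (1 + c) ^ l)) + c * (b * (1 + c) ^ n)"
      by (simp add: distrib_left add.assoc)
    also have "\<dots> = b * (1 + c) ^ Suc n" unfolding Suc by (simp add: distrib_left distrib_right ac_simps)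
    finally show ?case .
  qed simp
  have "\<phi> n \<le> b + c * (\<Sum>l<n. \<phi> l)" using assms(1) less by blast
  also have "\<dots> \<le> b + c * (\<Sum>l<n. b * (1 + c) ^ l)"
    using less by (intro add_left_mono mult_left_mono sum_mono) auto
  finally show ?case using id by simp
qed

lemma one_plus_power_le_exp:
  assumes "0 \<le> c" "c * real n \<le> r"
  shows "(1 + ennreal c) ^ n \<le> ennreal (exp r)"
proof -
  have "(1 + ennreal c) ^ n = ennreal ((1 + c) ^ n)"
    using assms by (simp add: ennreal_power flip: ennreal_plus ennreal_1)
  also have "(1 + c) ^ n \<le> exp c ^ n" using assms exp_ge_add_one_self[of c] by (intro power_mono) auto
  also have "exp c ^ n = exp (c * n)" by (simp add: exp_of_nat_mult[symmetric] mult.commute)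
  also have "\<dots> \<le> exp r" using assms by simp
  finally show ?thesis by (simp add: ennreal_leI)
qed

text \<open>\<open>mis z a \<beta> H i\<close> is the discrete counterpart of the multiple integral over \<open>[a, i]\<close> for the
  multi-index \<open>rev \<beta>\<close>: the head of \<open>\<beta>\<close> belongs to the outermost sum.\<close>

fun mis :: "(nat \<Rightarrow> nat \<Rightarrow> real) \<Rightarrow> nat \<Rightarrow> nat list \<Rightarrow> (nat \<Rightarrow> real) \<Rightarrow> nat \<Rightarrow> real" where
  "mis z a [] H i = H i"
| "mis z a (j # \<beta>) H i = (\<Sum>l\<in>{a..<i}. mis z a \<beta> H l * z j l)"

text \<open>The end of the list belongs to the innermost sum, so appending an index only replaces
  the integrand by its own sum. As \<open>rev (j # \<alpha>) = rev \<alpha> @ [j]\<close>, this is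
  one step of an Ito-Taylor expansion.\<close>

lemma mis_append: "mis z a (\<beta> @ [j]) H i = mis z a \<beta> (\<lambda>i. \<Sum>l\<in>{a..<i}. H l * z j l) i"
  by (induction \<beta> arbitrary: i) auto

lemma mis_add: "mis z a \<beta> (\<lambda>i. H i + K i) i = mis z a \<beta> H i + mis z a \<beta> K i"
  by (induction \<beta> arbitrary: i) (auto simp: sum.distrib distrib_right)

lemma mis_cmult: "mis z a \<beta> (\<lambda>i. c * H i) i = c * mis z a \<beta> H i"
  by (induction \<beta> arbitrary: i) (auto simp: sum_distrib_left mult.assoc)

lemma mis_diff: "mis z a \<beta> (\<lambda>i. H i - K i) i = mis z a \<beta> H i - mis z a \<beta> K i"
  using mis_add[of z a \<beta> H "\<lambda>i. -1 * K i" i] mis_cmult[of z a \<beta> "-1" K i] by simp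

lemma mis_cong: "(\<And>l. a \<le> l \<Longrightarrow> l \<le> i \<Longrightarrow> H l = K l) \<Longrightarrow> a \<le> i \<Longrightarrow> mis z a \<beta> H i = mis z a \<beta> K i"
  by (induction \<beta> arbitrary: i) (auto intro!: sum.cong)

text \<open>The closed cells share endpoints, so grid points are indexed by pairs \<open>(n, i)\<close>.\<close>

definition cells :: "nat \<Rightarrow> nat \<Rightarrow> (nat \<times> nat) set" where
  "cells m L = (SIGMA n:{..<L}. {n * m..n * m + m})"

context gaussian_walk
begin

definition incr :: "'a \<Rightarrow> nat \<Rightarrow> nat \<Rightarrow> real" where
  "incr \<omega> j l = (if j = 0 then \<epsilon> else \<xi> l \<omega>)"

abbreviation ms :: "nat \<Rightarrow> nat list \<Rightarrow> (nat \<Rightarrow> 'a \<Rightarrow> real) \<Rightarrow> nat \<Rightarrow> 'a \<Rightarrow> real" where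
  "ms a \<beta> H i \<omega> \<equiv> mis (incr \<omega>) a \<beta> (\<lambda>l. H l \<omega>) i"

lemma incr_meas: "(\<lambda>\<omega>. incr \<omega> j l) \<in> borel_measurable (\<H> (Suc l))"
  unfolding incr_def using xi_meas by auto

text \<open>Adaptedness: a sum up to \<open>i\<close> uses only increments l < i, each measurable at
  l + 1.\<close>

lemma ms_meas:
  assumes "\<And>l. a \<le> l \<Longrightarrow> l \<le> b \<Longrightarrow> H l \<in> borel_measurable (\<H> l)" "a \<le> i" "i \<le> b"
  shows "ms a \<beta> H i \<in> borel_measurable (\<H> i)"
  using assms(2,3)
proof (induction \<beta> arbitrary: i)
  case Nil
  then show ?case using assms(1) by simp
next
  case (Cons j \<beta>)
  show ?case unfolding mis.simps
  proof (intro borel_measurable_sum borel_measurable_times)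
    fix l assume l: "l \<in> {a..<i}"
    show "ms a \<beta> H l \<in> borel_measurable (\<H> i)" using l Cons by (intro H_meas_mono[OF Cons.IH]) auto
    show "(\<lambda>\<omega>. incr \<omega> j l) \<in> borel_measurable (\<H> i)" using l by (intro H_meas_mono[OF incr_meas]) auto
  qed
qed

text \<open>One layer of an iterated sum over a cell of length m \<epsilon>: a sum against time
  gains the square of the length by Cauchy-Schwarz, one against the noise gains its first power by
  the maximal inequality.\<close>

lemma step_bound:
  assumes Q: "\<And>l. a \<le> l \<Longrightarrow> l < a + m \<Longrightarrow> Q l \<in> borel_measurable (\<H> l)"
  shows "sup2 M {a..a + m} (\<lambda>i \<omega>. \<Sum>l\<in>{a..<i}. Q l \<omega> * incr \<omega> j l)
    \<le> (if j = 0 then ennreal (m * \<epsilon>) ^ 2 else 8 * ennreal (m * \<epsilon>)) * sup2 M {a..a + m} Q"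
proof -
  have QM: "Q l \<in> borel_measurable M" if "a \<le> l" "l < a + m" for l using Q[OF that] H_meas_M by blast
  have le: "(\<Sum>l\<in>{a..<a + m}. \<integral>\<^sup>+\<omega>. ennreal ((Q l \<omega>)\<^sup>2) \<partial>M) \<le> of_nat m * sup2 M {a..a + m} Q"
    using sum_bounded_above[of "{a..<a + m}" "\<lambda>l. \<integral>\<^sup>+\<omega>. ennreal ((Q l \<omega>)\<^sup>2) \<partial>M" "sup2 M {a..a + m} Q"]
    using nn_le_sup2[where I="{a..a + m}" and S=Q and M=M] by auto
  show ?thesis
  proof (cases "j = 0")
    case True
    have "sup2 M {a..a + m} (\<lambda>i \<omega>. \<Sum>l\<in>{a..<i}. Q l \<omega> * incr \<omega> j l) \<le> sup2 M {..m} (\<lambda>n \<omega>. \<Sum>l<n. Q (a + l) \<omega> * \<epsilon>)"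
    proof (rule sup2_mono)
      fix \<omega> i assume i: "i \<in> {a..a + m}"
      have "(\<Sum>l\<in>{a..<i}. Q l \<omega> * incr \<omega> j l) = (\<Sum>l<i - a. Q (a + l) \<omega> * \<epsilon>)"
        using i True sum.shift_bounds_nat_ivl[of "\<lambda>l. Q l \<omega> * \<epsilon>" 0 a "i - a"] by (simp add: incr_def atLeast0LessThan add.commute)
      then show "\<exists>n\<in>{..m}. \<bar>\<Sum>l\<in>{a..<i}. Q l \<omega> * incr \<omega> j l\<bar> \<le> \<bar>\<Sum>l<n. Q (a + l) \<omega> * \<epsilon>\<bar>"
        using i by (intro bexI[of _ "i - a"]) auto
    qed
    also have "\<dots> \<le> ennreal (\<epsilon>\<^sup>2 * m) * (\<Sum>l<m. \<integral>\<^sup>+\<omega>. ennreal ((Q (a + l) \<omega>)\<^sup>2) \<partial>M)"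
      by (rule dt_maximal) (auto intro: QM)
    also have "(\<Sum>l<m. \<integral>\<^sup>+\<omega>. ennreal ((Q (a + l) \<omega>)\<^sup>2) \<partial>M) = (\<Sum>l\<in>{a..<a + m}. \<integral>\<^sup>+\<omega>. ennreal ((Q l \<omega>)\<^sup>2) \<partial>M)"
      using sum.shift_bounds_nat_ivl[of "\<lambda>l. \<integral>\<^sup>+\<omega>. ennreal ((Q l \<omega>)\<^sup>2) \<partial>M" 0 a m] by (simp add: atLeast0LessThan add.commute)
    also have "ennreal (\<epsilon>\<^sup>2 * m) * \<dots> \<le> ennreal (\<epsilon>\<^sup>2 * m) * (of_nat m * sup2 M {a..a + m} Q)"
      by (intro mult_left_mono le) auto
    also have "\<dots> = ennreal (m * \<epsilon>) ^ 2 * sup2 M {a..a + m} Q"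
    proof -
      have "ennreal (\<epsilon>\<^sup>2 * m) * of_nat m = ennreal ((\<epsilon>\<^sup>2 * m) * m)"
        by (simp add: ennreal_of_nat_eq_real_of_nat ennreal_mult')
      also have "(\<epsilon>\<^sup>2 * m) * m = (m * \<epsilon>)\<^sup>2" by (simp add: power2_eq_square)
      also have "ennreal ((m * \<epsilon>)\<^sup>2) = ennreal (m * \<epsilon>) ^ 2" using eps by (simp add: ennreal_power)
      finally show ?thesis by (simp add: mult.assoc[symmetric])
    qed
    finally show ?thesis using True by simp
  next
    case False
    \<comment> \<open>\<open>xi_maximal\<close> sums from 0, so the coefficients are set to 0 before
      the cell.\<close>
    define Q' where "Q' l = (if a \<le> l then Q l else (\<lambda>_. 0))" for l
    have "sup2 M {a..a + m} (\<lambda>i \<omega>. \<Sum>l\<in>{a..<i}. Q l \<omega> * incr \<omega> j l) \<le> sup2 M {..a + m} (\<lambda>n \<omega>. \<Sum>l<n. Q' l \<omega> * \<xi> l \<omega>)"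
    proof (rule sup2_mono)
      fix \<omega> i assume i: "i \<in> {a..a + m}"
      have "(\<Sum>l\<in>{a..<i}. Q l \<omega> * incr \<omega> j l) = (\<Sum>l<i. Q' l \<omega> * \<xi> l \<omega>)"
        using False by (intro sum.mono_neutral_cong_left) (auto simp: Q'_def incr_def)
      then show "\<exists>n\<in>{..a + m}. \<bar>\<Sum>l\<in>{a..<i}. Q l \<omega> * incr \<omega> j l\<bar> \<le> \<bar>\<Sum>l<n. Q' l \<omega> * \<xi> l \<omega>\<bar>"
        using i by (intro bexI[of _ i]) auto
    qed
    also have "\<dots> \<le> 8 * ennreal \<epsilon> * (\<Sum>l<a + m. \<integral>\<^sup>+\<omega>. ennreal ((Q' l \<omega>)\<^sup>2) \<partial>M)"
      by (rule xi_maximal) (auto simp: Q'_def Q)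
    also have "(\<Sum>l<a + m. \<integral>\<^sup>+\<omega>. ennreal ((Q' l \<omega>)\<^sup>2) \<partial>M) = (\<Sum>l\<in>{a..<a + m}. \<integral>\<^sup>+\<omega>. ennreal ((Q l \<omega>)\<^sup>2) \<partial>M)"
      by (intro sum.mono_neutral_cong_right) (auto simp: Q'_def)
    also have "8 * ennreal \<epsilon> * \<dots> \<le> 8 * ennreal \<epsilon> * (of_nat m * sup2 M {a..a + m} Q)"
      by (intro mult_left_mono le) auto
    also have "\<dots> = 8 * ennreal (m * \<epsilon>) * sup2 M {a..a + m} Q"
      using eps by (simp add: ennreal_of_nat_eq_real_of_nat ennreal_mult ac_simps)
    finally show ?thesis using False by simp
  qed
qed

text \<open>A time index contributes two powers of the cell length and a noise index one, hence the
  exponent. The factor 8 is paid in every layer for uniformity.\<close>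

lemma ms_bound:
  assumes H: "\<And>l. a \<le> l \<Longrightarrow> l \<le> a + m \<Longrightarrow> H l \<in> borel_measurable (\<H> l)"
  shows "sup2 M {a..a + m} (ms a \<beta> H)
    \<le> 8 ^ length \<beta> * ennreal (m * \<epsilon>) ^ (length \<beta> + count_list \<beta> 0) * sup2 M {a..a + m} H"
proof (induction \<beta>)
  case (Cons j \<beta>)
  have "sup2 M {a..a + m} (ms a (j # \<beta>) H)
    \<le> (if j = 0 then ennreal (m * \<epsilon>) ^ 2 else 8 * ennreal (m * \<epsilon>)) * sup2 M {a..a + m} (ms a \<beta> H)"
    unfolding mis.simps by (intro step_bound ms_meas[where b="a + m"] H) auto
  also have "\<dots> \<le> (if j = 0 then ennreal (m * \<epsilon>) ^ 2 else 8 * ennreal (m * \<epsilon>))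
      * (8 ^ length \<beta> * ennreal (m * \<epsilon>) ^ (length \<beta> + count_list \<beta> 0) * sup2 M {a..a + m} H)"
    by (intro mult_left_mono Cons.IH) auto
  also have "\<dots> \<le> 8 ^ length (j # \<beta>) * ennreal (m * \<epsilon>) ^ (length (j # \<beta>) + count_list (j # \<beta>) 0) * sup2 M {a..a + m} H"
  proof (cases "j = 0")
    case True
    have "1 * (ennreal (m * \<epsilon>) ^ 2 * (8 ^ length \<beta> * ennreal (m * \<epsilon>) ^ (length \<beta> + count_list \<beta> 0) * sup2 M {a..a + m} H))
      \<le> 8 * (ennreal (m * \<epsilon>) ^ 2 * (8 ^ length \<beta> * ennreal (m * \<epsilon>) ^ (length \<beta> + count_list \<beta> 0) * sup2 M {a..a + m} H))"
      by (intro mult_right_mono) auto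
    then show ?thesis using True by (simp add: power_add power2_eq_square ac_simps)
  next
    case False
    then show ?thesis by (simp add: power_add ac_simps)
  qed
  finally show ?case .
qed simp

lemma sup2_finite_l2: "sup2 M I S < \<infinity> \<Longrightarrow> i \<in> I \<Longrightarrow> S i \<in> borel_measurable M \<Longrightarrow> l2 M (S i)"
  unfolding l2_def using nn_le_sup2[where I=I and S=S and M=M and i=i] by (auto intro: le_less_trans)

text \<open>Layers are peeled off from outside. An outermost noise increment is independent of
  everything before it; an outermost time increment is deterministic, so the question passes to the
  next layer, which must still contain a noise index.\<close>

lemma ms_mdiff:
  assumes H: "\<And>l. a \<le> l \<Longrightarrow> l \<le> a + m \<Longrightarrow> H l \<in> borel_measurable (\<H> l)"
    and fin: "sup2 M {a..a + m} H < \<infinity>" and \<beta>: "\<exists>j\<in>set \<beta>. j \<noteq> 0" and i: "a \<le> i" "i \<le> a + m"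
  shows "mdiff M (\<H> a) (ms a \<beta> H i)"
proof -
  have L2: "l2 M (ms a \<beta> H i)" if "a \<le> i" "i \<le> a + m" for i \<beta>
  proof (rule sup2_finite_l2)
    have "sup2 M {a..a + m} (ms a \<beta> H) \<le> 8 ^ length \<beta> * ennreal (m * \<epsilon>) ^ (length \<beta> + count_list \<beta> 0) * sup2 M {a..a + m} H"
      using H by (rule ms_bound)
    also have "\<dots> < \<infinity>" using fin by (simp add: ennreal_mult_less_top power_less_top_ennreal)
    finally show "sup2 M {a..a + m} (ms a \<beta> H) < \<infinity>" .
    show "ms a \<beta> H i \<in> borel_measurable M" using ms_meas[where b="a + m"] H that by (blast intro: H_meas_M)
  qed (use that in auto)
  have "(\<integral>\<omega>. W \<omega> * ms a \<beta> H i \<omega> \<partial>M) = 0" if W: "W \<in> borel_measurable (\<H> a)" "l2 M W" for W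
    using \<beta> i
  proof (induction \<beta> arbitrary: i)
    case (Cons j \<beta>)
    have z: "(\<integral>\<omega>. W \<omega> * (ms a \<beta> H l \<omega> * incr \<omega> j l) \<partial>M) = 0" "integrable M (\<lambda>\<omega>. W \<omega> * (ms a \<beta> H l \<omega> * incr \<omega> j l))"
      if l: "l \<in> {a..<i}" for l
    proof -
      have WI: "integrable M (\<lambda>\<omega>. W \<omega> * ms a \<beta> H l \<omega>)" using l Cons.prems by (intro l2_mult_integrable L2 W) auto
      have m: "(\<lambda>\<omega>. W \<omega> * ms a \<beta> H l \<omega>) \<in> borel_measurable (\<H> l)"
        using l Cons.prems H_meas_mono[OF W(1), of l] ms_meas[where b="a + m" and i=l and \<beta>=\<beta> and a=a and H=H] H by auto
      have "(\<integral>\<omega>. (W \<omega> * ms a \<beta> H l \<omega>) * incr \<omega> j l \<partial>M) = 0 \<and> integrable M (\<lambda>\<omega>. (W \<omega> * ms a \<beta> H l \<omega>) * incr \<omega> j l)"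
      proof (cases "j = 0")
        case True
        with Cons.prems have "\<exists>j\<in>set \<beta>. j \<noteq> 0" by auto
        then have "(\<integral>\<omega>. W \<omega> * ms a \<beta> H l \<omega> \<partial>M) = 0" using Cons.IH[of l] l Cons.prems by auto
        then show ?thesis using WI True incr_def by simp
      next
        case False
        then show ?thesis
          using xi_product[where g="\<lambda>x. x", OF m WI] xi_moments(2)[of l] xi_moments(1)[of l 1] by (simp add: incr_def)
      qed
      then show "(\<integral>\<omega>. W \<omega> * (ms a \<beta> H l \<omega> * incr \<omega> j l) \<partial>M) = 0" "integrable M (\<lambda>\<omega>. W \<omega> * (ms a \<beta> H l \<omega> * incr \<omega> j l))"
        by (auto simp: mult.assoc)
    qed
    show ?case using z by (simp add: sum_distrib_left Bochner_Integration.integral_sum)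
  qed auto
  then show ?thesis using L2[OF i] by (simp add: mdiff_def)
qed

section \<open>Accumulation of the contributions of the cells\<close>

definition concat_cells :: "nat \<Rightarrow> (nat \<Rightarrow> nat \<Rightarrow> 'a \<Rightarrow> real) \<Rightarrow> nat \<times> nat \<Rightarrow> 'a \<Rightarrow> real" where
  "concat_cells m g = (\<lambda>(n, i) \<omega>. (\<Sum>n'<n. g n' (n' * m + m) \<omega>) + g n i \<omega>)"

lemma finite_cells [simp]: "finite (cells m L)" "countable (cells m L)"
  by (auto simp: cells_def intro: countable_finite)

text \<open>With a noise index present, the cell totals are martingale differences on the coarse
  grid and their second moments add up without loss. A purely temporal index has no cancellation and
  loses the factor \<open>L\<close>. The constants are 18 = 2 (8 + 1) and 2 (L + 1), for the
  completed cells plus the current one.\<close>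

lemma cell_bound:
  assumes H: "\<And>n l. n < L \<Longrightarrow> n * m \<le> l \<Longrightarrow> l \<le> n * m + m \<Longrightarrow> H n l \<in> borel_measurable (\<H> l)"
  shows "sup2 M (cells m L) (concat_cells m (\<lambda>n. ms (n * m) \<beta> (H n)))
    \<le> (if \<forall>j\<in>set \<beta>. j = 0 then 2 * (of_nat L + 1) else 18)
       * (8 ^ length \<beta> * ennreal (m * \<epsilon>) ^ (length \<beta> + count_list \<beta> 0)) * (\<Sum>n<L. sup2 M {n * m..n * m + m} (H n))"
    (is "_ \<le> ?c * ?d * ?S")
proof (cases "?S < \<infinity>")
  case False
  show ?thesis
  \<comment> \<open>In \<open>ennreal\<close> zero times infinity is zero, so an infinite last
    factor helps only if the others are not 0. They are 0 only for m = 0 and a nonempty index; then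
    each cell is a point and all sums are empty.\<close>
  proof (cases "?d = 0")
    case True
    then have "real m * \<epsilon> = 0 \<and> \<beta> \<noteq> []" using eps by (auto simp: ennreal_eq_0_iff mult_le_0_iff)
    then have m: "m = 0" "\<beta> \<noteq> []" using eps by auto
    have z: "mis z a \<beta> G a = 0" for z a G using m(2) by (cases \<beta>) auto
    have "sup2 M (cells m L) (concat_cells m (\<lambda>n. ms (n * m) \<beta> (H n))) \<le> (\<integral>\<^sup>+\<omega>. 0 \<partial>M)"
      by (rule sup2_le_nn) (auto simp: cells_def concat_cells_def m(1) z)
    then show ?thesis by simp
  next
    case d: False
    have S: "?S = top" using False unfolding infinity_ennreal_def by (metis top.not_eq_extremum)
    have "?c * ?d \<noteq> 0" using d by (simp only: mult_eq_0_iff) simp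
    then have "?c * ?d * ?S = top" unfolding S by (metis ennreal_mult_top)
    then show ?thesis by simp
  qed
next
  case True
  let ?g = "\<lambda>n. ms (n * m) \<beta> (H n)"
  have gm: "?g n i \<in> borel_measurable (\<H> i)" if "n < L" "n * m \<le> i" "i \<le> n * m + m" for n i
    using that by (intro ms_meas[where b="n * m + m"] H) auto
  have gM: "?g n i \<in> borel_measurable M" if "n < L" "n * m \<le> i" "i \<le> n * m + m" for n i
    using gm[OF that] H_meas_M by blast
  have fin: "sup2 M {n * m..n * m + m} (H n) < \<infinity>" if "n < L" for n
    using True that by (simp add: less_top sum_Pinfty)
  have b: "sup2 M {n * m..n * m + m} (?g n) \<le> ?d * sup2 M {n * m..n * m + m} (H n)" if "n < L" for n
    using that H by (intro ms_bound) auto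
  have sb: "(\<Sum>n<L. sup2 M {n * m..n * m + m} (?g n)) \<le> ?d * ?S"
    unfolding sum_distrib_left by (intro sum_mono b) auto
  \<comment> \<open>Totals of the completed cells; the current cell is added at the end.\<close>
  define T where "T n \<omega> = (\<Sum>n'<n. ?g n' (n' * m + m) \<omega>)" for n \<omega>
  have T: "sup2 M {..L} T \<le> (if \<forall>j\<in>set \<beta>. j = 0 then of_nat L else 8) * (?d * ?S)"
  proof (cases "\<forall>j\<in>set \<beta>. j = 0")
    case True
    have "sup2 M {..L} T \<le> (\<integral>\<^sup>+\<omega>. of_nat L * (\<Sum>n<L. ennreal ((?g n (n * m + m) \<omega>)\<^sup>2)) \<partial>M)"
    proof (rule sup2_le_nn)
      fix \<omega> n assume n: "n \<in> {..L}"
      have "(T n \<omega>)\<^sup>2 \<le> n * (\<Sum>n'<n. (?g n' (n' * m + m) \<omega>)\<^sup>2)"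
        using Cauchy_Schwarz_ineq_sum[of "\<lambda>_. 1" "\<lambda>n'. ?g n' (n' * m + m) \<omega>" "{..<n}"] by (simp add: T_def)
      also have "\<dots> \<le> L * (\<Sum>n'<L. (?g n' (n' * m + m) \<omega>)\<^sup>2)"
        using n by (intro mult_mono sum_mono2) (auto intro: sum_nonneg)
      finally show "ennreal ((T n \<omega>)\<^sup>2) \<le> of_nat L * (\<Sum>n<L. ennreal ((?g n (n * m + m) \<omega>)\<^sup>2))"
        by (simp add: ennreal_leI sum_nonneg ennreal_of_nat_eq_real_of_nat flip: ennreal_mult')
    qed
    also have "\<dots> = of_nat L * (\<integral>\<^sup>+\<omega>. (\<Sum>n<L. ennreal ((?g n (n * m + m) \<omega>)\<^sup>2)) \<partial>M)"
      by (intro nn_integral_cmult borel_measurable_sum measurable_compose[OF _ measurable_ennreal] borel_measurable_power gM) auto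
    also have "(\<integral>\<^sup>+\<omega>. (\<Sum>n<L. ennreal ((?g n (n * m + m) \<omega>)\<^sup>2)) \<partial>M) = (\<Sum>n<L. \<integral>\<^sup>+\<omega>. ennreal ((?g n (n * m + m) \<omega>)\<^sup>2) \<partial>M)"
      by (intro nn_integral_sum measurable_compose[OF _ measurable_ennreal] borel_measurable_power gM) auto
    also have "\<dots> \<le> (\<Sum>n<L. sup2 M {n * m..n * m + m} (?g n))" by (intro sum_mono nn_le_sup2) auto
    also have "of_nat L * \<dots> \<le> of_nat L * (?d * ?S)" by (intro mult_left_mono sb) auto
    finally show ?thesis using True by (simp add: mult_left_mono)
  next
    case False
    have "sup2 M {..L} T \<le> 8 * (\<Sum>n<L. \<integral>\<^sup>+\<omega>. ennreal ((?g n (n * m + m) \<omega>)\<^sup>2) \<partial>M)"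
      unfolding T_def
    \<comment> \<open>The filtration is read on the coarse grid: the total of cell n is known at its
      end and orthogonal to what is known at its start.\<close>
    proof (rule maximal_inequality[where G="\<lambda>n. \<H> (n * m)"])
      show "?g n (n * m + m) \<in> borel_measurable (\<H> (Suc n * m))" if "n < L" for n
        using gm[OF that, of "n * m + m"] by (simp add: add.commute)
      show "mdiff M (\<H> (n * m)) (?g n (n * m + m))" if "n < L" for n
        using False that by (intro ms_mdiff[where m=m] H fin) auto
      show "sets (\<H> (n * m)) \<subseteq> sets (\<H> (Suc n * m))" for n by (rule H_mono) simp
    qed (rule sub)
    also have "(\<Sum>n<L. \<integral>\<^sup>+\<omega>. ennreal ((?g n (n * m + m) \<omega>)\<^sup>2) \<partial>M) \<le> (\<Sum>n<L. sup2 M {n * m..n * m + m} (?g n))"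
      by (intro sum_mono nn_le_sup2) auto
    also have "\<dots> \<le> ?d * ?S" by (rule sb)
    finally have "sup2 M {..L} T \<le> 8 * (?d * ?S)" by (simp add: mult_left_mono)
    then show ?thesis unfolding if_not_P[OF False] .
  qed
  have TM: "T n \<in> borel_measurable M" if "n \<le> L" for n
    unfolding T_def using that by (intro borel_measurable_sum gM) auto
  have "sup2 M (cells m L) (concat_cells m ?g) = sup2 M (cells m L) (\<lambda>p \<omega>. T (fst p) \<omega> + ?g (fst p) (snd p) \<omega>)"
    by (simp add: concat_cells_def T_def case_prod_unfold)
  also have "\<dots> \<le> 2 * (sup2 M (cells m L) (\<lambda>p. T (fst p)) + sup2 M (cells m L) (\<lambda>p. ?g (fst p) (snd p)))"
    by (intro sup2_add) (auto simp: cells_def intro: TM gM)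
  also have "sup2 M (cells m L) (\<lambda>p. T (fst p)) \<le> sup2 M {..L} T"
    by (rule sup2_mono) (auto simp: cells_def)
  also have "sup2 M (cells m L) (\<lambda>p. ?g (fst p) (snd p)) = sup2 M (\<Union>n\<in>{..<L}. Pair n ` {n * m..n * m + m}) (\<lambda>p. ?g (fst p) (snd p))"
    by (intro arg_cong[where f="\<lambda>I. sup2 M I (\<lambda>p. ?g (fst p) (snd p))"]) (auto simp: cells_def)
  also have "\<dots> \<le> (\<Sum>n<L. sup2 M (Pair n ` {n * m..n * m + m}) (\<lambda>p. ?g (fst p) (snd p)))"
    by (intro sup2_UN) (auto intro: gM)
  also have "\<dots> \<le> (\<Sum>n<L. sup2 M {n * m..n * m + m} (?g n))"
    by (intro sum_mono sup2_mono) auto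
  also note sb
  also note T
  finally have "sup2 M (cells m L) (concat_cells m ?g) \<le> 2 * ((if \<forall>j\<in>set \<beta>. j = 0 then of_nat L else 8) * (?d * ?S) + ?d * ?S)"
    by (simp add: mult_left_mono add_mono)
  also have "\<dots> = ?c * ?d * ?S"
  proof -
    have X: "2 * (c * X + X) = (2 * (c + 1)) * X" for c X :: ennreal
      by (simp add: distrib_right distrib_left mult.assoc)
    show ?thesis
    proof (cases "\<forall>j\<in>set \<beta>. j = 0")
      case True
      then show ?thesis using X[of "of_nat L" "?d * ?S"] by (simp only: if_P mult.assoc)
    next
      case False
      have "2 * (8 + 1) = (18 :: ennreal)" by simp
      then show ?thesis using False X[of 8 "?d * ?S"] by (simp only: if_False mult.assoc)
    qed
  qed
  finally show ?thesis .
qed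

end

section \<open>Euler approximation on a fine grid against the Taylor scheme on a coarse grid\<close>

text \<open>Dictionary: a coarse step of length m \<epsilon> consists of \<open>m\<close> fine ones,
  \<open>L\<close> coarse steps lead to the horizon \<open>U\<close>, \<open>g\<close> is 2
  \<gamma>, and \<open>h\<close>, \<open>k\<close> bound the coefficients on all of [0, U]. In
  \<open>R_order\<close> a purely temporal index must have one more order, which pays for its loss
  of a factor \<open>L\<close> in \<open>cell_bound\<close>. \<kappa> collects constants that depend
  on the index sets only.\<close>

locale taylor_walk = gaussian_walk M \<H> \<xi> \<epsilon>
  for M :: "'a measure" and \<H> \<xi> \<epsilon> +
  fixes f :: "nat list \<Rightarrow> real \<Rightarrow> real \<Rightarrow> real" and A R :: "nat list set"
    and m L g :: nat and x0 h k \<kappa> U :: real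
  assumes m_pos: "0 < m" and d_le: "m * \<epsilon> \<le> 1" and U_def: "U = L * (m * \<epsilon>)"
    and A_fin: "finite A" and A_base: "[] \<in> A" "[0] \<in> A" "[1] \<in> A"
    and A_tl: "\<And>\<alpha>. \<alpha> \<in> A \<Longrightarrow> \<alpha> \<noteq> [] \<Longrightarrow> tl \<alpha> \<in> A \<and> (hd \<alpha> = 0 \<or> hd \<alpha> = 1)"
    and R_def: "R = (#) 0 ` A \<union> (#) 1 ` A - A"
    and R_order: "\<And>\<alpha>. \<alpha> \<in> R \<Longrightarrow> (if \<forall>j\<in>set \<alpha>. j = 0 then g + 2 else g + 1) \<le> length \<alpha> + count_list \<alpha> 0"
    and f_nil: "\<And>u x. f [] u x = x"
    and f_meas: "\<And>\<alpha> u. \<alpha> \<in> A \<union> R \<Longrightarrow> 0 \<le> u \<Longrightarrow> f \<alpha> u \<in> borel_measurable borel"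
    and f_lip: "\<And>\<alpha> u x y. \<alpha> \<in> A - {[]} \<Longrightarrow> 0 \<le> u \<Longrightarrow> u \<le> U \<Longrightarrow> \<bar>f \<alpha> u x - f \<alpha> u y\<bar> \<le> h * \<bar>x - y\<bar>"
    and f_lin: "\<And>\<alpha> u x. \<alpha> \<in> A - {[]} \<Longrightarrow> 0 \<le> u \<Longrightarrow> u \<le> U \<Longrightarrow> \<bar>f \<alpha> u x\<bar> \<le> h * (1 + \<bar>x\<bar>)"
    and f_rem: "\<And>\<alpha> u x. \<alpha> \<in> R \<Longrightarrow> 0 \<le> u \<Longrightarrow> u \<le> U \<Longrightarrow> \<bar>f \<alpha> u x\<bar> \<le> k * (1 + \<bar>x\<bar>)"
    and hk: "0 \<le> h" "0 \<le> k"
    and \<kappa>: "20 * real (card A) * (\<Sum>\<alpha>\<in>A. 8 ^ length \<alpha>) \<le> \<kappa>" "20 * real (card R) * (\<Sum>\<alpha>\<in>R. 8 ^ length \<alpha>) \<le> \<kappa>"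
begin

definition tm :: "nat \<Rightarrow> real" where "tm l = l * \<epsilon>"

primrec euler :: "nat \<Rightarrow> 'a \<Rightarrow> real" where
  "euler 0 \<omega> = x0"
| "euler (Suc l) \<omega> = euler l \<omega> + f [0] (tm l) (euler l \<omega>) * \<epsilon> + f [1] (tm l) (euler l \<omega>) * \<xi> l \<omega>"

text \<open>The Taylor scheme at the coarse grid points, with the multiple integrals replaced by
  multiple sums over the fine grid inside the cell.\<close>

primrec scheme :: "nat \<Rightarrow> 'a \<Rightarrow> real" where
  "scheme 0 \<omega> = x0"
| "scheme (Suc n) \<omega> = scheme n \<omega>
    + (\<Sum>\<alpha>\<in>A - {[]}. ms (n * m) (rev \<alpha>) (\<lambda>_ _. f \<alpha> (tm (n * m)) (scheme n \<omega>)) (n * m + m) \<omega>)"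

definition scheme_in :: "nat \<Rightarrow> nat \<Rightarrow> 'a \<Rightarrow> real" where
  "scheme_in n i \<omega> = scheme n \<omega>
    + (\<Sum>\<alpha>\<in>A - {[]}. ms (n * m) (rev \<alpha>) (\<lambda>_ _. f \<alpha> (tm (n * m)) (scheme n \<omega>)) i \<omega>)"

text \<open>Defect of the discrete Ito formula for \<open>f \<alpha>\<close> over one fine step:
  \<open>0 # \<alpha>\<close> and \<open>1 # \<alpha>\<close> stand for L^0 and L^1 applied to
  \<open>f \<alpha>\<close>. It vanishes for the empty index.\<close>

definition ito_rem :: "nat list \<Rightarrow> nat \<Rightarrow> 'a \<Rightarrow> real" where
  "ito_rem \<alpha> l \<omega> = f \<alpha> (tm (Suc l)) (euler (Suc l) \<omega>) - f \<alpha> (tm l) (euler l \<omega>)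
     - f (0 # \<alpha>) (tm l) (euler l \<omega>) * \<epsilon> - f (1 # \<alpha>) (tm l) (euler l \<omega>) * \<xi> l \<omega>"

definition cell_err :: "nat \<Rightarrow> nat \<Rightarrow> 'a \<Rightarrow> real" where
  "cell_err n i \<omega> = (\<Sum>\<alpha>\<in>A. ms (n * m) (rev \<alpha>) (\<lambda>i \<omega>. \<Sum>l\<in>{n * m..<i}. ito_rem \<alpha> l \<omega>) i \<omega>)"

text \<open>Only the first \<open>n\<close> cells are inspected, so the event is known at the start
  of cell \<open>n\<close> and its indicator may multiply the integrand of that cell.\<close>

definition good :: "real \<Rightarrow> nat \<Rightarrow> 'a \<Rightarrow> bool" where
  "good \<eta> n \<omega> \<longleftrightarrow> (\<forall>p\<in>cells m n. \<bar>concat_cells m cell_err p \<omega>\<bar> \<le> \<eta>)"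

lemma tm_nonneg [simp]: "0 \<le> tm l" using eps by (simp add: tm_def)

lemma tm_le: "l \<le> L * m \<Longrightarrow> tm l \<le> U"
proof -
  assume "l \<le> L * m"
  then have "real l * \<epsilon> \<le> real (L * m) * \<epsilon>" using eps by (intro mult_right_mono) (auto simp only: of_nat_le_iff)
  then show ?thesis by (simp add: tm_def U_def)
qed

lemma d_nonneg: "0 \<le> m * \<epsilon>" using eps by simp

lemma U_nonneg: "0 \<le> U" using eps by (simp add: U_def)

lemma ext_in: "\<alpha> \<in> A \<Longrightarrow> j = 0 \<or> j = 1 \<Longrightarrow> j # \<alpha> \<in> A \<union> R"
  unfolding R_def by auto

lemma R_fin: "finite R" using A_fin by (simp add: R_def)

text \<open>An exact identity, since the Ito defects are kept. Each \<open>f \<alpha>\<close> with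
  \<alpha> in \<open>A\<close> is expanded by the discrete Ito formula; after summation over
  \<open>A\<close> the terms with index in \<open>A - {[]}\<close> appear on both sides and cancel,
  and the extensions that leave \<open>A\<close> form the remainder.\<close>

lemma taylor_expansion:
  assumes "a \<le> i"
  shows "euler i \<omega> = euler a \<omega> + (\<Sum>\<alpha>\<in>A - {[]}. ms a (rev \<alpha>) (\<lambda>_ _. f \<alpha> (tm a) (euler a \<omega>)) i \<omega>)
    + (\<Sum>\<alpha>\<in>R. ms a (rev \<alpha>) (\<lambda>l \<omega>. f \<alpha> (tm l) (euler l \<omega>)) i \<omega>)
    + (\<Sum>\<alpha>\<in>A. ms a (rev \<alpha>) (\<lambda>i \<omega>. \<Sum>l\<in>{a..<i}. ito_rem \<alpha> l \<omega>) i \<omega>)"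
proof -
  define T where "T \<alpha> = ms a (rev \<alpha>) (\<lambda>l \<omega>. f \<alpha> (tm l) (euler l \<omega>)) i \<omega>" for \<alpha>
  define C where "C \<alpha> = ms a (rev \<alpha>) (\<lambda>_ _. f \<alpha> (tm a) (euler a \<omega>)) i \<omega>" for \<alpha>
  define E where "E \<alpha> = ms a (rev \<alpha>) (\<lambda>i \<omega>. \<Sum>l\<in>{a..<i}. ito_rem \<alpha> l \<omega>) i \<omega>" for \<alpha>
  have step: "T \<alpha> = C \<alpha> + T (0 # \<alpha>) + T (1 # \<alpha>) + E \<alpha>" for \<alpha>
  proof -
    have p: "f \<alpha> (tm l) (euler l \<omega>) = f \<alpha> (tm a) (euler a \<omega>)
        + (\<Sum>l\<in>{a..<l}. f (0 # \<alpha>) (tm l) (euler l \<omega>) * incr \<omega> 0 l)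
        + (\<Sum>l\<in>{a..<l}. f (1 # \<alpha>) (tm l) (euler l \<omega>) * incr \<omega> 1 l) + (\<Sum>l\<in>{a..<l}. ito_rem \<alpha> l \<omega>)"
      if "a \<le> l" for l
      using that
    proof (induction l rule: dec_induct)
      case (step n)
      show ?case using step.hyps unfolding sum.atLeastLessThan_Suc[OF step.hyps(1)] ito_rem_def[of \<alpha> n]
        using step.IH by (simp add: incr_def)
    qed simp
    have "T \<alpha> = mis (incr \<omega>) a (rev \<alpha>) (\<lambda>l. f \<alpha> (tm a) (euler a \<omega>)
        + (\<Sum>l\<in>{a..<l}. f (0 # \<alpha>) (tm l) (euler l \<omega>) * incr \<omega> 0 l)
        + (\<Sum>l\<in>{a..<l}. f (1 # \<alpha>) (tm l) (euler l \<omega>) * incr \<omega> 1 l) + (\<Sum>l\<in>{a..<l}. ito_rem \<alpha> l \<omega>)) i"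
      unfolding T_def by (rule mis_cong[OF p assms])
    then show ?thesis unfolding mis_add by (simp add: T_def C_def E_def mis_append)
  qed
  have inj: "inj_on ((#) j) A" for j :: nat by (simp add: inj_on_def)
  \<comment> \<open>Every index of \<open>A - {[]}\<close> has its tail in \<open>A\<close>, so the
    one-letter extensions of \<open>A\<close> are exactly these indices and those of
    \<open>R\<close>.\<close>
  have S: "(#) 0 ` A \<union> (#) 1 ` A = (A - {[]}) \<union> R"
  proof
    show "(A - {[]}) \<union> R \<subseteq> (#) 0 ` A \<union> (#) 1 ` A"
    proof
      fix \<alpha> assume "\<alpha> \<in> (A - {[]}) \<union> R"
      then show "\<alpha> \<in> (#) 0 ` A \<union> (#) 1 ` A"
        using A_tl[of \<alpha>] by (cases \<alpha>) (auto simp: R_def)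
    qed
  qed (auto simp: R_def)
  have "(\<Sum>\<alpha>\<in>A. T (0 # \<alpha>)) + (\<Sum>\<alpha>\<in>A. T (1 # \<alpha>)) = (\<Sum>\<alpha>\<in>(#) 0 ` A. T \<alpha>) + (\<Sum>\<alpha>\<in>(#) 1 ` A. T \<alpha>)"
    by (simp add: sum.reindex[OF inj])
  also have "\<dots> = (\<Sum>\<alpha>\<in>(#) 0 ` A \<union> (#) 1 ` A. T \<alpha>)"
    using A_fin by (subst sum.union_disjoint) auto
  also have "\<dots> = (\<Sum>\<alpha>\<in>A - {[]}. T \<alpha>) + (\<Sum>\<alpha>\<in>R. T \<alpha>)"
    unfolding S using A_fin R_fin by (subst sum.union_disjoint) (auto simp: R_def)
  finally have 1: "(\<Sum>\<alpha>\<in>A. T (0 # \<alpha>)) + (\<Sum>\<alpha>\<in>A. T (1 # \<alpha>)) = (\<Sum>\<alpha>\<in>A - {[]}. T \<alpha>) + (\<Sum>\<alpha>\<in>R. T \<alpha>)" .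
  have "(\<Sum>\<alpha>\<in>A. T \<alpha>) = (\<Sum>\<alpha>\<in>A. C \<alpha>) + ((\<Sum>\<alpha>\<in>A. T (0 # \<alpha>)) + (\<Sum>\<alpha>\<in>A. T (1 # \<alpha>))) + (\<Sum>\<alpha>\<in>A. E \<alpha>)"
  proof -
    have "(\<Sum>\<alpha>\<in>A. T \<alpha>) = (\<Sum>\<alpha>\<in>A. C \<alpha> + T (0 # \<alpha>) + T (1 # \<alpha>) + E \<alpha>)" by (intro sum.cong refl step)
    then show ?thesis by (simp only: sum.distrib add.assoc)
  qed
  also have "(\<Sum>\<alpha>\<in>A. T \<alpha>) = T [] + (\<Sum>\<alpha>\<in>A - {[]}. T \<alpha>)" using A_fin A_base by (simp add: sum.remove)
  also have "(\<Sum>\<alpha>\<in>A. C \<alpha>) = C [] + (\<Sum>\<alpha>\<in>A - {[]}. C \<alpha>)" using A_fin A_base by (simp add: sum.remove)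
  finally have "T [] = C [] + (\<Sum>\<alpha>\<in>A - {[]}. C \<alpha>) + (\<Sum>\<alpha>\<in>R. T \<alpha>) + (\<Sum>\<alpha>\<in>A. E \<alpha>)" using 1 by simp
  then show ?thesis by (simp add: T_def C_def E_def f_nil)
qed

section \<open>Measurability of the discrete processes\<close>

lemma f_comp_meas:
  assumes "Y \<in> borel_measurable (\<H> l)" "\<alpha> \<in> A \<union> R" "0 \<le> u"
  shows "(\<lambda>\<omega>. f \<alpha> u (Y \<omega>)) \<in> borel_measurable (\<H> l)"
  using measurable_compose[OF assms(1) f_meas[OF assms(2,3)]] .

lemma euler_meas: "euler l \<in> borel_measurable (\<H> l)"
proof (induction l)
  case (Suc l)
  have 1: "euler l \<in> borel_measurable (\<H> (Suc l))" using Suc by (rule H_meas_mono) simp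
  have "(\<lambda>\<omega>. f [0] (tm l) (euler l \<omega>)) \<in> borel_measurable (\<H> (Suc l))" "(\<lambda>\<omega>. f [1] (tm l) (euler l \<omega>)) \<in> borel_measurable (\<H> (Suc l))"
    using A_base by (auto intro!: f_comp_meas[OF 1])
  then show ?case using 1 xi_meas by auto
qed simp

lemma f_euler_meas: "\<alpha> \<in> A \<union> R \<Longrightarrow> (\<lambda>\<omega>. f \<alpha> (tm l) (euler l \<omega>)) \<in> borel_measurable (\<H> l)"
  by (intro f_comp_meas euler_meas) auto

lemma scheme_term_meas:
  assumes "scheme n \<in> borel_measurable (\<H> (n * m))" "\<alpha> \<in> A" "n * m \<le> i"
  shows "(\<lambda>\<omega>. ms (n * m) (rev \<alpha>) (\<lambda>_ _. f \<alpha> (tm (n * m)) (scheme n \<omega>)) i \<omega>) \<in> borel_measurable (\<H> i)"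
proof -
  have "ms (n * m) (rev \<alpha>) (\<lambda>_ \<omega>. f \<alpha> (tm (n * m)) (scheme n \<omega>)) i \<in> borel_measurable (\<H> i)"
    using assms by (intro ms_meas[where b=i] H_meas_mono[OF f_comp_meas[OF assms(1)]]) auto
  then show ?thesis .
qed

lemma scheme_meas: "scheme n \<in> borel_measurable (\<H> (n * m))"
proof (induction n)
  case (Suc n)
  have "scheme n \<in> borel_measurable (\<H> (n * m + m))" using Suc by (rule H_meas_mono) simp
  moreover have "scheme (Suc n) = (\<lambda>\<omega>. scheme n \<omega>
      + (\<Sum>\<alpha>\<in>A - {[]}. ms (n * m) (rev \<alpha>) (\<lambda>_ _. f \<alpha> (tm (n * m)) (scheme n \<omega>)) (n * m + m) \<omega>))"
    by (rule ext) simp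
  ultimately have "scheme (Suc n) \<in> borel_measurable (\<H> (n * m + m))"
    using scheme_term_meas[OF Suc] by (auto intro!: borel_measurable_add borel_measurable_sum)
  then show ?case by (simp only: mult_Suc add.commute)
qed simp

lemma scheme_in_meas: "n * m \<le> i \<Longrightarrow> scheme_in n i \<in> borel_measurable (\<H> i)"
  unfolding scheme_in_def using scheme_term_meas[OF scheme_meas] H_meas_mono[OF scheme_meas, of n i]
  by (auto intro!: borel_measurable_add borel_measurable_sum)

lemma scheme_in_end: "scheme_in n (n * m + m) \<omega> = scheme (Suc n) \<omega>"
  by (simp add: scheme_in_def)

lemma ito_rem_meas: "\<alpha> \<in> A \<Longrightarrow> ito_rem \<alpha> l \<in> borel_measurable (\<H> (Suc l))"
proof -
  assume a: "\<alpha> \<in> A"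
  then have "0 # \<alpha> \<in> A \<union> R" "1 # \<alpha> \<in> A \<union> R" using ext_in by auto
  note this[THEN f_euler_meas, of l, THEN H_meas_mono, of "Suc l"]
  moreover have "(\<lambda>\<omega>. f \<alpha> (tm l) (euler l \<omega>)) \<in> borel_measurable (\<H> (Suc l))"
    using a by (intro H_meas_mono[OF f_euler_meas, of _ l]) auto
  moreover have "(\<lambda>\<omega>. f \<alpha> (tm (Suc l)) (euler (Suc l) \<omega>)) \<in> borel_measurable (\<H> (Suc l))"
    using a by (intro f_euler_meas) auto
  ultimately show ?thesis unfolding ito_rem_def using xi_meas[of l]
    by (intro borel_measurable_diff borel_measurable_times) (auto simp del: euler.simps)
qed

lemma ito_rem_sum_meas: "\<alpha> \<in> A \<Longrightarrow> (\<lambda>\<omega>. \<Sum>l\<in>{a..<i}. ito_rem \<alpha> l \<omega>) \<in> borel_measurable (\<H> i)"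
  by (intro borel_measurable_sum H_meas_mono[OF ito_rem_meas]) auto

lemma cell_err_meas: "n * m \<le> i \<Longrightarrow> cell_err n i \<in> borel_measurable (\<H> i)"
  unfolding cell_err_def by (intro borel_measurable_sum ms_meas[where b=i] ito_rem_sum_meas) auto

lemma good_meas: "Measurable.pred (\<H> (n * m)) (good \<eta> n)"
proof -
  have "concat_cells m cell_err p \<in> borel_measurable (\<H> (n * m))" if p: "p \<in> cells m n" for p
  proof -
    obtain n' i where pi: "p = (n', i)" "n' < n" "n' * m \<le> i" "i \<le> n' * m + m" using p by (auto simp: cells_def)
    \<comment> \<open>Cells before \<open>n\<close> end no later than n m, so everything the event
      depends on is known by then.\<close>
    have le: "n'' * m + m \<le> n * m" if "n'' \<le> n'" for n''
    proof -
      have "Suc n'' * m \<le> n * m" using that pi by (intro mult_right_mono) auto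
      then show ?thesis by (simp add: add.commute)
    qed
    have "cell_err n'' (n'' * m + m) \<in> borel_measurable (\<H> (n * m))" if "n'' < n'" for n''
      using le that by (intro H_meas_mono[OF cell_err_meas]) auto
    moreover have "cell_err n' i \<in> borel_measurable (\<H> (n * m))"
      using pi le[of n'] by (intro H_meas_mono[OF cell_err_meas]) auto
    ultimately show ?thesis unfolding pi concat_cells_def by auto
  qed
  then show ?thesis unfolding good_def by (intro pred_intros_finite) auto
qed

section \<open>Second moments of the Euler process and mean square error of the scheme\<close>

lemma sup2_const_le: "sup2 M I (\<lambda>_ _. c) \<le> ennreal (c\<^sup>2)"
proof -
  have "sup2 M I (\<lambda>_ _. c) \<le> (\<integral>\<^sup>+\<omega>. ennreal (c\<^sup>2) \<partial>M)" by (rule sup2_le_nn) simp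
  then show ?thesis by (simp add: emeasure_space_1)
qed

lemma linear_growth_sq: "0 \<le> c \<Longrightarrow> \<bar>a\<bar> \<le> c * (1 + \<bar>y\<bar>) \<Longrightarrow> a\<^sup>2 \<le> 2 * c\<^sup>2 * (1 + y\<^sup>2)" for a c y :: real
proof -
  assume *: "0 \<le> c" "\<bar>a\<bar> \<le> c * (1 + \<bar>y\<bar>)"
  have "a\<^sup>2 \<le> (c * (1 + \<bar>y\<bar>))\<^sup>2" using * by (simp add: abs_le_square_iff[symmetric])
  also have "\<dots> = c\<^sup>2 * (1 + \<bar>y\<bar>)\<^sup>2" by (simp add: power_mult_distrib)
  also have "\<dots> \<le> c\<^sup>2 * (2 * (1 + y\<^sup>2))"
    using sum_squares_bound[of 1 "\<bar>y\<bar>"] by (intro mult_left_mono) (auto simp: power2_sum)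
  finally show ?thesis by (simp add: algebra_simps)
qed

lemma nn_linear_growth:
  assumes "0 \<le> c" "\<And>\<omega>. \<omega> \<in> space M \<Longrightarrow> \<bar>a \<omega>\<bar> \<le> c * (1 + \<bar>y \<omega>\<bar>)" "y \<in> borel_measurable M"
  shows "(\<integral>\<^sup>+\<omega>. ennreal ((a \<omega>)\<^sup>2) \<partial>M) \<le> ennreal (2 * c\<^sup>2) * (1 + (\<integral>\<^sup>+\<omega>. ennreal ((y \<omega>)\<^sup>2) \<partial>M))"
proof -
  have "(\<integral>\<^sup>+\<omega>. ennreal ((a \<omega>)\<^sup>2) \<partial>M) \<le> (\<integral>\<^sup>+\<omega>. ennreal (2 * c\<^sup>2) * (1 + ennreal ((y \<omega>)\<^sup>2)) \<partial>M)"
  proof (rule nn_integral_mono)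
    fix \<omega> assume "\<omega> \<in> space M"
    then have "(a \<omega>)\<^sup>2 \<le> 2 * c\<^sup>2 * (1 + (y \<omega>)\<^sup>2)" using assms by (intro linear_growth_sq) auto
    then have "ennreal ((a \<omega>)\<^sup>2) \<le> ennreal (2 * c\<^sup>2 * (1 + (y \<omega>)\<^sup>2))" by (rule ennreal_leI)
    also have "\<dots> = ennreal (2 * c\<^sup>2) * (1 + ennreal ((y \<omega>)\<^sup>2))"
      by (subst ennreal_mult) (simp_all flip: ennreal_1 ennreal_plus)
    finally show "ennreal ((a \<omega>)\<^sup>2) \<le> ennreal (2 * c\<^sup>2) * (1 + ennreal ((y \<omega>)\<^sup>2))" .
  qed
  also have "\<dots> = ennreal (2 * c\<^sup>2) * (1 + (\<integral>\<^sup>+\<omega>. ennreal ((y \<omega>)\<^sup>2) \<partial>M))"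
    using assms(3) by (subst nn_integral_cmult) (auto simp: nn_integral_add emeasure_space_1)
  finally show ?thesis .
qed

lemma euler_sum: "euler n \<omega> = x0 + ((\<Sum>l<n. f [0] (tm l) (euler l \<omega>) * \<epsilon>) + (\<Sum>l<n. f [1] (tm l) (euler l \<omega>) * \<xi> l \<omega>))"
  by (induction n) auto

lemma euler_M: "euler l \<in> borel_measurable M" using euler_meas by (rule H_meas_M)

text \<open>Gronwall for the running supremum. Linear growth gives 2 h^2 (1 + second moment), the
  time sum costs \<open>U\<close>, the noise sum 8, and two uses of (a + b)^2 <= 2 a^2 + 2 b^2 give
  4; hence 8 (U + 8) h^2. Adding 1 to the moment makes the recursion linear in one quantity.\<close>

lemma euler_moment:
  "1 + sup2 M {..L * m} euler \<le> ennreal ((1 + 2 * x0\<^sup>2) * exp (8 * (U + 8) * h\<^sup>2 * U))"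
proof -
  let ?c = "8 * (U + 8) * h\<^sup>2 * \<epsilon>"
  have gro: "1 + sup2 M {..n} euler \<le> ennreal (1 + 2 * x0\<^sup>2) + ennreal ?c * (\<Sum>l<n. 1 + sup2 M {..l} euler)" if n: "n \<le> L * m" for n
  proof -
    let ?S = "\<lambda>j n \<omega>. \<Sum>l<n. f [j] (tm l) (euler l \<omega>) * (if j = 0 then \<epsilon> else \<xi> l \<omega>)"
    have fm: "(\<lambda>\<omega>. f [j] (tm l) (euler l \<omega>)) \<in> borel_measurable (\<H> l)" if "j = 0 \<or> j = 1" for j l
      using that A_base by (intro f_euler_meas) auto
    have Sm: "?S j n \<in> borel_measurable M" if "j = 0 \<or> j = 1" for j n
      using H_meas_M[OF fm[OF that]] by auto
    have E: "(\<integral>\<^sup>+\<omega>. ennreal ((f [j] (tm l) (euler l \<omega>))\<^sup>2) \<partial>M) \<le> ennreal (2 * h\<^sup>2) * (1 + sup2 M {..l} euler)"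
      if "j = 0 \<or> j = 1" "l < n" for j l
    proof -
      have "(\<integral>\<^sup>+\<omega>. ennreal ((f [j] (tm l) (euler l \<omega>))\<^sup>2) \<partial>M) \<le> ennreal (2 * h\<^sup>2) * (1 + (\<integral>\<^sup>+\<omega>. ennreal ((euler l \<omega>)\<^sup>2) \<partial>M))"
        using that n A_base hk tm_le[of l] by (intro nn_linear_growth euler_M f_lin) auto
      also have "\<dots> \<le> ennreal (2 * h\<^sup>2) * (1 + sup2 M {..l} euler)"
        by (intro mult_left_mono add_left_mono nn_le_sup2) auto
      finally show ?thesis .
    qed
    let ?X = "\<Sum>l<n. 1 + sup2 M {..l} euler"
    have E': "(\<Sum>l<n. \<integral>\<^sup>+\<omega>. ennreal ((f [j] (tm l) (euler l \<omega>))\<^sup>2) \<partial>M) \<le> ennreal (2 * h\<^sup>2) * ?X" if "j = 0 \<or> j = 1" for j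
      unfolding sum_distrib_left using that E by (intro sum_mono) auto
    have S0: "sup2 M {..n} (?S 0) \<le> ennreal (\<epsilon> * U) * (ennreal (2 * h\<^sup>2) * ?X)"
    proof -
      have "sup2 M {..n} (?S 0) \<le> ennreal (\<epsilon>\<^sup>2 * n) * (\<Sum>l<n. \<integral>\<^sup>+\<omega>. ennreal ((f [0] (tm l) (euler l \<omega>))\<^sup>2) \<partial>M)"
        using dt_maximal[of n "\<lambda>l \<omega>. f [0] (tm l) (euler l \<omega>)"] H_meas_M[OF fm] by simp
      also have "\<dots> \<le> ennreal (\<epsilon> * U) * (ennreal (2 * h\<^sup>2) * ?X)"
      proof (intro mult_mono)
        have "\<epsilon> * (n * \<epsilon>) \<le> \<epsilon> * U" using tm_le[OF n] eps by (intro mult_left_mono) (auto simp: tm_def)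
        then show "ennreal (\<epsilon>\<^sup>2 * n) \<le> ennreal (\<epsilon> * U)" by (intro ennreal_leI) (simp add: power2_eq_square ac_simps)
      qed (use E'[of 0] in auto)
      finally show ?thesis .
    qed
    have S1: "sup2 M {..n} (?S 1) \<le> 8 * ennreal \<epsilon> * (ennreal (2 * h\<^sup>2) * ?X)"
    proof -
      have "sup2 M {..n} (?S 1) \<le> 8 * ennreal \<epsilon> * (\<Sum>l<n. \<integral>\<^sup>+\<omega>. ennreal ((f [1] (tm l) (euler l \<omega>))\<^sup>2) \<partial>M)"
        using xi_maximal[of n "\<lambda>l \<omega>. f [1] (tm l) (euler l \<omega>)"] fm by simp
      also have "\<dots> \<le> 8 * ennreal \<epsilon> * (ennreal (2 * h\<^sup>2) * ?X)"
        using E'[of 1] by (intro mult_left_mono) auto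
      finally show ?thesis .
    qed
    have "sup2 M {..n} euler = sup2 M {..n} (\<lambda>n \<omega>. x0 + (?S 0 n \<omega> + ?S 1 n \<omega>))"
      by (subst euler_sum[abs_def]) simp
    also have "\<dots> \<le> 2 * (sup2 M {..n} (\<lambda>_ _. x0) + sup2 M {..n} (\<lambda>n \<omega>. ?S 0 n \<omega> + ?S 1 n \<omega>))"
      using Sm[of 0] Sm[of 1] by (intro sup2_add) auto
    also have "\<dots> \<le> 2 * (ennreal (x0\<^sup>2) + 2 * (sup2 M {..n} (?S 0) + sup2 M {..n} (?S 1)))"
      using Sm[of 0] Sm[of 1] by (intro mult_left_mono add_mono sup2_const_le sup2_add) auto
    also have "\<dots> \<le> 2 * (ennreal (x0\<^sup>2) + 2 * (ennreal (\<epsilon> * U) * (ennreal (2 * h\<^sup>2) * ?X) + 8 * ennreal \<epsilon> * (ennreal (2 * h\<^sup>2) * ?X)))"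
      by (intro mult_left_mono add_mono S0 S1) auto
    also have "ennreal (\<epsilon> * U) * (ennreal (2 * h\<^sup>2) * ?X) + 8 * ennreal \<epsilon> * (ennreal (2 * h\<^sup>2) * ?X)
        = ennreal (2 * (U + 8) * h\<^sup>2 * \<epsilon>) * ?X"
    proof -
      have "ennreal (\<epsilon> * U) * (ennreal (2 * h\<^sup>2) * ?X) + 8 * ennreal \<epsilon> * (ennreal (2 * h\<^sup>2) * ?X)
        = (ennreal (\<epsilon> * U) * ennreal (2 * h\<^sup>2) + ennreal 8 * ennreal \<epsilon> * ennreal (2 * h\<^sup>2)) * ?X"
        by (simp add: distrib_right mult.assoc)
      also have "ennreal (\<epsilon> * U) * ennreal (2 * h\<^sup>2) + ennreal 8 * ennreal \<epsilon> * ennreal (2 * h\<^sup>2) = ennreal (2 * (U + 8) * h\<^sup>2 * \<epsilon>)"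
        using eps U_nonneg by (simp add: algebra_simps flip: ennreal_mult ennreal_plus ennreal_numeral del: ennreal_numeral)
      finally show ?thesis .
    qed
    also have "2 * (ennreal (x0\<^sup>2) + 2 * (ennreal (2 * (U + 8) * h\<^sup>2 * \<epsilon>) * ?X)) = ennreal (2 * x0\<^sup>2) + ennreal ?c * ?X"
    proof -
      have "ennreal ?c = ennreal 4 * ennreal (2 * (U + 8) * h\<^sup>2 * \<epsilon>)" using eps U_nonneg by (subst ennreal_mult[symmetric]) (auto intro!: arg_cong[where f=ennreal])
      then show ?thesis by (simp add: distrib_left ennreal_mult mult.assoc[symmetric])
    qed
    finally have "1 + sup2 M {..n} euler \<le> 1 + (ennreal (2 * x0\<^sup>2) + ennreal ?c * ?X)" by (rule add_left_mono)
    also have "\<dots> = ennreal (1 + 2 * x0\<^sup>2) + ennreal ?c * ?X" by (simp add: add.assoc)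
    finally show ?thesis .
  qed
  have "1 + sup2 M {..L * m} euler \<le> ennreal (1 + 2 * x0\<^sup>2) * (1 + ennreal ?c) ^ (L * m)"
    using gro by (rule discrete_gronwall) auto
  also have "\<dots> \<le> ennreal (1 + 2 * x0\<^sup>2) * ennreal (exp (8 * (U + 8) * h\<^sup>2 * U))"
    using eps U_nonneg by (intro mult_left_mono one_plus_power_le_exp) (auto simp: U_def algebra_simps)
  finally show ?thesis by (simp add: ennreal_mult)
qed

text \<open>For a purely temporal index the factor n + 1 of \<open>cell_bound\<close> is absorbed by
  a spare power of the cell length, because (n + 1) m \<epsilon> <= U + 1. The number 20 dominates
  both 2 and 18.\<close>

lemma order_coeff:
  assumes n: "n \<le> L" and q: "q + (if \<forall>j\<in>set \<beta>. j = 0 then 1 else 0) \<le> length \<beta> + count_list \<beta> 0"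
  shows "(if \<forall>j\<in>set \<beta>. j = 0 then 2 * (of_nat n + 1) else 18) * (8 ^ length \<beta> * ennreal (m * \<epsilon>) ^ (length \<beta> + count_list \<beta> 0))
    \<le> ennreal (20 * 8 ^ length \<beta> * (U + 1) * (m * \<epsilon>) ^ q)" (is "?c * (8 ^ ?l * ennreal ?d ^ ?e) \<le> _")
proof -
  let ?r = "if \<forall>j\<in>set \<beta>. j = 0 then 2 * (real n + 1) else 18"
  have "?r * ?d ^ ?e \<le> 20 * (U + 1) * ?d ^ q"
  proof (cases "\<forall>j\<in>set \<beta>. j = 0")
    case True
    have "?d ^ ?e \<le> ?d ^ (q + 1)" using d_nonneg d_le q True by (intro power_decreasing) auto
    then have "2 * (real n + 1) * ?d ^ ?e \<le> 2 * (real n + 1) * ?d ^ (q + 1)" by (intro mult_left_mono) auto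
    also have "\<dots> = 2 * ((real n + 1) * ?d) * ?d ^ q" by simp
    also have "(real n + 1) * ?d \<le> U + 1"
      using n d_le d_nonneg mult_right_mono[of "real n" "real L" ?d] by (simp add: U_def distrib_right)
    also have "2 * (U + 1) * ?d ^ q \<le> 20 * (U + 1) * ?d ^ q"
      using U_nonneg d_nonneg by (intro mult_right_mono) auto
    finally show ?thesis using True d_nonneg by (simp add: mult_right_mono)
  next
    case False
    have "?d ^ ?e \<le> ?d ^ q" using d_nonneg d_le q False by (intro power_decreasing) (auto split: if_splits)
    then have "18 * ?d ^ ?e \<le> 20 * (U + 1) * ?d ^ q"
      using U_nonneg d_nonneg by (intro mult_mono) auto
    then show ?thesis by (subst if_not_P[OF False])
  qed
  then have "8 ^ ?l * (?r * ?d ^ ?e) \<le> 8 ^ ?l * (20 * (U + 1) * ?d ^ q)" by (intro mult_left_mono) auto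
  then have "ennreal (8 ^ ?l * (?r * ?d ^ ?e)) \<le> ennreal (8 ^ ?l * (20 * (U + 1) * ?d ^ q))" by (rule ennreal_leI)
  moreover have "?c = ennreal ?r"
  proof (cases "\<forall>j\<in>set \<beta>. j = 0")
    case True
    have "ennreal (2 * (real n + 1)) = ennreal 2 * (ennreal (real n) + ennreal 1)" by (subst ennreal_mult) auto
    then show ?thesis unfolding if_P[OF True] by (simp add: ennreal_of_nat_eq_real_of_nat)
  next
    case False
    then show ?thesis unfolding if_not_P[OF False] by simp
  qed
  moreover have "(8::ennreal) ^ ?l = ennreal (8 ^ ?l)" by (simp flip: ennreal_power)
  moreover have "ennreal ?d ^ ?e = ennreal (?d ^ ?e)" using d_nonneg by (rule ennreal_power)
  moreover have "ennreal ?r * (ennreal (8 ^ ?l) * ennreal (?d ^ ?e)) = ennreal (8 ^ ?l * (?r * ?d ^ ?e))"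
  proof -
    have "0 \<le> ?r" "0 \<le> ?d ^ ?e" using d_nonneg by auto
    then show ?thesis by (simp add: mult.left_commute flip: ennreal_mult)
  qed
  ultimately have "?c * (8 ^ ?l * ennreal ?d ^ ?e) \<le> ennreal (8 ^ ?l * (20 * (U + 1) * ?d ^ q))"
    by (simp only:)
  also have "8 ^ ?l * (20 * (U + 1) * ?d ^ q) = 20 * 8 ^ ?l * (U + 1) * ?d ^ q" by (simp only: ac_simps)
  finally show ?thesis .
qed

lemma concat_cells_sum: "concat_cells m (\<lambda>n i \<omega>. \<Sum>a\<in>S. G a n i \<omega>) p \<omega> = (\<Sum>a\<in>S. concat_cells m (G a) p \<omega>)"
  by (cases p) (simp add: concat_cells_def sum.distrib sum.swap[of _ S])

lemma concat_cells_meas: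
  assumes "\<And>n i. n < L' \<Longrightarrow> n * m \<le> i \<Longrightarrow> i \<le> n * m + m \<Longrightarrow> G n i \<in> borel_measurable M" "p \<in> cells m L'"
  shows "concat_cells m G p \<in> borel_measurable M"
proof (cases p)
  case (Pair n i)
  with assms(2) have "n < L'" "n * m \<le> i" "i \<le> n * m + m" by (auto simp: cells_def)
  then show ?thesis unfolding Pair concat_cells_def using assms(1) by auto
qed

end

lemma sup2_abs: "sup2 M I (\<lambda>i \<omega>. \<bar>S i \<omega>\<bar>) = sup2 M I S"
  by (simp add: sup2_def)

context taylor_walk
begin

text \<open>\<open>cell_bound\<close> summed over a finite set of indices. It is used with q = 1 for
  the differences of coefficients, where Gronwall follows, and with q = g + 1 for the remainder,
  where summation over the cells takes one power back.\<close>

lemma concat_bound: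
  assumes n: "n \<le> L" and S: "finite S" "20 * real (card S) * (\<Sum>\<alpha>\<in>S. 8 ^ length \<alpha>) \<le> \<kappa>"
    and q: "\<And>\<alpha>. \<alpha> \<in> S \<Longrightarrow> q + (if \<forall>j\<in>set \<alpha>. j = 0 then 1 else 0) \<le> length \<alpha> + count_list \<alpha> 0"
    and H: "\<And>\<alpha> n' l. \<alpha> \<in> S \<Longrightarrow> n' < n \<Longrightarrow> n' * m \<le> l \<Longrightarrow> l \<le> n' * m + m \<Longrightarrow> H \<alpha> n' l \<in> borel_measurable (\<H> l)"
    and B: "\<And>\<alpha>. \<alpha> \<in> S \<Longrightarrow> (\<Sum>n'<n. sup2 M {n' * m..n' * m + m} (H \<alpha> n')) \<le> B"
  shows "sup2 M (cells m n) (concat_cells m (\<lambda>n i \<omega>. \<Sum>\<alpha>\<in>S. ms (n * m) (rev \<alpha>) (H \<alpha> n) i \<omega>))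
    \<le> ennreal (\<kappa> * (U + 1) * (m * \<epsilon>) ^ q) * B"
proof -
  have gM: "concat_cells m (\<lambda>n. ms (n * m) (rev \<alpha>) (H \<alpha> n)) p \<in> borel_measurable M"
    if "\<alpha> \<in> S" "p \<in> cells m n" for \<alpha> p
  proof (rule concat_cells_meas[OF _ that(2)])
    fix n' i assume "n' < n" "n' * m \<le> i" "i \<le> n' * m + m"
    then show "ms (n' * m) (rev \<alpha>) (H \<alpha> n') i \<in> borel_measurable M"
      using that by (intro H_meas_M[OF ms_meas[where b="n' * m + m"]] H) auto
  qed
  have "sup2 M (cells m n) (concat_cells m (\<lambda>n i \<omega>. \<Sum>\<alpha>\<in>S. ms (n * m) (rev \<alpha>) (H \<alpha> n) i \<omega>))
    = sup2 M (cells m n) (\<lambda>p \<omega>. \<Sum>\<alpha>\<in>S. concat_cells m (\<lambda>n. ms (n * m) (rev \<alpha>) (H \<alpha> n)) p \<omega>)"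
    by (intro arg_cong[where f="sup2 M _"] ext concat_cells_sum)
  also have "\<dots> \<le> of_nat (card S) * (\<Sum>\<alpha>\<in>S. sup2 M (cells m n) (concat_cells m (\<lambda>n. ms (n * m) (rev \<alpha>) (H \<alpha> n))))"
    using gM by (intro sup2_sum S) auto
  also have "\<dots> \<le> of_nat (card S) * (\<Sum>\<alpha>\<in>S. ennreal (20 * 8 ^ length \<alpha> * (U + 1) * (m * \<epsilon>) ^ q) * B)"
  proof (intro mult_left_mono sum_mono)
    fix \<alpha> assume a: "\<alpha> \<in> S"
    have "sup2 M (cells m n) (concat_cells m (\<lambda>n. ms (n * m) (rev \<alpha>) (H \<alpha> n)))
      \<le> (if \<forall>j\<in>set (rev \<alpha>). j = 0 then 2 * (of_nat n + 1) else 18)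
       * (8 ^ length (rev \<alpha>) * ennreal (m * \<epsilon>) ^ (length (rev \<alpha>) + count_list (rev \<alpha>) 0)) * (\<Sum>n'<n. sup2 M {n' * m..n' * m + m} (H \<alpha> n'))"
      using a H by (intro cell_bound) auto
    also have "\<dots> \<le> ennreal (20 * 8 ^ length (rev \<alpha>) * (U + 1) * (m * \<epsilon>) ^ q) * B"
      using q[OF a] by (intro mult_mono order_coeff n B a) auto
    finally show "sup2 M (cells m n) (concat_cells m (\<lambda>n. ms (n * m) (rev \<alpha>) (H \<alpha> n)))
      \<le> ennreal (20 * 8 ^ length \<alpha> * (U + 1) * (m * \<epsilon>) ^ q) * B" by simp
  qed auto
  also have "\<dots> = ennreal (20 * real (card S) * (\<Sum>\<alpha>\<in>S. 8 ^ length \<alpha>) * ((U + 1) * (m * \<epsilon>) ^ q)) * B"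
  proof -
    have "(\<Sum>\<alpha>\<in>S. ennreal (20 * 8 ^ length \<alpha> * (U + 1) * (m * \<epsilon>) ^ q)) = ennreal (\<Sum>\<alpha>\<in>S. 20 * 8 ^ length \<alpha> * (U + 1) * (m * \<epsilon>) ^ q)"
      using U_nonneg d_nonneg by (intro sum_ennreal) auto
    moreover have "(\<Sum>\<alpha>\<in>S. 20 * 8 ^ length \<alpha> * (U + 1) * (m * \<epsilon>) ^ q) = (\<Sum>\<alpha>\<in>S. 8 ^ length \<alpha>) * (20 * ((U + 1) * (m * \<epsilon>) ^ q))"
      unfolding sum_distrib_right by (intro sum.cong) auto
    ultimately have "(\<Sum>\<alpha>\<in>S. ennreal (20 * 8 ^ length \<alpha> * (U + 1) * (m * \<epsilon>) ^ q)) = ennreal ((\<Sum>\<alpha>\<in>S. 8 ^ length \<alpha>) * (20 * ((U + 1) * (m * \<epsilon>) ^ q)))"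
      by simp
    then have "of_nat (card S) * (\<Sum>\<alpha>\<in>S. ennreal (20 * 8 ^ length \<alpha> * (U + 1) * (m * \<epsilon>) ^ q) * B)
      = ennreal (card S) * ennreal ((\<Sum>\<alpha>\<in>S. 8 ^ length \<alpha>) * (20 * ((U + 1) * (m * \<epsilon>) ^ q))) * B"
      by (simp add: sum_distrib_right[symmetric] ennreal_of_nat_eq_real_of_nat mult.assoc)
    also have "ennreal (card S) * ennreal ((\<Sum>\<alpha>\<in>S. 8 ^ length \<alpha>) * (20 * ((U + 1) * (m * \<epsilon>) ^ q)))
      = ennreal (card S * ((\<Sum>\<alpha>\<in>S. 8 ^ length \<alpha>) * (20 * ((U + 1) * (m * \<epsilon>) ^ q))))"
      using U_nonneg d_nonneg by (intro ennreal_mult[symmetric]) (auto intro!: sum_nonneg mult_nonneg_nonneg)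
    finally show ?thesis by (simp add: ac_simps)
  qed
  also have "\<dots> \<le> ennreal (\<kappa> * ((U + 1) * (m * \<epsilon>) ^ q)) * B"
    using S(2) U_nonneg d_nonneg by (intro mult_right_mono ennreal_leI) auto
  finally show ?thesis by (simp add: mult.assoc)
qed

lemma kappa_nonneg: "0 \<le> \<kappa>"
proof -
  have "(0::real) \<le> 20 * real (card A) * (\<Sum>\<alpha>\<in>A. 8 ^ length \<alpha>)" by (intro mult_nonneg_nonneg sum_nonneg) auto
  then show ?thesis using \<kappa>(1) by linarith
qed

text \<open>Subtracting the two expansions leaves three parts: differences of coefficients,
  controlled by the Lipschitz bounds and the error at the start of the cell; the terms of
  \<open>R\<close>, controlled by \<open>k\<close> and the moment bound; and the Ito defects, at
  most \<eta> on the good event. Gronwall runs over the cells, not over the fine grid, and its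
  values may be infinite, so the scheme itself needs no moment bound.\<close>

lemma scheme_error:
  assumes eta: "0 \<le> \<eta>"
  shows "sup2 M (cells m L) (\<lambda>(n, i) \<omega>. of_bool (good \<eta> L \<omega>) * (euler i \<omega> - scheme_in n i \<omega>))
    \<le> ennreal ((8 * \<kappa> * (U + 1) * U * k\<^sup>2 * ((1 + 2 * x0\<^sup>2) * exp (8 * (U + 8) * h\<^sup>2 * U)) * (m * \<epsilon>) ^ g + 4 * \<eta>\<^sup>2)
        * exp (2 * \<kappa> * (U + 1) * h\<^sup>2 * U))"
proof -
  \<comment> \<open>Indicator of the good event up to cell \<open>n\<close>; it decreases in
    \<open>n\<close> and is known at the start of cell \<open>n\<close>.\<close>
  define \<theta> where "\<theta> n \<omega> = (of_bool (good \<eta> n \<omega>) :: real)" for n \<omega>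
  define es where "es n \<omega> = euler (n * m) \<omega> - scheme n \<omega>" for n \<omega>
  define e where "e = (\<lambda>(n, i) \<omega>. euler i \<omega> - scheme_in n i \<omega>)"
  define De where "De \<alpha> n \<omega> = f \<alpha> (tm (n * m)) (euler (n * m) \<omega>) - f \<alpha> (tm (n * m)) (scheme n \<omega>)" for \<alpha> n \<omega>
  define Rm where "Rm n i \<omega> = (\<Sum>\<alpha>\<in>R. ms (n * m) (rev \<alpha>) (\<lambda>l \<omega>. f \<alpha> (tm l) (euler l \<omega>)) i \<omega>)" for n i \<omega>
  define D1 where "D1 n i \<omega> = (\<Sum>\<alpha>\<in>A - {[]}. ms (n * m) (rev \<alpha>) (\<lambda>_. De \<alpha> n) i \<omega>)" for n i \<omega>
  \<comment> \<open>\<open>D1\<close> with the indicator placed inside the sums, which keeps the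
    integrand adapted. On the good event of a later index both agree.\<close>
  define D\<theta> where "D\<theta> n i \<omega> = (\<Sum>\<alpha>\<in>A - {[]}. ms (n * m) (rev \<alpha>) (\<lambda>_ \<omega>. \<theta> n \<omega> * De \<alpha> n \<omega>) i \<omega>)" for n i \<omega>
  have es0: "es 0 \<omega> = 0" for \<omega> by (simp add: es_def)
  have esS: "es (Suc n) \<omega> = e (n, n * m + m) \<omega>" for n \<omega>
    unfolding es_def e_def prod.case scheme_in_end by (simp add: add.commute)
  have e_tot: "e (n, i) \<omega> = es n \<omega> + (D1 n i \<omega> + Rm n i \<omega> + cell_err n i \<omega>)" if "n * m \<le> i" for n i \<omega>
  proof -
    have "D1 n i \<omega> = (\<Sum>\<alpha>\<in>A - {[]}. ms (n * m) (rev \<alpha>) (\<lambda>_ _. f \<alpha> (tm (n * m)) (euler (n * m) \<omega>)) i \<omega>)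
       - (\<Sum>\<alpha>\<in>A - {[]}. ms (n * m) (rev \<alpha>) (\<lambda>_ _. f \<alpha> (tm (n * m)) (scheme n \<omega>)) i \<omega>)"
      by (simp add: D1_def De_def mis_diff sum_subtractf)
    then show ?thesis
      using taylor_expansion[OF that, of \<omega>] by (simp add: e_def es_def scheme_in_def Rm_def cell_err_def)
  qed
  have es_tot: "es n \<omega> = (\<Sum>n'<n. D1 n' (n' * m + m) \<omega> + Rm n' (n' * m + m) \<omega> + cell_err n' (n' * m + m) \<omega>)" for n \<omega>
    by (induction n) (simp_all add: es0 esS e_tot)
  have e_concat: "e (n, i) \<omega> = concat_cells m D1 (n, i) \<omega> + concat_cells m Rm (n, i) \<omega> + concat_cells m cell_err (n, i) \<omega>"
    if "n * m \<le> i" for n i \<omega>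
    using e_tot[OF that] es_tot[of n \<omega>] by (simp add: concat_cells_def sum.distrib)
  have good_mono: "good \<eta> n' \<omega>" if "good \<eta> n \<omega>" "n' \<le> n" for n n' \<omega>
    using that by (auto simp: good_def cells_def)
  have D1\<theta>: "concat_cells m D1 (n', i) \<omega> = concat_cells m D\<theta> (n', i) \<omega>" if "good \<eta> n \<omega>" "n' < n" for n n' i \<omega>
  proof -
    have "D1 n'' j \<omega> = D\<theta> n'' j \<omega>" if "n'' \<le> n'" for n'' j
      using good_mono[OF \<open>good \<eta> n \<omega>\<close>, of n''] that \<open>n' < n\<close> by (simp add: D1_def D\<theta>_def \<theta>_def)
    then show ?thesis by (simp add: concat_cells_def)
  qed
  define \<phi> where "\<phi> n = sup2 M (cells m n) (\<lambda>p \<omega>. \<theta> n \<omega> * e p \<omega>)" for n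
  \<comment> \<open>The error at a coarse point is the error at the right end of the previous cell,
    hence part of the supremum in \<open>\<phi> n\<close>.\<close>
  have es_\<phi>: "(\<integral>\<^sup>+\<omega>. ennreal ((\<theta> n \<omega> * es n \<omega>)\<^sup>2) \<partial>M) \<le> \<phi> n" for n
  proof (cases n)
    case 0 then show ?thesis by (simp add: es0)
  next
    case (Suc q)
    have "(q, q * m + m) \<in> cells m n" by (simp add: cells_def Suc)
    from nn_le_sup2[OF this, where S="\<lambda>p \<omega>. \<theta> n \<omega> * e p \<omega>" and M=M] show ?thesis
      by (simp add: \<phi>_def Suc esS)
  qed
  have \<theta>m: "\<theta> n \<in> borel_measurable (\<H> (n * m))" for n
    unfolding \<theta>_def using good_meas[of \<eta> n] by measurable
  have Dem: "De \<alpha> n \<in> borel_measurable (\<H> (n * m))" if "\<alpha> \<in> A" for \<alpha> n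
    unfolding De_def using that by (intro borel_measurable_diff f_comp_meas euler_meas scheme_meas) auto
  have D\<theta>_b: "sup2 M (cells m n) (concat_cells m D\<theta>) \<le> ennreal (\<kappa> * (U + 1) * (m * \<epsilon>) ^ 1) * (ennreal (h\<^sup>2) * (\<Sum>n'<n. \<phi> n'))"
    if n: "n \<le> L" for n
    unfolding D\<theta>_def
  proof (rule concat_bound[OF n, where H="\<lambda>\<alpha> n _ \<omega>. \<theta> n \<omega> * De \<alpha> n \<omega>"])
    have "20 * real (card (A - {[]})) * (\<Sum>\<alpha>\<in>A - {[]}. 8 ^ length \<alpha>) \<le> 20 * real (card A) * (\<Sum>\<alpha>\<in>A. 8 ^ length \<alpha>)"
      using A_fin by (intro mult_mono sum_mono2) (auto intro: sum_nonneg card_mono)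
    with \<kappa>(1) show "20 * real (card (A - {[]})) * (\<Sum>\<alpha>\<in>A - {[]}. 8 ^ length \<alpha>) \<le> \<kappa>" by linarith
    fix \<alpha> assume a: "\<alpha> \<in> A - {[]}"
    have "\<forall>j\<in>set \<alpha>. j = 0 \<Longrightarrow> count_list \<alpha> 0 = length \<alpha>" by (induction \<alpha>) auto
    moreover have "1 \<le> length \<alpha>" using a by (cases \<alpha>) auto
    ultimately show "1 + (if \<forall>j\<in>set \<alpha>. j = 0 then 1 else 0) \<le> length \<alpha> + count_list \<alpha> 0" by auto
    show "(\<Sum>n'<n. sup2 M {n' * m..n' * m + m} (\<lambda>_ \<omega>. \<theta> n' \<omega> * De \<alpha> n' \<omega>)) \<le> ennreal (h\<^sup>2) * (\<Sum>n'<n. \<phi> n')"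
      unfolding sum_distrib_left
    proof (rule sum_mono)
      fix n' assume "n' \<in> {..<n}"
      then have "n' * m \<le> L * m" using n by simp
      note U = tm_le[OF this]
      have "sup2 M {n' * m..n' * m + m} (\<lambda>_ \<omega>. \<theta> n' \<omega> * De \<alpha> n' \<omega>) \<le> (\<integral>\<^sup>+\<omega>. ennreal (h\<^sup>2) * ennreal ((\<theta> n' \<omega> * es n' \<omega>)\<^sup>2) \<partial>M)"
      proof (rule sup2_le_nn)
        fix \<omega> :: 'a
        have "\<bar>De \<alpha> n' \<omega>\<bar> \<le> h * \<bar>es n' \<omega>\<bar>" unfolding De_def es_def using a U by (intro f_lip) auto
        then have "\<bar>\<theta> n' \<omega> * De \<alpha> n' \<omega>\<bar> \<le> \<bar>h * (\<theta> n' \<omega> * es n' \<omega>)\<bar>" using hk by (simp add: \<theta>_def abs_mult)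
        then have "(\<theta> n' \<omega> * De \<alpha> n' \<omega>)\<^sup>2 \<le> (h * (\<theta> n' \<omega> * es n' \<omega>))\<^sup>2" by (simp only: abs_le_square_iff)
        then show "ennreal ((\<theta> n' \<omega> * De \<alpha> n' \<omega>)\<^sup>2) \<le> ennreal (h\<^sup>2) * ennreal ((\<theta> n' \<omega> * es n' \<omega>)\<^sup>2)"
          by (simp add: power_mult_distrib ennreal_leI flip: ennreal_mult)
      qed
      also have "\<dots> = ennreal (h\<^sup>2) * (\<integral>\<^sup>+\<omega>. ennreal ((\<theta> n' \<omega> * es n' \<omega>)\<^sup>2) \<partial>M)"
        unfolding es_def
        by (intro nn_integral_cmult measurable_compose[OF _ measurable_ennreal] borel_measurable_power
            borel_measurable_times borel_measurable_diff H_meas_M[OF \<theta>m] H_meas_M[OF euler_meas] H_meas_M[OF scheme_meas])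
      also have "\<dots> \<le> ennreal (h\<^sup>2) * \<phi> n'" by (intro mult_left_mono es_\<phi>) auto
      finally show "sup2 M {n' * m..n' * m + m} (\<lambda>_ \<omega>. \<theta> n' \<omega> * De \<alpha> n' \<omega>) \<le> ennreal (h\<^sup>2) * \<phi> n'" .
    qed
    fix n' l assume l: "n' * m \<le> l"
    show "(\<lambda>\<omega>. \<theta> n' \<omega> * De \<alpha> n' \<omega>) \<in> borel_measurable (\<H> l)"
      using a by (intro H_meas_mono[OF _ l] borel_measurable_times \<theta>m Dem) auto
  qed (use A_fin in auto)
  define Y where "Y = (1 + 2 * x0\<^sup>2) * exp (8 * (U + 8) * h\<^sup>2 * U)"
  have Y0: "0 \<le> Y" by (simp add: Y_def)
  \<comment> \<open>Each of at most \<open>L\<close> cells contributes the order g + 1; below, L m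
    \<epsilon> = U turns this into the order g.\<close>
  have Rm_b: "sup2 M (cells m n) (concat_cells m Rm) \<le> ennreal (\<kappa> * (U + 1) * (m * \<epsilon>) ^ (g + 1)) * (of_nat L * ennreal (2 * k\<^sup>2 * Y))"
    if n: "n \<le> L" for n
    unfolding Rm_def
  proof (rule concat_bound[OF n, where H="\<lambda>\<alpha> n l \<omega>. f \<alpha> (tm l) (euler l \<omega>)"])
    fix \<alpha> assume a: "\<alpha> \<in> R"
    then show "g + 1 + (if \<forall>j\<in>set \<alpha>. j = 0 then 1 else 0) \<le> length \<alpha> + count_list \<alpha> 0"
      using R_order[OF a] by (cases "\<forall>j\<in>set \<alpha>. j = 0") (simp_all only: if_True if_False simp_thms, simp_all)
    have "(\<Sum>n'<n. sup2 M {n' * m..n' * m + m} (\<lambda>l \<omega>. f \<alpha> (tm l) (euler l \<omega>))) \<le> (\<Sum>n'<n. ennreal (2 * k\<^sup>2 * Y))"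
    proof (rule sum_mono)
      fix n' assume "n' \<in> {..<n}"
      then have le: "n' * m + m \<le> L * m" using n mult_le_mono1[of "Suc n'" L m] by simp
      have "sup2 M {n' * m..n' * m + m} (\<lambda>l \<omega>. f \<alpha> (tm l) (euler l \<omega>))
        \<le> (\<integral>\<^sup>+\<omega>. ennreal (2 * k\<^sup>2) * (1 + (SUP l\<in>{..L * m}. ennreal ((euler l \<omega>)\<^sup>2))) \<partial>M)"
      proof (rule sup2_le_nn)
        fix \<omega> :: 'a and l assume "l \<in> {n' * m..n' * m + m}"
        then have l: "l \<le> L * m" using le by auto
        have "(f \<alpha> (tm l) (euler l \<omega>))\<^sup>2 \<le> 2 * k\<^sup>2 * (1 + (euler l \<omega>)\<^sup>2)"
          using a tm_le[OF l] hk by (intro linear_growth_sq f_rem) auto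
        then have "ennreal ((f \<alpha> (tm l) (euler l \<omega>))\<^sup>2) \<le> ennreal (2 * k\<^sup>2 * (1 + (euler l \<omega>)\<^sup>2))" by (rule ennreal_leI)
        also have "\<dots> = ennreal (2 * k\<^sup>2) * (1 + ennreal ((euler l \<omega>)\<^sup>2))"
          by (subst ennreal_mult) (simp_all flip: ennreal_1 ennreal_plus)
        also have "\<dots> \<le> ennreal (2 * k\<^sup>2) * (1 + (SUP l\<in>{..L * m}. ennreal ((euler l \<omega>)\<^sup>2)))"
          using l by (intro mult_left_mono add_left_mono SUP_upper) auto
        finally show "ennreal ((f \<alpha> (tm l) (euler l \<omega>))\<^sup>2) \<le> ennreal (2 * k\<^sup>2) * (1 + (SUP l\<in>{..L * m}. ennreal ((euler l \<omega>)\<^sup>2)))" .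
      qed
      also have "\<dots> = ennreal (2 * k\<^sup>2) * (1 + sup2 M {..L * m} euler)"
      proof -
        have "(\<lambda>\<omega>. SUP l\<in>{..L * m}. ennreal ((euler l \<omega>)\<^sup>2)) \<in> borel_measurable M"
          by (intro measurable_sup2 euler_M) auto
        then show ?thesis by (subst nn_integral_cmult) (auto simp: nn_integral_add emeasure_space_1 sup2_def)
      qed
      also have "\<dots> \<le> ennreal (2 * k\<^sup>2) * ennreal Y"
        unfolding Y_def by (intro mult_left_mono euler_moment) auto
      also have "\<dots> = ennreal (2 * k\<^sup>2 * Y)" using Y0 by (simp add: ennreal_mult)
      finally show "sup2 M {n' * m..n' * m + m} (\<lambda>l \<omega>. f \<alpha> (tm l) (euler l \<omega>)) \<le> ennreal (2 * k\<^sup>2 * Y)" .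
    qed
    also have "\<dots> \<le> of_nat L * ennreal (2 * k\<^sup>2 * Y)"
      using n by (simp add: mult_right_mono)
    finally show "(\<Sum>n'<n. sup2 M {n' * m..n' * m + m} (\<lambda>l \<omega>. f \<alpha> (tm l) (euler l \<omega>))) \<le> of_nat L * ennreal (2 * k\<^sup>2 * Y)" .
  qed (use R_fin \<kappa> f_euler_meas in auto)
  have "ennreal (\<kappa> * (U + 1) * (m * \<epsilon>) ^ (g + 1)) * (of_nat L * ennreal (2 * k\<^sup>2 * Y))
      = ennreal (2 * \<kappa> * (U + 1) * U * k\<^sup>2 * Y * (m * \<epsilon>) ^ g)"
  proof -
    have "ennreal (\<kappa> * (U + 1) * (m * \<epsilon>) ^ (g + 1)) * (of_nat L * ennreal (2 * k\<^sup>2 * Y))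
      = ennreal ((\<kappa> * (U + 1) * (m * \<epsilon>) ^ (g + 1)) * (L * (2 * k\<^sup>2 * Y)))"
      using kappa_nonneg U_nonneg d_nonneg Y0
      unfolding ennreal_of_nat_eq_real_of_nat by (subst ennreal_mult[symmetric], simp, simp)+ simp
    also have "(\<kappa> * (U + 1) * (m * \<epsilon>) ^ (g + 1)) * (L * (2 * k\<^sup>2 * Y))
      = 2 * \<kappa> * (U + 1) * (L * (m * \<epsilon>)) * k\<^sup>2 * Y * (m * \<epsilon>) ^ g"
      by simp
    finally show ?thesis unfolding U_def[symmetric] .
  qed
  note Rm_b' = Rm_b[unfolded this]
  define c1 where "c1 = 2 * \<kappa> * (U + 1) * U * k\<^sup>2 * Y * (m * \<epsilon>) ^ g"
  define c2 where "c2 = 2 * \<kappa> * (U + 1) * h\<^sup>2 * (m * \<epsilon>)"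
  have c0: "0 \<le> c1" "0 \<le> c2" using kappa_nonneg U_nonneg d_nonneg Y0 by (auto simp: c1_def c2_def)
  \<comment> \<open>Splitting off the first of three terms costs a factor 2, separating the other
    two a further 2; hence the 2 in \<open>c2\<close> and the 4 in front of \<open>c1\<close> and
    \<eta>^2.\<close>
  have main: "\<phi> n \<le> ennreal (4 * c1 + 4 * \<eta>\<^sup>2) + ennreal c2 * (\<Sum>n'<n. \<phi> n')" if n: "n \<le> L" for n
  proof -
    have gM1: "concat_cells m D\<theta> p \<in> borel_measurable M" "concat_cells m Rm p \<in> borel_measurable M" if "p \<in> cells m n" for p
    proof -
      have "D\<theta> n' i \<in> borel_measurable M" if "n' * m \<le> i" for n' i
      proof -
        have "(\<lambda>\<omega>. \<theta> n' \<omega> * De \<alpha> n' \<omega>) \<in> borel_measurable (\<H> l)" if "\<alpha> \<in> A - {[]}" "n' * m \<le> l" for \<alpha> l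
          using that(1) by (intro H_meas_mono[OF _ that(2)] borel_measurable_times \<theta>m Dem) auto
        then show ?thesis
          unfolding D\<theta>_def using that by (intro borel_measurable_sum H_meas_M[OF ms_meas[where b=i]]) auto
      qed
      moreover have "Rm n' i \<in> borel_measurable M" if "n' * m \<le> i" for n' i
        unfolding Rm_def using that by (intro borel_measurable_sum H_meas_M[OF ms_meas[where b=i]] f_euler_meas) auto
      ultimately show "concat_cells m D\<theta> p \<in> borel_measurable M" "concat_cells m Rm p \<in> borel_measurable M"
        using concat_cells_meas[OF _ that] by auto
    qed
    have "\<phi> n \<le> sup2 M (cells m n) (\<lambda>p \<omega>. \<bar>concat_cells m D\<theta> p \<omega>\<bar> + (\<bar>concat_cells m Rm p \<omega>\<bar> + \<eta>))"
      unfolding \<phi>_def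
    proof (rule sup2_mono)
      fix \<omega> p assume p: "p \<in> cells m n"
      then obtain n' i where pi: "p = (n', i)" "n' < n" "n' * m \<le> i" by (auto simp: cells_def)
      have "\<bar>\<theta> n \<omega> * e p \<omega>\<bar> \<le> \<bar>\<bar>concat_cells m D\<theta> p \<omega>\<bar> + (\<bar>concat_cells m Rm p \<omega>\<bar> + \<eta>)\<bar>"
      proof (cases "good \<eta> n \<omega>")
        case True
        then have "\<bar>concat_cells m cell_err p \<omega>\<bar> \<le> \<eta>" using p by (auto simp: good_def)
        moreover have "e p \<omega> = concat_cells m D\<theta> p \<omega> + concat_cells m Rm p \<omega> + concat_cells m cell_err p \<omega>"
          using e_concat[OF pi(3)] D1\<theta>[OF True pi(2)] pi(1) by simp
        ultimately show ?thesis using True by (simp add: \<theta>_def)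
      qed (simp add: \<theta>_def)
      then show "\<exists>p'\<in>cells m n. \<bar>\<theta> n \<omega> * e p \<omega>\<bar> \<le> \<bar>\<bar>concat_cells m D\<theta> p' \<omega>\<bar> + (\<bar>concat_cells m Rm p' \<omega>\<bar> + \<eta>)\<bar>" using p by blast
    qed
    also have "\<dots> \<le> 2 * (sup2 M (cells m n) (concat_cells m D\<theta>) + sup2 M (cells m n) (\<lambda>p \<omega>. \<bar>concat_cells m Rm p \<omega>\<bar> + \<eta>))"
      using sup2_add[of "cells m n" "\<lambda>p \<omega>. \<bar>concat_cells m D\<theta> p \<omega>\<bar>" M "\<lambda>p \<omega>. \<bar>concat_cells m Rm p \<omega>\<bar> + \<eta>"] gM1
      by (simp add: sup2_abs)
    also have "\<dots> \<le> 2 * (sup2 M (cells m n) (concat_cells m D\<theta>) + 2 * (sup2 M (cells m n) (concat_cells m Rm) + ennreal (\<eta>\<^sup>2)))"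
    proof (intro mult_left_mono add_left_mono)
      have "sup2 M (cells m n) (\<lambda>p \<omega>. \<bar>concat_cells m Rm p \<omega>\<bar> + \<eta>) \<le> 2 * (sup2 M (cells m n) (concat_cells m Rm) + sup2 M (cells m n) (\<lambda>_ _. \<eta>))"
        using sup2_add[of "cells m n" "\<lambda>p \<omega>. \<bar>concat_cells m Rm p \<omega>\<bar>" M "\<lambda>_ _. \<eta>"] gM1 by (simp add: sup2_abs)
      also have "\<dots> \<le> 2 * (sup2 M (cells m n) (concat_cells m Rm) + ennreal (\<eta>\<^sup>2))"
        by (intro mult_left_mono add_left_mono sup2_const_le) auto
      finally show "sup2 M (cells m n) (\<lambda>p \<omega>. \<bar>concat_cells m Rm p \<omega>\<bar> + \<eta>) \<le> 2 * (sup2 M (cells m n) (concat_cells m Rm) + ennreal (\<eta>\<^sup>2))" .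
    qed auto
    also have "\<dots> \<le> 2 * (ennreal (\<kappa> * (U + 1) * (m * \<epsilon>) ^ 1) * (ennreal (h\<^sup>2) * (\<Sum>n'<n. \<phi> n')) + 2 * (ennreal c1 + ennreal (\<eta>\<^sup>2)))"
      unfolding c1_def by (intro mult_left_mono add_mono D\<theta>_b Rm_b' n) auto
    also have "\<dots> = ennreal c2 * (\<Sum>n'<n. \<phi> n') + ennreal (4 * c1 + 4 * \<eta>\<^sup>2)"
    proof -
      have "ennreal c2 = ennreal 2 * (ennreal (\<kappa> * (U + 1) * (m * \<epsilon>) ^ 1) * ennreal (h\<^sup>2))"
      proof -
        have "ennreal 2 * (ennreal (\<kappa> * (U + 1) * (m * \<epsilon>) ^ 1) * ennreal (h\<^sup>2)) = ennreal (2 * ((\<kappa> * (U + 1) * (m * \<epsilon>) ^ 1) * h\<^sup>2))"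
          using kappa_nonneg U_nonneg d_nonneg by (subst ennreal_mult[symmetric], simp, simp)+ simp
        also have "2 * ((\<kappa> * (U + 1) * (m * \<epsilon>) ^ 1) * h\<^sup>2) = c2" by (simp add: c2_def)
        finally show ?thesis ..
      qed
      moreover have "ennreal (4 * c1 + 4 * \<eta>\<^sup>2) = ennreal 4 * (ennreal c1 + ennreal (\<eta>\<^sup>2))"
        using c0 by (simp add: distrib_left flip: ennreal_mult ennreal_plus ennreal_numeral del: ennreal_numeral)
      ultimately show ?thesis by (simp add: distrib_left mult.assoc[symmetric])
    qed
    finally show ?thesis by (simp add: add.commute)
  qed
  have "\<phi> L \<le> ennreal (4 * c1 + 4 * \<eta>\<^sup>2) * (1 + ennreal c2) ^ L"
    using main by (rule discrete_gronwall) auto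
  also have "\<dots> \<le> ennreal (4 * c1 + 4 * \<eta>\<^sup>2) * ennreal (exp (2 * \<kappa> * (U + 1) * h\<^sup>2 * U))"
    using c0 by (intro mult_left_mono one_plus_power_le_exp) (auto simp: c2_def U_def ac_simps)
  also have "\<dots> = ennreal ((4 * c1 + 4 * \<eta>\<^sup>2) * exp (2 * \<kappa> * (U + 1) * h\<^sup>2 * U))"
    using c0 by (simp add: ennreal_mult)
  finally show ?thesis
    by (simp add: \<phi>_def \<theta>_def e_def c1_def Y_def case_prod_unfold mult.assoc)
qed

end

section \<open>Uniform convergence to zero in outer probability\<close>

text \<open>Smallness in outer probability: the exceptional set is only covered by a measurable one,
  since \<open>X p i\<close> may involve processes of unknown measurability. The index set may
  depend on \<omega>, because grid points count only while the subordinator is below the time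
  horizon.\<close>

definition usmall :: "'a measure \<Rightarrow> (nat \<Rightarrow> 'a \<Rightarrow> 'i set) \<Rightarrow> (nat \<Rightarrow> 'i \<Rightarrow> 'a \<Rightarrow> real) \<Rightarrow> bool" where
  "usmall M I X \<longleftrightarrow> (\<forall>\<eta>>0. \<forall>\<kappa>>0. \<exists>p0. \<forall>p\<ge>p0. \<exists>A\<in>sets M. measure M A < \<kappa> \<and>
     (\<forall>\<omega>\<in>space M - A. \<forall>i\<in>I p \<omega>. \<bar>X p i \<omega>\<bar> \<le> \<eta>))"

lemma usmallD:
  assumes "usmall M I X" "0 < \<eta>" "0 < \<kappa>"
  obtains p0 where "\<And>p. p \<ge> p0 \<Longrightarrow> \<exists>A\<in>sets M. measure M A < \<kappa> \<and> (\<forall>\<omega>\<in>space M - A. \<forall>i\<in>I p \<omega>. \<bar>X p i \<omega>\<bar> \<le> \<eta>)"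
  using assms unfolding usmall_def by meson

context prob_space
begin

text \<open>Comparison up to a constant, eventually in \<open>p\<close> and off a null set; it
  serves to change index sets and to discard null sets.\<close>

lemma usmall_AE_mono:
  assumes Y: "usmall M J Y" and C: "0 < C"
    and le: "\<And>p. p \<ge> p1 \<Longrightarrow> AE \<omega> in M. \<forall>i\<in>I p \<omega>. \<exists>j\<in>J p \<omega>. \<bar>X p i \<omega>\<bar> \<le> C * \<bar>Y p j \<omega>\<bar>"
  shows "usmall M I X"
  unfolding usmall_def
proof (intro allI impI)
  fix \<eta> \<kappa> :: real assume "0 < \<eta>" "0 < \<kappa>"
  then obtain p0 where p0: "\<And>p. p \<ge> p0 \<Longrightarrow> \<exists>A\<in>sets M. measure M A < \<kappa> \<and> (\<forall>\<omega>\<in>space M - A. \<forall>i\<in>J p \<omega>. \<bar>Y p i \<omega>\<bar> \<le> \<eta> / C)"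
    using usmallD[OF Y, of "\<eta> / C" \<kappa>] C by auto
  show "\<exists>p0. \<forall>p\<ge>p0. \<exists>A\<in>sets M. prob A < \<kappa> \<and> (\<forall>\<omega>\<in>space M - A. \<forall>i\<in>I p \<omega>. \<bar>X p i \<omega>\<bar> \<le> \<eta>)"
  proof (intro exI[of _ "max p0 p1"] allI impI)
    fix p assume p: "max p0 p1 \<le> p"
    then obtain A where A: "A \<in> sets M" "measure M A < \<kappa>" "\<forall>\<omega>\<in>space M - A. \<forall>i\<in>J p \<omega>. \<bar>Y p i \<omega>\<bar> \<le> \<eta> / C"
      using p0[of p] by auto
    obtain N where N: "{\<omega>\<in>space M. \<not> (\<forall>i\<in>I p \<omega>. \<exists>j\<in>J p \<omega>. \<bar>X p i \<omega>\<bar> \<le> C * \<bar>Y p j \<omega>\<bar>)} \<subseteq> N" "emeasure M N = 0" "N \<in> sets M"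
      using le[of p] p by (auto elim: AE_E)
    have "measure M (A \<union> N) \<le> measure M A + measure M N" using A N by (intro measure_Un_le) auto
    then have "measure M (A \<union> N) < \<kappa>" using A(2) N(2) by (simp add: measure_def)
    moreover have "\<bar>X p i \<omega>\<bar> \<le> \<eta>" if \<omega>: "\<omega> \<in> space M - (A \<union> N)" "i \<in> I p \<omega>" for \<omega> i
    proof -
      obtain j where j: "j \<in> J p \<omega>" "\<bar>X p i \<omega>\<bar> \<le> C * \<bar>Y p j \<omega>\<bar>" using \<omega> N(1) by blast
      note j(2)
      also have "C * \<bar>Y p j \<omega>\<bar> \<le> C * (\<eta> / C)" using C A(3) \<omega> j(1) by (intro mult_left_mono) auto
      finally show ?thesis using C by simp
    qed
    ultimately show "\<exists>A\<in>sets M. prob A < \<kappa> \<and> (\<forall>\<omega>\<in>space M - A. \<forall>i\<in>I p \<omega>. \<bar>X p i \<omega>\<bar> \<le> \<eta>)"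
      using A N by (intro bexI[of _ "A \<union> N"]) auto
  qed
qed

lemma usmall_mono:
  assumes "usmall M J Y" "\<And>p \<omega> i. \<omega> \<in> space M \<Longrightarrow> i \<in> I p \<omega> \<Longrightarrow> \<exists>j\<in>J p \<omega>. \<bar>X p i \<omega>\<bar> \<le> \<bar>Y p j \<omega>\<bar>"
  shows "usmall M I X"
  by (rule usmall_AE_mono[where J=J and Y=Y and C=1 and ?p1.0=0]) (use assms in auto)

lemma usmall_zero: "usmall M I (\<lambda>_ _ _. 0)"
  unfolding usmall_def by (intro allI impI exI[of _ 0] bexI[of _ "{}"]) auto

lemma usmall_add:
  assumes X: "usmall M I X" and Y: "usmall M I Y"
  shows "usmall M I (\<lambda>p i \<omega>. X p i \<omega> + Y p i \<omega>)"
  unfolding usmall_def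
proof (intro allI impI)
  fix \<eta> \<kappa> :: real assume pos: "0 < \<eta>" "0 < \<kappa>"
  obtain p0 where p0: "\<And>p. p \<ge> p0 \<Longrightarrow> \<exists>A\<in>sets M. measure M A < \<kappa> / 2 \<and> (\<forall>\<omega>\<in>space M - A. \<forall>i\<in>I p \<omega>. \<bar>X p i \<omega>\<bar> \<le> \<eta> / 2)"
    using usmallD[OF X, of "\<eta> / 2" "\<kappa> / 2"] pos by auto
  obtain p1 where p1: "\<And>p. p \<ge> p1 \<Longrightarrow> \<exists>A\<in>sets M. measure M A < \<kappa> / 2 \<and> (\<forall>\<omega>\<in>space M - A. \<forall>i\<in>I p \<omega>. \<bar>Y p i \<omega>\<bar> \<le> \<eta> / 2)"
    using usmallD[OF Y, of "\<eta> / 2" "\<kappa> / 2"] pos by auto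
  show "\<exists>p0. \<forall>p\<ge>p0. \<exists>A\<in>sets M. prob A < \<kappa> \<and> (\<forall>\<omega>\<in>space M - A. \<forall>i\<in>I p \<omega>. \<bar>X p i \<omega> + Y p i \<omega>\<bar> \<le> \<eta>)"
  proof (intro exI[of _ "max p0 p1"] allI impI)
    fix p assume p: "max p0 p1 \<le> p"
    obtain A where A: "A \<in> sets M" "measure M A < \<kappa> / 2" "\<forall>\<omega>\<in>space M - A. \<forall>i\<in>I p \<omega>. \<bar>X p i \<omega>\<bar> \<le> \<eta> / 2"
      using p0[of p] p by auto
    obtain B where B: "B \<in> sets M" "measure M B < \<kappa> / 2" "\<forall>\<omega>\<in>space M - B. \<forall>i\<in>I p \<omega>. \<bar>Y p i \<omega>\<bar> \<le> \<eta> / 2"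
      using p1[of p] p by auto
    have "measure M (A \<union> B) \<le> measure M A + measure M B" using A B by (intro measure_Un_le) auto
    then have "measure M (A \<union> B) < \<kappa>" using A(2) B(2) by simp
    moreover have "\<bar>X p i \<omega> + Y p i \<omega>\<bar> \<le> \<eta>" if "\<omega> \<in> space M - (A \<union> B)" "i \<in> I p \<omega>" for \<omega> i
    proof -
      have "\<bar>X p i \<omega>\<bar> \<le> \<eta> / 2" "\<bar>Y p i \<omega>\<bar> \<le> \<eta> / 2" using that A(3) B(3) by auto
      then show ?thesis by linarith
    qed
    ultimately show "\<exists>A\<in>sets M. prob A < \<kappa> \<and> (\<forall>\<omega>\<in>space M - A. \<forall>i\<in>I p \<omega>. \<bar>X p i \<omega> + Y p i \<omega>\<bar> \<le> \<eta>)"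
      using A B by (intro bexI[of _ "A \<union> B"]) auto
  qed
qed

lemma usmall_cmult: "usmall M I X \<Longrightarrow> usmall M I (\<lambda>p i \<omega>. c * X p i \<omega>)"
  by (rule usmall_AE_mono[where J=I and Y=X and C="\<bar>c\<bar> + 1" and ?p1.0=0]) (auto intro!: AE_I2 bexI simp: abs_mult mult_right_mono)

lemma usmall_diff: "usmall M I X \<Longrightarrow> usmall M I Y \<Longrightarrow> usmall M I (\<lambda>p i \<omega>. X p i \<omega> - Y p i \<omega>)"
  using usmall_add[of I X "\<lambda>p i \<omega>. -1 * Y p i \<omega>"] usmall_cmult[of I Y "-1"] by simp

lemma usmall_sum:
  assumes "finite S" "\<And>a. a \<in> S \<Longrightarrow> usmall M I (X a)"
  shows "usmall M I (\<lambda>p i \<omega>. \<Sum>a\<in>S. X a p i \<omega>)"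
  using assms by (induction S rule: finite_induct) (auto intro: usmall_add usmall_zero)

text \<open>The family is split into its part on \<open>I\<close> and the rest, and each part is
  small on the whole union.\<close>

lemma usmall_Un:
  assumes "usmall M I X" "usmall M J X"
  shows "usmall M (\<lambda>p \<omega>. I p \<omega> \<union> J p \<omega>) X"
proof -
  have 1: "usmall M (\<lambda>p \<omega>. I p \<omega> \<union> J p \<omega>) (\<lambda>p i \<omega>. if i \<in> I p \<omega> then X p i \<omega> else 0)"
    unfolding usmall_def
  proof (intro allI impI)
    fix \<eta> \<kappa> :: real assume "0 < \<eta>" "0 < \<kappa>"
    then show "\<exists>p0. \<forall>p\<ge>p0. \<exists>A\<in>sets M. prob A < \<kappa> \<and> (\<forall>\<omega>\<in>space M - A. \<forall>i\<in>I p \<omega> \<union> J p \<omega>. \<bar>if i \<in> I p \<omega> then X p i \<omega> else 0\<bar> \<le> \<eta>)"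
      using assms(1) unfolding usmall_def by (elim allE[of _ \<eta>] allE[of _ \<kappa>]) (fastforce intro: less_imp_le)
  qed
  have 2: "usmall M (\<lambda>p \<omega>. I p \<omega> \<union> J p \<omega>) (\<lambda>p i \<omega>. if i \<in> I p \<omega> then 0 else X p i \<omega>)"
    unfolding usmall_def
  proof (intro allI impI)
    fix \<eta> \<kappa> :: real assume "0 < \<eta>" "0 < \<kappa>"
    then show "\<exists>p0. \<forall>p\<ge>p0. \<exists>A\<in>sets M. prob A < \<kappa> \<and> (\<forall>\<omega>\<in>space M - A. \<forall>i\<in>I p \<omega> \<union> J p \<omega>. \<bar>if i \<in> I p \<omega> then 0 else X p i \<omega>\<bar> \<le> \<eta>)"
      using assms(2) unfolding usmall_def by (elim allE[of _ \<eta>] allE[of _ \<kappa>]) (fastforce intro: less_imp_le)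
  qed
  show ?thesis by (rule usmall_mono[OF usmall_add[OF 1 2]]) auto
qed

lemma usmall_UN:
  assumes "finite S" "\<And>a. a \<in> S \<Longrightarrow> usmall M (I a) X"
  shows "usmall M (\<lambda>p \<omega>. \<Union>a\<in>S. I a p \<omega>) X"
  using assms
proof (induction S rule: finite_induct)
  case empty
  then show ?case unfolding usmall_def by (intro allI impI exI[of _ 0] bexI[of _ "{}"]) auto
qed (auto intro: usmall_Un)

lemma chebyshev_sup2:
  assumes I: "countable I" "\<And>i. i \<in> I \<Longrightarrow> S i \<in> borel_measurable M" and c: "sup2 M I S \<le> ennreal c" "0 \<le> c" and \<eta>: "0 < \<eta>"
  shows "\<exists>A\<in>sets M. measure M A \<le> c / \<eta>\<^sup>2 \<and> (\<forall>\<omega>\<in>space M - A. \<forall>i\<in>I. \<bar>S i \<omega>\<bar> \<le> \<eta>)"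
proof -
  let ?u = "\<lambda>\<omega>. SUP i\<in>I. ennreal ((S i \<omega>)\<^sup>2)"
  let ?A = "{\<omega>\<in>space M. 1 \<le> ennreal (1 / \<eta>\<^sup>2) * ?u \<omega>}"
  have u: "?u \<in> borel_measurable M" using I by (rule measurable_sup2)
  have A: "?A \<in> sets M" using u by measurable
  have "emeasure M ?A \<le> ennreal (1 / \<eta>\<^sup>2) * (\<integral>\<^sup>+\<omega>. ?u \<omega> * indicator (space M) \<omega> \<partial>M)"
    using u by (intro nn_integral_Markov_inequality) auto
  also have "(\<integral>\<^sup>+\<omega>. ?u \<omega> * indicator (space M) \<omega> \<partial>M) = sup2 M I S"
    unfolding sup2_def by (intro nn_integral_cong) auto
  also have "ennreal (1 / \<eta>\<^sup>2) * sup2 M I S \<le> ennreal (1 / \<eta>\<^sup>2) * ennreal c" using c by (intro mult_left_mono) auto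
  also have "\<dots> = ennreal (c / \<eta>\<^sup>2)" using c by (simp flip: ennreal_mult)
  finally have "measure M ?A \<le> c / \<eta>\<^sup>2" using c by (simp add: emeasure_eq_measure)
  moreover have "\<bar>S i \<omega>\<bar> \<le> \<eta>" if "\<omega> \<in> space M - ?A" "i \<in> I" for \<omega> i
  proof (rule ccontr)
    assume "\<not> \<bar>S i \<omega>\<bar> \<le> \<eta>"
    then have "\<eta>\<^sup>2 \<le> (S i \<omega>)\<^sup>2" using \<eta> by (intro power2_le_iff_abs_le[THEN iffD2] abs_le_square_iff[THEN iffD1]) auto
    then have "1 \<le> ennreal (1 / \<eta>\<^sup>2 * (S i \<omega>)\<^sup>2)" using \<eta> by (simp add: field_simps)
    also have "\<dots> = ennreal (1 / \<eta>\<^sup>2) * ennreal ((S i \<omega>)\<^sup>2)" by (rule ennreal_mult) auto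
    also have "\<dots> \<le> ennreal (1 / \<eta>\<^sup>2) * ?u \<omega>" using that by (intro mult_left_mono SUP_upper) auto
    finally show False using that by simp
  qed
  ultimately show ?thesis using A by blast
qed

lemma usmall_sup2:
  assumes J: "\<And>p. countable (J p)" "\<And>p i. i \<in> J p \<Longrightarrow> X p i \<in> borel_measurable M"
    and c: "\<And>p. sup2 M (J p) (X p) \<le> ennreal (c p)" "\<And>p. 0 \<le> c p" "c \<longlonglongrightarrow> 0"
  shows "usmall M (\<lambda>p _. J p) X"
  unfolding usmall_def
proof (intro allI impI)
  fix \<eta> \<kappa> :: real assume pos: "0 < \<eta>" "0 < \<kappa>"
  then have "\<forall>\<^sub>F p in sequentially. c p < \<kappa> * \<eta>\<^sup>2" using c(3) by (intro order_tendstoD) auto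
  then obtain p0 where p0: "\<And>p. p \<ge> p0 \<Longrightarrow> c p < \<kappa> * \<eta>\<^sup>2" by (auto simp: eventually_sequentially)
  show "\<exists>p0. \<forall>p\<ge>p0. \<exists>A\<in>sets M. prob A < \<kappa> \<and> (\<forall>\<omega>\<in>space M - A. \<forall>i\<in>J p. \<bar>X p i \<omega>\<bar> \<le> \<eta>)"
  proof (intro exI[of _ p0] allI impI)
    fix p assume "p0 \<le> p"
    then have "c p / \<eta>\<^sup>2 < \<kappa>" using p0[of p] pos by (simp add: divide_less_eq)
    moreover obtain A where "A \<in> sets M" "measure M A \<le> c p / \<eta>\<^sup>2" "\<forall>\<omega>\<in>space M - A. \<forall>i\<in>J p. \<bar>X p i \<omega>\<bar> \<le> \<eta>"
      using chebyshev_sup2[OF J(1)[of p] J(2)[of _ p] c(1,2)[of p] pos(1)] by blast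
    ultimately show "\<exists>A\<in>sets M. prob A < \<kappa> \<and> (\<forall>\<omega>\<in>space M - A. \<forall>i\<in>J p. \<bar>X p i \<omega>\<bar> \<le> \<eta>)"
      by (intro bexI[of _ A]) auto
  qed
qed

end

text \<open>Truncating the summands at \<open>\<eta>\<close> does not change the sum off a small event and makes the
  second moment bound available.\<close>

lemma usmall_step:
  assumes W: "\<And>p. gaussian_walk M (\<H> p) (\<xi> p) (\<epsilon> p)"
    and ab: "\<And>p. a p \<le> b p" "\<And>p. real (b p - a p) * \<epsilon> p \<le> U"
    and P: "\<And>p l. a p \<le> l \<Longrightarrow> l \<le> b p \<Longrightarrow> Measurable.pred (\<H> p l) (P p l)" "\<And>p l \<omega>. P p (Suc l) \<omega> \<Longrightarrow> P p l \<omega>"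
    and Qm: "\<And>p l. a p \<le> l \<Longrightarrow> l \<le> b p \<Longrightarrow> Q p l \<in> borel_measurable (\<H> p l)"
    and Q: "usmall M (\<lambda>p \<omega>. {i\<in>{a p..b p}. P p i \<omega>}) Q"
  shows "usmall M (\<lambda>p \<omega>. {i\<in>{a p..b p}. P p i \<omega>}) (\<lambda>p i \<omega>. \<Sum>l\<in>{a p..<i}. Q p l \<omega> * gaussian_walk.incr (\<xi> p) (\<epsilon> p) \<omega> j l)"
  unfolding usmall_def
proof (intro allI impI)
  interpret prob_space M using W unfolding gaussian_walk_def by blast
  fix \<eta> \<kappa> :: real assume pos: "0 < \<eta>" "0 < \<kappa>"
  have U: "0 \<le> U" using ab(2)[of 0] gaussian_walk.eps[OF W[of 0]] by (meson mult_nonneg_nonneg less_imp_le of_nat_0_le_iff order_trans)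
  define C where "C = U\<^sup>2 + 8 * U + 1"
  have C: "0 < C" using U by (auto simp: C_def intro: add_nonneg_pos)
  \<comment> \<open>Chosen so that the truncated sum has second moment at most \<kappa>/4 times
    \<eta>^2; Chebyshev then leaves probability \<kappa>/4, and the truncation takes less than
    \<kappa>/2.\<close>
  define \<eta>' where "\<eta>' = \<eta> * sqrt (\<kappa> / (4 * C))"
  have \<eta>': "0 < \<eta>'" "C * \<eta>'\<^sup>2 = \<kappa> / 4 * \<eta>\<^sup>2" using pos C by (auto simp: \<eta>'_def power_mult_distrib)
  obtain p0 where p0: "\<And>p. p \<ge> p0 \<Longrightarrow> \<exists>A\<in>sets M. measure M A < \<kappa> / 2 \<and> (\<forall>\<omega>\<in>space M - A. \<forall>i\<in>{i\<in>{a p..b p}. P p i \<omega>}. \<bar>Q p i \<omega>\<bar> \<le> \<eta>')"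
    using usmallD[OF Q, of \<eta>' "\<kappa> / 2"] pos \<eta>' by auto
  show "\<exists>p0. \<forall>p\<ge>p0. \<exists>A\<in>sets M. prob A < \<kappa> \<and> (\<forall>\<omega>\<in>space M - A. \<forall>i\<in>{i\<in>{a p..b p}. P p i \<omega>}.
      \<bar>\<Sum>l\<in>{a p..<i}. Q p l \<omega> * gaussian_walk.incr (\<xi> p) (\<epsilon> p) \<omega> j l\<bar> \<le> \<eta>)"
  proof (intro exI[of _ p0] allI impI)
    fix p assume p: "p0 \<le> p"
    interpret W: gaussian_walk M "\<H> p" "\<xi> p" "\<epsilon> p" by (rule W)
    define Q' where "Q' l \<omega> = (if P p l \<omega> \<and> \<bar>Q p l \<omega>\<bar> \<le> \<eta>' then Q p l \<omega> else 0)" for l \<omega>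
    have Q'm: "Q' l \<in> borel_measurable (\<H> p l)" if l: "a p \<le> l" "l \<le> b p" for l
      unfolding Q'_def using P(1)[OF l] Qm[OF l] by measurable
    define m where "m = b p - a p"
    have bm: "b p = a p + m" using ab(1)[of p] by (simp add: m_def)
    have mU: "m * \<epsilon> p \<le> U" "0 \<le> m * \<epsilon> p" using ab(2)[of p] W.eps by (auto simp: m_def)
    obtain A where A: "A \<in> sets M" "measure M A < \<kappa> / 2" "\<forall>\<omega>\<in>space M - A. \<forall>i\<in>{i\<in>{a p..b p}. P p i \<omega>}. \<bar>Q p i \<omega>\<bar> \<le> \<eta>'"
      using p0[OF p] by auto
    let ?S = "\<lambda>i \<omega>. \<Sum>l\<in>{a p..<i}. Q' l \<omega> * W.incr \<omega> j l"
    have "sup2 M {a p..a p + m} ?S \<le> (if j = 0 then ennreal (m * \<epsilon> p) ^ 2 else 8 * ennreal (m * \<epsilon> p)) * sup2 M {a p..a p + m} Q'"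
      using Q'm bm by (intro W.step_bound) auto
    also have "\<dots> \<le> ennreal C * ennreal (\<eta>'\<^sup>2)"
    proof (intro mult_mono)
      have "ennreal (m * \<epsilon> p) ^ 2 = ennreal ((m * \<epsilon> p)\<^sup>2)" "8 * ennreal (m * \<epsilon> p) = ennreal (8 * (m * \<epsilon> p))"
        using mU by (auto simp: ennreal_power ennreal_mult)
      moreover have "(m * \<epsilon> p)\<^sup>2 \<le> U\<^sup>2" using mU by (intro power_mono) auto
      ultimately show "(if j = 0 then ennreal (m * \<epsilon> p) ^ 2 else 8 * ennreal (m * \<epsilon> p)) \<le> ennreal C"
      proof -
        assume *: "ennreal (m * \<epsilon> p) ^ 2 = ennreal ((m * \<epsilon> p)\<^sup>2)" "8 * ennreal (m * \<epsilon> p) = ennreal (8 * (m * \<epsilon> p))"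
          "(m * \<epsilon> p)\<^sup>2 \<le> U\<^sup>2"
        have "(m * \<epsilon> p)\<^sup>2 \<le> C" "8 * (m * \<epsilon> p) \<le> C" using *(3) mU U zero_le_power2[of U] unfolding C_def by linarith+
        then show ?thesis unfolding *(1,2) by (simp add: ennreal_leI)
      qed
      have "sup2 M {a p..a p + m} Q' \<le> (\<integral>\<^sup>+\<omega>. ennreal (\<eta>'\<^sup>2) \<partial>M)"
      proof (rule sup2_le_nn)
        show "ennreal ((Q' i \<omega>)\<^sup>2) \<le> ennreal (\<eta>'\<^sup>2)" for i \<omega>
          using \<eta>'(1) by (auto simp: Q'_def intro!: ennreal_leI simp flip: abs_le_square_iff)
      qed
      then show "sup2 M {a p..a p + m} Q' \<le> ennreal (\<eta>'\<^sup>2)" by (simp add: emeasure_space_1)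
    qed auto
    also have "\<dots> = ennreal (\<kappa> / 4 * \<eta>\<^sup>2)" using C unfolding \<eta>'(2)[symmetric] by (subst ennreal_mult) auto
    finally have "sup2 M {a p..a p + m} ?S \<le> ennreal (\<kappa> / 4 * \<eta>\<^sup>2)" .
    moreover have "?S i \<in> borel_measurable M" if "i \<in> {a p..a p + m}" for i
      using that bm by (intro borel_measurable_sum borel_measurable_times W.H_meas_M[OF Q'm] W.H_meas_M[OF W.incr_meas]) auto
    ultimately obtain B where B: "B \<in> sets M" "measure M B \<le> \<kappa> / 4 * \<eta>\<^sup>2 / \<eta>\<^sup>2" "\<forall>\<omega>\<in>space M - B. \<forall>i\<in>{a p..a p + m}. \<bar>?S i \<omega>\<bar> \<le> \<eta>"
      using chebyshev_sup2[of "{a p..a p + m}" ?S "\<kappa> / 4 * \<eta>\<^sup>2" \<eta>] pos by auto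
    have "measure M (A \<union> B) \<le> measure M A + measure M B" using A B by (intro measure_Un_le) auto
    then have "measure M (A \<union> B) < \<kappa>" using A(2) B(2) pos by simp
    moreover have "\<bar>\<Sum>l\<in>{a p..<i}. Q p l \<omega> * W.incr \<omega> j l\<bar> \<le> \<eta>"
      if "\<omega> \<in> space M - (A \<union> B)" "i \<in> {i\<in>{a p..b p}. P p i \<omega>}" for \<omega> i
    proof -
      \<comment> \<open>\<open>P\<close> decreases with the index, so all earlier summands lie in
        the index set too and are not truncated.\<close>
      have Pl: "P p l \<omega>" if "l \<le> i" for l
        using that \<open>i \<in> {i\<in>{a p..b p}. P p i \<omega>}\<close> by (induction l rule: inc_induct) (auto intro: P(2))
      have "(\<Sum>l\<in>{a p..<i}. Q p l \<omega> * W.incr \<omega> j l) = ?S i \<omega>"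
        using that A(3) Pl by (intro sum.cong) (auto simp: Q'_def)
      then show ?thesis using B(3) that bm by auto
    qed
    ultimately show "\<exists>A\<in>sets M. prob A < \<kappa> \<and> (\<forall>\<omega>\<in>space M - A. \<forall>i\<in>{i\<in>{a p..b p}. P p i \<omega>}.
      \<bar>\<Sum>l\<in>{a p..<i}. Q p l \<omega> * W.incr \<omega> j l\<bar> \<le> \<eta>)"
      using A B by (intro bexI[of _ "A \<union> B"]) auto
  qed
qed

lemma usmall_mis:
  assumes W: "\<And>p. gaussian_walk M (\<H> p) (\<xi> p) (\<epsilon> p)"
    and ab: "\<And>p. a p \<le> b p" "\<And>p. real (b p - a p) * \<epsilon> p \<le> U"
    and P: "\<And>p l. a p \<le> l \<Longrightarrow> l \<le> b p \<Longrightarrow> Measurable.pred (\<H> p l) (P p l)" "\<And>p l \<omega>. P p (Suc l) \<omega> \<Longrightarrow> P p l \<omega>"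
    and Qm: "\<And>p l. a p \<le> l \<Longrightarrow> l \<le> b p \<Longrightarrow> Q p l \<in> borel_measurable (\<H> p l)"
    and Q: "usmall M (\<lambda>p \<omega>. {i\<in>{a p..b p}. P p i \<omega>}) Q"
  shows "usmall M (\<lambda>p \<omega>. {i\<in>{a p..b p}. P p i \<omega>})
    (\<lambda>p i \<omega>. mis (gaussian_walk.incr (\<xi> p) (\<epsilon> p) \<omega>) (a p) \<beta> (\<lambda>l. Q p l \<omega>) i)"
proof (induction \<beta>)
  case (Cons j \<beta>)
  have "mis (gaussian_walk.incr (\<xi> p) (\<epsilon> p) \<omega>) (a p) \<beta> (\<lambda>l. Q p l \<omega>) l
      = (\<lambda>\<omega>. mis (gaussian_walk.incr (\<xi> p) (\<epsilon> p) \<omega>) (a p) \<beta> (\<lambda>l. Q p l \<omega>) l) \<omega>" for p l \<omega> by simp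
  show ?case unfolding mis.simps
    by (rule usmall_step[OF W ab P _ Cons.IH]) (auto intro!: gaussian_walk.ms_meas[OF W, where b="b _"] Qm)
qed (use Q in simp)

section \<open>The remainder in the discrete Ito formula\<close>

text \<open>Second order Taylor formula with Lagrange remainder. The case y' = y is separate because
  the expansion takes place on a nondegenerate interval.\<close>

lemma C12_space_taylor:
  assumes "C12 \<phi>" "0 \<le> u"
  shows "\<exists>z. \<bar>z - y\<bar> \<le> \<bar>y' - y\<bar> \<and> \<phi> u y' - \<phi> u y = D_x \<phi> u y * (y' - y) + 1 / 2 * D_x (D_x \<phi>) u z * (y' - y)\<^sup>2"
proof (cases "y' = y")
  case False
  have d: "(\<phi> u has_real_derivative D_x \<phi> u x) (at x)" "(D_x \<phi> u has_real_derivative D_x (D_x \<phi>) u x) (at x)" for x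
    using assms unfolding C12_def D_x_def[of \<phi>] D_x_def[of "D_x \<phi>"]
    by (auto simp: DERIV_deriv_iff_real_differentiable D_x_def real_differentiable_def field_differentiable_def[symmetric] DERIV_deriv_iff_field_differentiable)
  define df where "df m = (if m = 0 then \<phi> u else if m = 1 then D_x \<phi> u else D_x (D_x \<phi>) u)" for m :: nat
  have "\<exists>t. (if y' < y then y' < t \<and> t < y else y < t \<and> t < y') \<and>
      \<phi> u y' = (\<Sum>m<2. (df m y / fact m) * (y' - y) ^ m) + (df 2 t / fact 2) * (y' - y) ^ 2"
  proof (rule Taylor[where a="min y y'" and b="max y y'"])
    show "\<forall>m t. m < 2 \<and> min y y' \<le> t \<and> t \<le> max y y' \<longrightarrow> (df m has_real_derivative df (Suc m) t) (at t)"
      using d by (auto simp: df_def less_2_cases_iff)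
  qed (use False in \<open>auto simp: df_def\<close>)
  then obtain t where t: "if y' < y then y' < t \<and> t < y else y < t \<and> t < y'"
    "\<phi> u y' = (\<Sum>m<2. (df m y / fact m) * (y' - y) ^ m) + (df 2 t / fact 2) * (y' - y) ^ 2" by blast
  show ?thesis
  proof (intro exI[of _ t] conjI)
    show "\<bar>t - y\<bar> \<le> \<bar>y' - y\<bar>" using t(1) by (auto split: if_splits)
    show "\<phi> u y' - \<phi> u y = D_x \<phi> u y * (y' - y) + 1 / 2 * D_x (D_x \<phi>) u t * (y' - y)\<^sup>2"
      using t(2) by (simp add: df_def numeral_2_eq_2)
  qed
qed auto

lemma C12_time_mvt:
  assumes "C12 \<phi>" "0 \<le> u" "0 < e" and bd: "\<And>v. u \<le> v \<Longrightarrow> v \<le> u + e \<Longrightarrow> \<bar>D_u \<phi> v y - c\<bar> \<le> w"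
  shows "\<bar>\<phi> (u + e) y - \<phi> u y - c * e\<bar> \<le> w * e"
proof -
  have d: "((\<lambda>v. \<phi> v y) has_derivative (\<lambda>h. h * D_u \<phi> v y)) (at v within {u..u + e})" if "v \<in> {u..u + e}" for v
  proof -
    have "(\<lambda>v. \<phi> v y) differentiable (at v within {0..})" using assms that by (auto simp: C12_def)
    then have "((\<lambda>v. \<phi> v y) has_vector_derivative D_u \<phi> v y) (at v within {0..})"
      unfolding D_u_def using vector_derivative_works by blast
    then have "((\<lambda>v. \<phi> v y) has_vector_derivative D_u \<phi> v y) (at v within {u..u + e})"
      by (rule has_vector_derivative_within_subset) (use assms(2) in auto)
    then show ?thesis by (simp add: has_vector_derivative_def)
  qed
  obtain v where v: "v \<in> {u<..<u + e}" "\<phi> (u + e) y - \<phi> u y = e * D_u \<phi> v y"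
    using mvt_simple[of u "u + e" "\<lambda>v. \<phi> v y" "\<lambda>v h. h * D_u \<phi> v y"] d assms(3) by auto
  have "\<bar>\<phi> (u + e) y - \<phi> u y - c * e\<bar> = \<bar>D_u \<phi> v y - c\<bar> * e"
  proof -
    have "e * D_u \<phi> v y - c * e = (D_u \<phi> v y - c) * e" by (simp add: algebra_simps)
    then show ?thesis unfolding v(2) using assms(3) by (simp add: abs_mult)
  qed
  also have "\<dots> \<le> w * e" using v(1) assms(3) by (intro mult_right_mono bd) auto
  finally show ?thesis .
qed

text \<open>The time increment is taken at the new point \<open>y'\<close>, the space increment is
  expanded to second order. In (y' - y)^2 = F^2 e^2 + 2 F G e z + G^2 z^2 only the last term is of
  order e; replacing z^2 by e gives the second order part of L^0, and z^2 - e is kept on the left as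
  a martingale increment. \<open>w\<close> is a modulus of continuity of the derivatives.\<close>

lemma ito_step:
  assumes \<phi>: "C12 \<phi>" and u: "0 \<le> u" "0 < e"
    and y': "y' = y + F u y * e + G u y * z" and y'_le: "\<bar>y' - y\<bar> \<le> d"
    and mu: "\<And>v x. u \<le> v \<Longrightarrow> v \<le> u + e \<Longrightarrow> \<bar>x - y\<bar> \<le> d \<Longrightarrow> \<bar>D_u \<phi> v x - D_u \<phi> u y\<bar> \<le> w"
    and mx: "\<And>x. \<bar>x - y\<bar> \<le> d \<Longrightarrow> \<bar>D_x (D_x \<phi>) u x - D_x (D_x \<phi>) u y\<bar> \<le> w"
    and C: "\<bar>F u y\<bar> \<le> C" "\<bar>G u y\<bar> \<le> C" "\<bar>D_x (D_x \<phi>) u y\<bar> \<le> C"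
  shows "\<bar>\<phi> (u + e) y' - \<phi> u y - L_op F G 0 \<phi> u y * e - L_op F G 1 \<phi> u y * z
      - 1 / 2 * D_x (D_x \<phi>) u y * (G u y)\<^sup>2 * (z\<^sup>2 - e)\<bar>
    \<le> w * e + w * C\<^sup>2 * (e\<^sup>2 + z\<^sup>2) + C ^ 3 * (e\<^sup>2 + 2 * e * \<bar>z\<bar>)"
proof -
  let ?c = "D_x (D_x \<phi>)"
  have C0: "0 \<le> C" using C(1) by linarith
  have w0: "0 \<le> w" using mx[of y] y'_le by (smt (verit) abs_ge_zero)
  have 1: "\<bar>\<phi> (u + e) y' - \<phi> u y' - D_u \<phi> u y * e\<bar> \<le> w * e"
    using y'_le by (intro C12_time_mvt[OF \<phi> u] mu) auto
  obtain x where x: "\<bar>x - y\<bar> \<le> \<bar>y' - y\<bar>" "\<phi> u y' - \<phi> u y = D_x \<phi> u y * (y' - y) + 1 / 2 * ?c u x * (y' - y)\<^sup>2"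
    using C12_space_taylor[OF \<phi> u(1)] by blast
  have 2: "\<bar>1 / 2 * (?c u x - ?c u y) * (y' - y)\<^sup>2\<bar> \<le> w * C\<^sup>2 * (e\<^sup>2 + z\<^sup>2)"
  proof -
    have "\<bar>1 / 2 * (?c u x - ?c u y) * (y' - y)\<^sup>2\<bar> = 1 / 2 * \<bar>?c u x - ?c u y\<bar> * (y' - y)\<^sup>2" by (simp add: abs_mult)
    also have "\<dots> \<le> 1 / 2 * w * (2 * (C\<^sup>2 * e\<^sup>2) + 2 * (C\<^sup>2 * z\<^sup>2))"
    proof (intro mult_mono)
      show "\<bar>?c u x - ?c u y\<bar> \<le> w" using x(1) y'_le by (intro mx) auto
      have "(F u y * e)\<^sup>2 \<le> (C * e)\<^sup>2" "(G u y * z)\<^sup>2 \<le> (C * z)\<^sup>2"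
        using C C0 u by (auto simp: abs_mult intro!: mult_right_mono simp flip: abs_le_square_iff)
      moreover have "(y' - y)\<^sup>2 \<le> 2 * (F u y * e)\<^sup>2 + 2 * (G u y * z)\<^sup>2"
        unfolding y' using sum_squares_bound[of "F u y * e" "G u y * z"] by (simp add: power2_sum)
      ultimately show "(y' - y)\<^sup>2 \<le> 2 * (C\<^sup>2 * e\<^sup>2) + 2 * (C\<^sup>2 * z\<^sup>2)" by (simp add: power_mult_distrib)
    qed (use w0 in auto)
    finally show ?thesis by (simp add: algebra_simps)
  qed
  have 3: "\<bar>1 / 2 * ?c u y * ((F u y)\<^sup>2 * e\<^sup>2 + 2 * (F u y * G u y) * (e * z))\<bar> \<le> C ^ 3 * (e\<^sup>2 + 2 * e * \<bar>z\<bar>)"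
  proof -
    have "\<bar>1 / 2 * ?c u y * ((F u y)\<^sup>2 * e\<^sup>2 + 2 * (F u y * G u y) * (e * z))\<bar>
       = 1 / 2 * \<bar>?c u y\<bar> * \<bar>(F u y)\<^sup>2 * e\<^sup>2 + 2 * (F u y * G u y) * (e * z)\<bar>" by (simp add: abs_mult)
    also have "\<dots> \<le> 1 * C * (C\<^sup>2 * e\<^sup>2 + 2 * (C * C) * (e * \<bar>z\<bar>))"
    proof (intro mult_mono)
      have "\<bar>(F u y)\<^sup>2 * e\<^sup>2 + 2 * (F u y * G u y) * (e * z)\<bar> \<le> \<bar>F u y\<bar>\<^sup>2 * e\<^sup>2 + 2 * (\<bar>F u y\<bar> * \<bar>G u y\<bar>) * (e * \<bar>z\<bar>)"
        using u by (intro order_trans[OF abs_triangle_ineq]) (simp add: abs_mult)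
      also have "\<dots> \<le> C\<^sup>2 * e\<^sup>2 + 2 * (C * C) * (e * \<bar>z\<bar>)"
        using C C0 u by (intro add_mono mult_right_mono mult_left_mono mult_mono power_mono) auto
      finally show "\<bar>(F u y)\<^sup>2 * e\<^sup>2 + 2 * (F u y * G u y) * (e * z)\<bar> \<le> C\<^sup>2 * e\<^sup>2 + 2 * (C * C) * (e * \<bar>z\<bar>)" .
    qed (use C C0 in auto)
    finally show ?thesis by (simp add: power3_eq_cube power2_eq_square algebra_simps)
  qed
  \<comment> \<open>Three pieces: the time increment, the oscillation of the second derivative, and
    the terms of the square that are of smaller order than e.\<close>
  have "\<phi> (u + e) y' - \<phi> u y - L_op F G 0 \<phi> u y * e - L_op F G 1 \<phi> u y * z
      - 1 / 2 * ?c u y * (G u y)\<^sup>2 * (z\<^sup>2 - e)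
    = (\<phi> (u + e) y' - \<phi> u y' - D_u \<phi> u y * e)
      + (1 / 2 * (?c u x - ?c u y) * (y' - y)\<^sup>2)
      + (1 / 2 * ?c u y * ((F u y)\<^sup>2 * e\<^sup>2 + 2 * (F u y * G u y) * (e * z)))"
  proof -
    have sq: "(y' - y)\<^sup>2 = (F u y)\<^sup>2 * e\<^sup>2 + 2 * (F u y * G u y) * (e * z) + (G u y)\<^sup>2 * z\<^sup>2"
      unfolding y' by (simp add: power2_eq_square algebra_simps)
    have lin: "D_x \<phi> u y * (y' - y) = F u y * D_x \<phi> u y * e + G u y * D_x \<phi> u y * z"
      unfolding y' by (simp add: algebra_simps)
    have "\<phi> (u + e) y' - \<phi> u y = (\<phi> (u + e) y' - \<phi> u y') + (D_x \<phi> u y * (y' - y) + 1 / 2 * ?c u x * (y' - y)\<^sup>2)"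
      using x(2) by simp
    then show ?thesis unfolding lin L_op_def
      by (simp add: algebra_simps sq diff_divide_distrib)
  qed
  with 1 2 3 show ?thesis by linarith
qed

section \<open>Compensated squares of the increments and localization\<close>

lemma (in gaussian_walk) xi_sq_mdiff:
  assumes q: "q \<in> borel_measurable (\<H> l)" "\<And>\<omega>. \<bar>q \<omega>\<bar> \<le> C" and C: "0 \<le> C"
  shows "mdiff M (\<H> l) (\<lambda>\<omega>. q \<omega> * ((\<xi> l \<omega>)\<^sup>2 - \<epsilon>))"
    and "(\<integral>\<^sup>+\<omega>. ennreal ((q \<omega> * ((\<xi> l \<omega>)\<^sup>2 - \<epsilon>))\<^sup>2) \<partial>M) \<le> ennreal (2 * C\<^sup>2 * \<epsilon>\<^sup>2)"
proof -
  have qM: "q \<in> borel_measurable M" using q H_meas_M by blast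
  have ex: "((\<xi> l \<omega>)\<^sup>2 - \<epsilon>)\<^sup>2 = \<xi> l \<omega> ^ 4 - 2 * \<epsilon> * (\<xi> l \<omega>)\<^sup>2 + \<epsilon>\<^sup>2" for \<omega>
    by (simp add: power2_eq_square power4_eq_xxxx algebra_simps)
  have i4: "integrable M (\<lambda>\<omega>. ((\<xi> l \<omega>)\<^sup>2 - \<epsilon>)\<^sup>2)"
    unfolding ex using xi_moments(1) by (intro Bochner_Integration.integrable_add Bochner_Integration.integrable_diff integrable_mult_right) auto
  have v4: "(\<integral>\<omega>. ((\<xi> l \<omega>)\<^sup>2 - \<epsilon>)\<^sup>2 \<partial>M) = 2 * \<epsilon>\<^sup>2"
  proof -
    have "(\<integral>\<omega>. ((\<xi> l \<omega>)\<^sup>2 - \<epsilon>)\<^sup>2 \<partial>M) = (\<integral>\<omega>. \<xi> l \<omega> ^ 4 \<partial>M) - 2 * \<epsilon> * (\<integral>\<omega>. (\<xi> l \<omega>)\<^sup>2 \<partial>M) + \<epsilon>\<^sup>2"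
      unfolding ex using xi_moments(1) by (simp add: prob_space)
    then show ?thesis using xi_moments(3,4)[of l] by (simp add: power2_eq_square)
  qed
  show b: "(\<integral>\<^sup>+\<omega>. ennreal ((q \<omega> * ((\<xi> l \<omega>)\<^sup>2 - \<epsilon>))\<^sup>2) \<partial>M) \<le> ennreal (2 * C\<^sup>2 * \<epsilon>\<^sup>2)"
  proof -
    have "(\<integral>\<^sup>+\<omega>. ennreal ((q \<omega> * ((\<xi> l \<omega>)\<^sup>2 - \<epsilon>))\<^sup>2) \<partial>M) \<le> (\<integral>\<^sup>+\<omega>. ennreal (C\<^sup>2 * ((\<xi> l \<omega>)\<^sup>2 - \<epsilon>)\<^sup>2) \<partial>M)"
    proof (intro nn_integral_mono ennreal_leI)
      fix \<omega>
      have "(q \<omega>)\<^sup>2 \<le> C\<^sup>2" using q(2)[of \<omega>] C by (simp flip: abs_le_square_iff)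
      then show "(q \<omega> * ((\<xi> l \<omega>)\<^sup>2 - \<epsilon>))\<^sup>2 \<le> C\<^sup>2 * ((\<xi> l \<omega>)\<^sup>2 - \<epsilon>)\<^sup>2"
        by (simp add: power_mult_distrib mult_right_mono)
    qed
    also have "\<dots> = ennreal (\<integral>\<omega>. C\<^sup>2 * ((\<xi> l \<omega>)\<^sup>2 - \<epsilon>)\<^sup>2 \<partial>M)"
      using i4 by (intro nn_integral_eq_integral) auto
    also have "\<dots> = ennreal (2 * C\<^sup>2 * \<epsilon>\<^sup>2)" using v4 by simp
    finally show ?thesis .
  qed
  have l2: "l2 M (\<lambda>\<omega>. q \<omega> * ((\<xi> l \<omega>)\<^sup>2 - \<epsilon>))"
    unfolding l2_def using qM b by (auto intro: le_less_trans)
  show "mdiff M (\<H> l) (\<lambda>\<omega>. q \<omega> * ((\<xi> l \<omega>)\<^sup>2 - \<epsilon>))"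
    unfolding mdiff_def
  proof (intro conjI ballI impI l2)
    fix W assume W: "W \<in> borel_measurable (\<H> l)" "l2 M W"
    have i: "integrable M (\<lambda>\<omega>. W \<omega> * q \<omega>)"
      by (rule l2_mult_integrable[OF W(2)]) (rule l2_bound[where g="\<lambda>_. C\<^sup>2"], use qM q(2) C in \<open>auto simp flip: abs_le_square_iff\<close>)
    have "(\<integral>\<omega>. (W \<omega> * q \<omega>) * ((\<xi> l \<omega>)\<^sup>2 - \<epsilon>) \<partial>M) = (\<integral>\<omega>. W \<omega> * q \<omega> \<partial>M) * (\<integral>\<omega>. (\<xi> l \<omega>)\<^sup>2 - \<epsilon> \<partial>M)"
    proof (rule xi_product(2)[where g="\<lambda>x. x\<^sup>2 - \<epsilon>"])
      show "(\<lambda>\<omega>. W \<omega> * q \<omega>) \<in> borel_measurable (\<H> l)" using W(1) q(1) by (rule borel_measurable_times)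
      show "integrable M (\<lambda>\<omega>. (\<xi> l \<omega>)\<^sup>2 - \<epsilon>)" using xi_moments(1)[of l 2] by simp
    qed (use i in auto)
    also have "(\<integral>\<omega>. (\<xi> l \<omega>)\<^sup>2 - \<epsilon> \<partial>M) = 0" using xi_moments(1)[of l 2] xi_moments(3)[of l] by (simp add: prob_space)
    finally show "(\<integral>\<omega>. W \<omega> * (q \<omega> * ((\<xi> l \<omega>)\<^sup>2 - \<epsilon>)) \<partial>M) = 0" by (simp add: mult.assoc)
  qed
qed

text \<open>Each compensated square has variance 2 \<epsilon>^2 by the fourth moment, so with N
  \<epsilon> bounded the total is of order \<epsilon>: the quadratic variation converges.\<close>

lemma (in gaussian_walk) xi_sq_maximal:
  assumes q: "\<And>l. l < N \<Longrightarrow> q l \<in> borel_measurable (\<H> l)" "\<And>l \<omega>. \<bar>q l \<omega>\<bar> \<le> C" and C: "0 \<le> C"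
  shows "sup2 M {..N} (\<lambda>n \<omega>. \<Sum>l<n. q l \<omega> * ((\<xi> l \<omega>)\<^sup>2 - \<epsilon>)) \<le> ennreal (16 * C\<^sup>2 * (N * \<epsilon>) * \<epsilon>)"
proof -
  have "sup2 M {..N} (\<lambda>n \<omega>. \<Sum>l<n. q l \<omega> * ((\<xi> l \<omega>)\<^sup>2 - \<epsilon>))
    \<le> 8 * (\<Sum>l<N. \<integral>\<^sup>+\<omega>. ennreal ((q l \<omega> * ((\<xi> l \<omega>)\<^sup>2 - \<epsilon>))\<^sup>2) \<partial>M)"
  proof (rule maximal_inequality[where G=\<H>])
    show "(\<lambda>\<omega>. q n \<omega> * ((\<xi> n \<omega>)\<^sup>2 - \<epsilon>)) \<in> borel_measurable (\<H> (Suc n))" if "n < N" for n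
      using H_meas_mono[OF q(1)[OF that], of "Suc n"] xi_meas[of n] by auto
    show "mdiff M (\<H> n) (\<lambda>\<omega>. q n \<omega> * ((\<xi> n \<omega>)\<^sup>2 - \<epsilon>))" if "n < N" for n
      by (rule xi_sq_mdiff(1)[OF q(1)[OF that] q(2) C])
    show "sets (\<H> n) \<subseteq> sets (\<H> (Suc n))" for n by (rule H_mono) simp
  qed (rule sub)
  also have "\<dots> \<le> 8 * (\<Sum>l<N. ennreal (2 * C\<^sup>2 * \<epsilon>\<^sup>2))"
    by (intro mult_left_mono sum_mono xi_sq_mdiff(2) q C) auto
  also have "\<dots> = ennreal (8 * (N * (2 * C\<^sup>2 * \<epsilon>\<^sup>2)))"
  proof -
    have "ennreal (8 * (N * (2 * C\<^sup>2 * \<epsilon>\<^sup>2))) = ennreal 8 * (ennreal N * ennreal (2 * C\<^sup>2 * \<epsilon>\<^sup>2))"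
      by (subst ennreal_mult, simp, simp)+ simp
    then show ?thesis by (simp add: ennreal_of_nat_eq_real_of_nat)
  qed
  also have "8 * (N * (2 * C\<^sup>2 * \<epsilon>\<^sup>2)) = 16 * C\<^sup>2 * (N * \<epsilon>) * \<epsilon>" by (simp add: power2_eq_square)
  finally show ?thesis .
qed

text \<open>Uniform continuity on a rectangle enlarged by 1; d <= 1 keeps the second point inside.
  Time moves forward only, as in one Euler step.\<close>

lemma jc_unif:
  assumes "jointly_continuous c" "0 < w"
  shows "\<exists>d>0. d \<le> 1 \<and> (\<forall>u v x y. 0 \<le> u \<longrightarrow> u \<le> U \<longrightarrow> \<bar>y\<bar> \<le> R \<longrightarrow> u \<le> v \<longrightarrow> v \<le> u + d \<longrightarrow> \<bar>x - y\<bar> \<le> d \<longrightarrow> \<bar>c v x - c u y\<bar> \<le> w)"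
proof -
  let ?K = "{0..U + 1} \<times> {- R - 1..R + 1} :: (real \<times> real) set"
  have "uniformly_continuous_on ?K (\<lambda>(u, x). c u x)"
    using assms(1) unfolding jointly_continuous_def
    by (intro compact_uniformly_continuous compact_Times) (auto intro: continuous_on_subset)
  then obtain e where e: "e > 0" "\<And>p q. p \<in> ?K \<Longrightarrow> q \<in> ?K \<Longrightarrow> dist q p < e \<Longrightarrow> dist ((\<lambda>(u, x). c u x) q) ((\<lambda>(u, x). c u x) p) < w"
    unfolding uniformly_continuous_on_def using assms(2) by blast
  define d where "d = min 1 (e / 3)"
  show ?thesis
  proof (intro exI[of _ d] conjI allI impI)
    show "0 < d" "d \<le> 1" using e(1) by (auto simp: d_def)
    fix u v x y :: real assume a: "0 \<le> u" "u \<le> U" "\<bar>y\<bar> \<le> R" "u \<le> v" "v \<le> u + d" "\<bar>x - y\<bar> \<le> d"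
    have d: "d \<le> 1" "d \<le> e / 3" by (auto simp: d_def)
    have "dist (v, x) (u, y) \<le> \<bar>v - u\<bar> + \<bar>x - y\<bar>" unfolding dist_Pair_Pair dist_real_def
      by (rule order_trans[OF sqrt_sum_squares_le_sum_abs]) simp
    also have "\<dots> < e" using a d e(1) by auto
    finally have "dist (v, x) (u, y) < e" .
    moreover have "(v, x) \<in> ?K" "(u, y) \<in> ?K" using a d by auto
    ultimately show "\<bar>c v x - c u y\<bar> \<le> w" using e(2)[of "(u, y)" "(v, x)"] by (auto simp: dist_real_def)
  qed
qed

lemma jc_bounded:
  assumes "jointly_continuous c"
  shows "\<exists>C>0. \<forall>u y. 0 \<le> u \<longrightarrow> u \<le> U \<longrightarrow> \<bar>y\<bar> \<le> R \<longrightarrow> \<bar>c u y\<bar> \<le> C"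
proof -
  let ?K = "{0..U} \<times> {- R..R} :: (real \<times> real) set"
  have "compact ((\<lambda>(u, x). c u x) ` ?K)"
    using assms unfolding jointly_continuous_def
    by (intro compact_continuous_image compact_Times) (auto intro: continuous_on_subset)
  then obtain C where C: "C > 0" "\<forall>z\<in>(\<lambda>(u, x). c u x) ` ?K. norm z \<le> C"
    using compact_imp_bounded bounded_pos by metis
  show ?thesis
  proof (intro exI[of _ C] conjI allI impI C(1))
    fix u y :: real assume "0 \<le> u" "u \<le> U" "\<bar>y\<bar> \<le> R"
    then have "(u, y) \<in> ?K" by auto
    with C(2) show "\<bar>c u y\<bar> \<le> C" by force
  qed
qed

text \<open>A fixed coarse grid of step \<delta> with fine steps \<delta> / 2^p. All bounds are
  independent of \<open>p\<close>, which is what the passage to the limit in \<open>p\<close> rests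
  on.\<close>

locale taylor_seq = prob_space M for M :: "'a measure" +
  fixes \<H> :: "nat \<Rightarrow> nat \<Rightarrow> 'a measure" and \<xi> :: "nat \<Rightarrow> nat \<Rightarrow> 'a \<Rightarrow> real" and \<delta> :: real
    and f :: "nat list \<Rightarrow> real \<Rightarrow> real \<Rightarrow> real" and A R :: "nat list set" and L g :: nat and x0 h k \<kappa> :: real
  assumes delta: "0 < \<delta>" "\<delta> \<le> 1"
    and tw: "taylor_walk M (\<H> p) (\<xi> p) (\<delta> / 2 ^ p) f A R (2 ^ p) L g h k \<kappa> (real L * \<delta>)"
    and cont: "jointly_continuous (f [0])" "jointly_continuous (f [1])"
    and C12: "\<And>\<alpha>. \<alpha> \<in> A \<Longrightarrow> \<alpha> \<noteq> [] \<Longrightarrow> C12 (f \<alpha>)"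
    and Lop: "\<And>\<alpha> j. \<alpha> \<in> A \<Longrightarrow> \<alpha> \<noteq> [] \<Longrightarrow> j = 0 \<or> j = 1 \<Longrightarrow> f (j # \<alpha>) = L_op (f [0]) (f [1]) j (f \<alpha>)"
begin

abbreviation "ep p \<equiv> \<delta> / 2 ^ p"
abbreviation "N p \<equiv> L * 2 ^ p"
abbreviation "eul p \<equiv> taylor_walk.euler (\<xi> p) (ep p) f x0"
abbreviation "irem p \<equiv> taylor_walk.ito_rem (\<xi> p) (ep p) f x0"
abbreviation "inc p \<equiv> gaussian_walk.incr (\<xi> p) (ep p)"
abbreviation "time p \<equiv> taylor_walk.tm (ep p)"

lemma gw: "gaussian_walk M (\<H> p) (\<xi> p) (ep p)"
  using tw[of p] by (simp add: taylor_walk_def)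

lemma ep_pos: "0 < ep p" using delta by simp

lemma N_ep: "real (N p) * ep p = real L * \<delta>" by simp

lemma ep_tendsto: "ep \<longlonglongrightarrow> 0"
proof -
  have "(\<lambda>p. \<delta> * (1 / 2) ^ p) \<longlonglongrightarrow> \<delta> * 0" by (intro tendsto_intros LIMSEQ_realpow_zero) auto
  then show ?thesis by (simp add: power_divide)
qed

lemma ep_eventually_le: "0 < b \<Longrightarrow> \<exists>p0. \<forall>p\<ge>p0. ep p \<le> b"
  using order_tendstoD(2)[OF ep_tendsto, of b] by (auto simp: eventually_sequentially intro: less_imp_le)

text \<open>The moment bound is uniform in \<open>p\<close>, and Chebyshev with Rr^2 = 2 Y /
  \<kappa>' leaves probability \<kappa>'/2.\<close>

lemma euler_tight:
  assumes "0 < \<kappa>'"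
  shows "\<exists>Rr>0. \<forall>p. \<exists>B\<in>sets M. measure M B < \<kappa>' \<and> (\<forall>\<omega>\<in>space M - B. \<forall>l\<in>{..N p}. \<bar>eul p l \<omega>\<bar> \<le> Rr)"
proof -
  define Y where "Y = (1 + 2 * x0\<^sup>2) * exp (8 * (real L * \<delta> + 8) * h\<^sup>2 * (real L * \<delta>))"
  have Y: "0 < Y" by (simp add: Y_def add_pos_nonneg)
  define Rr where "Rr = sqrt (2 * Y / \<kappa>')"
  have Rr: "0 < Rr" "Y / Rr\<^sup>2 < \<kappa>'" using Y assms by (auto simp: Rr_def)
  show ?thesis
  proof (intro exI[of _ Rr] conjI allI Rr)
    fix p
    interpret T: taylor_walk M "\<H> p" "\<xi> p" "ep p" f A R "2 ^ p" L g x0 h k \<kappa> "real L * \<delta>" by (rule tw)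
    have "sup2 M {..N p} T.euler \<le> 1 + sup2 M {..N p} T.euler" by (simp add: add_increasing)
    also have "\<dots> \<le> ennreal Y" using T.euler_moment by (simp add: Y_def)
    finally have "sup2 M {..N p} T.euler \<le> ennreal Y" .
    from chebyshev_sup2[OF _ T.euler_M this _ Rr(1)] Y
    obtain B where "B \<in> sets M" "measure M B \<le> Y / Rr\<^sup>2" "\<forall>\<omega>\<in>space M - B. \<forall>i\<in>{..N p}. \<bar>T.euler i \<omega>\<bar> \<le> Rr" by auto
    then show "\<exists>B\<in>sets M. prob B < \<kappa>' \<and> (\<forall>\<omega>\<in>space M - B. \<forall>l\<in>{..N p}. \<bar>T.euler l \<omega>\<bar> \<le> Rr)"
      using Rr(2) by (intro bexI[of _ B]) auto
  qed
qed

text \<open>Union bound with fourth moments: the number of increments is of order 1/\<epsilon> and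
  each contributes 3 \<epsilon>^2. Second moments would only give a bounded sum.\<close>

lemma increments_small: "usmall M (\<lambda>p _. {..<N p}) (\<lambda>p l \<omega>. (\<xi> p l \<omega>)\<^sup>2)"
proof (rule usmall_sup2[where c="\<lambda>p. 3 * (real L * \<delta>) * ep p"])
  fix p
  interpret W: gaussian_walk M "\<H> p" "\<xi> p" "ep p" by (rule gw)
  show "(\<lambda>\<omega>. (\<xi> p i \<omega>)\<^sup>2) \<in> borel_measurable M" for i by simp
  have "sup2 M (\<Union>l\<in>{..<N p}. {l}) (\<lambda>l \<omega>. (\<xi> p l \<omega>)\<^sup>2) \<le> (\<Sum>l<N p. sup2 M {l} (\<lambda>l \<omega>. (\<xi> p l \<omega>)\<^sup>2))"
    by (intro sup2_UN) auto
  also have "\<dots> = (\<Sum>l<N p. ennreal (3 * (ep p)\<^sup>2))"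
  proof (intro sum.cong refl)
    fix l
    have "sup2 M {l} (\<lambda>l \<omega>. (\<xi> p l \<omega>)\<^sup>2) = (\<integral>\<^sup>+\<omega>. ennreal (\<xi> p l \<omega> ^ 4) \<partial>M)"
      by (simp add: sup2_def power4_eq_xxxx power2_eq_square mult.assoc)
    also have "\<dots> = ennreal (\<integral>\<omega>. \<xi> p l \<omega> ^ 4 \<partial>M)"
      by (intro nn_integral_eq_integral W.xi_moments(1)) auto
    finally show "sup2 M {l} (\<lambda>l \<omega>. (\<xi> p l \<omega>)\<^sup>2) = ennreal (3 * (ep p)\<^sup>2)" using W.xi_moments(4) by simp
  qed
  also have "\<dots> = ennreal (N p * (3 * (ep p)\<^sup>2))"
    by (simp add: ennreal_mult ennreal_of_nat_eq_real_of_nat del: of_nat_mult of_nat_power)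
  also have "N p * (3 * (ep p)\<^sup>2) = 3 * (real (N p) * ep p) * ep p" by (simp add: power2_eq_square)
  finally show "sup2 M {..<N p} (\<lambda>l \<omega>. (\<xi> p l \<omega>)\<^sup>2) \<le> ennreal (3 * (real L * \<delta>) * ep p)"
    unfolding N_ep by simp
  show "0 \<le> 3 * (real L * \<delta>) * ep p" using delta by simp
next
  show "(\<lambda>p. 3 * (real L * \<delta>) * ep p) \<longlonglongrightarrow> 0" using tendsto_mult_left[OF ep_tendsto, of "3 * (real L * \<delta>)"] by simp
qed auto

lemma martingale_small:
  assumes q: "\<And>p l. l < N p \<Longrightarrow> q p l \<in> borel_measurable (\<H> p l)" "\<And>p l \<omega>. \<bar>q p l \<omega>\<bar> \<le> C"
  shows "usmall M (\<lambda>p _. {..N p}) (\<lambda>p n \<omega>. \<Sum>l<n. q p l \<omega> * ((\<xi> p l \<omega>)\<^sup>2 - ep p))"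
proof (rule usmall_sup2[where c="\<lambda>p. 16 * C\<^sup>2 * (real L * \<delta>) * ep p"])
  have C: "0 \<le> C" using q(2)[of 0 0 undefined] by linarith
  fix p
  interpret W: gaussian_walk M "\<H> p" "\<xi> p" "ep p" by (rule gw)
  have qM: "l < N p \<Longrightarrow> q p l \<in> borel_measurable M" for l using W.H_meas_M[OF q(1)] by simp
  show "(\<lambda>\<omega>. \<Sum>l<i. q p l \<omega> * ((\<xi> p l \<omega>)\<^sup>2 - ep p)) \<in> borel_measurable M" if "i \<in> {..N p}" for i
    using that by (intro borel_measurable_sum borel_measurable_times qM) auto
  show "sup2 M {..N p} (\<lambda>n \<omega>. \<Sum>l<n. q p l \<omega> * ((\<xi> p l \<omega>)\<^sup>2 - ep p)) \<le> ennreal (16 * C\<^sup>2 * (real L * \<delta>) * ep p)"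
    using W.xi_sq_maximal[of "N p" "q p" C] q C unfolding N_ep by blast
  show "0 \<le> 16 * C\<^sup>2 * (real L * \<delta>) * ep p" using delta by simp
next
  show "(\<lambda>p. 16 * C\<^sup>2 * (real L * \<delta>) * ep p) \<longlonglongrightarrow> 0" using tendsto_mult_left[OF ep_tendsto, of "16 * C\<^sup>2 * (real L * \<delta>)"] by simp
qed auto

text \<open>Localization: off a small event the Euler process stays in |y| <= \<open>Rr\<close>,
  where the derivatives are bounded and uniformly continuous. There \<open>ito_step\<close> leaves a
  martingale of compensated squares, which vanishes in probability, and errors that sum to a small
  multiple of elapsed time and quadratic variation.\<close>

lemma ito_rem_small:
  assumes \<alpha>: "\<alpha> \<in> A"
  shows "usmall M (\<lambda>p _. {..N p}) (\<lambda>p i \<omega>. \<Sum>l<i. irem p \<alpha> l \<omega>)"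
proof (cases "\<alpha> = []")
  case True
  have "irem p [] l \<omega> = 0" for p l \<omega>
  proof -
    interpret T: taylor_walk M "\<H> p" "\<xi> p" "ep p" f A R "2 ^ p" L g x0 h k \<kappa> "real L * \<delta>" by (rule tw)
    show ?thesis by (simp add: T.ito_rem_def T.f_nil)
  qed
  then show ?thesis using True by (simp add: usmall_zero)
next
  case False
  let ?F = "f [0]" and ?G = "f [1]" and ?\<phi> = "f \<alpha>"
  let ?c = "D_x (D_x ?\<phi>)"
  define U where "U = real L * \<delta>"
  have U: "0 \<le> U" using delta by (simp add: U_def)
  have c12: "C12 ?\<phi>" using C12 \<alpha> False by blast
  then have jc: "jointly_continuous (D_u ?\<phi>)" "jointly_continuous ?c" by (auto simp: C12_def)
  show ?thesis
    unfolding usmall_def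
  proof (intro allI impI)
    fix \<eta> \<kappa>' :: real assume pos: "0 < \<eta>" "0 < \<kappa>'"
    obtain Rr where Rr: "0 < Rr" "\<And>p. \<exists>B\<in>sets M. measure M B < \<kappa>' / 4 \<and> (\<forall>\<omega>\<in>space M - B. \<forall>l\<in>{..N p}. \<bar>eul p l \<omega>\<bar> \<le> Rr)"
      using euler_tight[of "\<kappa>' / 4"] pos by auto
    obtain C1 where C1: "0 < C1" "\<And>u y. 0 \<le> u \<Longrightarrow> u \<le> U \<Longrightarrow> \<bar>y\<bar> \<le> Rr \<Longrightarrow> \<bar>?F u y\<bar> \<le> C1" using jc_bounded[OF cont(1)] by meson
    obtain C2 where C2: "0 < C2" "\<And>u y. 0 \<le> u \<Longrightarrow> u \<le> U \<Longrightarrow> \<bar>y\<bar> \<le> Rr \<Longrightarrow> \<bar>?G u y\<bar> \<le> C2" using jc_bounded[OF cont(2)] by meson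
    obtain C3 where C3: "0 < C3" "\<And>u y. 0 \<le> u \<Longrightarrow> u \<le> U \<Longrightarrow> \<bar>y\<bar> \<le> Rr \<Longrightarrow> \<bar>?c u y\<bar> \<le> C3" using jc_bounded[OF jc(2)] by meson
    define C where "C = max C1 (max C2 C3)"
    have C: "0 < C" "\<And>u y. 0 \<le> u \<Longrightarrow> u \<le> U \<Longrightarrow> \<bar>y\<bar> \<le> Rr \<Longrightarrow> \<bar>?F u y\<bar> \<le> C \<and> \<bar>?G u y\<bar> \<le> C \<and> \<bar>?c u y\<bar> \<le> C"
      using C1 C2 C3 by (force simp: C_def)+
    \<comment> \<open>Calibrated against the sums to come: total time at most U, and C^2 times time
      plus quadratic variation, at most U + (U + 1). Together they will cost at most
      \<eta>/4.\<close>
    define w where "w = \<eta> / (4 * (U + C\<^sup>2 * (2 * U + 1) + 1))"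
    have den: "0 < 4 * (U + C\<^sup>2 * (2 * U + 1) + 1)" using U by (intro mult_pos_pos add_nonneg_pos add_nonneg_nonneg mult_nonneg_nonneg) auto
    have w: "0 < w" "w * (U + C\<^sup>2 * (2 * U + 1) + 1) = \<eta> / 4" using den pos by (auto simp: w_def field_simps)
    obtain d1 where d1: "d1 > 0" "d1 \<le> 1" "\<And>u v x y. 0 \<le> u \<Longrightarrow> u \<le> U \<Longrightarrow> \<bar>y\<bar> \<le> Rr \<Longrightarrow> u \<le> v \<Longrightarrow> v \<le> u + d1 \<Longrightarrow> \<bar>x - y\<bar> \<le> d1 \<Longrightarrow> \<bar>D_u ?\<phi> v x - D_u ?\<phi> u y\<bar> \<le> w"
      using jc_unif[OF jc(1) w(1), of U Rr] by blast
    obtain d2 where d2: "d2 > 0" "d2 \<le> 1" "\<And>u v x y. 0 \<le> u \<Longrightarrow> u \<le> U \<Longrightarrow> \<bar>y\<bar> \<le> Rr \<Longrightarrow> u \<le> v \<Longrightarrow> v \<le> u + d2 \<Longrightarrow> \<bar>x - y\<bar> \<le> d2 \<Longrightarrow> \<bar>?c v x - ?c u y\<bar> \<le> w"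
      using jc_unif[OF jc(2) w(1), of U Rr] by blast
    define d where "d = min d1 d2"
    have d: "0 < d" "d \<le> 1" "d \<le> d1" "d \<le> d2" using d1 d2 by (auto simp: d_def)
    \<comment> \<open>Bound for a single increment: an Euler step then moves by at most
      \<open>d\<close>, and the terms of order e |z| sum to at most 3 \<eta>/8.\<close>
    define z0 where "z0 = min (d / (2 * C)) (\<eta> / (8 * (C ^ 3 * U + 1)))"
    have c3: "0 < C ^ 3 * U + 1" using C U by (simp add: add_nonneg_pos)
    have z0: "0 < z0" "C * z0 \<le> d / 2" "C ^ 3 * U * z0 \<le> \<eta> / 8"
    proof -
      show "0 < z0" using d C c3 pos by (simp add: z0_def)
      have "C * z0 \<le> C * (d / (2 * C))" using C by (intro mult_left_mono) (auto simp: z0_def)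
      then show "C * z0 \<le> d / 2" using C by simp
      have "C ^ 3 * U * z0 \<le> (C ^ 3 * U + 1) * (\<eta> / (8 * (C ^ 3 * U + 1)))"
        using C U c3 pos \<open>0 < z0\<close> by (intro mult_mono) (auto simp: z0_def)
      also have "\<dots> = \<eta> / 8" using c3 by (metis less_irrefl mult.commute mult_divide_mult_cancel_left_if times_divide_eq_right mult.left_neutral mult_1_right)
      finally show "C ^ 3 * U * z0 \<le> \<eta> / 8" .
    qed
    \<comment> \<open>Coefficient of the compensated square, cut off where the Euler process is
      large so that it is bounded; the cut-off is known at time l.\<close>
    define ym where "ym p l \<omega> = (if \<bar>eul p l \<omega>\<bar> \<le> Rr then 1 / 2 * ?c (time p l) (eul p l \<omega>) * (?G (time p l) (eul p l \<omega>))\<^sup>2 else 0)" for p l \<omega>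
    have ym_b: "\<bar>ym p l \<omega>\<bar> \<le> C ^ 3" if "l \<le> N p" for p l \<omega>
    proof (cases "\<bar>eul p l \<omega>\<bar> \<le> Rr")
      case True
      interpret T: taylor_walk M "\<H> p" "\<xi> p" "ep p" f A R "2 ^ p" L g x0 h k \<kappa> "real L * \<delta>" by (rule tw)
      have b: "\<bar>?c (time p l) (eul p l \<omega>)\<bar> \<le> C" "\<bar>?G (time p l) (eul p l \<omega>)\<bar> \<le> C"
        using C(2)[of "time p l" "eul p l \<omega>"] True T.tm_le[OF that] by (auto simp: U_def)
      have "\<bar>ym p l \<omega>\<bar> = 1 / 2 * (\<bar>?c (time p l) (eul p l \<omega>)\<bar> * \<bar>?G (time p l) (eul p l \<omega>)\<bar>\<^sup>2)" using True by (simp add: ym_def abs_mult)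
      also have "\<dots> \<le> 1 * (C * C\<^sup>2)" using b C by (intro mult_mono power_mono) auto
      finally show ?thesis by (simp add: power3_eq_cube power2_eq_square)
    qed (use C in \<open>simp add: ym_def\<close>)
    have ym_m: "ym p l \<in> borel_measurable (\<H> p l)" for p l
    proof -
      interpret T: taylor_walk M "\<H> p" "\<xi> p" "ep p" f A R "2 ^ p" L g x0 h k \<kappa> "real L * \<delta>" by (rule tw)
      have c: "?c (time p l) \<in> borel_measurable borel"
      proof (intro borel_measurable_continuous_onI)
        have "continuous_on ({0..} \<times> UNIV) (\<lambda>(u, x). ?c u x)" using jc(2) by (simp add: jointly_continuous_def)
        then have "continuous_on UNIV (\<lambda>x. (\<lambda>(u, x). ?c u x) (time p l, x))"
          by (rule continuous_on_compose2) (auto intro!: continuous_on_Pair continuous_on_const continuous_on_id)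
        then show "continuous_on UNIV (?c (time p l))" by simp
      qed
      have "(\<lambda>\<omega>. ?G (time p l) (eul p l \<omega>)) \<in> borel_measurable (\<H> p l)" using T.A_base by (intro T.f_euler_meas) auto
      moreover have "(\<lambda>\<omega>. ?c (time p l) (eul p l \<omega>)) \<in> borel_measurable (\<H> p l)"
        by (rule measurable_compose[OF T.euler_meas c])
      moreover note T.euler_meas[of l]
      ultimately show ?thesis unfolding ym_def by measurable
    qed
    \<comment> \<open>Set to 0 beyond the horizon, since \<open>martingale_small\<close> asks for
      the bound at all indices.\<close>
    define ym' where "ym' p l \<omega> = (if l < N p then ym p l \<omega> else 0)" for p l \<omega>
    have "usmall M (\<lambda>p _. {..N p}) (\<lambda>p n \<omega>. \<Sum>l<n. ym' p l \<omega> * ((\<xi> p l \<omega>)\<^sup>2 - ep p))"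
      using ym_m ym_b C by (intro martingale_small[where C="C ^ 3"]) (auto simp: ym'_def)
    from usmallD[OF this, of "\<eta> / 4" "\<kappa>' / 4"] pos obtain p1 where
      p1: "\<And>p. p \<ge> p1 \<Longrightarrow> \<exists>B\<in>sets M. measure M B < \<kappa>' / 4 \<and> (\<forall>\<omega>\<in>space M - B. \<forall>i\<in>{..N p}. \<bar>\<Sum>l<i. ym' p l \<omega> * ((\<xi> p l \<omega>)\<^sup>2 - ep p)\<bar> \<le> \<eta> / 4)" by auto
    \<comment> \<open>With coefficient 1 this bounds the sum of the squared increments by the
      elapsed time plus 1.\<close>
    have "usmall M (\<lambda>p _. {..N p}) (\<lambda>p n \<omega>. \<Sum>l<n. 1 * ((\<xi> p l \<omega>)\<^sup>2 - ep p))"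
      by (intro martingale_small[where C=1]) auto
    from usmallD[OF this, of 1 "\<kappa>' / 4"] pos obtain p2 where
      p2: "\<And>p. p \<ge> p2 \<Longrightarrow> \<exists>B\<in>sets M. measure M B < \<kappa>' / 4 \<and> (\<forall>\<omega>\<in>space M - B. \<forall>i\<in>{..N p}. \<bar>\<Sum>l<i. 1 * ((\<xi> p l \<omega>)\<^sup>2 - ep p)\<bar> \<le> 1)" by auto
    from usmallD[OF increments_small, of "z0\<^sup>2" "\<kappa>' / 4"] pos z0 obtain p3 where
      p3: "\<And>p. p \<ge> p3 \<Longrightarrow> \<exists>B\<in>sets M. measure M B < \<kappa>' / 4 \<and> (\<forall>\<omega>\<in>space M - B. \<forall>l\<in>{..<N p}. \<bar>(\<xi> p l \<omega>)\<^sup>2\<bar> \<le> z0\<^sup>2)" by auto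
    obtain p4 where p4: "\<And>p. p \<ge> p4 \<Longrightarrow> ep p \<le> min d z0" using ep_eventually_le[of "min d z0"] d z0 by auto
    show "\<exists>p0. \<forall>p\<ge>p0. \<exists>B\<in>sets M. prob B < \<kappa>' \<and> (\<forall>\<omega>\<in>space M - B. \<forall>i\<in>{..N p}. \<bar>\<Sum>l<i. irem p \<alpha> l \<omega>\<bar> \<le> \<eta>)"
    proof (intro exI[of _ "max (max p1 p2) (max p3 p4)"] allI impI)
      fix p assume p: "max (max p1 p2) (max p3 p4) \<le> p"
      interpret T: taylor_walk M "\<H> p" "\<xi> p" "ep p" f A R "2 ^ p" L g x0 h k \<kappa> "real L * \<delta>" by (rule tw)
      obtain B0 where B0: "B0 \<in> sets M" "measure M B0 < \<kappa>' / 4" "\<And>\<omega> l. \<omega> \<in> space M - B0 \<Longrightarrow> l \<le> N p \<Longrightarrow> \<bar>eul p l \<omega>\<bar> \<le> Rr" using Rr(2)[of p] by auto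
      obtain B1 where B1: "B1 \<in> sets M" "measure M B1 < \<kappa>' / 4" "\<And>\<omega> i. \<omega> \<in> space M - B1 \<Longrightarrow> i \<le> N p \<Longrightarrow> \<bar>\<Sum>l<i. ym' p l \<omega> * ((\<xi> p l \<omega>)\<^sup>2 - ep p)\<bar> \<le> \<eta> / 4" using p1[of p] p by auto
      obtain B2 where B2: "B2 \<in> sets M" "measure M B2 < \<kappa>' / 4" "\<And>\<omega> i. \<omega> \<in> space M - B2 \<Longrightarrow> i \<le> N p \<Longrightarrow> \<bar>\<Sum>l<i. ((\<xi> p l \<omega>)\<^sup>2 - ep p)\<bar> \<le> 1" using p2[of p] p by auto
      obtain B3 where B3: "B3 \<in> sets M" "measure M B3 < \<kappa>' / 4" "\<And>\<omega> l. \<omega> \<in> space M - B3 \<Longrightarrow> l < N p \<Longrightarrow> (\<xi> p l \<omega>)\<^sup>2 \<le> z0\<^sup>2" using p3[of p] p by auto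
      have e: "0 < ep p" "ep p \<le> d" "ep p \<le> z0" using p4[of p] p ep_pos by auto
      define B where "B = (B0 \<union> B1) \<union> (B2 \<union> B3)"
      have "measure M B \<le> measure M (B0 \<union> B1) + measure M (B2 \<union> B3)" unfolding B_def using B0 B1 B2 B3 by (intro measure_Un_le) auto
      also have "\<dots> \<le> (measure M B0 + measure M B1) + (measure M B2 + measure M B3)" using B0 B1 B2 B3 by (intro add_mono measure_Un_le) auto
      finally have "measure M B < \<kappa>'" using B0(2) B1(2) B2(2) B3(2) by linarith
      moreover have "B \<in> sets M" using B0 B1 B2 B3 by (auto simp: B_def)
      moreover have "\<bar>\<Sum>l<i. irem p \<alpha> l \<omega>\<bar> \<le> \<eta>" if \<omega>: "\<omega> \<in> space M - B" and i: "i \<le> N p" for \<omega> i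
      proof -
        have zl: "\<bar>\<xi> p l \<omega>\<bar> \<le> z0" if "l < i" for l
          using B3(3)[of \<omega> l] \<omega> that i z0(1) by (auto simp: B_def simp flip: abs_le_square_iff)
        have step: "\<bar>irem p \<alpha> l \<omega> - ym' p l \<omega> * ((\<xi> p l \<omega>)\<^sup>2 - ep p)\<bar>
            \<le> w * ep p + w * C\<^sup>2 * ((ep p)\<^sup>2 + (\<xi> p l \<omega>)\<^sup>2) + C ^ 3 * ((ep p)\<^sup>2 + 2 * ep p * \<bar>\<xi> p l \<omega>\<bar>)" if l: "l < i" for l
        proof -
          have lN: "l < N p" using l i by simp
          let ?y = "eul p l \<omega>" and ?u = "time p l"
          have y: "\<bar>?y\<bar> \<le> Rr" using B0(3)[of \<omega> l] \<omega> lN by (auto simp: B_def)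
          have u: "0 \<le> ?u" "?u \<le> U" using T.tm_le[of l] lN by (auto simp: U_def)
          note Cb = C(2)[OF u y]
          have s: "eul p (Suc l) \<omega> = ?y + ?F ?u ?y * ep p + ?G ?u ?y * \<xi> p l \<omega>" by simp
          have "\<bar>?F ?u ?y * ep p\<bar> \<le> C * z0" "\<bar>?G ?u ?y * \<xi> p l \<omega>\<bar> \<le> C * z0"
          proof -
            have "\<bar>?F ?u ?y\<bar> * \<bar>ep p\<bar> \<le> C * z0" "\<bar>?G ?u ?y\<bar> * \<bar>\<xi> p l \<omega>\<bar> \<le> C * z0"
              using Cb zl[OF l] z0(1) C(1) e(3) abs_of_pos[OF e(1)] by (intro mult_mono; linarith)+
            then show "\<bar>?F ?u ?y * ep p\<bar> \<le> C * z0" "\<bar>?G ?u ?y * \<xi> p l \<omega>\<bar> \<le> C * z0" unfolding abs_mult by blast+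
          qed
          moreover have gen: "\<bar>a\<bar> \<le> b \<Longrightarrow> \<bar>c\<bar> \<le> b \<Longrightarrow> b \<le> d / 2 \<Longrightarrow> \<bar>y + a + c - y\<bar> \<le> d" for a b c y d :: real
            by linarith
          ultimately have sl: "\<bar>eul p (Suc l) \<omega> - ?y\<bar> \<le> d" unfolding s using z0(2) gen by blast
          have t: "time p (Suc l) = ?u + ep p" by (simp add: T.tm_def add_divide_distrib algebra_simps)
          have ir: "irem p \<alpha> l \<omega> = ?\<phi> (?u + ep p) (eul p (Suc l) \<omega>) - ?\<phi> ?u ?y - L_op ?F ?G 0 ?\<phi> ?u ?y * ep p - L_op ?F ?G 1 ?\<phi> ?u ?y * \<xi> p l \<omega>"
            unfolding T.ito_rem_def t using Lop[OF \<alpha> False] by simp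
          have ye: "ym' p l \<omega> * ((\<xi> p l \<omega>)\<^sup>2 - ep p) = 1 / 2 * ?c ?u ?y * (?G ?u ?y)\<^sup>2 * ((\<xi> p l \<omega>)\<^sup>2 - ep p)"
            using y lN by (simp add: ym'_def ym_def)
          show ?thesis unfolding ir ye
          proof (rule ito_step[where F="?F" and G="?G" and y="?y" and u="?u" and e="ep p" and z="\<xi> p l \<omega>" and d=d, OF c12 u(1) e(1) s sl])
            show "\<bar>D_u ?\<phi> v x - D_u ?\<phi> ?u ?y\<bar> \<le> w" if "?u \<le> v" "v \<le> ?u + ep p" "\<bar>x - ?y\<bar> \<le> d" for v x
              using that u y d e by (intro d1(3)) auto
            show "\<bar>?c ?u x - ?c ?u ?y\<bar> \<le> w" if "\<bar>x - ?y\<bar> \<le> d" for x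
              using that u y d d2(1) by (intro d2(3)) auto
          qed (use Cb in auto)
        qed
        have Nep: "real i * ep p \<le> U"
          using i ep_pos[of p] mult_right_mono[of "real i" "real (N p)" "ep p"] unfolding N_ep U_def by (simp only: of_nat_le_iff less_imp_le)
        have sx: "(\<Sum>l<i. (\<xi> p l \<omega>)\<^sup>2) \<le> U + 1"
          using B2(3)[of \<omega> i] \<omega> i Nep by (auto simp: B_def sum_subtractf)
        have e1: "ep p \<le> 1" using e d by linarith
        have "\<bar>(\<Sum>l<i. irem p \<alpha> l \<omega>) - (\<Sum>l<i. ym' p l \<omega> * ((\<xi> p l \<omega>)\<^sup>2 - ep p))\<bar>
          \<le> (\<Sum>l<i. w * ep p + w * C\<^sup>2 * ((ep p)\<^sup>2 + (\<xi> p l \<omega>)\<^sup>2) + C ^ 3 * ((ep p)\<^sup>2 + 2 * ep p * \<bar>\<xi> p l \<omega>\<bar>))"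
          unfolding sum_subtractf[symmetric] using step by (intro order_trans[OF sum_abs] sum_mono) auto
        also have "\<dots> \<le> (\<Sum>l<i. w * ep p + w * C\<^sup>2 * (ep p + (\<xi> p l \<omega>)\<^sup>2) + C ^ 3 * (3 * z0 * ep p))"
        proof (intro sum_mono add_mono mult_left_mono)
          fix l assume "l \<in> {..<i}"
          then have z: "\<bar>\<xi> p l \<omega>\<bar> \<le> z0" using zl by simp
          show "(ep p)\<^sup>2 \<le> ep p" using power_decreasing[of 1 2 "ep p"] e(1) e1 by (simp only: power_one_right less_imp_le one_le_numeral)
          have gen: "a\<^sup>2 + 2 * a * \<bar>b\<bar> \<le> 3 * c * a" if "0 < a" "a \<le> c" "\<bar>b\<bar> \<le> c" for a b c :: real
          proof -
            have "a * a \<le> a * c" "a * \<bar>b\<bar> \<le> a * c" using that by (intro mult_left_mono; linarith)+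
            then show ?thesis by (simp add: power2_eq_square algebra_simps)
          qed
          show "(ep p)\<^sup>2 + 2 * ep p * \<bar>\<xi> p l \<omega>\<bar> \<le> 3 * z0 * ep p" by (rule gen[OF e(1) e(3) z])
        qed (use w C in auto)
        also have "\<dots> = w * (i * ep p) + w * C\<^sup>2 * (i * ep p + (\<Sum>l<i. (\<xi> p l \<omega>)\<^sup>2)) + C ^ 3 * (3 * z0 * (i * ep p))"
          by (simp add: sum.distrib sum_distrib_left[symmetric] distrib_left algebra_simps)
        also have "\<dots> \<le> w * U + w * C\<^sup>2 * (U + (U + 1)) + C ^ 3 * (3 * z0 * U)"
          using w C z0 Nep sx by (intro add_mono mult_left_mono) auto
        also have "\<dots> = w * (U + C\<^sup>2 * (2 * U + 1) + 1) - w + 3 * (C ^ 3 * U * z0)" by (simp add: algebra_simps)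
        also have "\<dots> \<le> \<eta> / 4 + 3 * (\<eta> / 8)" using w z0(3) by simp
        finally have "\<bar>(\<Sum>l<i. irem p \<alpha> l \<omega>) - (\<Sum>l<i. ym' p l \<omega> * ((\<xi> p l \<omega>)\<^sup>2 - ep p))\<bar> \<le> \<eta> / 4 + 3 * (\<eta> / 8)" .
        moreover have "\<bar>\<Sum>l<i. ym' p l \<omega> * ((\<xi> p l \<omega>)\<^sup>2 - ep p)\<bar> \<le> \<eta> / 4" using B1(3)[of \<omega> i] \<omega> i by (auto simp: B_def)
        ultimately show ?thesis using pos by linarith
      qed
      ultimately show "\<exists>B\<in>sets M. prob B < \<kappa>' \<and> (\<forall>\<omega>\<in>space M - B. \<forall>i\<in>{..N p}. \<bar>\<Sum>l<i. irem p \<alpha> l \<omega>\<bar> \<le> \<eta>)"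
        by (intro bexI[of _ B]) auto
    qed
  qed
qed

text \<open>Within a cell the summed defects are differences of the partial sums in
  \<open>ito_rem_small\<close>; \<open>usmall_mis\<close> carries them through the iterated sums,
  and there are finitely many indices and cells.\<close>

lemma good_event:
  assumes "0 < \<eta>" "0 < \<kappa>'"
  shows "\<exists>p0. \<forall>p\<ge>p0. \<exists>B\<in>sets M. measure M B < \<kappa>' \<and> (\<forall>\<omega>\<in>space M - B. taylor_walk.good (\<xi> p) (ep p) f A (2 ^ p) x0 \<eta> L \<omega>)"
proof -
  let ?ce = "\<lambda>p. taylor_walk.cell_err (\<xi> p) (ep p) f A (2 ^ p) x0"
  let ?I = "\<lambda>n p \<omega>. {i\<in>{n * 2 ^ p..n * 2 ^ p + 2 ^ p}. True}"
  have ce: "usmall M (?I n) (\<lambda>p i \<omega>. ?ce p n i \<omega>)" if n: "n < L" for n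
  proof -
    have "usmall M (?I n) (\<lambda>p i \<omega>. \<Sum>\<alpha>\<in>A. mis (inc p \<omega>) (n * 2 ^ p) (rev \<alpha>) (\<lambda>i. \<Sum>l\<in>{n * 2 ^ p..<i}. irem p \<alpha> l \<omega>) i)"
    proof (rule usmall_sum)
      show "finite A" using tw[of 0] by (simp add: taylor_walk_def taylor_walk_axioms_def)
      fix \<alpha> assume a: "\<alpha> \<in> A"
      show "usmall M (?I n) (\<lambda>p i \<omega>. mis (inc p \<omega>) (n * 2 ^ p) (rev \<alpha>) (\<lambda>i. \<Sum>l\<in>{n * 2 ^ p..<i}. irem p \<alpha> l \<omega>) i)"
      proof (rule usmall_mis[OF gw, where P="\<lambda>_ _ _. True" and U=\<delta>])
        show "(\<lambda>\<omega>. \<Sum>l\<in>{n * 2 ^ p..<l'}. irem p \<alpha> l \<omega>) \<in> borel_measurable (\<H> p l')" for p l'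
        proof -
          interpret T: taylor_walk M "\<H> p" "\<xi> p" "ep p" f A R "2 ^ p" L g x0 h k \<kappa> "real L * \<delta>" by (rule tw)
          show ?thesis by (rule T.ito_rem_sum_meas[OF a])
        qed
        have le: "n * 2 ^ p + 2 ^ p \<le> N p" for p using n mult_le_mono1[of "Suc n" L "2 ^ p"] by simp
        have "usmall M (?I n) (\<lambda>p i \<omega>. \<Sum>l<i. irem p \<alpha> l \<omega>)" "usmall M (?I n) (\<lambda>p i \<omega>. \<Sum>l<n * 2 ^ p. irem p \<alpha> l \<omega>)"
        proof -
          show "usmall M (?I n) (\<lambda>p i \<omega>. \<Sum>l<i. irem p \<alpha> l \<omega>)"
          proof (rule usmall_mono[OF ito_rem_small[OF a]])
            fix p \<omega> i assume "i \<in> ?I n p \<omega>"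
            then show "\<exists>j\<in>{..N p}. \<bar>\<Sum>l<i. irem p \<alpha> l \<omega>\<bar> \<le> \<bar>\<Sum>l<j. irem p \<alpha> l \<omega>\<bar>"
              using le[of p] by (intro bexI[of _ i]) auto
          qed
          show "usmall M (?I n) (\<lambda>p i \<omega>. \<Sum>l<n * 2 ^ p. irem p \<alpha> l \<omega>)"
          proof (rule usmall_mono[OF ito_rem_small[OF a]])
            show "\<exists>j\<in>{..N p}. \<bar>\<Sum>l<n * 2 ^ p. irem p \<alpha> l \<omega>\<bar> \<le> \<bar>\<Sum>l<j. irem p \<alpha> l \<omega>\<bar>" for p \<omega>
              using n by (intro bexI[of _ "n * 2 ^ p"]) auto
          qed
        qed
        from usmall_diff[OF this]
        show "usmall M (?I n) (\<lambda>p i \<omega>. \<Sum>l\<in>{n * 2 ^ p..<i}. irem p \<alpha> l \<omega>)"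
        proof (rule usmall_mono)
          fix p \<omega> i assume i: "i \<in> ?I n p \<omega>"
          have "(\<Sum>l<i. irem p \<alpha> l \<omega>) - (\<Sum>l<n * 2 ^ p. irem p \<alpha> l \<omega>) = (\<Sum>l\<in>{n * 2 ^ p..<i}. irem p \<alpha> l \<omega>)"
            using i by (simp add: lessThan_atLeast0 sum_diff_nat_ivl)
          then show "\<exists>j\<in>?I n p \<omega>. \<bar>\<Sum>l\<in>{n * 2 ^ p..<i}. irem p \<alpha> l \<omega>\<bar> \<le> \<bar>(\<Sum>l<j. irem p \<alpha> l \<omega>) - (\<Sum>l<n * 2 ^ p. irem p \<alpha> l \<omega>)\<bar>"
            using i by (intro bexI[of _ i]) auto
        qed
      qed auto
    qed
    moreover have "?ce p n i \<omega> = (\<Sum>\<alpha>\<in>A. mis (inc p \<omega>) (n * 2 ^ p) (rev \<alpha>) (\<lambda>i. \<Sum>l\<in>{n * 2 ^ p..<i}. irem p \<alpha> l \<omega>) i)" for p i \<omega>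
    proof -
      interpret T: taylor_walk M "\<H> p" "\<xi> p" "ep p" f A R "2 ^ p" L g x0 h k \<kappa> "real L * \<delta>" by (rule tw)
      show ?thesis by (simp add: T.cell_err_def)
    qed
    ultimately show ?thesis by simp
  qed
  have conc: "usmall M (\<lambda>p \<omega>. {n} \<times> ?I n p \<omega>) (\<lambda>p. gaussian_walk.concat_cells (2 ^ p) (?ce p))" if n: "n < L" for n
  proof -
    have ends: "usmall M (\<lambda>p \<omega>. {n} \<times> ?I n p \<omega>) (\<lambda>p q \<omega>. ?ce p n' (n' * 2 ^ p + 2 ^ p) \<omega>)" if "n' < n" for n'
    proof (rule usmall_mono[OF ce[of n']])
      show "\<exists>j\<in>?I n' p \<omega>. \<bar>?ce p n' (n' * 2 ^ p + 2 ^ p) \<omega>\<bar> \<le> \<bar>?ce p n' j \<omega>\<bar>" for p \<omega>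
        by (intro bexI[of _ "n' * 2 ^ p + 2 ^ p"]) auto
    qed (use that n in simp)
    have last: "usmall M (\<lambda>p \<omega>. {n} \<times> ?I n p \<omega>) (\<lambda>p q \<omega>. ?ce p n (snd q) \<omega>)"
      by (rule usmall_mono[OF ce[OF n]]) auto
    have "usmall M (\<lambda>p \<omega>. {n} \<times> ?I n p \<omega>) (\<lambda>p q \<omega>. (\<Sum>n'<n. ?ce p n' (n' * 2 ^ p + 2 ^ p) \<omega>) + ?ce p n (snd q) \<omega>)"
      by (intro usmall_add usmall_sum last ends) auto
    then show ?thesis
    proof (rule usmall_mono)
      fix p \<omega> q assume q: "q \<in> {n} \<times> ?I n p \<omega>"
      show "\<exists>j\<in>{n} \<times> ?I n p \<omega>. \<bar>gaussian_walk.concat_cells (2 ^ p) (?ce p) q \<omega>\<bar> \<le> \<bar>(\<Sum>n'<n. ?ce p n' (n' * 2 ^ p + 2 ^ p) \<omega>) + ?ce p n (snd j) \<omega>\<bar>"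
        using q by (intro bexI[of _ q]) (auto simp: gaussian_walk.concat_cells_def[OF gw])
    qed
  qed
  have "usmall M (\<lambda>p \<omega>. \<Union>n\<in>{..<L}. {n} \<times> ?I n p \<omega>) (\<lambda>p. gaussian_walk.concat_cells (2 ^ p) (?ce p))"
    using conc by (intro usmall_UN) auto
  then obtain p0 where p0: "\<And>p. p \<ge> p0 \<Longrightarrow> \<exists>B\<in>sets M. measure M B < \<kappa>' \<and>
     (\<forall>\<omega>\<in>space M - B. \<forall>q\<in>(\<Union>n\<in>{..<L}. {n} \<times> ?I n p \<omega>). \<bar>gaussian_walk.concat_cells (2 ^ p) (?ce p) q \<omega>\<bar> \<le> \<eta>)"
    using usmallD[OF _ assms] by blast
  show ?thesis
  proof (intro exI[of _ p0] allI impI)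
    fix p assume "p0 \<le> p"
    interpret T: taylor_walk M "\<H> p" "\<xi> p" "ep p" f A R "2 ^ p" L g x0 h k \<kappa> "real L * \<delta>" by (rule tw)
    have "(\<Union>n\<in>{..<L}. {n} \<times> ?I n p \<omega>) = cells (2 ^ p) L" for \<omega> :: 'a by (auto simp: cells_def)
    then show "\<exists>B\<in>sets M. measure M B < \<kappa>' \<and> (\<forall>\<omega>\<in>space M - B. T.good \<eta> L \<omega>)"
      using p0[OF \<open>p0 \<le> p\<close>] by (simp add: T.good_def)
  qed
qed

end

section \<open>Inverse paths of subordinators\<close>

text \<open>One path of the subordinator, treated deterministically. Strict increase makes the
  inverse continuous; jumps of \<open>d\<close> become intervals on which the inverse is
  constant.\<close>

locale clock_path =
  fixes d :: "real \<Rightarrow> real"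
  assumes d0: "d 0 = 0"
    and smono: "strict_mono_on {0..} d"
    and rc: "\<And>t. 0 \<le> t \<Longrightarrow> continuous (at_right t) d"
    and unb: "\<And>K. \<exists>u\<ge>0. K < d u"
begin

definition e :: "real \<Rightarrow> real" where "e t = Inf {u. 0 < u \<and> t < d u}"

lemma d_less: "0 \<le> u \<Longrightarrow> u < v \<Longrightarrow> d u < d v"
  using smono by (auto simp: strict_mono_on_def)

lemma d_le: "0 \<le> u \<Longrightarrow> u \<le> v \<Longrightarrow> d u \<le> d v"
  using d_less[of u v] by (cases "u = v") auto

lemma d_nonneg: "0 \<le> u \<Longrightarrow> 0 \<le> d u"
  using d_le[of 0 u] d0 by simp

lemma set_ne: "\<exists>u>0. t < d u"
proof -
  obtain u where "u \<ge> 0" "t < d u" using unb[of t] by blast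
  then show ?thesis using d_less[of u "u + 1"] by (intro exI[of _ "u + 1"]) auto
qed

lemma bdd: "bdd_below {u. 0 < u \<and> t < d u}" by (auto intro: bdd_belowI[of _ 0])

lemma e_nonneg: "0 \<le> e t"
  unfolding e_def using set_ne[of t] by (intro cInf_greatest) auto

lemma e_le: "0 < u \<Longrightarrow> t < d u \<Longrightarrow> e t \<le> u"
  unfolding e_def by (intro cInf_lower bdd) auto

lemma less_d: "e t < v \<Longrightarrow> t < d v"
proof -
  assume "e t < v"
  then obtain u where "0 < u" "t < d u" "u < v"
    unfolding e_def using set_ne[of t] bdd[of t] by (subst (asm) cInf_less_iff) auto
  then show "t < d v" using d_less[of u v] by simp
qed

lemma le_e: "0 \<le> u \<Longrightarrow> d u \<le> t \<Longrightarrow> u \<le> e t"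
  unfolding e_def using set_ne[of t]
proof (intro cInf_greatest)
  fix w assume "0 \<le> u" "d u \<le> t" "w \<in> {u. 0 < u \<and> t < d u}"
  then show "u \<le> w" using d_le[of w u] by force
qed auto

text \<open>Strict increase makes the inverse exact at \<open>u\<close> even if the path jumps
  there. This is why the grid may be deterministic on the scale of the inverse.\<close>

lemma e_d [simp]: "0 \<le> u \<Longrightarrow> e (d u) = u"
proof (rule antisym)
  assume u: "0 \<le> u"
  show "e (d u) \<le> u"
  proof (rule field_le_epsilon)
    fix w :: real assume "0 < w"
    then show "e (d u) \<le> u + w" using u by (intro e_le d_less) auto
  qed
qed (rule le_e, auto)

lemma e_mono: "s \<le> t \<Longrightarrow> e s \<le> e t"
proof -
  assume "s \<le> t"
  then show "e s \<le> e t" unfolding e_def using set_ne[of t] by (intro cInf_superset_mono bdd) auto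
qed

lemma e_le_iff: "0 \<le> v \<Longrightarrow> e t \<le> v \<longleftrightarrow> (\<forall>w>v. t < d w)"
proof
  assume "0 \<le> v" "\<forall>w>v. t < d w"
  then have "e t \<le> v + w" if "0 < w" for w using that by (intro e_le) auto
  then show "e t \<le> v" by (rule field_le_epsilon)
next
  assume "e t \<le> v"
  then show "\<forall>w>v. t < d w" by (auto intro: less_d)
qed

lemma d_le_of_less_e: "0 \<le> u \<Longrightarrow> u < e t \<Longrightarrow> d u < t"
proof -
  assume u: "0 \<le> u" "u < e t"
  define w where "w = (u + e t) / 2"
  have w: "u < w" "w < e t" using u by (auto simp: w_def)
  have "d w \<le> t" using e_le[of w t] w u by force
  then show "d u < t" using d_less[OF u(1) w(1)] by simp
qed

lemma e_cont: "continuous_on {0..} e"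
  unfolding continuous_on_iff
proof (intro ballI allI impI)
  fix t \<epsilon> :: real assume t: "t \<in> {0..}" and \<epsilon>: "0 < \<epsilon>"
  have up: "t < d (e t + \<epsilon> / 2)" using \<epsilon> by (intro less_d) auto
  \<comment> \<open>If \<open>e t\<close> is at most \<epsilon>/2 the lower estimate is trivial, and
    t - 1 is just some point below t.\<close>
  define lo where "lo = (if e t \<le> \<epsilon> / 2 then t - 1 else d (e t - \<epsilon> / 2))"
  have lo: "lo < t" unfolding lo_def using \<epsilon> by (auto intro!: d_le_of_less_e)
  show "\<exists>h>0. \<forall>s\<in>{0..}. dist s t < h \<longrightarrow> dist (e s) (e t) < \<epsilon>"
  proof (intro exI[of _ "min (d (e t + \<epsilon> / 2) - t) (t - lo)"] conjI ballI impI)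
    fix s assume s: "s \<in> {0..}" "dist s t < min (d (e t + \<epsilon> / 2) - t) (t - lo)"
    have 1: "e s \<le> e t + \<epsilon> / 2" using s(2) \<epsilon> e_nonneg[of t] by (intro e_le) (auto simp: dist_real_def)
    have 2: "e t - \<epsilon> / 2 \<le> e s"
    proof (cases "e t \<le> \<epsilon> / 2")
      case True
      then show ?thesis using e_nonneg[of s] by simp
    next
      case False
      then show ?thesis using s(2) by (intro le_e) (auto simp: dist_real_def lo_def)
    qed
    show "dist (e s) (e t) < \<epsilon>" using 1 2 \<epsilon> by (auto simp: dist_real_def)
  qed (use up lo in auto)
qed

text \<open>A path that is constant wherever \<open>e\<close> is factors through \<open>e\<close>,
  and on a compact interval it is uniformly continuous as a function of \<open>e\<close>. Otherwise
  pairs of times violating this would converge to a pair with equal \<open>e\<close> but different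
  \<open>y\<close>.\<close>

lemma e_uniformly_continuous:
  assumes Y: "continuous_on {0..T} y" and flat: "\<And>s t. s \<in> {0..T} \<Longrightarrow> t \<in> {0..T} \<Longrightarrow> e s = e t \<Longrightarrow> y s = y t"
    and \<eta>: "0 < \<eta>"
  shows "\<exists>\<zeta>>0. \<forall>s\<in>{0..T}. \<forall>t\<in>{0..T}. \<bar>e s - e t\<bar> \<le> \<zeta> \<longrightarrow> \<bar>y s - y t\<bar> \<le> (\<eta>::real)"
proof (rule ccontr)
  assume "\<not> ?thesis"
  then have "\<forall>\<zeta>>0. \<exists>p. p \<in> {0..T} \<times> {0..T} \<and> \<bar>e (fst p) - e (snd p)\<bar> \<le> \<zeta> \<and> \<eta> < \<bar>y (fst p) - y (snd p)\<bar>"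
    by force
  then have "\<forall>n. \<exists>p. p \<in> {0..T} \<times> {0..T} \<and> \<bar>e (fst p) - e (snd p)\<bar> \<le> inverse (real (Suc n)) \<and> \<eta> < \<bar>y (fst p) - y (snd p)\<bar>"
    by simp
  then obtain p where p: "\<And>n. p n \<in> {0..T} \<times> {0..T}" "\<And>n. \<bar>e (fst (p n)) - e (snd (p n))\<bar> \<le> inverse (real (Suc n))"
    "\<And>n. \<eta> < \<bar>y (fst (p n)) - y (snd (p n))\<bar>" by metis
  have "compact ({0..T} \<times> {0..T})" by (intro compact_Times) auto
  then obtain l r where l: "l \<in> {0..T} \<times> {0..T}" "strict_mono r" "(p \<circ> r) \<longlonglongrightarrow> l"
    using p(1) unfolding compact_eq_seq_compact_metric seq_compact_def by meson
  have lim: "(\<lambda>n. z (fst (p (r n)))) \<longlonglongrightarrow> z (fst l)" "(\<lambda>n. z (snd (p (r n)))) \<longlonglongrightarrow> z (snd l)"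
    if z: "continuous_on {0..T} z" for z :: "real \<Rightarrow> real"
  proof -
    have "(\<lambda>n. fst ((p \<circ> r) n)) \<longlonglongrightarrow> fst l" "(\<lambda>n. snd ((p \<circ> r) n)) \<longlonglongrightarrow> snd l" using tendsto_fst[OF l(3)] tendsto_snd[OF l(3)] by auto
    moreover have "fst (p n) \<in> {0..T}" "snd (p n) \<in> {0..T}" for n using p(1)[of n] by (auto simp: mem_Times_iff)
    ultimately show "(\<lambda>n. z (fst (p (r n)))) \<longlonglongrightarrow> z (fst l)" "(\<lambda>n. z (snd (p (r n)))) \<longlonglongrightarrow> z (snd l)"
      using l(1) by (auto intro!: continuous_on_tendsto_compose[OF z] simp: mem_Times_iff)
  qed
  have ec: "continuous_on {0..T} e" using e_cont by (rule continuous_on_subset) auto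
  have "(\<lambda>n. e (fst (p (r n))) - e (snd (p (r n)))) \<longlonglongrightarrow> e (fst l) - e (snd l)" by (intro tendsto_diff lim ec)
  moreover have "(\<lambda>n. e (fst (p (r n))) - e (snd (p (r n)))) \<longlonglongrightarrow> 0"
  proof (rule Lim_null_comparison)
    show "\<forall>\<^sub>F n in sequentially. norm (e (fst (p (r n))) - e (snd (p (r n)))) \<le> inverse (real (Suc (r n)))"
      using p(2) by (intro always_eventually) auto
    show "(\<lambda>n. inverse (real (Suc (r n)))) \<longlonglongrightarrow> 0"
      using LIMSEQ_subseq_LIMSEQ[OF LIMSEQ_inverse_real_of_nat l(2)] by (simp add: comp_def)
  qed
  ultimately have "e (fst l) = e (snd l)" using LIMSEQ_unique by fastforce
  then have "y (fst l) = y (snd l)" using l(1) by (intro flat) (auto simp: mem_Times_iff)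
  moreover have "(\<lambda>n. \<bar>y (fst (p (r n))) - y (snd (p (r n)))\<bar>) \<longlonglongrightarrow> \<bar>y (fst l) - y (snd l)\<bar>"
    by (intro tendsto_rabs tendsto_diff lim Y)
  ultimately have "(\<lambda>n. \<bar>y (fst (p (r n))) - y (snd (p (r n)))\<bar>) \<longlonglongrightarrow> 0" by simp
  then have "\<forall>\<^sub>F n in sequentially. \<bar>y (fst (p (r n))) - y (snd (p (r n)))\<bar> < \<eta>" using \<eta> by (rule order_tendstoD)
  then obtain n where "\<bar>y (fst (p (r n))) - y (snd (p (r n)))\<bar> < \<eta>" by (auto simp: eventually_sequentially)
  then show False using p(3)[of "r n"] by simp
qed

end

section \<open>Regular variation\<close>

text \<open>A one-sided Potter bound: for a monotone function the ratio at the factor 2 suffices, by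
  iteration along 2^n s0 and monotonicity in between.\<close>

lemma doubling_lower:
  assumes f: "\<And>s. 0 < s \<Longrightarrow> 0 < f s" "\<And>s t. 0 < s \<Longrightarrow> s \<le> t \<Longrightarrow> f s \<le> (f t :: real)"
    and lim: "((\<lambda>s. f (2 * s) / f s) \<longlongrightarrow> 2 powr b) at_top" and b': "0 \<le> b'" "b' < b"
  shows "\<exists>c>0. \<exists>s0>0. \<forall>s\<ge>s0. c * s powr b' \<le> f s"
proof -
  have "2 powr b' < (2::real) powr b" using b' by simp
  with lim have "\<forall>\<^sub>F s in at_top. 2 powr b' < f (2 * s) / f s" by (rule order_tendstoD)
  then obtain s1 where s1: "\<And>s. s \<ge> s1 \<Longrightarrow> 2 powr b' < f (2 * s) / f s" by (auto simp: eventually_at_top_linorder)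
  define s0 where "s0 = max s1 1"
  have s0: "0 < s0" "1 \<le> s0" "s1 \<le> s0" by (auto simp: s0_def)
  have dbl: "2 powr b' * f s \<le> f (2 * s)" if "s \<ge> s0" for s
    using s1[of s] that s0 f(1)[of s] by (auto simp: field_simps)
  have pw: "(2 powr b') ^ n * f s0 \<le> f (2 ^ n * s0)" for n
  proof (induction n)
    case (Suc n)
    have "(2 powr b') ^ Suc n * f s0 = 2 powr b' * ((2 powr b') ^ n * f s0)" by simp
    also have "\<dots> \<le> 2 powr b' * f (2 ^ n * s0)" by (intro mult_left_mono Suc) auto
    also have "\<dots> \<le> f (2 * (2 ^ n * s0))" using s0 by (intro dbl) (simp add: mult_le_cancel_right1)
    finally show ?case by (simp add: mult.assoc)
  qed simp
  define c where "c = f s0 / (2 * s0) powr b'"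
  have c: "0 < c" using f(1)[of s0] s0 by (simp add: c_def)
  show ?thesis
  proof (rule exI[of _ c], rule conjI[OF c], rule exI[of _ s0], rule conjI[OF s0(1)], intro allI impI)
    fix s assume s: "s \<ge> s0"
    \<comment> \<open>2^n s0 is the largest such point not above s; comparing s with 2^(n+1) s0
      costs the denominator in \<open>c\<close>.\<close>
    define n where "n = nat \<lfloor>log 2 (s / s0)\<rfloor>"
    have l0: "0 \<le> log 2 (s / s0)" using s s0 by simp
    have n1: "real n \<le> log 2 (s / s0)" "log 2 (s / s0) < real n + 1" using l0 unfolding n_def by linarith+
    have p: "2 powr real n \<le> s / s0" "s / s0 < 2 powr (real n + 1)"
      using n1 s s0 by (simp_all add: le_log_iff log_less_iff)
    have "c * s powr b' \<le> c * (2 powr (real n + 1) * s0) powr b'"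
      using p(2) s s0 c b' by (intro mult_left_mono powr_mono2) (auto simp: field_simps)
    also have "(2 powr (real n + 1) * s0) powr b' = (2 powr b') ^ n * (2 * s0) powr b'"
      using s0 by (simp add: powr_mult powr_powr powr_add powr_realpow[symmetric] distrib_right mult.commute)
    also have "c * ((2 powr b') ^ n * (2 * s0) powr b') = (2 powr b') ^ n * f s0" using s0 by (simp add: c_def)
    also have "\<dots> \<le> f (2 ^ n * s0)" by (rule pw)
    also have "\<dots> \<le> f s" using p(1) s0 s by (intro f(2)) (auto simp: powr_realpow field_simps)
    finally show "c * s powr b' \<le> f s" .
  qed
qed

text \<open>The mirror image, valid from 1 on: below the threshold \<open>s0\<close> monotonicity
  suffices, because c >= f(s0).\<close>

lemma doubling_upper:
  assumes f: "\<And>s. 0 < s \<Longrightarrow> 0 < f s" "\<And>s t. 0 < s \<Longrightarrow> s \<le> t \<Longrightarrow> f s \<le> (f t :: real)"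
    and lim: "((\<lambda>s. f (2 * s) / f s) \<longlongrightarrow> 2 powr b) at_top" and b': "b < b'" "0 \<le> b'"
  shows "\<exists>c>0. \<forall>s\<ge>1. f s \<le> c * s powr b'"
proof -
  have "(2::real) powr b < 2 powr b'" using b' by simp
  with lim have "\<forall>\<^sub>F s in at_top. f (2 * s) / f s < 2 powr b'" by (rule order_tendstoD)
  then obtain s1 where s1: "\<And>s. s \<ge> s1 \<Longrightarrow> f (2 * s) / f s < 2 powr b'" by (auto simp: eventually_at_top_linorder)
  define s0 where "s0 = max s1 1"
  have s0: "0 < s0" "1 \<le> s0" "s1 \<le> s0" by (auto simp: s0_def)
  have dbl: "f (2 * s) \<le> 2 powr b' * f s" if "s \<ge> s0" for s
    using s1[of s] that s0 f(1)[of s] by (auto simp: field_simps)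
  have pw: "f (2 ^ n * s0) \<le> (2 powr b') ^ n * f s0" for n
  proof (induction n)
    case (Suc n)
    have "f (2 ^ Suc n * s0) = f (2 * (2 ^ n * s0))" by (simp add: mult.assoc)
    also have "\<dots> \<le> 2 powr b' * f (2 ^ n * s0)" using s0 by (intro dbl) (simp add: mult_le_cancel_right1)
    also have "\<dots> \<le> 2 powr b' * ((2 powr b') ^ n * f s0)" by (intro mult_left_mono Suc) auto
    finally show ?case by simp
  qed simp
  define c where "c = f s0 * 2 powr b'"
  have c: "0 < c" using f(1)[of s0] s0 by (simp add: c_def)
  show ?thesis
  proof (intro exI[of _ c] conjI c allI impI)
    fix s :: real assume s1: "1 \<le> s"
    show "f s \<le> c * s powr b'"
    proof (cases "s0 \<le> s")
      case False
      then have "f s \<le> f s0" using s1 by (intro f(2)) auto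
      also have "\<dots> \<le> f s0 * (2 powr b' * s powr b')"
        using s1 b' f(1)[of s0] s0 ge_one_powr_ge_zero[of 2 b'] ge_one_powr_ge_zero[of s b'] mult_mono[of 1 "2 powr b'" 1 "s powr b'"]
        by (simp add: mult_le_cancel_left1)
      finally show ?thesis by (simp add: c_def mult.assoc)
    next
      case s: True
      \<comment> \<open>Rounded up this time: s <= 2^n s0, while 2^n s0 is still at most 2
        s.\<close>
      define n where "n = nat \<lceil>log 2 (s / s0)\<rceil>"
      have l0: "0 \<le> log 2 (s / s0)" using s s0 by simp
      have n1: "log 2 (s / s0) \<le> real n" "real n < log 2 (s / s0) + 1" using l0 unfolding n_def by linarith+
      have p: "s / s0 \<le> 2 powr real n" using n1 s s0 by (simp add: log_le_iff)
      have "real n - 1 \<le> log 2 (s / s0)" using n1 by simp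
      then have "2 powr (real n - 1) \<le> s / s0" using s s0 by (subst (asm) le_log_iff) auto
      then have p2: "2 powr real n \<le> 2 * (s / s0)" by (simp add: powr_diff mult.commute)
      have "f s \<le> f (2 ^ n * s0)" using p s0 s by (intro f(2)) (auto simp: powr_realpow field_simps)
      also have "\<dots> \<le> (2 powr b') ^ n * f s0" by (rule pw)
      also have "(2 powr b') ^ n = (2 powr real n) powr b'" by (simp add: powr_powr powr_realpow[symmetric] mult.commute)
      also have "\<dots> \<le> (2 * s) powr b'"
      proof (intro powr_mono2 b')
        have "s / s0 \<le> s" using s0 s by (simp add: divide_le_eq mult_le_cancel_left1)
        then show "2 powr real n \<le> 2 * s" using p2 by linarith
      qed auto
      also have "(2 * s) powr b' * f s0 = c * s powr b'" using s1 by (simp add: c_def powr_mult)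
      finally show ?thesis using f(1)[of s0] s0 by (simp add: mult_right_mono)
    qed
  qed
qed

section \<open>The time change\<close>

locale clock_setting = prob_space M for M :: "'a measure" +
  fixes \<F> :: "real \<Rightarrow> 'a measure" and B D E :: "real \<Rightarrow> 'a \<Rightarrow> real" and \<nu> :: "real measure"
    and \<G> :: "real \<Rightarrow> 'a measure" and T \<beta> :: real
  assumes cmpl: "complete_measure M"
    and usual: "usual_filtration M \<F>"
    and BM: "brownian_motion M \<F> B"
    and subord: "subordinator M \<F> D"
    and laplace: "\<And>s t. 0 < s \<Longrightarrow> 0 \<le> t \<Longrightarrow> (\<integral>\<omega>. exp (- (s * D t \<omega>)) \<partial>M) = exp (- (t * laplace_exponent \<nu> s))"
    and E_def: "E = first_passage D"
    and G_def: "\<G> = time_changed_filtration M \<F> E"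
    and T_pos: "0 < T"
    and beta: "0 < \<beta>" "regularly_varying (laplace_exponent \<nu>) \<beta>"
begin

abbreviation "\<psi> \<equiv> laplace_exponent \<nu>"

section \<open>Null sets and right-continuity of the filtration\<close>

lemma F_space [simp]: "space (\<F> t) = space M"
  and F_sub: "subalgebra M (\<F> t)"
  and F_sets_mono: "s \<le> t \<Longrightarrow> sets (\<F> s) \<subseteq> sets (\<F> t)"
  and F_null: "N \<in> null_sets M \<Longrightarrow> N \<in> sets (\<F> t)"
  and F_inf: "0 \<le> t \<Longrightarrow> sets (\<F> t) = (\<Inter>s\<in>{t<..}. sets (\<F> s))"
  and F_filtration: "filtration (space M) \<F>"
  using usual by (auto simp: usual_filtration_def subalgebra_def filtration_def)

lemma F_mono: "f \<in> borel_measurable (\<F> s) \<Longrightarrow> s \<le> t \<Longrightarrow> f \<in> borel_measurable (\<F> t)"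
  using F_sets_mono[of s t] by (metis F_space measurable_from_subalg subalgebra_def)

lemma F_M: "f \<in> borel_measurable (\<F> s) \<Longrightarrow> f \<in> borel_measurable M"
  using F_sub by (rule measurable_from_subalg)

lemma D_F: "0 \<le> t \<Longrightarrow> D t \<in> borel_measurable (\<F> t)"
  and B_F: "0 \<le> t \<Longrightarrow> B t \<in> borel_measurable (\<F> t)"
  using subord BM by (auto simp: subordinator_def brownian_motion_def adapted_on_def)

lemma D_M [measurable]: "0 \<le> t \<Longrightarrow> D t \<in> borel_measurable M"
  using D_F F_M by blast

lemma AE_null: "(AE \<omega> in M. P \<omega>) \<longleftrightarrow> {\<omega>\<in>space M. \<not> P \<omega>} \<in> null_sets M"
  using cmpl by (rule complete_measure.AE_iff_null_sets)

text \<open>The symmetric difference is a null set, and every \<open>\<F> v\<close> contains all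
  null sets, at negative times too.\<close>

lemma F_AE_set:
  assumes "A \<in> sets (\<F> v)" "C \<subseteq> space M" "AE \<omega> in M. \<omega> \<in> A \<longleftrightarrow> \<omega> \<in> C"
  shows "C \<in> sets (\<F> v)"
proof -
  have n: "{\<omega>\<in>space M. \<not> (\<omega> \<in> A \<longleftrightarrow> \<omega> \<in> C)} \<in> null_sets M" using assms(3) by (simp add: AE_null)
  have A: "A \<subseteq> space M" using assms(1) sets.sets_into_space[of A "\<F> v"] by simp
  have "C - A \<in> null_sets M" "A - C \<in> null_sets M"
    using A assms(2) by (auto intro!: complete_measure.complete2[OF cmpl _ n])
  then have "(A \<union> (C - A)) - (A - C) \<in> sets (\<F> v)" by (intro sets.Diff sets.Un assms(1) F_null)
  moreover have "(A \<union> (C - A)) - (A - C) = C" by auto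
  ultimately show ?thesis by simp
qed

lemma F_AE_cong:
  assumes "f \<in> borel_measurable (\<F> v)" "AE \<omega> in M. f \<omega> = g \<omega>"
  shows "g \<in> borel_measurable (\<F> v)"
proof (rule measurableI)
  fix S :: "'b set" assume "S \<in> sets borel"
  then have "f -` S \<inter> space (\<F> v) \<in> sets (\<F> v)" using assms(1) by (rule measurable_sets[rotated])
  then have "g -` S \<inter> space M \<in> sets (\<F> v)"
    by (rule F_AE_set) (use assms(2) in \<open>auto elim: AE_mp\<close>)
  then show "g -` S \<inter> space (\<F> v) \<in> sets (\<F> v)" by simp
qed simp

lemma F_rightI:
  assumes "0 \<le> v" "\<And>s. v < s \<Longrightarrow> f \<in> borel_measurable (\<F> s)"
  shows "f \<in> borel_measurable (\<F> v)"
proof (rule measurableI)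
  fix S :: "'b set" assume S: "S \<in> sets borel"
  have "f -` S \<inter> space M \<in> sets (\<F> s)" if "v < s" for s
    using measurable_sets[OF assms(2)[OF that] S] by simp
  then show "f -` S \<inter> space (\<F> v) \<in> sets (\<F> v)" unfolding F_inf[OF assms(1)] by auto
qed simp

text \<open>No measurability of \<open>Q\<close> is assumed: the intersection of the exceptional
  sets is null and covers the failures.\<close>

lemma AE_of_small:
  assumes "\<And>\<kappa>. 0 < \<kappa> \<Longrightarrow> \<exists>A\<in>sets M. measure M A < \<kappa> \<and> (\<forall>\<omega>\<in>space M - A. Q \<omega>)"
  shows "AE \<omega> in M. Q \<omega>"
proof -
  have "\<forall>n. \<exists>A\<in>sets M. measure M A < inverse (real (Suc n)) \<and> (\<forall>\<omega>\<in>space M - A. Q \<omega>)" using assms by simp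
  then obtain A where A: "\<And>n. A n \<in> sets M" "\<And>n. measure M (A n) < inverse (real (Suc n))" "\<And>n \<omega>. \<omega> \<in> space M - A n \<Longrightarrow> Q \<omega>"
    by metis
  have "measure M (\<Inter>n. A n) \<le> 0"
  proof (rule field_le_epsilon)
    fix e :: real assume "0 < e"
    then obtain n where n: "inverse (real (Suc n)) < e" using reals_Archimedean by blast
    have "measure M (\<Inter>n. A n) \<le> measure M (A n)" using A by (intro finite_measure_mono) auto
    then show "measure M (\<Inter>n. A n) \<le> 0 + e" using A(2)[of n] n by simp
  qed
  then have "(\<Inter>n. A n) \<in> null_sets M" using A by (intro null_setsI) (auto simp: emeasure_eq_measure measure_le_0_iff)
  then show ?thesis by (rule AE_I') (use A(3) in auto)
qed

text \<open>Continuity from above of the measure, along the unions of tails.\<close>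

lemma prob_eventually_small:
  assumes A: "\<And>p. A p \<in> sets M" and ev: "AE \<omega> in M. \<exists>p0. \<forall>p\<ge>p0. \<omega> \<notin> A p" and "0 < \<kappa>"
  shows "\<exists>p0::nat. \<forall>p\<ge>p0. measure M (A p) < \<kappa>"
proof -
  define C where "C q = (\<Union>p\<in>{q..}. A p)" for q
  have C: "range C \<subseteq> sets M" using A by (auto simp: C_def)
  have "decseq C" by (force simp: C_def decseq_def)
  then have lim: "(\<lambda>q. measure M (C q)) \<longlonglongrightarrow> measure M (\<Inter>q. C q)" by (rule finite_Lim_measure_decseq[OF C])
  have "AE \<omega> in M. \<omega> \<notin> (\<Inter>q. C q)" using ev by eventually_elim (auto simp: C_def)
  moreover have "(\<Inter>q. C q) \<in> sets M" using C by auto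
  ultimately have "(\<Inter>q. C q) \<in> null_sets M" by (simp only: AE_iff_null_sets)
  then have "measure M (\<Inter>q. C q) = 0" by (rule measure_eq_0_null_sets)
  with lim have "\<forall>\<^sub>F q in sequentially. measure M (C q) < \<kappa>" using \<open>0 < \<kappa>\<close> by (intro order_tendstoD(2)[of _ 0]) auto
  then obtain p0 where "\<And>p. p \<ge> p0 \<Longrightarrow> measure M (C p) < \<kappa>" by (auto simp: eventually_sequentially)
  moreover have "measure M (A p) \<le> measure M (C p)" for p
    using C by (intro finite_measure_mono) (auto simp: C_def)
  ultimately show ?thesis by (meson order_le_less_trans)
qed

subsection \<open>Almost sure properties of the paths\<close>

lemma psi_pos: "0 < s \<Longrightarrow> 0 < \<psi> s" using beta by (simp add: regularly_varying_def)

lemma AE_D_mono: "AE \<omega> in M. mono_on {0..} (\<lambda>t. D t \<omega>)"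
  and AE_D_0: "AE \<omega> in M. D 0 \<omega> = 0"
  and AE_D_rc: "AE \<omega> in M. \<forall>t\<ge>0. continuous (at_right t) (\<lambda>u. D u \<omega>)"
  using subord by (auto simp: subordinator_def)

lemma AE_D_nonneg: "0 \<le> t \<Longrightarrow> AE \<omega> in M. 0 \<le> D t \<omega>"
  using AE_D_mono AE_D_0 by eventually_elim (metis atLeast_iff mono_onD order_refl)

lemma exp_D_integrable: "0 < s \<Longrightarrow> 0 \<le> t \<Longrightarrow> integrable M (\<lambda>\<omega>. exp (- (s * D t \<omega>)))"
  using AE_D_nonneg[of t] by (intro integrable_const_bound[where B=1]) (auto elim!: AE_mp)

text \<open>Chernoff bound, that is, Markov's inequality for exp (- s D u).\<close>

lemma tail_bound:
  assumes "0 < s" "0 \<le> u"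
  shows "measure M {\<omega>\<in>space M. D u \<omega> \<le> t} \<le> exp (s * t - u * \<psi> s)"
proof -
  have "measure M {\<omega>\<in>space M. D u \<omega> \<le> t} = (\<integral>\<omega>. indicator {\<omega>\<in>space M. D u \<omega> \<le> t} \<omega> \<partial>M)" using assms by simp
  also have "\<dots> \<le> (\<integral>\<omega>. exp (s * t) * exp (- (s * D u \<omega>)) \<partial>M)"
  proof (rule integral_mono)
    show "integrable M (indicat_real {\<omega> \<in> space M. D u \<omega> \<le> t})" using assms by (intro integrable_real_indicator) (auto simp: emeasure_eq_measure)
    show "integrable M (\<lambda>\<omega>. exp (s * t) * exp (- (s * D u \<omega>)))" using exp_D_integrable[OF assms] by simp
    show "indicat_real {\<omega> \<in> space M. D u \<omega> \<le> t} \<omega> \<le> exp (s * t) * exp (- (s * D u \<omega>))" for \<omega>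
      using assms by (auto simp: indicator_def mult_left_mono simp flip: exp_add)
  qed
  also have "\<dots> = exp (s * t) * exp (- (u * \<psi> s))" using laplace[OF assms] by simp
  finally show ?thesis by (simp flip: exp_add)
qed

text \<open>Read off from the expectations at time 1, as D 1 >= 0 almost surely.\<close>

lemma psi_mono: "0 < s \<Longrightarrow> s \<le> s' \<Longrightarrow> \<psi> s \<le> \<psi> s'"
proof -
  assume s: "0 < s" "s \<le> s'"
  have "exp (- (1 * \<psi> s')) \<le> exp (- (1 * \<psi> s))"
    unfolding laplace[OF s(1), of 1, simplified, symmetric] using laplace[of s' 1, symmetric] s
  proof simp
    show "(\<integral>\<omega>. exp (- (s' * D 1 \<omega>)) \<partial>M) \<le> exp (- \<psi> s)"
      unfolding laplace[OF s(1), of 1, simplified, symmetric]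
    proof (rule integral_mono_AE)
      show "AE \<omega> in M. exp (- (s' * D 1 \<omega>)) \<le> exp (- (s * D 1 \<omega>))"
        using AE_D_nonneg[of 1] s by (auto elim!: AE_mp intro: mult_right_mono)
    qed (use exp_D_integrable s in auto)
  qed
  then show ?thesis by simp
qed

lemma psi_lower: "0 \<le> b \<Longrightarrow> b < \<beta> \<Longrightarrow> \<exists>c>0. \<exists>s0>0. \<forall>s\<ge>s0. c * s powr b \<le> \<psi> s"
  using beta psi_pos psi_mono by (intro doubling_lower[where b=\<beta>]) (auto simp: regularly_varying_def)

lemma psi_unbounded: "\<exists>s>0. K < \<psi> s"
proof -
  obtain c s0 where c: "0 < c" "0 < s0" "\<And>s. s \<ge> s0 \<Longrightarrow> c * s powr (\<beta> / 2) \<le> \<psi> s" using psi_lower[of "\<beta> / 2"] beta by auto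
  \<comment> \<open>Beyond \<open>s0\<close>, and so large that c s^(\<beta>/2) reaches |K| +
    1.\<close>
  define s where "s = max s0 (((\<bar>K\<bar> + 1) / c) powr (2 / \<beta>))"
  have s: "s0 \<le> s" "0 < s" using c by (auto simp: s_def)
  have "(\<bar>K\<bar> + 1) / c = (((\<bar>K\<bar> + 1) / c) powr (2 / \<beta>)) powr (\<beta> / 2)" using c beta by (simp add: powr_powr)
  also have "\<dots> \<le> s powr (\<beta> / 2)" using beta by (intro powr_mono2) (auto simp: s_def)
  finally have "\<bar>K\<bar> + 1 \<le> c * s powr (\<beta> / 2)" using c by (simp add: field_simps)
  then show ?thesis using c(3)[OF s(1)] s by (intro exI[of _ s]) auto
qed

text \<open>By stationarity the increment has the law of D (v - u) - D 0. The Chernoff bound at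
  level 0 is exp (-(v - u) \<psi> s), and \<psi> is unbounded.\<close>

lemma AE_D_strict: assumes "0 \<le> u" "u < v" shows "AE \<omega> in M. D u \<omega> < D v \<omega>"
proof -
  let ?Z = "\<lambda>\<omega>. D v \<omega> - D u \<omega>"
  have st: "distr M borel ?Z = distr M borel (\<lambda>\<omega>. D (v - u) \<omega> - D 0 \<omega>)"
    using subord assms unfolding subordinator_def by blast
  have Zint: "integrable M (\<lambda>\<omega>. exp (- (s * ?Z \<omega>)))" if "0 < s" for s
    using AE_D_mono assms that by (intro integrable_const_bound[where B=1]) (auto elim!: AE_mp simp: mono_on_def)
  have b: "measure M {\<omega>\<in>space M. ?Z \<omega> \<le> 0} \<le> exp (- ((v - u) * \<psi> s))" if s: "0 < s" for s
  proof -
    have "measure M {\<omega>\<in>space M. ?Z \<omega> \<le> 0} = (\<integral>\<omega>. indicator {\<omega>\<in>space M. ?Z \<omega> \<le> 0} \<omega> \<partial>M)" using assms by simp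
    also have "\<dots> \<le> (\<integral>\<omega>. exp (- (s * ?Z \<omega>)) \<partial>M)"
    proof (intro integral_mono Zint s)
      show "integrable M (indicat_real {\<omega> \<in> space M. ?Z \<omega> \<le> 0})"
        using assms by (intro integrable_real_indicator) (auto simp: emeasure_eq_measure)
    qed (use s in \<open>auto simp: indicator_def mult_nonneg_nonpos\<close>)
    also have "\<dots> = (\<integral>x. exp (- (s * x)) \<partial>distr M borel ?Z)" using assms by (subst integral_distr) auto
    also have "\<dots> = (\<integral>\<omega>. exp (- (s * (D (v - u) \<omega> - D 0 \<omega>))) \<partial>M)" unfolding st using assms by (subst integral_distr) auto
    also have "\<dots> = (\<integral>\<omega>. exp (- (s * D (v - u) \<omega>)) \<partial>M)" using AE_D_0 assms by (intro integral_cong_AE) (auto elim!: AE_mp)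
    finally show ?thesis using laplace[of s "v - u"] s assms by simp
  qed
  have "measure M {\<omega>\<in>space M. ?Z \<omega> \<le> 0} \<le> 0"
  proof (rule field_le_epsilon)
    fix e :: real assume e: "0 < e"
    obtain s where s: "0 < s" "- ln e / (v - u) < \<psi> s" using psi_unbounded by blast
    then have "- ((v - u) * \<psi> s) < ln e" using assms by (simp add: field_simps)
    then have "exp (- ((v - u) * \<psi> s)) \<le> e" using e by (metis exp_less_cancel_iff exp_ln less_imp_le)
    then show "measure M {\<omega>\<in>space M. ?Z \<omega> \<le> 0} \<le> 0 + e" using b[OF s(1)] by simp
  qed
  then have "{\<omega>\<in>space M. ?Z \<omega> \<le> 0} \<in> null_sets M"
    using assms by (intro null_setsI) (auto simp: emeasure_eq_measure measure_le_0_iff)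
  then show ?thesis by (rule AE_I') auto
qed

lemma AE_D_unbounded: "AE \<omega> in M. \<forall>K. \<exists>u\<ge>0. K < D u \<omega>"
proof -
  have "AE \<omega> in M. \<exists>n::nat. real k < D (real n) \<omega>" for k :: nat
  proof -
    have "measure M {\<omega>\<in>space M. \<forall>n. D (real n) \<omega> \<le> real k} \<le> 0"
    proof (rule field_le_epsilon)
      fix e :: real assume e: "0 < e"
      obtain n :: nat where n: "(real k - ln e) / \<psi> 1 < real n" using reals_Archimedean2 by blast
      then have "1 * real k - real n * \<psi> 1 < ln e" using psi_pos[of 1] by (simp add: field_simps)
      then have "exp (1 * real k - real n * \<psi> 1) \<le> e" using e by (metis exp_less_cancel_iff exp_ln less_imp_le)
      moreover have "measure M {\<omega>\<in>space M. \<forall>n. D (real n) \<omega> \<le> real k} \<le> measure M {\<omega>\<in>space M. D (real n) \<omega> \<le> real k}"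
        by (intro finite_measure_mono) auto
      ultimately show "measure M {\<omega>\<in>space M. \<forall>n. D (real n) \<omega> \<le> real k} \<le> 0 + e"
        using tail_bound[of 1 "real n" "real k"] by simp
    qed
    then have "{\<omega>\<in>space M. \<forall>n. D (real n) \<omega> \<le> real k} \<in> null_sets M"
      by (intro null_setsI) (auto simp: emeasure_eq_measure measure_le_0_iff)
    then show ?thesis by (rule AE_I') (auto simp: not_less)
  qed
  then have "AE \<omega> in M. \<forall>k::nat. \<exists>n::nat. real k < D (real n) \<omega>" by (simp add: AE_all_countable)
  then show ?thesis
  proof eventually_elim
    case (elim \<omega>)
    show ?case
    proof
      fix K :: real
      obtain k :: nat where "K < real k" using reals_Archimedean2 by blast
      with elim obtain n :: nat where "K < D (real n) \<omega>" by (meson less_trans)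
      then show "\<exists>u\<ge>0. K < D u \<omega>" by (intro exI[of _ "real n"]) auto
    qed
  qed
qed

text \<open>All pathwise arguments take place on these paths. The complement is null and therefore
  belongs to every \<open>\<F> t\<close>.\<close>

definition nice :: "'a \<Rightarrow> bool" where
  "nice \<omega> \<longleftrightarrow> clock_path (\<lambda>u. D u \<omega>) \<and> B 0 \<omega> = 0 \<and> continuous_on {0..} (\<lambda>t. B t \<omega>)"

lemma AE_nice: "AE \<omega> in M. nice \<omega>"
proof -
  \<comment> \<open>Strictness is obtained for the countably many rational pairs; monotonicity
    spreads it to all times.\<close>
  have "AE \<omega> in M. \<forall>q\<in>\<rat>. \<forall>r\<in>\<rat>. 0 \<le> q \<longrightarrow> q < r \<longrightarrow> D q \<omega> < D r \<omega>"
    using AE_D_strict by (intro AE_ball_countable'[OF _ countable_rat]) auto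
  moreover have "AE \<omega> in M. B 0 \<omega> = 0" "AE \<omega> in M. continuous_on {0..} (\<lambda>t. B t \<omega>)"
    using BM by (auto simp: brownian_motion_def)
  ultimately show ?thesis using AE_D_mono AE_D_0 AE_D_rc AE_D_unbounded
  proof eventually_elim
    case (elim \<omega>)
    have "strict_mono_on {0..} (\<lambda>u. D u \<omega>)"
    proof (rule strict_mono_onI)
      fix u v :: real assume uv: "u \<in> {0..}" "v \<in> {0..}" "u < v"
      obtain q where q: "q \<in> \<rat>" "u < q" "q < v" using Rats_dense_in_real[OF uv(3)] by blast
      obtain r where r: "r \<in> \<rat>" "q < r" "r < v" using Rats_dense_in_real[OF q(3)] by blast
      have "D u \<omega> \<le> D q \<omega>" "D r \<omega> \<le> D v \<omega>" using elim(4) uv q r by (auto simp: mono_on_def)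
      moreover have "D q \<omega> < D r \<omega>" using elim(1) q r uv by auto
      ultimately show "D u \<omega> < D v \<omega>" by simp
    qed
    with elim show ?case unfolding nice_def clock_path_def by blast
  qed
qed

lemma nice_clock: "nice \<omega> \<Longrightarrow> clock_path (\<lambda>u. D u \<omega>)" by (simp add: nice_def)

lemma E_eq: "nice \<omega> \<Longrightarrow> E t \<omega> = clock_path.e (\<lambda>u. D u \<omega>) t"
  by (simp add: E_def first_passage_def clock_path.e_def[OF nice_clock])

lemmas n_d_less = clock_path.d_less[OF nice_clock]
lemmas n_d_le = clock_path.d_le[OF nice_clock]
lemmas n_d0 = clock_path.d0[OF nice_clock]

lemma n_E_nonneg: "nice \<omega> \<Longrightarrow> 0 \<le> E t \<omega>" using E_eq clock_path.e_nonneg[OF nice_clock] by simp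
lemma n_le_E: "nice \<omega> \<Longrightarrow> 0 \<le> u \<Longrightarrow> D u \<omega> \<le> t \<Longrightarrow> u \<le> E t \<omega>" using E_eq clock_path.le_e[OF nice_clock] by simp
lemma n_E_le: "nice \<omega> \<Longrightarrow> 0 < u \<Longrightarrow> t < D u \<omega> \<Longrightarrow> E t \<omega> \<le> u" using E_eq clock_path.e_le[OF nice_clock] by simp
lemma n_E_D: "nice \<omega> \<Longrightarrow> 0 \<le> u \<Longrightarrow> E (D u \<omega>) \<omega> = u" using E_eq clock_path.e_d[OF nice_clock] by simp
lemma n_E_mono: "nice \<omega> \<Longrightarrow> s \<le> t \<Longrightarrow> E s \<omega> \<le> E t \<omega>" using E_eq clock_path.e_mono[OF nice_clock] by simp
lemma n_less_D: "nice \<omega> \<Longrightarrow> E t \<omega> < v \<Longrightarrow> t < D v \<omega>" using E_eq clock_path.less_d[OF nice_clock] by simp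
lemma n_D_less: "nice \<omega> \<Longrightarrow> 0 \<le> u \<Longrightarrow> u < E t \<omega> \<Longrightarrow> D u \<omega> < t" using E_eq clock_path.d_le_of_less_e[OF nice_clock] by simp
lemma n_E_le_iff: "nice \<omega> \<Longrightarrow> 0 \<le> v \<Longrightarrow> E t \<omega> \<le> v \<longleftrightarrow> (\<forall>w>v. t < D w \<omega>)" using E_eq clock_path.e_le_iff[OF nice_clock] by simp
lemma n_E_cont: "nice \<omega> \<Longrightarrow> continuous_on {0..} (\<lambda>t. E t \<omega>)" using E_eq clock_path.e_cont[OF nice_clock] by simp
lemma n_E_uniform:
  assumes "nice \<omega>" "continuous_on {0..T} y" "\<And>s t. s \<in> {0..T} \<Longrightarrow> t \<in> {0..T} \<Longrightarrow> E s \<omega> = E t \<omega> \<Longrightarrow> y s = y t" "0 < (\<eta>::real)"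
  shows "\<exists>\<zeta>>0. \<forall>s\<in>{0..T}. \<forall>t\<in>{0..T}. \<bar>E s \<omega> - E t \<omega>\<bar> \<le> \<zeta> \<longrightarrow> \<bar>y s - y t\<bar> \<le> \<eta>"
  unfolding E_eq[OF assms(1)]
  by (rule clock_path.e_uniformly_continuous[OF nice_clock[OF assms(1)] assms(2) _ assms(4)])
    (rule assms(3), simp_all add: E_eq[OF assms(1)])

subsection \<open>Measurability\<close>

text \<open>E t <= v says that t < D w for all w > v. Along w = v + 1/(n+1) only large n matter, so
  the event is known at every time after v, and right-continuity of \<open>\<F>\<close> gives it at
  v.\<close>

lemma E_stop: "stopping_time \<F> (E t)"
proof (rule stopping_timeI)
  fix v
  have "{\<omega>\<in>space M. E t \<omega> \<le> v} \<in> sets (\<F> v)"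
  proof (cases "0 \<le> v")
    case True
    let ?A = "{\<omega>\<in>space M. \<forall>n::nat. t < D (v + inverse (real (Suc n))) \<omega>}"
    have "?A \<in> sets (\<F> s)" if s: "v < s" for s
    proof -
      obtain n0 where n0: "inverse (real (Suc n0)) < s - v" using reals_Archimedean[of "s - v"] s by auto
      let ?A' = "{\<omega>\<in>space M. \<forall>n\<ge>n0. t < D (v + inverse (real (Suc n))) \<omega>}"
      have "D (v + inverse (real (Suc n))) \<in> borel_measurable (\<F> s)" if "n \<ge> n0" for n
      proof (rule F_mono[OF D_F])
        have "inverse (real (Suc n)) \<le> inverse (real (Suc n0))" using that by (intro le_imp_inverse_le) auto
          with n0 show "v + inverse (real (Suc n)) \<le> s" by linarith
      qed (use True in simp)
      then have "{\<omega>\<in>space (\<F> s). n0 \<le> n \<longrightarrow> t < D (v + inverse (real (Suc n))) \<omega>} \<in> sets (\<F> s)" for n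
        by (cases "n0 \<le> n") (use borel_measurable_less[OF borel_measurable_const[of t "\<F> s"]] sets.top[of "\<F> s"] in auto)
      then have "{\<omega>\<in>space (\<F> s). \<forall>n. n0 \<le> n \<longrightarrow> t < D (v + inverse (real (Suc n))) \<omega>} \<in> sets (\<F> s)"
        by (rule sets.sets_Collect_countable_All)
      then have A': "?A' \<in> sets (\<F> s)" by (simp only: F_space)
      show ?thesis
      proof (rule F_AE_set[OF A'])
        show "AE \<omega> in M. \<omega> \<in> ?A' \<longleftrightarrow> \<omega> \<in> ?A"
          using AE_nice
        proof eventually_elim
          case (elim \<omega>)
          have "t < D (v + inverse (real (Suc n))) \<omega>" if *: "\<forall>n\<ge>n0. t < D (v + inverse (real (Suc n))) \<omega>" for n
          proof -
            have "t < D (v + inverse (real (Suc (max n n0)))) \<omega>" using * by simp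
            also have "\<dots> \<le> D (v + inverse (real (Suc n))) \<omega>"
              using elim True by (intro n_d_le add_left_mono le_imp_inverse_le) auto
            finally show "t < D (v + inverse (real (Suc n))) \<omega>" .
          qed
          then show ?case by blast
        qed
      qed auto
    qed
    then have "?A \<in> sets (\<F> v)" unfolding F_inf[OF True] by auto
    then show ?thesis
    proof (rule F_AE_set)
      show "AE \<omega> in M. \<omega> \<in> ?A \<longleftrightarrow> \<omega> \<in> {\<omega>\<in>space M. E t \<omega> \<le> v}"
        using AE_nice
      proof eventually_elim
        case (elim \<omega>)
        have "(\<forall>w>v. t < D w \<omega>) \<longleftrightarrow> (\<forall>n::nat. t < D (v + inverse (real (Suc n))) \<omega>)"
        proof (intro iffI allI impI)
          fix w assume *: "\<forall>n::nat. t < D (v + inverse (real (Suc n))) \<omega>" and w: "v < w"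
          obtain n where n: "inverse (real (Suc n)) < w - v" using reals_Archimedean[of "w - v"] w by auto
          have "t < D (v + inverse (real (Suc n))) \<omega>" using * by simp
          also have "\<dots> \<le> D w \<omega>" using elim True n by (intro n_d_le) auto
          finally show "t < D w \<omega>" .
        qed auto
        then show ?case using n_E_le_iff[OF elim True] by auto
      qed
    qed auto
  next
    case False
    show ?thesis
    \<comment> \<open>For negative v the event is null, since the inverse is nonnegative on nice
      paths.\<close>
    proof (rule F_AE_set[of "{}"])
      show "AE \<omega> in M. \<omega> \<in> {} \<longleftrightarrow> \<omega> \<in> {\<omega> \<in> space M. E t \<omega> \<le> v}"
        using AE_nice
      proof eventually_elim
        case (elim \<omega>)
        then show ?case using n_E_nonneg[OF elim, of t] False by auto
      qed
    qed auto
  qed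
  then show "Measurable.pred (\<F> v) (\<lambda>x. E t x \<le> v)" by (simp add: pred_def)
qed

lemma E_le_F: "{\<omega>\<in>space M. E t \<omega> \<le> v} \<in> sets (\<F> v)"
  using stopping_timeD[OF E_stop, where t=v] by (simp add: pred_def)

lemma G_sets: "sets (\<G> t) = {A. \<forall>v. {\<omega>\<in>A. E t \<omega> \<le> v} \<in> sets (\<F> v)}"
  unfolding G_def time_changed_filtration_def by (rule filtration.sets_pre_sigma[OF F_filtration E_stop])

lemma G_space [simp]: "space (\<G> t) = space M"
  unfolding G_def time_changed_filtration_def by (rule filtration.space_pre_sigma[OF F_filtration])

lemma G_filtration: "filtration (space M) \<G>"
proof
  fix s t :: real assume st: "s \<le> t"
  show "sets (\<G> s) \<subseteq> sets (\<G> t)"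
  proof
    fix A assume A: "A \<in> sets (\<G> s)"
    then have As: "A \<subseteq> space M" using sets.sets_into_space[of A "\<G> s"] by simp
    show "A \<in> sets (\<G> t)" unfolding G_sets
    proof (intro CollectI allI)
      fix v
      have "{\<omega>\<in>A. E s \<omega> \<le> v} \<inter> {\<omega>\<in>space M. E t \<omega> \<le> v} \<in> sets (\<F> v)"
        using A E_le_F by (intro sets.Int) (auto simp: G_sets)
      then show "{\<omega>\<in>A. E t \<omega> \<le> v} \<in> sets (\<F> v)"
      proof (rule F_AE_set)
        show "AE \<omega> in M. \<omega> \<in> {\<omega> \<in> A. E s \<omega> \<le> v} \<inter> {\<omega> \<in> space M. E t \<omega> \<le> v} \<longleftrightarrow> \<omega> \<in> {\<omega> \<in> A. E t \<omega> \<le> v}"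
          using AE_nice AE_space by eventually_elim (use n_E_mono[OF _ st] As in force)
      qed (use As in auto)
    qed
  qed
qed simp

text \<open>On the event E t <= v, what is known at calendar time t is known to
  \<open>\<F> v\<close>; off this event the value 0 adds nothing, and the event itself is in
  \<open>\<F> v\<close>.\<close>

lemma G_F:
  assumes "Y \<in> borel_measurable (\<G> t)"
  shows "(\<lambda>\<omega>. if E t \<omega> \<le> v then Y \<omega> else (0::real)) \<in> borel_measurable (\<F> v)"
proof (rule measurableI)
  fix S :: "real set" assume S: "S \<in> sets borel"
  have "Y -` S \<inter> space (\<G> t) \<in> sets (\<G> t)" using assms S by (rule measurable_sets)
  then have 1: "{\<omega> \<in> Y -` S \<inter> space M. E t \<omega> \<le> v} \<in> sets (\<F> v)" by (simp add: G_sets)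
  have 2: "{\<omega>\<in>space M. \<not> E t \<omega> \<le> v} \<in> sets (\<F> v)" using sets.sets_Collect_neg[of "\<F> v"] E_le_F[of t v] by simp
  have "(\<lambda>\<omega>. if E t \<omega> \<le> v then Y \<omega> else 0) -` S \<inter> space (\<F> v)
     = {\<omega> \<in> Y -` S \<inter> space M. E t \<omega> \<le> v} \<union> (if 0 \<in> S then {\<omega>\<in>space M. \<not> E t \<omega> \<le> v} else {})"
    by (auto split: if_splits)
  then show "(\<lambda>\<omega>. if E t \<omega> \<le> v then Y \<omega> else 0) -` S \<inter> space (\<F> v) \<in> sets (\<F> v)" using 1 2 by auto
qed simp

text \<open>\<open>E t\<close> is finite, so the events E t <= n exhaust the space.\<close>

lemma G_M: "Y \<in> borel_measurable (\<G> t) \<Longrightarrow> Y \<in> borel_measurable M"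
proof -
  have "A \<in> sets M" if A: "A \<in> sets (\<G> t)" for A
  proof -
    have "{\<omega>\<in>A. E t \<omega> \<le> real n} \<in> sets M" for n :: nat using A F_sub by (auto simp: G_sets subalgebra_def)
    then have "(\<Union>n::nat. {\<omega>\<in>A. E t \<omega> \<le> real n}) \<in> sets M" by auto
    moreover have "(\<Union>n::nat. {\<omega>\<in>A. E t \<omega> \<le> real n}) = A" using real_arch_simple by auto
    ultimately show ?thesis by simp
  qed
  then have "subalgebra M (\<G> t)" by (auto simp: subalgebra_def)
  then show "Y \<in> borel_measurable (\<G> t) \<Longrightarrow> Y \<in> borel_measurable M" by (rule measurable_from_subalg)
qed

end

context clock_setting
begin

section \<open>From processes adapted to \<open>\<G>\<close> to grid times on the scale of
  \<open>\<F>\<close>\<close>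

lemma n_D_nonneg: "nice \<omega> \<Longrightarrow> 0 \<le> u \<Longrightarrow> 0 \<le> D u \<omega>"
  using n_d_le[of \<omega> 0 u] n_d0[of \<omega>] by simp

text \<open>The limit is known immediately after \<open>D u\<close>, so right-continuity of the filtration \<open>\<F>\<close> applies.\<close>

lemma right_limit_F:
  assumes H: "adapted_on {0<..T} \<G> H" and u: "0 \<le> u"
    and lim: "AE \<omega> in M. D u \<omega> < T \<longrightarrow> ((\<lambda>r. H r \<omega>) \<longlongrightarrow> h \<omega>) (at_right (D u \<omega>))"
  shows "(\<lambda>\<omega>. if D u \<omega> < T then h \<omega> else 0) \<in> borel_measurable (\<F> u)"
proof (rule F_rightI[OF u])
  fix v assume uv: "u < v"
  define r where "r j i = real i * T / 2 ^ j" for j i :: nat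
  \<comment> \<open>The value of \<open>H\<close> at the first dyadic time strictly after D u,
    counted only if the inverse is at most v there; by \<open>G_F\<close> this is
    \<open>\<F> v\<close>-measurable.\<close>
  define Z where "Z j \<omega> = (\<Sum>i\<in>{1..2 ^ j}. if r j (i - 1) \<le> D u \<omega> \<and> D u \<omega> < r j i then (if E (r j i) \<omega> \<le> v then H (r j i) \<omega> else 0) else 0)" for j \<omega>
  define Q where "Q \<omega> \<longleftrightarrow> nice \<omega> \<and> (D u \<omega> < T \<longrightarrow> ((\<lambda>r. H r \<omega>) \<longlongrightarrow> h \<omega>) (at_right (D u \<omega>)))" for \<omega>
  have AQ: "AE \<omega> in M. Q \<omega>" using AE_nice lim by eventually_elim (simp add: Q_def)
  have Zm: "Z j \<in> borel_measurable (\<F> v)" for j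
    unfolding Z_def
  proof (rule borel_measurable_sum)
    fix i :: nat assume i: "i \<in> {1..2 ^ j}"
    have "real i \<le> 2 ^ j" using i by (metis atLeastAtMost_iff of_nat_le_iff of_nat_numeral of_nat_power)
    then have "r j i \<in> {0<..T}" using i T_pos by (auto simp: r_def field_simps)
    then have "H (r j i) \<in> borel_measurable (\<G> (r j i))" using H by (simp add: adapted_on_def)
    then have 1: "(\<lambda>\<omega>. if E (r j i) \<omega> \<le> v then H (r j i) \<omega> else 0) \<in> borel_measurable (\<F> v)" by (rule G_F)
    have 2: "D u \<in> borel_measurable (\<F> v)" using F_mono[OF D_F[OF u]] uv by simp
    show "(\<lambda>\<omega>. if r j (i - 1) \<le> D u \<omega> \<and> D u \<omega> < r j i then (if E (r j i) \<omega> \<le> v then H (r j i) \<omega> else 0) else 0) \<in> borel_measurable (\<F> v)"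
      by (rule measurable_If[OF 1]) (use 2 in measurable)
  qed
  have conv: "(\<lambda>j. Z j \<omega>) \<longlonglongrightarrow> (if D u \<omega> < T then h \<omega> else 0)" if Q: "Q \<omega>" for \<omega>
  proof (cases "D u \<omega> < T")
    case False
    have "Z j \<omega> = 0" for j
      unfolding Z_def
    proof (rule sum.neutral, rule ballI)
      fix i :: nat assume i: "i \<in> {1..2 ^ j}"
      have "real i \<le> 2 ^ j" using i by (metis atLeastAtMost_iff of_nat_le_iff of_nat_numeral of_nat_power)
      then have "r j i \<le> T" using T_pos by (auto simp: r_def field_simps)
      then show "(if r j (i - 1) \<le> D u \<omega> \<and> D u \<omega> < r j i then (if E (r j i) \<omega> \<le> v then H (r j i) \<omega> else 0) else 0) = 0"
        using False by simp
    qed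
    then show ?thesis using False by simp
  next
    case True
    have ni: "nice \<omega>" and hl: "((\<lambda>r. H r \<omega>) \<longlongrightarrow> h \<omega>) (at_right (D u \<omega>))" using Q True by (auto simp: Q_def)
    define x where "x = D u \<omega>"
    have x: "0 \<le> x" "x < T" "x < D v \<omega>" using True n_d_less[OF ni u uv] n_d_le[OF ni _ u] n_d0[OF ni] by (auto simp: x_def)
    \<comment> \<open>The dyadic interval containing x, closed on the left; its right end is
      strictly larger than x, as a limit from the right requires.\<close>
    define I where "I j = Suc (nat \<lfloor>x * 2 ^ j / T\<rfloor>)" for j
    have fl: "0 \<le> x * 2 ^ j / T" for j using x T_pos by simp
    have I1: "real (I j) - 1 \<le> x * 2 ^ j / T" "x * 2 ^ j / T < real (I j)" for j
      using fl[of j] unfolding I_def by (simp_all add: of_nat_nat) linarith+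
    have rI: "r j (I j - 1) \<le> x" "x < r j (I j)" "r j (I j) \<le> x + T * (1 / 2) ^ j" for j
      using I1[of j] T_pos by (auto simp: r_def I_def field_simps power_divide)
    have Ile: "I j \<in> {1..2 ^ j}" for j
    proof -
      have "x * 2 ^ j / T < 2 ^ j" using x T_pos by (simp add: field_simps)
      then have "nat \<lfloor>x * 2 ^ j / T\<rfloor> < 2 ^ j" using fl[of j] by (simp add: nat_less_iff floor_less_iff)
      then show ?thesis by (simp add: I_def Suc_le_eq)
    qed
    have Zeq: "Z j \<omega> = (if E (r j (I j)) \<omega> \<le> v then H (r j (I j)) \<omega> else 0)" for j
    proof -
      have uq: "i = I j" if "1 \<le> i" "r j (i - 1) \<le> x" "x < r j i" for i
      proof -
        have "real i - 1 \<le> x * 2 ^ j / T" "x * 2 ^ j / T < real i" using that T_pos by (auto simp: r_def field_simps of_nat_diff)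
        with I1[of j] have "real i < real (I j) + 1" "real (I j) < real i + 1" by linarith+
        then show ?thesis by linarith
      qed
      have "Z j \<omega> = (\<Sum>i\<in>{I j}. if E (r j i) \<omega> \<le> v then H (r j i) \<omega> else 0)"
        unfolding Z_def x_def[symmetric]
      proof (rule sum.mono_neutral_cong_right)
        show "\<forall>i\<in>{1..2 ^ j} - {I j}. (if r j (i - 1) \<le> x \<and> x < r j i then (if E (r j i) \<omega> \<le> v then H (r j i) \<omega> else 0) else 0) = 0"
          using uq by (metis DiffE atLeastAtMost_iff singletonI)
      qed (use Ile[of j] rI(1,2)[of j] in auto)
      then show ?thesis by simp
    qed
    have rlim: "(\<lambda>j. r j (I j)) \<longlonglongrightarrow> x"
    proof (rule tendsto_sandwich[of "\<lambda>_. x" _ _ "\<lambda>j. x + T * (1 / 2) ^ j"])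
      have "(\<lambda>j. x + T * (1 / 2) ^ j) \<longlonglongrightarrow> x + T * 0" by (intro tendsto_intros LIMSEQ_realpow_zero) auto
      then show "(\<lambda>j. x + T * (1 / 2) ^ j) \<longlonglongrightarrow> x" by simp
    qed (use rI in \<open>auto intro: always_eventually less_imp_le\<close>)
    then have "filterlim (\<lambda>j. r j (I j)) (at_right x) sequentially"
      unfolding filterlim_at using rI(2) by (auto intro!: always_eventually simp: less_imp_neq[symmetric])
    then have "(\<lambda>j. H (r j (I j)) \<omega>) \<longlonglongrightarrow> h \<omega>" using hl unfolding x_def[symmetric] by (rule filterlim_compose[rotated])
    \<comment> \<open>The grid times eventually fall below D v, where the inverse is at most v, so
      the cut-off in \<open>Z\<close> becomes inactive.\<close>
    moreover have "\<forall>\<^sub>F j in sequentially. H (r j (I j)) \<omega> = Z j \<omega>"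
      using order_tendstoD(2)[OF rlim x(3)]
    proof eventually_elim
      case (elim j)
      have "E (r j (I j)) \<omega> \<le> v" using n_E_le[OF ni _ elim] u uv by simp
      then show ?case by (simp add: Zeq)
    qed
    ultimately show ?thesis using True by (simp add: Lim_transform_eventually)
  qed
  have "(\<lambda>\<omega>. if Q \<omega> then (if D u \<omega> < T then h \<omega> else 0) else 0) \<in> borel_measurable (\<F> v)"
  proof (rule borel_measurable_LIMSEQ_real)
    show "(\<lambda>\<omega>. if Q \<omega> then Z j \<omega> else 0) \<in> borel_measurable (\<F> v)" for j
      by (rule F_AE_cong[OF Zm[of j]]) (use AQ in \<open>auto elim: AE_mp\<close>)
    show "(\<lambda>j. if Q \<omega> then Z j \<omega> else 0) \<longlonglongrightarrow> (if Q \<omega> then (if D u \<omega> < T then h \<omega> else 0) else 0)" for \<omega>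
      using conv[of \<omega>] by auto
  qed
  then show "(\<lambda>\<omega>. if D u \<omega> < T then h \<omega> else 0) \<in> borel_measurable (\<F> v)"
    by (rule F_AE_cong) (use AQ in \<open>auto elim: AE_mp\<close>)
qed

text \<open>\<open>simple_predictable\<close> demands order and nonnegativity at every \<omega>, not
  just almost surely; hence the value 0 on the exceptional null set.\<close>

definition D' :: "real \<Rightarrow> 'a \<Rightarrow> real" where "D' u \<omega> = (if nice \<omega> then D u \<omega> else 0)"

lemma D'_F: "0 \<le> u \<Longrightarrow> D' u \<in> borel_measurable (\<F> u)"
  by (rule F_AE_cong[OF D_F]) (use AE_nice in \<open>auto simp: D'_def elim: AE_mp\<close>)

text \<open>A nice path with D u <= t has u <= E t. Together with E t <= v this forces u <= v up to
  a null set, and then the whole event is known at v. In effect \<open>\<F> u\<close> is contained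
  in the \<sigma>-algebra of \<open>\<G>\<close> at the stopping time \<open>D' u\<close>.\<close>

lemma D'_event_G:
  assumes u: "0 \<le> u" and A: "A \<in> sets (\<F> u)"
  shows "{\<omega>\<in>A. D' u \<omega> \<le> t} \<in> sets (\<G> t)"
  unfolding G_sets
proof (intro CollectI allI)
  fix v
  have As: "A \<subseteq> space M" using sets.sets_into_space[OF A] by simp
  show "{\<omega> \<in> {\<omega>\<in>A. D' u \<omega> \<le> t}. E t \<omega> \<le> v} \<in> sets (\<F> v)"
  proof (cases "u \<le> v")
    case True
    have "A \<in> sets (\<F> v)" using A F_sets_mono[OF True] by auto
    moreover have "{\<omega>\<in>space M. D' u \<omega> \<le> t} \<in> sets (\<F> v)"
      using borel_measurable_le[OF F_mono[OF D'_F[OF u] True] borel_measurable_const[of t]] by simp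
    ultimately have "A \<inter> {\<omega>\<in>space M. D' u \<omega> \<le> t} \<inter> {\<omega>\<in>space M. E t \<omega> \<le> v} \<in> sets (\<F> v)" using E_le_F by auto
    moreover have "A \<inter> {\<omega>\<in>space M. D' u \<omega> \<le> t} \<inter> {\<omega>\<in>space M. E t \<omega> \<le> v} = {\<omega> \<in> {\<omega>\<in>A. D' u \<omega> \<le> t}. E t \<omega> \<le> v}" using As by auto
    ultimately show ?thesis by simp
  next
    case False
    show ?thesis
    proof (rule F_AE_set[of "{}"])
      show "AE \<omega> in M. \<omega> \<in> {} \<longleftrightarrow> \<omega> \<in> {\<omega> \<in> {\<omega> \<in> A. D' u \<omega> \<le> t}. E t \<omega> \<le> v}"
        using AE_nice
      proof eventually_elim
        case (elim \<omega>)
        then show ?case using n_le_E[OF elim u, of t] False by (auto simp: D'_def)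
      qed
    qed (use As in auto)
  qed
qed

lemma D'_stop: "0 \<le> u \<Longrightarrow> stopping_time \<G> (D' u)"
proof (rule stopping_timeI)
  fix t assume "0 \<le> u"
  then have "{\<omega>\<in>space M. D' u \<omega> \<le> t} \<in> sets (\<G> t)" using D'_event_G[of u "space M" t] sets.top[of "\<F> u"] by simp
  then show "Measurable.pred (\<G> t) (\<lambda>\<omega>. D' u \<omega> \<le> t)" by (simp add: pred_def)
qed

lemma grid_simple_predictable:
  assumes u: "\<And>i. 0 \<le> u i" "\<And>i. u i \<le> u (Suc i)" and K: "\<And>i. K i \<in> borel_measurable (\<F> (u i))"
  shows "simple_predictable M \<G> (n, \<lambda>i. D' (u i), K)"
  unfolding simple_predictable_def prod.case
proof (intro conjI allI impI ballI)
  show "stopping_time \<G> (D' (u i))" for i by (rule D'_stop[OF u(1)])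
  show "0 \<le> D' (u i) \<omega>" for i \<omega> using n_d_le[of \<omega> 0 "u i"] n_d0[of \<omega>] u(1)[of i] by (auto simp: D'_def)
  show "D' (u i) \<omega> \<le> D' (u (Suc i)) \<omega>" for i \<omega> using n_d_le[of \<omega> "u i" "u (Suc i)"] u by (auto simp: D'_def)
  show "K i \<in> borel_measurable (filtration.pre_sigma (space M) \<G> (D' (u i)))" for i
  proof (rule measurableI)
    fix S :: "real set" assume S: "S \<in> sets borel"
    have A: "K i -` S \<inter> space M \<in> sets (\<F> (u i))" using measurable_sets[OF K S, of i] by simp
    show "K i -` S \<inter> space (filtration.pre_sigma (space M) \<G> (D' (u i))) \<in> sets (filtration.pre_sigma (space M) \<G> (D' (u i)))"
      unfolding filtration.space_pre_sigma[OF G_filtration]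
      by (rule filtration.sets_pre_sigmaI[OF G_filtration D'_stop[OF u(1)]]) (rule D'_event_G[OF u(1) A])
  qed simp
qed

section \<open>Integrals against E and B o E: constancy and Riemann sums\<close>

lemma nice_null: "{\<omega>\<in>space M. \<not> nice \<omega>} \<in> null_sets M"
  using AE_nice by (simp add: AE_null)

lemma driver_flat:
  assumes "nice \<omega>" "E s \<omega> = E t \<omega>"
  shows "driver B E j (min s x) \<omega> = driver B E j (min t x) \<omega>"
proof -
  have "E (min s x) \<omega> = E (min t x) \<omega>"
  proof -
    have *: "E (min s x) \<omega> = E (min t x) \<omega>" if "E s \<omega> = E t \<omega>" "s \<le> t" for s t
    proof (cases "x \<le> s \<or> t \<le> x")
      case True
      then show ?thesis using that by (auto simp: min_def)
    next
      case False
      then have "E s \<omega> \<le> E x \<omega>" "E x \<omega> \<le> E t \<omega>" using n_E_mono[OF assms(1)] by auto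
      then show ?thesis using that False by (simp add: min_def)
    qed
    show ?thesis
    proof (cases "s \<le> t")
      case True
      then show ?thesis by (rule *[OF assms(2)])
    next
      case False
      then show ?thesis by (intro *[OF assms(2)[symmetric], symmetric]) simp
    qed
  qed
  then show ?thesis by (simp add: driver_def)
qed

text \<open>Simple integrals are constant where \<open>E\<close> is, since both drivers are
  functions of \<open>E\<close>, and a uniform limit in probability inherits this.\<close>

lemma integral_flat:
  assumes "stoch_integral M \<G> T (driver B E j) H Y"
  shows "AE \<omega> in M. \<forall>s\<in>{0..T}. \<forall>t\<in>{0..T}. E s \<omega> = E t \<omega> \<longrightarrow> Y s \<omega> = Y t \<omega>"
proof -
  obtain \<sigma> where \<sigma>: "uniform_conv_in_prob M {0..T} (\<lambda>k. simple_integral (driver B E j) (\<sigma> k)) Y"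
    using assms unfolding stoch_integral_def by blast
  have "AE \<omega> in M. \<forall>s\<in>{0..T}. \<forall>t\<in>{0..T}. E s \<omega> = E t \<omega> \<longrightarrow> \<bar>Y s \<omega> - Y t \<omega>\<bar> \<le> 2 * inverse (real (Suc n))" for n
  proof (rule AE_of_small)
    fix \<kappa> :: real assume "0 < \<kappa>"
    then obtain k A where A: "A \<in> sets M" "measure M A < \<kappa>"
      "\<And>\<omega> t. \<omega> \<in> space M - A \<Longrightarrow> t \<in> {0..T} \<Longrightarrow> \<bar>simple_integral (driver B E j) (\<sigma> k) t \<omega> - Y t \<omega>\<bar> \<le> inverse (real (Suc n))"
    proof -
      have "0 < inverse (real (Suc n))" by simp
      with \<sigma> \<open>0 < \<kappa>\<close> obtain k0 where "\<forall>k\<ge>k0. \<exists>A\<in>sets M. measure M A < \<kappa> \<and>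
          (\<forall>\<omega>\<in>space M - A. \<forall>t\<in>{0..T}. \<bar>simple_integral (driver B E j) (\<sigma> k) t \<omega> - Y t \<omega>\<bar> \<le> inverse (real (Suc n)))"
        unfolding uniform_conv_in_prob_def by meson
      then show ?thesis using that by blast
    qed
    let ?N = "{\<omega>\<in>space M. \<not> nice \<omega>}"
    show "\<exists>A\<in>sets M. measure M A < \<kappa> \<and> (\<forall>\<omega>\<in>space M - A. \<forall>s\<in>{0..T}. \<forall>t\<in>{0..T}. E s \<omega> = E t \<omega> \<longrightarrow> \<bar>Y s \<omega> - Y t \<omega>\<bar> \<le> 2 * inverse (real (Suc n)))"
    proof (intro bexI[of _ "A \<union> ?N"] conjI ballI impI)
      show "A \<union> ?N \<in> sets M" using A nice_null by auto
      show "measure M (A \<union> ?N) < \<kappa>" using A nice_null by (simp add: measure_Un_null_set)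
      fix \<omega> s t assume \<omega>: "\<omega> \<in> space M - (A \<union> ?N)" and st: "s \<in> {0..T}" "t \<in> {0..T}" and e: "E s \<omega> = E t \<omega>"
      have ni: "nice \<omega>" using \<omega> by auto
      have "simple_integral (driver B E j) (\<sigma> k) s \<omega> = simple_integral (driver B E j) (\<sigma> k) t \<omega>"
        unfolding simple_integral_def by (auto simp: case_prod_unfold driver_flat[OF ni e])
      then show "\<bar>Y s \<omega> - Y t \<omega>\<bar> \<le> 2 * inverse (real (Suc n))"
        using A(3)[of \<omega> s] A(3)[of \<omega> t] \<omega> st by auto
    qed
  qed
  then have "AE \<omega> in M. \<forall>n. \<forall>s\<in>{0..T}. \<forall>t\<in>{0..T}. E s \<omega> = E t \<omega> \<longrightarrow> \<bar>Y s \<omega> - Y t \<omega>\<bar> \<le> 2 * inverse (real (Suc n))"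
    by (simp only: AE_all_countable) auto
  then show ?thesis
  proof eventually_elim
    case (elim \<omega>)
    show ?case
    proof (intro ballI impI)
      fix s t assume st: "s \<in> {0..T}" "t \<in> {0..T}" "E s \<omega> = E t \<omega>"
      have "\<bar>Y s \<omega> - Y t \<omega>\<bar> \<le> 0"
      proof (rule field_le_epsilon)
        fix e :: real assume "0 < e"
        then obtain n where n: "inverse (real (Suc n)) < e / 2" using reals_Archimedean[of "e / 2"] by auto
        have "\<bar>Y s \<omega> - Y t \<omega>\<bar> \<le> 2 * inverse (real (Suc n))" using elim st by blast
        then show "\<bar>Y s \<omega> - Y t \<omega>\<bar> \<le> 0 + e" using n by linarith
      qed
      then show "Y s \<omega> = Y t \<omega>" by simp
    qed
  qed
qed

text \<open>Grid points are taken on the scale of \<open>E\<close>; evaluated at \<open>D u\<close> with \<open>u\<close> on the grid the simple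
  integral has no boundary term.\<close>

lemma riemann_sums:
  fixes \<delta> :: real and N :: nat
  defines "ep \<equiv> \<lambda>p. \<delta> / 2 ^ p"
  assumes \<delta>: "0 < \<delta>" and SI: "stoch_integral M \<G> T (driver B E j) H Y"
    and K: "\<And>u. 0 \<le> u \<Longrightarrow> K u \<in> borel_measurable (\<F> u)"
    and app: "AE \<omega> in M. \<forall>\<eta>>0. \<exists>p0. \<forall>p\<ge>p0. \<forall>l. \<forall>t\<in>{0<..T}. D (real l * ep p) \<omega> < t \<longrightarrow> t \<le> D (real (Suc l) * ep p) \<omega>
        \<longrightarrow> \<bar>H t \<omega> - K (real l * ep p) \<omega>\<bar> \<le> \<eta>"
  shows "usmall M (\<lambda>p \<omega>. {i. i \<le> N * 2 ^ p \<and> D (real i * ep p) \<omega> < T})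
    (\<lambda>p i \<omega>. (\<Sum>l<i. K (real l * ep p) \<omega> * (if j = 0 then ep p else B (real (Suc l) * ep p) \<omega> - B (real l * ep p) \<omega>))
       - Y (D (real i * ep p) \<omega>) \<omega>)"
proof -
  have ep: "0 < ep p" for p using \<delta> by (simp add: ep_def)
  have g0: "0 \<le> real l * ep p" for l p using ep[of p] by simp
  have gS: "real l * ep p < real (Suc l) * ep p" for l p using ep[of p] by simp
  have gmono: "real l * ep p \<le> real l' * ep p" if "l \<le> l'" for l l' p using that ep[of p] by simp
  \<comment> \<open>4^p points of mesh \<delta> / 2^p reach up to \<delta> 2^p, so the grids both
    refine and exhaust the half-line.\<close>
  define \<sigma> where "\<sigma> p = ((4::nat) ^ p, \<lambda>i. D' (real i * ep p), \<lambda>i. K (real i * ep p))" for p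
  have sp: "simple_predictable M \<G> (\<sigma> p)" for p
    unfolding \<sigma>_def by (rule grid_simple_predictable[where u="\<lambda>i. real i * ep p", OF g0 less_imp_le[OF gS] K[OF g0]])
  have lc: "AE \<omega> in M. \<forall>t\<in>{0<..T}. ((\<lambda>r. H r \<omega>) \<longlongrightarrow> H t \<omega>) (at_left t)"
    using SI unfolding stoch_integral_def by (elim conjE, elim AE_mp) auto
  have HM: "H t \<in> borel_measurable M" if "t \<in> {0<..T}" for t
    using SI that G_M unfolding stoch_integral_def adapted_on_def by blast
  define nz where "nz = {\<omega>\<in>space M. \<not> (nice \<omega> \<and> (\<forall>t\<in>{0<..T}. ((\<lambda>r. H r \<omega>) \<longlongrightarrow> H t \<omega>) (at_left t)))}"
  have nz: "nz \<in> null_sets M" unfolding nz_def using AE_nice lc by (subst AE_null[symmetric]) auto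
  have big: "\<exists>p0. \<forall>p\<ge>p0. C \<le> real (4 ^ p) * ep p" for C
  proof -
    obtain p0 where p0: "C / \<delta> < 2 ^ p0" using real_arch_pow[of 2 "C / \<delta>"] by auto
    show ?thesis
    proof (intro exI[of _ p0] allI impI)
      fix p assume "p0 \<le> p"
      then have "(2::real) ^ p0 \<le> 2 ^ p" by (intro power_increasing) auto
      then have "\<delta> * 2 ^ p0 \<le> \<delta> * 2 ^ p" using \<delta> by (intro mult_left_mono) auto
      moreover have "C < \<delta> * 2 ^ p0" using p0 \<delta> by (simp add: field_simps)
      ultimately have "C \<le> \<delta> * 2 ^ p" by linarith
      also have "\<delta> * 2 ^ p = real (4 ^ p) * ep p"
      proof -
        have "(4::real) ^ p = 2 ^ p * 2 ^ p" by (simp flip: power_mult_distrib)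
        then show ?thesis by (simp add: ep_def)
      qed
      finally show "C \<le> real (4 ^ p) * ep p" .
    qed
  qed
  have ucp: "uniform_conv_in_prob M {0<..T} (\<lambda>p. simple_process (\<sigma> p)) H"
    unfolding uniform_conv_in_prob_def
  proof (intro allI impI)
    fix \<eta> \<kappa> :: real assume pos: "0 < \<eta>" "0 < \<kappa>"
    \<comment> \<open>Paths on which the grid ends before \<open>T\<close>; the simple process is 0
      on what is left.\<close>
    define B1 where "B1 p = {\<omega>\<in>space M. D (real (4 ^ p) * ep p) \<omega> < T}" for p
    have B1m: "B1 p \<in> sets M" for p unfolding B1_def using D_M[OF g0, of "4 ^ p" p] by measurable
    have "AE \<omega> in M. \<exists>p0. \<forall>p\<ge>p0. \<omega> \<notin> B1 p"
      using AE_nice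
    proof eventually_elim
      case (elim \<omega>)
      obtain u where u: "0 \<le> u" "T < D u \<omega>" using clock_path.unb[OF nice_clock[OF elim]] by blast
      obtain p0 where p0: "\<And>p. p \<ge> p0 \<Longrightarrow> u \<le> real (4 ^ p) * ep p" using big by blast
      have "\<omega> \<notin> B1 p" if "p \<ge> p0" for p using n_d_le[OF elim u(1) p0[OF that]] u by (auto simp: B1_def)
      then show ?case by blast
    qed
    from prob_eventually_small[OF B1m this, of "\<kappa> / 2"] pos obtain p1 where p1: "\<And>p. p \<ge> p1 \<Longrightarrow> measure M (B1 p) < \<kappa> / 2" by auto
    \<comment> \<open>Violations at rational times only, which makes the set measurable.
      Left-continuity of \<open>H\<close> turns a violation at any time into one at a rational time
      of the same grid interval.\<close>
    define B2 where "B2 p = (\<Union>l\<in>{..<4 ^ p}. \<Union>q\<in>\<rat> \<inter> {0<..T}. {\<omega>\<in>space M. D (real l * ep p) \<omega> < q \<and> q \<le> D (real (Suc l) * ep p) \<omega> \<and> \<eta> < \<bar>H q \<omega> - K (real l * ep p) \<omega>\<bar>})" for p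
    have B2m: "B2 p \<in> sets M" for p
      unfolding B2_def
    proof (intro sets.countable_UN'' countable_Int1 countable_rat)
      fix l :: nat and q assume "q \<in> \<rat> \<inter> {0<..T}"
      then have "H q \<in> borel_measurable M" "K (real l * ep p) \<in> borel_measurable M" "D (real l * ep p) \<in> borel_measurable M"
          "D (real (Suc l) * ep p) \<in> borel_measurable M"
        using HM F_M[OF K[OF g0]] D_M[OF g0] by blast+
      then show "{\<omega>\<in>space M. D (real l * ep p) \<omega> < q \<and> q \<le> D (real (Suc l) * ep p) \<omega> \<and> \<eta> < \<bar>H q \<omega> - K (real l * ep p) \<omega>\<bar>} \<in> sets M"
        by measurable
    qed auto
    have "AE \<omega> in M. \<exists>p0. \<forall>p\<ge>p0. \<omega> \<notin> B2 p"
      using app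
    proof eventually_elim
      case (elim \<omega>)
      obtain p0 where p0: "\<And>p l t. p \<ge> p0 \<Longrightarrow> t \<in> {0<..T} \<Longrightarrow> D (real l * ep p) \<omega> < t \<Longrightarrow> t \<le> D (real (Suc l) * ep p) \<omega>
        \<Longrightarrow> \<bar>H t \<omega> - K (real l * ep p) \<omega>\<bar> \<le> \<eta>" using elim pos(1) by meson
      have "\<omega> \<notin> B2 p" if "p \<ge> p0" for p
      proof
        assume "\<omega> \<in> B2 p"
        then obtain l q where "q \<in> {0<..T}" "D (real l * ep p) \<omega> < q" "q \<le> D (real (Suc l) * ep p) \<omega>" "\<eta> < \<bar>H q \<omega> - K (real l * ep p) \<omega>\<bar>"
          unfolding B2_def by blast
        then show False using p0[OF that, of q l] by simp
      qed
      then show ?case by blast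
    qed
    from prob_eventually_small[OF B2m this, of "\<kappa> / 2"] pos obtain p2 where p2: "\<And>p. p \<ge> p2 \<Longrightarrow> measure M (B2 p) < \<kappa> / 2" by auto
    show "\<exists>k0. \<forall>k\<ge>k0. \<exists>A\<in>sets M. measure M A < \<kappa> \<and> (\<forall>\<omega>\<in>space M - A. \<forall>t\<in>{0<..T}. \<bar>simple_process (\<sigma> k) t \<omega> - H t \<omega>\<bar> \<le> \<eta>)"
    proof (intro exI[of _ "max p1 p2"] allI impI)
      fix p assume p: "max p1 p2 \<le> p"
      have "measure M (B1 p \<union> B2 p \<union> nz) = measure M (B1 p \<union> B2 p)" using B1m B2m nz by (simp add: measure_Un_null_set)
      also have "\<dots> \<le> measure M (B1 p) + measure M (B2 p)" using B1m B2m by (rule measure_Un_le)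
      finally have small: "measure M (B1 p \<union> B2 p \<union> nz) < \<kappa>" using p1[of p] p2[of p] p by simp
      have "\<bar>simple_process (\<sigma> p) t \<omega> - H t \<omega>\<bar> \<le> \<eta>" if \<omega>: "\<omega> \<in> space M - (B1 p \<union> B2 p \<union> nz)" and t: "t \<in> {0<..T}" for \<omega> t
      proof -
        have ni: "nice \<omega>" and hl: "((\<lambda>r. H r \<omega>) \<longlongrightarrow> H t \<omega>) (at_left t)" using \<omega> t by (auto simp: nz_def)
        let ?S = "\<lambda>i. D (real i * ep p) \<omega>"
        have top: "t \<le> ?S (4 ^ p)" using \<omega> t by (auto simp: B1_def)
        \<comment> \<open>The grid interval containing t, open on the left, ends at the first grid
          value that is not below t.\<close>
        define i where "i = (LEAST i. t \<le> ?S i)"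
        have i: "t \<le> ?S i" unfolding i_def using top by (rule LeastI)
        have i0: "i \<noteq> 0" using i t n_d0[OF ni] by (cases i) auto
        then obtain l where l: "i = Suc l" by (cases i) auto
        have lt: "?S l < t" using not_less_Least[of l "\<lambda>i. t \<le> ?S i"] l unfolding i_def by auto
        have l4: "l < 4 ^ p" using Least_le[of "\<lambda>i. t \<le> ?S i", OF top] l unfolding i_def[symmetric] by simp
        have Sm: "?S a \<le> ?S b" if "a \<le> b" for a b using n_d_le[OF ni g0 gmono[OF that]] .
        have "simple_process (\<sigma> p) t \<omega> = (\<Sum>i<4 ^ p. K (real i * ep p) \<omega> * indicator {?S i<..?S (Suc i)} t)"
          using ni by (simp add: simple_process_def \<sigma>_def D'_def)
        also have "\<dots> = (\<Sum>i\<in>{l}. K (real i * ep p) \<omega>)"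
        proof (rule sum.mono_neutral_cong_right)
          show "\<forall>i'\<in>{..<4 ^ p} - {l}. K (real i' * ep p) \<omega> * indicator {?S i'<..?S (Suc i')} t = 0"
          proof
            fix i' assume "i' \<in> {..<4 ^ p} - {l}"
            then have "i' < l \<or> l < i'" by auto
            then have "t \<notin> {?S i'<..?S (Suc i')}"
              using Sm[of "Suc i'" l] Sm[of "Suc l" i'] lt i l by auto
            then show "K (real i' * ep p) \<omega> * indicator {?S i'<..?S (Suc i')} t = 0" by simp
          qed
        qed (use l4 lt i l in \<open>auto simp: indicator_def\<close>)
        finally have spv: "simple_process (\<sigma> p) t \<omega> = K (real l * ep p) \<omega>" by simp
        show ?thesis
        proof (rule ccontr)
          assume "\<not> ?thesis"
          then have gt: "\<eta> < \<bar>H t \<omega> - K (real l * ep p) \<omega>\<bar>" unfolding spv by (simp add: abs_minus_commute)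
          have "((\<lambda>r. \<bar>H r \<omega> - K (real l * ep p) \<omega>\<bar>) \<longlongrightarrow> \<bar>H t \<omega> - K (real l * ep p) \<omega>\<bar>) (at_left t)"
            by (intro tendsto_intros hl)
          from order_tendstoD(1)[OF this gt] obtain r0 where r0: "r0 < t" "\<And>r. r0 < r \<Longrightarrow> r < t \<Longrightarrow> \<eta> < \<bar>H r \<omega> - K (real l * ep p) \<omega>\<bar>"
            using lt by (subst (asm) eventually_at_left[of "?S l"]) auto
          have S0: "0 \<le> ?S l" using n_D_nonneg[OF ni g0] by simp
          obtain q where q: "q \<in> \<rat>" "max r0 (?S l) < q" "q < t" using Rats_dense_in_real[of "max r0 (?S l)" t] r0(1) lt by auto
          have 1: "\<omega> \<in> space M" "?S l < q" "q \<le> D (real (Suc l) * ep p) \<omega>" "\<eta> < \<bar>H q \<omega> - K (real l * ep p) \<omega>\<bar>"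
            using \<omega> q r0 i l by auto
          have "l \<in> {..<4 ^ p}" "q \<in> \<rat> \<inter> {0<..T}" using l4 q S0 t by auto
          then have "\<omega> \<in> B2 p" unfolding B2_def using 1 by blast
          then show False using \<omega> by simp
        qed
      qed
      then show "\<exists>A\<in>sets M. measure M A < \<kappa> \<and> (\<forall>\<omega>\<in>space M - A. \<forall>t\<in>{0<..T}. \<bar>simple_process (\<sigma> p) t \<omega> - H t \<omega>\<bar> \<le> \<eta>)"
        using small B1m B2m nz by (intro bexI[of _ "B1 p \<union> B2 p \<union> nz"]) auto
    qed
  qed
  have conv: "uniform_conv_in_prob M {0..T} (\<lambda>k. simple_integral (driver B E j) (\<sigma> k)) Y"
    using SI sp ucp unfolding stoch_integral_def by blast
  show ?thesis
    unfolding usmall_def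
  proof (intro allI impI)
    fix \<eta> \<kappa> :: real assume "0 < \<eta>" "0 < \<kappa>"
    then obtain k0 where k0: "\<And>k. k \<ge> k0 \<Longrightarrow> \<exists>A\<in>sets M. measure M A < \<kappa> \<and> (\<forall>\<omega>\<in>space M - A. \<forall>t\<in>{0..T}. \<bar>simple_integral (driver B E j) (\<sigma> k) t \<omega> - Y t \<omega>\<bar> \<le> \<eta>)"
      using conv unfolding uniform_conv_in_prob_def by meson
    let ?N = "{\<omega>\<in>space M. \<not> nice \<omega>}"
    show "\<exists>p0. \<forall>p\<ge>p0. \<exists>A\<in>sets M. measure M A < \<kappa> \<and> (\<forall>\<omega>\<in>space M - A. \<forall>i\<in>{i. i \<le> N * 2 ^ p \<and> D (real i * ep p) \<omega> < T}.
       \<bar>(\<Sum>l<i. K (real l * ep p) \<omega> * (if j = 0 then ep p else B (real (Suc l) * ep p) \<omega> - B (real l * ep p) \<omega>)) - Y (D (real i * ep p) \<omega>) \<omega>\<bar> \<le> \<eta>)"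
    \<comment> \<open>p >= N gives N <= 2^p, so the N 2^p points in question are among the 4^p
      points used.\<close>
    proof (intro exI[of _ "max k0 N"] allI impI)
      fix p assume p: "max k0 N \<le> p"
      then obtain A where A: "A \<in> sets M" "measure M A < \<kappa>" "\<And>\<omega> t. \<omega> \<in> space M - A \<Longrightarrow> t \<in> {0..T} \<Longrightarrow> \<bar>simple_integral (driver B E j) (\<sigma> p) t \<omega> - Y t \<omega>\<bar> \<le> \<eta>"
        using k0[of p] by auto
      have "N \<le> 2 ^ p" using p less_exp[of p] by linarith
      then have N4: "N * 2 ^ p \<le> 4 ^ p" using mult_le_mono1[of N "2 ^ p" "2 ^ p"] by (simp flip: power_mult_distrib)
      have "\<bar>(\<Sum>l<i. K (real l * ep p) \<omega> * (if j = 0 then ep p else B (real (Suc l) * ep p) \<omega> - B (real l * ep p) \<omega>)) - Y (D (real i * ep p) \<omega>) \<omega>\<bar> \<le> \<eta>"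
        if \<omega>: "\<omega> \<in> space M - (A \<union> ?N)" and i: "i \<le> N * 2 ^ p" "D (real i * ep p) \<omega> < T" for \<omega> i
      proof -
        have ni: "nice \<omega>" using \<omega> by auto
        let ?S = "\<lambda>i. D (real i * ep p) \<omega>"
        have Sm: "?S a \<le> ?S b" if "a \<le> b" for a b using n_d_le[OF ni g0 gmono[OF that]] .
        have "simple_integral (driver B E j) (\<sigma> p) (?S i) \<omega>
          = (\<Sum>l<4 ^ p. K (real l * ep p) \<omega> * (driver B E j (min (?S i) (?S (Suc l))) \<omega> - driver B E j (min (?S i) (?S l)) \<omega>))"
          using ni by (simp add: simple_integral_def \<sigma>_def D'_def)
        \<comment> \<open>Stopping at the i-th grid value cuts the sum off at i, and E (D u) = u
          turns increments of the drivers into those of time and of \<open>B\<close>.\<close>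
        also have "\<dots> = (\<Sum>l<i. K (real l * ep p) \<omega> * (if j = 0 then ep p else B (real (Suc l) * ep p) \<omega> - B (real l * ep p) \<omega>))"
        proof (rule sum.mono_neutral_cong_right)
          show "\<forall>l\<in>{..<4 ^ p} - {..<i}. K (real l * ep p) \<omega> * (driver B E j (min (?S i) (?S (Suc l))) \<omega> - driver B E j (min (?S i) (?S l)) \<omega>) = 0"
          proof
            fix l assume "l \<in> {..<4 ^ p} - {..<i}"
            then have "i \<le> Suc l" "i \<le> l" by auto
            then have "min (?S i) (?S (Suc l)) = ?S i" "min (?S i) (?S l) = ?S i" by (blast intro: min_absorb1[OF Sm])+
            then show "K (real l * ep p) \<omega> * (driver B E j (min (?S i) (?S (Suc l))) \<omega> - driver B E j (min (?S i) (?S l)) \<omega>) = 0"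
              by (simp only:) simp
          qed
          fix l assume "l \<in> {..<i}"
          then have "Suc l \<le> i" "l \<le> i" by auto
          then have "min (?S i) (?S (Suc l)) = ?S (Suc l)" "min (?S i) (?S l) = ?S l" by (blast intro: min_absorb2[OF Sm])+
          moreover have "E (?S l) \<omega> = real l * ep p" for l by (rule n_E_D[OF ni g0])
          ultimately show "K (real l * ep p) \<omega> * (driver B E j (min (?S i) (?S (Suc l))) \<omega> - driver B E j (min (?S i) (?S l)) \<omega>)
            = K (real l * ep p) \<omega> * (if j = 0 then ep p else B (real (Suc l) * ep p) \<omega> - B (real l * ep p) \<omega>)"
          proof -
            assume *: "min (?S i) (?S (Suc l)) = ?S (Suc l)" "min (?S i) (?S l) = ?S l" "\<And>l. E (?S l) \<omega> = real l * ep p"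
            have d: "real (Suc l) * ep p - real l * ep p = ep p" by (simp add: algebra_simps)
            show ?thesis unfolding *(1,2) driver_def by (cases "j = 0") (simp_all only: if_True if_False simp_thms refl *(3) d)
          qed
        qed (use i N4 in auto)
        finally have eq: "simple_integral (driver B E j) (\<sigma> p) (?S i) \<omega> = \<dots>" .
        have "?S i \<in> {0..T}" using i n_D_nonneg[OF ni g0] by auto
        then show ?thesis using A(3)[of \<omega> "?S i"] \<omega> unfolding eq by auto
      qed
      then show "\<exists>A\<in>sets M. measure M A < \<kappa> \<and> (\<forall>\<omega>\<in>space M - A. \<forall>i\<in>{i. i \<le> N * 2 ^ p \<and> D (real i * ep p) \<omega> < T}.
       \<bar>(\<Sum>l<i. K (real l * ep p) \<omega> * (if j = 0 then ep p else B (real (Suc l) * ep p) \<omega> - B (real l * ep p) \<omega>)) - Y (D (real i * ep p) \<omega>) \<omega>\<bar> \<le> \<eta>)"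
        using A nice_null by (intro bexI[of _ "A \<union> ?N"]) (auto simp: measure_Un_null_set)
    qed
  qed
qed

end

section \<open>Limits of the discrete processes\<close>

context taylor_walk
begin

text \<open>A process satisfying the Euler recursion up to a defect of at most \<eta> stays within a
  multiple of \<eta> of the Euler process in mean square. The indicator records that the defect has
  been small so far and that the decreasing event \<open>P\<close> holds; it is adapted and may
  multiply the summands.\<close>

lemma euler_stability:
  assumes y: "\<And>l. l \<le> L * m \<Longrightarrow> y l \<in> borel_measurable (\<H> l)"
    and P: "\<And>l. l \<le> L * m \<Longrightarrow> Measurable.pred (\<H> l) (P l)" "\<And>l \<omega>. P (Suc l) \<omega> \<Longrightarrow> P l \<omega>"
    and \<eta>: "0 \<le> \<eta>"
  defines "err \<equiv> \<lambda>i \<omega>. y i \<omega> - x0 - (\<Sum>l<i. f [0] (tm l) (y l \<omega>) * \<epsilon>) - (\<Sum>l<i. f [1] (tm l) (y l \<omega>) * \<xi> l \<omega>)"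
  shows "sup2 M {..L * m} (\<lambda>i \<omega>. of_bool (P i \<omega> \<and> (\<forall>j\<le>i. \<bar>err j \<omega>\<bar> \<le> \<eta>)) * (y i \<omega> - euler i \<omega>))
    \<le> ennreal (2 * \<eta>\<^sup>2 * exp (4 * (U + 8) * h\<^sup>2 * U))"
proof -
  define \<theta> where "\<theta> i \<omega> = (of_bool (P i \<omega> \<and> (\<forall>j\<le>i. \<bar>err j \<omega>\<bar> \<le> \<eta>)) :: real)" for i \<omega>
  define Df where "Df j l \<omega> = f [j] (tm l) (y l \<omega>) - f [j] (tm l) (euler l \<omega>)" for j l \<omega>
  have fm: "(\<lambda>\<omega>. f [j] (tm l) (y l \<omega>)) \<in> borel_measurable (\<H> l)" if "j = 0 \<or> j = 1" "l \<le> L * m" for j l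
    using that A_base by (intro f_comp_meas y) auto
  have errm: "err i \<in> borel_measurable (\<H> i)" if i: "i \<le> L * m" for i
    unfolding err_def
  proof (intro borel_measurable_diff borel_measurable_sum borel_measurable_times borel_measurable_const y i)
    fix l assume l: "l \<in> {..<i}"
    show "(\<lambda>\<omega>. f [0] (tm l) (y l \<omega>)) \<in> borel_measurable (\<H> i)" "(\<lambda>\<omega>. f [1] (tm l) (y l \<omega>)) \<in> borel_measurable (\<H> i)"
      using l i by (auto intro!: H_meas_mono[OF fm])
    show "\<xi> l \<in> borel_measurable (\<H> i)" using l by (intro H_meas_mono[OF xi_meas]) auto
  qed
  have \<theta>m: "\<theta> i \<in> borel_measurable (\<H> i)" if i: "i \<le> L * m" for i
  proof -
    have "Measurable.pred (\<H> i) (\<lambda>\<omega>. \<bar>err j \<omega>\<bar> \<le> \<eta>)" if "j \<le> i" for j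
    proof -
      have "err j \<in> borel_measurable (\<H> i)" using that i by (intro H_meas_mono[OF errm that]) auto
      then show ?thesis by measurable
    qed
    then have "Measurable.pred (\<H> i) (\<lambda>\<omega>. \<forall>j\<in>{..i}. \<bar>err j \<omega>\<bar> \<le> \<eta>)" by (intro pred_intros_finite) auto
    then have "Measurable.pred (\<H> i) (\<lambda>\<omega>. P i \<omega> \<and> (\<forall>j\<in>{..i}. \<bar>err j \<omega>\<bar> \<le> \<eta>))"
      by (intro pred_intros_logic P(1)[OF i])
    then have "Measurable.pred (\<H> i) (\<lambda>\<omega>. P i \<omega> \<and> (\<forall>j\<le>i. \<bar>err j \<omega>\<bar> \<le> \<eta>))"
      by (simp only: Ball_def atMost_iff)
    then show ?thesis unfolding \<theta>_def by measurable
  qed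
  have Pd: "P l \<omega>" if "P i \<omega>" "l \<le> i" for l i \<omega>
    using that(2,1) by (induction l rule: inc_induct) (auto intro: P(2))
  \<comment> \<open>The indicator decreases, so it can be inserted into all earlier summands at no
    cost.\<close>
  have \<theta>d: "\<theta> l \<omega> = 1" if "\<theta> i \<omega> \<noteq> 0" "l \<le> i" for l i \<omega>
    using that Pd[of i \<omega> l] by (auto simp: \<theta>_def split: if_splits)
  define \<phi> where "\<phi> n = sup2 M {..n} (\<lambda>i \<omega>. \<theta> i \<omega> * (y i \<omega> - euler i \<omega>))" for n
  let ?c = "4 * (U + 8) * h\<^sup>2 * \<epsilon>"
  have main: "\<phi> n \<le> ennreal (2 * \<eta>\<^sup>2) + ennreal ?c * (\<Sum>l<n. \<phi> l)" if n: "n \<le> L * m" for n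
  proof -
    let ?S = "\<lambda>j n \<omega>. \<Sum>l<n. (\<theta> l \<omega> * Df j l \<omega>) * (if j = 0 then \<epsilon> else \<xi> l \<omega>)"
    have Qm: "(\<lambda>\<omega>. \<theta> l \<omega> * Df j l \<omega>) \<in> borel_measurable (\<H> l)" if "j = 0 \<or> j = 1" "l < n" for j l
      unfolding Df_def using that n A_base by (intro borel_measurable_times borel_measurable_diff \<theta>m fm f_euler_meas) auto
    have SM: "?S j i \<in> borel_measurable M" if "j = 0 \<or> j = 1" "i \<le> n" for j i
      using that by (intro borel_measurable_sum borel_measurable_times H_meas_M[OF Qm]) auto
    have E: "(\<integral>\<^sup>+\<omega>. ennreal ((\<theta> l \<omega> * Df j l \<omega>)\<^sup>2) \<partial>M) \<le> ennreal (h\<^sup>2) * \<phi> l" if "j = 0 \<or> j = 1" "l < n" for j l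
    proof -
      have "(\<integral>\<^sup>+\<omega>. ennreal ((\<theta> l \<omega> * Df j l \<omega>)\<^sup>2) \<partial>M) \<le> (\<integral>\<^sup>+\<omega>. ennreal (h\<^sup>2) * ennreal ((\<theta> l \<omega> * (y l \<omega> - euler l \<omega>))\<^sup>2) \<partial>M)"
      proof (rule nn_integral_mono)
        fix \<omega>
        have "\<bar>Df j l \<omega>\<bar> \<le> h * \<bar>y l \<omega> - euler l \<omega>\<bar>" unfolding Df_def using that n A_base tm_le[of l] by (intro f_lip) auto
        then have "\<bar>\<theta> l \<omega> * Df j l \<omega>\<bar> \<le> \<bar>h * (\<theta> l \<omega> * (y l \<omega> - euler l \<omega>))\<bar>" using hk by (simp add: \<theta>_def abs_mult)
        then have "(\<theta> l \<omega> * Df j l \<omega>)\<^sup>2 \<le> (h * (\<theta> l \<omega> * (y l \<omega> - euler l \<omega>)))\<^sup>2" by (simp only: abs_le_square_iff)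
        then show "ennreal ((\<theta> l \<omega> * Df j l \<omega>)\<^sup>2) \<le> ennreal (h\<^sup>2) * ennreal ((\<theta> l \<omega> * (y l \<omega> - euler l \<omega>))\<^sup>2)"
          by (simp add: power_mult_distrib ennreal_leI flip: ennreal_mult)
      qed
      also have "\<dots> = ennreal (h\<^sup>2) * (\<integral>\<^sup>+\<omega>. ennreal ((\<theta> l \<omega> * (y l \<omega> - euler l \<omega>))\<^sup>2) \<partial>M)"
        using that n by (intro nn_integral_cmult measurable_compose[OF _ measurable_ennreal] borel_measurable_power
            borel_measurable_times borel_measurable_diff H_meas_M[OF \<theta>m] H_meas_M[OF y] euler_M) auto
      also have "\<dots> \<le> ennreal (h\<^sup>2) * \<phi> l"
        unfolding \<phi>_def by (intro mult_left_mono nn_le_sup2) auto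
      finally show ?thesis .
    qed
    let ?X = "\<Sum>l<n. \<phi> l"
    have E': "(\<Sum>l<n. \<integral>\<^sup>+\<omega>. ennreal ((\<theta> l \<omega> * Df j l \<omega>)\<^sup>2) \<partial>M) \<le> ennreal (h\<^sup>2) * ?X" if "j = 0 \<or> j = 1" for j
      unfolding sum_distrib_left using that E by (intro sum_mono) auto
    have S0: "sup2 M {..n} (?S 0) \<le> ennreal (\<epsilon> * U) * (ennreal (h\<^sup>2) * ?X)"
    proof -
      have "sup2 M {..n} (?S 0) \<le> ennreal (\<epsilon>\<^sup>2 * n) * (\<Sum>l<n. \<integral>\<^sup>+\<omega>. ennreal ((\<theta> l \<omega> * Df 0 l \<omega>)\<^sup>2) \<partial>M)"
        using dt_maximal[of n "\<lambda>l \<omega>. \<theta> l \<omega> * Df 0 l \<omega>"] H_meas_M[OF Qm] by simp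
      also have "\<dots> \<le> ennreal (\<epsilon> * U) * (ennreal (h\<^sup>2) * ?X)"
      proof (intro mult_mono)
        have "\<epsilon> * (n * \<epsilon>) \<le> \<epsilon> * U" using tm_le[OF n] eps by (intro mult_left_mono) (auto simp: tm_def)
        then show "ennreal (\<epsilon>\<^sup>2 * n) \<le> ennreal (\<epsilon> * U)" by (intro ennreal_leI) (simp add: power2_eq_square ac_simps)
      qed (use E'[of 0] in auto)
      finally show ?thesis .
    qed
    have S1: "sup2 M {..n} (?S 1) \<le> 8 * ennreal \<epsilon> * (ennreal (h\<^sup>2) * ?X)"
    proof -
      have "sup2 M {..n} (?S 1) \<le> 8 * ennreal \<epsilon> * (\<Sum>l<n. \<integral>\<^sup>+\<omega>. ennreal ((\<theta> l \<omega> * Df 1 l \<omega>)\<^sup>2) \<partial>M)"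
        using xi_maximal[of n "\<lambda>l \<omega>. \<theta> l \<omega> * Df 1 l \<omega>"] Qm by simp
      also have "\<dots> \<le> 8 * ennreal \<epsilon> * (ennreal (h\<^sup>2) * ?X)"
        using E'[of 1] by (intro mult_left_mono) auto
      finally show ?thesis .
    qed
    have "\<phi> n \<le> sup2 M {..n} (\<lambda>i \<omega>. \<eta> + (\<bar>?S 0 i \<omega> + ?S 1 i \<omega>\<bar>))"
      unfolding \<phi>_def
    proof (rule sup2_mono)
      fix \<omega> i assume i: "i \<in> {..n}"
      have "\<bar>\<theta> i \<omega> * (y i \<omega> - euler i \<omega>)\<bar> \<le> \<bar>\<eta> + \<bar>?S 0 i \<omega> + ?S 1 i \<omega>\<bar>\<bar>"
      proof (cases "\<theta> i \<omega> = 0")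
        case False
        then have e: "\<bar>err i \<omega>\<bar> \<le> \<eta>" "\<theta> i \<omega> = 1" by (auto simp: \<theta>_def split: if_splits)
        have "?S j i \<omega> = (\<Sum>l<i. Df j l \<omega> * (if j = 0 then \<epsilon> else \<xi> l \<omega>))" for j
          using \<theta>d[OF False] by (intro sum.cong) auto
        from this[of 0] this[of 1] have "y i \<omega> - euler i \<omega> = err i \<omega> + (?S 0 i \<omega> + ?S 1 i \<omega>)"
          unfolding err_def euler_sum[of i] by (simp add: Df_def sum_subtractf left_diff_distrib)
        then show ?thesis using e by simp
      qed simp
      then show "\<exists>j\<in>{..n}. \<bar>\<theta> i \<omega> * (y i \<omega> - euler i \<omega>)\<bar> \<le> \<bar>\<eta> + \<bar>?S 0 j \<omega> + ?S 1 j \<omega>\<bar>\<bar>" using i by blast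
    qed
    also have "\<dots> \<le> 2 * (sup2 M {..n} (\<lambda>_ _. \<eta>) + sup2 M {..n} (\<lambda>i \<omega>. \<bar>?S 0 i \<omega> + ?S 1 i \<omega>\<bar>))"
      using SM[of 0] SM[of 1] by (intro sup2_add borel_measurable_abs borel_measurable_add) auto
    also have "sup2 M {..n} (\<lambda>i \<omega>. \<bar>?S 0 i \<omega> + ?S 1 i \<omega>\<bar>) = sup2 M {..n} (\<lambda>i \<omega>. ?S 0 i \<omega> + ?S 1 i \<omega>)" by (rule sup2_abs)
    also have "2 * (sup2 M {..n} (\<lambda>_ _. \<eta>) + \<dots>) \<le> 2 * (ennreal (\<eta>\<^sup>2) + 2 * (sup2 M {..n} (?S 0) + sup2 M {..n} (?S 1)))"
      using SM[of 0] SM[of 1] by (intro mult_left_mono add_mono sup2_const_le sup2_add) auto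
    also have "\<dots> \<le> 2 * (ennreal (\<eta>\<^sup>2) + 2 * (ennreal (\<epsilon> * U) * (ennreal (h\<^sup>2) * ?X) + 8 * ennreal \<epsilon> * (ennreal (h\<^sup>2) * ?X)))"
      by (intro mult_left_mono add_mono S0 S1) auto
    also have "\<dots> = ennreal (2 * \<eta>\<^sup>2) + ennreal ?c * ?X"
    proof -
      have "ennreal ?c = ennreal 4 * (ennreal (\<epsilon> * U) * ennreal (h\<^sup>2) + ennreal 8 * ennreal \<epsilon> * ennreal (h\<^sup>2))"
        using eps U_nonneg by (simp add: algebra_simps flip: ennreal_mult ennreal_plus ennreal_numeral del: ennreal_numeral)
      then have "ennreal ?c * ?X = 4 * (ennreal (\<epsilon> * U) * (ennreal (h\<^sup>2) * ?X) + 8 * ennreal \<epsilon> * (ennreal (h\<^sup>2) * ?X))"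
        by (simp add: distrib_right mult.assoc)
      then show ?thesis by (simp add: ennreal_mult distrib_left mult.assoc[symmetric])
    qed
    finally show ?thesis .
  qed
  have "\<phi> (L * m) \<le> ennreal (2 * \<eta>\<^sup>2) * (1 + ennreal ?c) ^ (L * m)"
    using main by (rule discrete_gronwall) auto
  also have "\<dots> \<le> ennreal (2 * \<eta>\<^sup>2) * ennreal (exp (4 * (U + 8) * h\<^sup>2 * U))"
    using eps U_nonneg by (intro mult_left_mono one_plus_power_le_exp) (auto simp: U_def algebra_simps)
  finally show ?thesis by (simp add: \<phi>_def \<theta>_def ennreal_mult)
qed

end

context taylor_seq
begin

text \<open>\<open>euler_stability\<close> followed by Chebyshev; \<eta>' is calibrated so that the
  truncated distance exceeds \<eta> with probability at most \<kappa>'/4.\<close>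

lemma euler_limit:
  assumes y: "\<And>p l. l \<le> N p \<Longrightarrow> y p l \<in> borel_measurable (\<H> p l)"
    and P: "\<And>p l. l \<le> N p \<Longrightarrow> Measurable.pred (\<H> p l) (P p l)" "\<And>p l \<omega>. P p (Suc l) \<omega> \<Longrightarrow> P p l \<omega>"
    and err: "usmall M (\<lambda>p \<omega>. {i\<in>{..N p}. P p i \<omega>})
      (\<lambda>p i \<omega>. y p i \<omega> - x0 - (\<Sum>l<i. f [0] (time p l) (y p l \<omega>) * ep p) - (\<Sum>l<i. f [1] (time p l) (y p l \<omega>) * \<xi> p l \<omega>))"
  shows "usmall M (\<lambda>p \<omega>. {i\<in>{..N p}. P p i \<omega>}) (\<lambda>p i \<omega>. y p i \<omega> - eul p i \<omega>)"
  unfolding usmall_def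
proof (intro allI impI)
  fix \<eta> \<kappa>' :: real assume pos: "0 < \<eta>" "0 < \<kappa>'"
  define C where "C = 2 * exp (4 * (real L * \<delta> + 8) * h\<^sup>2 * (real L * \<delta>))"
  have C: "0 < C" by (simp add: C_def)
  define \<eta>' where "\<eta>' = \<eta> * sqrt (\<kappa>' / (4 * C))"
  have \<eta>': "0 < \<eta>'" "C * \<eta>'\<^sup>2 = \<kappa>' / 4 * \<eta>\<^sup>2" using pos C by (auto simp: \<eta>'_def power_mult_distrib)
  obtain p0 where p0: "\<And>p. p \<ge> p0 \<Longrightarrow> \<exists>B\<in>sets M. measure M B < \<kappa>' / 2 \<and> (\<forall>\<omega>\<in>space M - B. \<forall>i\<in>{i\<in>{..N p}. P p i \<omega>}.
      \<bar>y p i \<omega> - x0 - (\<Sum>l<i. f [0] (time p l) (y p l \<omega>) * ep p) - (\<Sum>l<i. f [1] (time p l) (y p l \<omega>) * \<xi> p l \<omega>)\<bar> \<le> \<eta>')"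
    using usmallD[OF err, of \<eta>' "\<kappa>' / 2"] pos \<eta>' by auto
  show "\<exists>p0. \<forall>p\<ge>p0. \<exists>B\<in>sets M. prob B < \<kappa>' \<and> (\<forall>\<omega>\<in>space M - B. \<forall>i\<in>{i\<in>{..N p}. P p i \<omega>}. \<bar>y p i \<omega> - eul p i \<omega>\<bar> \<le> \<eta>)"
  proof (intro exI[of _ p0] allI impI)
    fix p assume p: "p0 \<le> p"
    interpret T: taylor_walk M "\<H> p" "\<xi> p" "ep p" f A R "2 ^ p" L g x0 h k \<kappa> "real L * \<delta>" by (rule tw)
    define er where "er i \<omega> = y p i \<omega> - x0 - (\<Sum>l<i. f [0] (time p l) (y p l \<omega>) * ep p) - (\<Sum>l<i. f [1] (time p l) (y p l \<omega>) * \<xi> p l \<omega>)" for i \<omega>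
    obtain B where B: "B \<in> sets M" "measure M B < \<kappa>' / 2" "\<And>\<omega> i. \<omega> \<in> space M - B \<Longrightarrow> i \<le> N p \<Longrightarrow> P p i \<omega> \<Longrightarrow> \<bar>er i \<omega>\<bar> \<le> \<eta>'"
      using p0[OF p] by (auto simp: er_def)
    let ?Z = "\<lambda>i \<omega>. of_bool (P p i \<omega> \<and> (\<forall>j\<le>i. \<bar>er j \<omega>\<bar> \<le> \<eta>')) * (y p i \<omega> - T.euler i \<omega>)"
    have s: "sup2 M {..N p} ?Z \<le> ennreal (\<kappa>' / 4 * \<eta>\<^sup>2)"
    proof -
      have "sup2 M {..N p} ?Z \<le> ennreal (2 * \<eta>'\<^sup>2 * exp (4 * (real L * \<delta> + 8) * h\<^sup>2 * (real L * \<delta>)))"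
        unfolding er_def by (rule T.euler_stability[where y="y p" and P="P p", OF y P(1) P(2) less_imp_le[OF \<eta>'(1)]])
      also have "2 * \<eta>'\<^sup>2 * exp (4 * (real L * \<delta> + 8) * h\<^sup>2 * (real L * \<delta>)) = \<kappa>' / 4 * \<eta>\<^sup>2"
        unfolding \<eta>'(2)[symmetric] C_def by simp
      finally show ?thesis .
    qed
    have yM: "y p l \<in> borel_measurable M" if "l \<le> N p" for l using T.H_meas_M[OF y[OF that]] .
    have PM: "Measurable.pred M (P p i)" if "i \<le> N p" for i
      using P(1)[OF that] by (rule measurable_from_subalg[OF T.sub])
    have erM: "er i \<in> borel_measurable M" if "i \<le> N p" for i
    proof -
      have "(\<lambda>\<omega>. f [j] (time p l) (y p l \<omega>)) \<in> borel_measurable M" if "j = 0 \<or> j = 1" "l \<le> N p" for j l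
        using that T.A_base by (intro measurable_compose[OF yM T.f_meas]) auto
      from this[of 0] this[of 1] show ?thesis unfolding er_def using that
        by (intro borel_measurable_diff borel_measurable_sum borel_measurable_times yM T.xi_M) auto
    qed
    have ZM: "?Z i \<in> borel_measurable M" if "i \<in> {..N p}" for i
    proof -
      have "Measurable.pred M (\<lambda>\<omega>. \<forall>j\<in>{..i}. \<bar>er j \<omega>\<bar> \<le> \<eta>')"
      proof (intro pred_intros_finite)
        fix j assume "j \<in> {..i}"
        then have "er j \<in> borel_measurable M" using that by (intro erM) auto
        then show "Measurable.pred M (\<lambda>\<omega>. \<bar>er j \<omega>\<bar> \<le> \<eta>')" by measurable
      qed simp
      then have "Measurable.pred M (\<lambda>\<omega>. P p i \<omega> \<and> (\<forall>j\<in>{..i}. \<bar>er j \<omega>\<bar> \<le> \<eta>'))"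
        using that by (intro pred_intros_logic PM) auto
      then have 1: "Measurable.pred M (\<lambda>\<omega>. P p i \<omega> \<and> (\<forall>j\<le>i. \<bar>er j \<omega>\<bar> \<le> \<eta>'))" by (simp only: Ball_def atMost_iff)
      have 2: "y p i \<in> borel_measurable M" "T.euler i \<in> borel_measurable M" using yM[of i] T.euler_M[of i] that by auto
      show ?thesis using 1 2 by measurable
    qed
    from chebyshev_sup2[OF _ ZM s _ pos(1)] obtain B' where
      B': "B' \<in> sets M" "measure M B' \<le> \<kappa>' / 4 * \<eta>\<^sup>2 / \<eta>\<^sup>2" "\<And>\<omega> i. \<omega> \<in> space M - B' \<Longrightarrow> i \<le> N p \<Longrightarrow> \<bar>?Z i \<omega>\<bar> \<le> \<eta>"
      using pos by (auto intro: countable_finite)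
    have "measure M (B \<union> B') \<le> measure M B + measure M B'" using B B' by (intro measure_Un_le) auto
    then have "measure M (B \<union> B') < \<kappa>'" using B(2) B'(2) pos by simp
    moreover have "\<bar>y p i \<omega> - T.euler i \<omega>\<bar> \<le> \<eta>" if \<omega>: "\<omega> \<in> space M - (B \<union> B')" and i: "i \<le> N p" "P p i \<omega>" for \<omega> i
    proof -
      have Pl: "P p l \<omega>" if "l \<le> i" for l
        using that i(2) by (induction l rule: inc_induct) (auto intro: P(2))
      have "\<forall>j\<le>i. \<bar>er j \<omega>\<bar> \<le> \<eta>'" using B(3)[of \<omega>] \<omega> i Pl by auto
      then have "?Z i \<omega> = y p i \<omega> - T.euler i \<omega>" using i by simp
      then show ?thesis using B'(3)[of \<omega> i] \<omega> i by auto
    qed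
    ultimately show "\<exists>B\<in>sets M. prob B < \<kappa>' \<and> (\<forall>\<omega>\<in>space M - B. \<forall>i\<in>{i\<in>{..N p}. P p i \<omega>}. \<bar>y p i \<omega> - T.euler i \<omega>\<bar> \<le> \<eta>)"
      using B B' by (intro bexI[of _ "B \<union> B'"]) auto
  qed
qed

end

section \<open>Multi-indices\<close>

lemma finite_A_set: "finite (A_set \<gamma>)"
proof (rule finite_subset)
  show "A_set \<gamma> \<subseteq> {\<alpha>. set \<alpha> \<subseteq> {0, 1} \<and> length \<alpha> \<le> nat \<lceil>2 * \<bar>\<gamma>\<bar> + 1\<rceil>}"
  proof
    fix \<alpha> assume "\<alpha> \<in> A_set \<gamma>"
    then have "set \<alpha> \<subseteq> {0, 1}" "real (length \<alpha>) \<le> 2 * \<bar>\<gamma>\<bar> + 1" by (auto simp: A_set_def multi_indices_def)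
    then show "\<alpha> \<in> {\<alpha>. set \<alpha> \<subseteq> {0, 1} \<and> length \<alpha> \<le> nat \<lceil>2 * \<bar>\<gamma>\<bar> + 1\<rceil>}" by (simp add: le_nat_iff) linarith
  qed
qed (rule finite_lists_length_le, simp)

lemma R_set_eq: "R_set \<gamma> = (#) 0 ` A_set \<gamma> \<union> (#) 1 ` A_set \<gamma> - A_set \<gamma>"
proof
  show "R_set \<gamma> \<subseteq> (#) 0 ` A_set \<gamma> \<union> (#) 1 ` A_set \<gamma> - A_set \<gamma>"
  proof
    fix \<alpha> assume a: "\<alpha> \<in> R_set \<gamma>"
    then obtain j \<beta> where "\<alpha> = j # \<beta>" by (cases \<alpha>) (auto simp: R_set_def)
    with a show "\<alpha> \<in> (#) 0 ` A_set \<gamma> \<union> (#) 1 ` A_set \<gamma> - A_set \<gamma>" by (auto simp: R_set_def multi_indices_def)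
  qed
qed (auto simp: R_set_def A_set_def multi_indices_def)

lemma A_set_tl:
  assumes "\<alpha> \<in> A_set \<gamma>" "\<alpha> \<noteq> []"
  shows "tl \<alpha> \<in> A_set \<gamma> \<and> (hd \<alpha> = 0 \<or> hd \<alpha> = 1)"
proof -
  obtain j \<beta> where a: "\<alpha> = j # \<beta>" using assms(2) by (cases \<alpha>) auto
  have "count_list \<beta> 0 \<le> length \<beta>" by (rule count_le_length)
  then show ?thesis using assms(1) unfolding a by (auto simp: A_set_def multi_indices_def split: if_splits)
qed

text \<open>Outside \<open>A_set\<close> the order, length plus number of zeros, is at least g + 1.
  For zeros only it is twice the length, and the value g + 1 is excluded by the second clause of
  \<open>A_set\<close>: this is the extra order asked of purely temporal indices.\<close>

lemma R_set_order:
  assumes g: "real g = 2 * \<gamma>" and a: "\<alpha> \<in> R_set \<gamma>"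
  shows "(if \<forall>j\<in>set \<alpha>. j = 0 then g + 2 else g + 1) \<le> length \<alpha> + count_list \<alpha> 0"
proof -
  have m: "\<alpha> \<in> multi_indices" "\<alpha> \<notin> A_set \<gamma>" using a by (auto simp: R_set_def)
  then have "\<not> real (length \<alpha> + count_list \<alpha> 0) \<le> real g" "\<not> (length \<alpha> = count_list \<alpha> 0 \<and> real (2 * length \<alpha>) = real (g + 1))"
    unfolding g by (auto simp: A_set_def g)
  then have 1: "g + 1 \<le> length \<alpha> + count_list \<alpha> 0" "\<not> (length \<alpha> = count_list \<alpha> 0 \<and> 2 * length \<alpha> = g + 1)"
    by (simp_all only: of_nat_le_iff of_nat_eq_iff) auto
  have "\<forall>j\<in>set \<alpha>. j = 0 \<Longrightarrow> count_list \<alpha> 0 = length \<alpha>" by (induction \<alpha>) auto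
  then show ?thesis using 1 by (cases "\<forall>j\<in>set \<alpha>. j = 0") (simp_all only: if_True if_False simp_thms, auto)
qed

lemma jointly_continuous_meas:
  assumes "jointly_continuous c" "0 \<le> u" shows "c u \<in> borel_measurable borel"
proof (rule borel_measurable_continuous_onI)
  have "continuous_on ({0..} \<times> UNIV) (\<lambda>(u, x). c u x)" using assms(1) by (simp add: jointly_continuous_def)
  then have "continuous_on UNIV (\<lambda>x. (\<lambda>(u, x). c u x) (u, x))"
    by (rule continuous_on_compose2) (use assms(2) in \<open>auto intro!: continuous_on_Pair continuous_on_const continuous_on_id\<close>)
  then show "continuous_on UNIV (c u)" by simp
qed

section \<open>The setting of the approximation\<close>

locale scheme_setting = clock_setting M \<F> B D E \<nu> \<G> T \<beta>
  for M :: "'a measure" and \<F> and B D E :: "real \<Rightarrow> 'a \<Rightarrow> real" and \<nu> \<G> T \<beta> +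
  fixes F G :: "real \<Rightarrow> real \<Rightarrow> real" and h k :: "nat list \<Rightarrow> real \<Rightarrow> real" and \<gamma> x0 :: real and X :: "real \<Rightarrow> 'a \<Rightarrow> real"
  assumes gamma: "0 < \<gamma>" "2 * \<gamma> \<in> \<nat>"
    and FG_cont: "jointly_continuous F" "jointly_continuous G"
    and bounds: "coefficient_bounds \<gamma> F G h k"
    and X: "solves_SDE M \<G> B E T F G x0 X"
begin

abbreviation "f \<equiv> f_coeff F G"
abbreviation "A \<equiv> A_set \<gamma>"
abbreviation "R \<equiv> R_set \<gamma>"

definition g :: nat where "g = nat \<lfloor>2 * \<gamma>\<rfloor>"
text \<open>A sum instead of a maximum: it dominates each \<open>h \<alpha>\<close> because all are
  nonnegative, and growth bounds of the summands simply add up.\<close>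

definition hb :: "real \<Rightarrow> real" where "hb U = (\<Sum>\<alpha>\<in>A - {[]}. h \<alpha> U)"
definition kb :: "real \<Rightarrow> real" where "kb U = (\<Sum>\<alpha>\<in>R. k \<alpha> U)"
definition kap :: real where
  "kap = 20 * real (card A) * (\<Sum>\<alpha>\<in>A. 8 ^ length \<alpha>) + 20 * real (card R) * (\<Sum>\<alpha>\<in>R. 8 ^ length \<alpha>)"

lemma kap_nonneg: "0 \<le> kap"
  unfolding kap_def by (intro add_nonneg_nonneg mult_nonneg_nonneg sum_nonneg) auto

lemma g_eq: "real g = 2 * \<gamma>"
proof -
  obtain n :: nat where "2 * \<gamma> = real n" using gamma(2) by (auto elim: Nats_cases)
  then show ?thesis by (simp add: g_def)
qed

lemma A_base: "[] \<in> A" "[0] \<in> A" "[1] \<in> A"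
proof -
  have "1 \<le> g" using g_eq gamma(1) by linarith
  then have "g = 1 \<or> 2 \<le> g" by auto
  then have c: "\<gamma> = 1 / 2 \<or> 2 \<le> 2 * \<gamma>" using g_eq by auto
  then have "1 \<le> 2 * \<gamma>" by auto
  with c gamma show "[] \<in> A" "[0] \<in> A" "[1] \<in> A" by (auto simp: A_set_def multi_indices_def)
qed

lemma finite_R: "finite R" using finite_A_set by (simp add: R_set_eq)

lemma f_C12: "\<alpha> \<in> A \<Longrightarrow> C12 (f \<alpha>)"
proof -
  assume "\<alpha> \<in> A"
  then have "0 # \<alpha> \<in> (A \<union> R) - {[]}" by (auto simp: R_set_eq)
  then have "C12 (f (tl (0 # \<alpha>)))" using bounds unfolding coefficient_bounds_def by blast
  then show ?thesis by simp
qed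

lemma f_Lop: "\<alpha> \<noteq> [] \<Longrightarrow> f (j # \<alpha>) = L_op F G j (f \<alpha>)" by (cases \<alpha>) auto

lemma f_01: "f [0] = F" "f [1] = G" by simp_all

text \<open>The coefficient of an index of \<open>R\<close> need not be smooth, but it is
  \<open>F\<close> or \<open>G\<close>, or one operator applied to the smooth coefficient of the
  tail.\<close>

lemma f_meas: assumes "\<alpha> \<in> A \<union> R" "0 \<le> u" shows "f \<alpha> u \<in> borel_measurable borel"
proof (cases "\<alpha> \<in> A")
  case True
  show ?thesis using f_C12[OF True] assms(2) unfolding C12_def by (blast intro: jointly_continuous_meas)
next
  case False
  then obtain j \<beta> where a: "\<alpha> = j # \<beta>" "\<beta> \<in> A" using assms(1) by (auto simp: R_set_eq)
  note m = jointly_continuous_meas[OF _ assms(2)]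
  show ?thesis
  proof (cases "\<beta> = []")
    case True
    then show ?thesis using m[OF FG_cont(1)] m[OF FG_cont(2)] a by simp
  next
    case False
    have "C12 (f \<beta>)" using f_C12 a by blast
    then have "D_u (f \<beta>) u \<in> borel_measurable borel" "D_x (f \<beta>) u \<in> borel_measurable borel" "D_x (D_x (f \<beta>)) u \<in> borel_measurable borel"
      unfolding C12_def by (blast intro: m)+
    note this[measurable] m[OF FG_cont(1), measurable] m[OF FG_cont(2), measurable]
    have "(\<lambda>x. L_op F G j (f \<beta>) u x) \<in> borel_measurable borel" unfolding L_op_def by measurable
    then show ?thesis unfolding a(1) f_Lop[OF False] by simp
  qed
qed

lemma h_le: "\<alpha> \<in> A - {[]} \<Longrightarrow> 0 \<le> u \<Longrightarrow> u \<le> U \<Longrightarrow> h \<alpha> u \<le> hb U"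
proof -
  assume a: "\<alpha> \<in> A - {[]}" "0 \<le> u" "u \<le> U"
  have "h \<alpha> u \<le> h \<alpha> U" using a bounds unfolding coefficient_bounds_def by (auto simp: mono_on_def)
  also have "\<dots> \<le> hb U" unfolding hb_def
    using a bounds finite_A_set by (intro member_le_sum) (auto simp: coefficient_bounds_def)
  finally show ?thesis .
qed

lemma k_le: "\<alpha> \<in> R \<Longrightarrow> 0 \<le> u \<Longrightarrow> u \<le> U \<Longrightarrow> k \<alpha> u \<le> kb U"
proof -
  assume a: "\<alpha> \<in> R" "0 \<le> u" "u \<le> U"
  have "k \<alpha> u \<le> k \<alpha> U" using a bounds unfolding coefficient_bounds_def by (auto simp: mono_on_def)
  also have "\<dots> \<le> kb U" unfolding kb_def
    using a bounds finite_R by (intro member_le_sum) (auto simp: coefficient_bounds_def intro: less_imp_le)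
  finally show ?thesis .
qed

lemma hb_nonneg: "0 \<le> U \<Longrightarrow> 0 \<le> hb U" and kb_nonneg: "0 \<le> U \<Longrightarrow> 0 \<le> kb U"
  unfolding hb_def kb_def using bounds by (auto simp: coefficient_bounds_def intro!: sum_nonneg intro: less_imp_le)

lemma taylor_seq:
  assumes \<delta>: "0 < \<delta>" "\<delta> < 1"
  shows "taylor_seq M (\<lambda>p l. \<F> (real l * (\<delta> / 2 ^ p)))
    (\<lambda>p l \<omega>. B (real (Suc l) * (\<delta> / 2 ^ p)) \<omega> - B (real l * (\<delta> / 2 ^ p)) \<omega>) \<delta> f A R L g (hb (real L * \<delta>)) (kb (real L * \<delta>)) kap"
proof -
  let ?e = "\<lambda>p. \<delta> / 2 ^ p"
  have U: "0 \<le> real L * \<delta>" using \<delta> by simp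
  have gw: "gaussian_walk M (\<lambda>l. \<F> (real l * ?e p)) (\<lambda>l \<omega>. B (real (Suc l) * ?e p) \<omega> - B (real l * ?e p) \<omega>) (?e p)" for p
  proof (intro gaussian_walk.intro gaussian_walk_axioms.intro)
    show "prob_space M" by (rule prob_space_axioms)
    show e: "0 < ?e p" using \<delta> by simp
    fix l l' :: nat
    show "subalgebra M (\<F> (real l * ?e p))" by (rule F_sub)
    show "sets (\<F> (real l * ?e p)) \<subseteq> sets (\<F> (real l' * ?e p))" if "l \<le> l'"
      using that e by (intro F_sets_mono mult_right_mono) auto
    have lt: "0 \<le> real l * ?e p" "real l * ?e p < real (Suc l) * ?e p"
      by (rule mult_nonneg_nonneg, simp, rule less_imp_le[OF e]) (rule mult_strict_right_mono[OF _ e], simp)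
    have d: "real (Suc l) * ?e p - real l * ?e p = ?e p" by (simp add: algebra_simps add_divide_distrib)
    show "(\<lambda>\<omega>. B (real (Suc l) * ?e p) \<omega> - B (real l * ?e p) \<omega>) \<in> borel_measurable (\<F> (real (Suc l) * ?e p))"
      using lt by (intro borel_measurable_diff B_F F_mono[OF B_F, of "real l * ?e p"]) auto
    have bm: "distributed M lborel (\<lambda>\<omega>. B t \<omega> - B s \<omega>) (\<lambda>x. ennreal (normal_density 0 (sqrt (t - s)) x)) \<and>
        indep_set (sets (\<F> s)) (sets (vimage_algebra (space M) (\<lambda>\<omega>. B t \<omega> - B s \<omega>) borel))" if "0 \<le> s" "s < t" for s t
      using BM that unfolding brownian_motion_def by blast
    show "distributed M lborel (\<lambda>\<omega>. B (real (Suc l) * ?e p) \<omega> - B (real l * ?e p) \<omega>) (\<lambda>x. ennreal (normal_density 0 (sqrt (?e p)) x))"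
      using bm[OF lt] unfolding d by blast
    show "indep_set (sets (\<F> (real l * ?e p))) (sets (vimage_algebra (space M) (\<lambda>\<omega>. B (real (Suc l) * ?e p) \<omega> - B (real l * ?e p) \<omega>) borel))"
      using bm[OF lt] by blast
  qed
  have k1: "20 * real (card A) * (\<Sum>\<alpha>\<in>A. 8 ^ length \<alpha>) \<ge> 0" "20 * real (card R) * (\<Sum>\<alpha>\<in>R. 8 ^ length \<alpha>) \<ge> 0"
    by (auto intro!: mult_nonneg_nonneg sum_nonneg)
  have tw: "taylor_walk M (\<lambda>l. \<F> (real l * ?e p)) (\<lambda>l \<omega>. B (real (Suc l) * ?e p) \<omega> - B (real l * ?e p) \<omega>) (?e p) f A R (2 ^ p) L g
      (hb (real L * \<delta>)) (kb (real L * \<delta>)) kap (real L * \<delta>)" for p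
  proof (intro taylor_walk.intro gw taylor_walk_axioms.intro)
    show "\<bar>f \<alpha> u x - f \<alpha> u y\<bar> \<le> hb (real L * \<delta>) * \<bar>x - y\<bar>" if "\<alpha> \<in> A - {[]}" "0 \<le> u" "u \<le> real L * \<delta>" for \<alpha> u x y
    proof -
      have "\<bar>f \<alpha> u x - f \<alpha> u y\<bar> \<le> h \<alpha> u * \<bar>x - y\<bar>" using bounds that unfolding coefficient_bounds_def by blast
      also have "\<dots> \<le> hb (real L * \<delta>) * \<bar>x - y\<bar>" using h_le[OF that] by (intro mult_right_mono) auto
      finally show ?thesis .
    qed
    show "\<bar>f \<alpha> u x\<bar> \<le> hb (real L * \<delta>) * (1 + \<bar>x\<bar>)" if "\<alpha> \<in> A - {[]}" "0 \<le> u" "u \<le> real L * \<delta>" for \<alpha> u x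
    proof -
      have "\<bar>f \<alpha> u x\<bar> \<le> h \<alpha> u * (1 + \<bar>x\<bar>)" using bounds that unfolding coefficient_bounds_def by blast
      also have "\<dots> \<le> hb (real L * \<delta>) * (1 + \<bar>x\<bar>)" using h_le[OF that] by (intro mult_right_mono) auto
      finally show ?thesis .
    qed
    show "\<bar>f \<alpha> u x\<bar> \<le> kb (real L * \<delta>) * (1 + \<bar>x\<bar>)" if "\<alpha> \<in> R" "0 \<le> u" "u \<le> real L * \<delta>" for \<alpha> u x
    proof -
      have "\<bar>f \<alpha> u x\<bar> \<le> k \<alpha> u * (1 + \<bar>x\<bar>)" using bounds that unfolding coefficient_bounds_def by blast
      also have "\<dots> \<le> kb (real L * \<delta>) * (1 + \<bar>x\<bar>)" using k_le[OF that] by (intro mult_right_mono) auto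
      finally show ?thesis .
    qed
  qed (use \<delta> A_base finite_A_set A_set_tl R_set_eq R_set_order[OF g_eq] f_meas hb_nonneg[OF U] kb_nonneg[OF U] k1 in \<open>auto simp: kap_def\<close>)
  show ?thesis
  proof (intro taylor_seq.intro taylor_seq_axioms.intro tw)
    show "prob_space M" by (rule prob_space_axioms)
  qed (use \<delta> FG_cont f_C12 f_Lop in auto)
qed

section \<open>Paths at the random times D u before T\<close>

definition alive :: "real \<Rightarrow> 'a \<Rightarrow> bool" where "alive u \<omega> \<longleftrightarrow> nice \<omega> \<and> D u \<omega> < T"

lemma alive_mono: "alive v \<omega> \<Longrightarrow> 0 \<le> u \<Longrightarrow> u \<le> v \<Longrightarrow> alive u \<omega>"
  using n_d_le[of \<omega> u v] by (auto simp: alive_def)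

lemma AE_alive: "AE \<omega> in M. \<forall>u. alive u \<omega> \<longleftrightarrow> D u \<omega> < T"
  using AE_nice by eventually_elim (simp add: alive_def)

lemma alive_F: "0 \<le> u \<Longrightarrow> Measurable.pred (\<F> u) (alive u)"
proof -
  assume u: "0 \<le> u"
  have "{\<omega>\<in>space M. D u \<omega> < T} \<in> sets (\<F> u)" using borel_measurable_less[OF D_F[OF u] borel_measurable_const[of T]] by simp
  then have "{\<omega>\<in>space M. alive u \<omega>} \<in> sets (\<F> u)"
    by (rule F_AE_set) (use AE_nice in \<open>auto simp: alive_def elim: AE_mp\<close>)
  then show ?thesis by (simp add: pred_def)
qed

lemma alive_limit_F:
  assumes H: "adapted_on {0<..T} \<G> H" and u: "0 \<le> u"
    and lim: "AE \<omega> in M. alive u \<omega> \<longrightarrow> ((\<lambda>r. H r \<omega>) \<longlongrightarrow> z \<omega>) (at_right (D u \<omega>))"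
  shows "(\<lambda>\<omega>. if alive u \<omega> then z \<omega> else 0) \<in> borel_measurable (\<F> u)"
proof -
  have "AE \<omega> in M. D u \<omega> < T \<longrightarrow> ((\<lambda>r. H r \<omega>) \<longlongrightarrow> z \<omega>) (at_right (D u \<omega>))"
    using lim AE_alive by eventually_elim auto
  from right_limit_F[OF H u this] show ?thesis
    by (rule F_AE_cong) (use AE_alive in \<open>auto elim!: AE_mp\<close>)
qed

lemma right_continuous_path:
  assumes "continuous_on {0..T} y" "0 \<le> t" "t < T"
  shows "(y \<longlongrightarrow> (y t :: real)) (at_right t)"
proof -
  have "(y \<longlongrightarrow> y t) (at t within {0..T})" using assms by (auto simp: continuous_on_def)
  then have "(y \<longlongrightarrow> y t) (at t within {t<..<T})" using assms by (elim tendsto_within_subset) auto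
  moreover have "at t within {t<..<T} = at_right t" using assms by (intro at_within_nhd[where S="{..<T}"]) auto
  ultimately show ?thesis by simp
qed

text \<open>Between two neighbouring grid values the inverse moves by at most one mesh, however far
  \<open>D\<close> jumps. A path that is a function of \<open>E\<close> therefore moves little,
  uniformly in the grid interval.\<close>

lemma grid_app:
  assumes ni: "nice \<omega>" and \<delta>: "0 < \<delta>" and y: "continuous_on {0..T} y"
    and flat: "\<And>s t. s \<in> {0..T} \<Longrightarrow> t \<in> {0..T} \<Longrightarrow> E s \<omega> = E t \<omega> \<Longrightarrow> y s = y t" and \<eta>: "0 < (\<eta>::real)"
  shows "\<exists>p0. \<forall>p\<ge>p0. \<forall>l. \<forall>t\<in>{0<..T}. D (real l * (\<delta> / 2 ^ p)) \<omega> < t \<longrightarrow> t \<le> D (real (Suc l) * (\<delta> / 2 ^ p)) \<omega>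
    \<longrightarrow> \<bar>y t - y (D (real l * (\<delta> / 2 ^ p)) \<omega>)\<bar> \<le> \<eta>"
proof -
  obtain \<zeta> where \<zeta>: "0 < \<zeta>" "\<And>s t. s \<in> {0..T} \<Longrightarrow> t \<in> {0..T} \<Longrightarrow> \<bar>E s \<omega> - E t \<omega>\<bar> \<le> \<zeta> \<Longrightarrow> \<bar>y s - y t\<bar> \<le> \<eta>"
    using n_E_uniform[OF ni y flat \<eta>] by blast
  obtain p0 where p0: "\<delta> / \<zeta> < 2 ^ p0" using real_arch_pow[of 2 "\<delta> / \<zeta>"] by auto
  show ?thesis
  proof (intro exI[of _ p0] allI ballI impI)
    fix p l t assume p: "p0 \<le> p" and t: "t \<in> {0<..T}" "D (real l * (\<delta> / 2 ^ p)) \<omega> < t" "t \<le> D (real (Suc l) * (\<delta> / 2 ^ p)) \<omega>"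
    have "(2::real) ^ p0 \<le> 2 ^ p" using p by (intro power_increasing) auto
    then have "\<zeta> * 2 ^ p0 \<le> \<zeta> * 2 ^ p" using \<zeta>(1) by (intro mult_left_mono) auto
    moreover have "\<delta> < \<zeta> * 2 ^ p0" using p0 \<zeta>(1) by (simp add: field_simps)
    ultimately have "\<delta> \<le> \<zeta> * 2 ^ p" by linarith
    then have e\<zeta>: "\<delta> / 2 ^ p \<le> \<zeta>" by (simp add: field_simps)
    define e where "e = \<delta> / 2 ^ p"
    have e: "0 < e" "e \<le> \<zeta>" using \<delta> e\<zeta> by (auto simp: e_def)
    have t': "D (real l * e) \<omega> < t" "t \<le> D (real (Suc l) * e) \<omega>" using t by (auto simp: e_def)
    have l0: "0 \<le> real l * e" "0 \<le> real (Suc l) * e" using e by auto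
    have "real l * e \<le> E t \<omega>" using n_le_E[OF ni l0(1)] t' by simp
    moreover have "E t \<omega> \<le> real (Suc l) * e" using n_E_mono[OF ni t'(2)] n_E_D[OF ni l0(2)] by simp
    moreover have "real (Suc l) * e = real l * e + e" by (simp add: algebra_simps)
    ultimately have "\<bar>E t \<omega> - E (D (real l * e) \<omega>) \<omega>\<bar> \<le> \<zeta>" using n_E_D[OF ni l0(1)] e by simp
    then show "\<bar>y t - y (D (real l * (\<delta> / 2 ^ p)) \<omega>)\<bar> \<le> \<eta>"
      using \<zeta>(2)[of t "D (real l * e) \<omega>"] t(1) t'(1) n_D_nonneg[OF ni l0(1)] by (auto simp: e_def)
  qed
qed

text \<open>Both integrals in the equation are constant where \<open>E\<close> is, hence so is the
  solution.\<close>

lemma X_path: "AE \<omega> in M. continuous_on {0..T} (\<lambda>t. X t \<omega>) \<and> (\<forall>s\<in>{0..T}. \<forall>t\<in>{0..T}. E s \<omega> = E t \<omega> \<longrightarrow> X s \<omega> = X t \<omega>)"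
proof -
  obtain I0 I1 where I: "stoch_integral M \<G> T (driver B E 0) (\<lambda>r \<omega>. F (E r \<omega>) (X r \<omega>)) I0"
    "stoch_integral M \<G> T (driver B E 1) (\<lambda>r \<omega>. G (E r \<omega>) (X r \<omega>)) I1"
    "AE \<omega> in M. \<forall>t\<in>{0..T}. X t \<omega> = x0 + I0 t \<omega> + I1 t \<omega>"
    "AE \<omega> in M. continuous_on {0..T} (\<lambda>t. X t \<omega>)" using X unfolding solves_SDE_def by blast
  show ?thesis using I(3,4) integral_flat[OF I(1)] integral_flat[OF I(2)]
  proof eventually_elim
    case (elim \<omega>)
    show ?case
    proof (intro conjI ballI impI)
      fix s t assume "s \<in> {0..T}" "t \<in> {0..T}" "E s \<omega> = E t \<omega>"
      then have "I0 s \<omega> = I0 t \<omega>" "I1 s \<omega> = I1 t \<omega>" using elim by blast+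
      then show "X s \<omega> = X t \<omega>" using elim(1) \<open>s \<in> {0..T}\<close> \<open>t \<in> {0..T}\<close> by simp
    qed (rule elim(2))
  qed
qed

end

section \<open>Grid values of the solution and of the approximation for one step size\<close>

locale scheme_step = scheme_setting M \<F> B D E \<nu> \<G> T \<beta> F G h k \<gamma> x0 X
  for M :: "'a measure" and \<F> and B D E :: "real \<Rightarrow> 'a \<Rightarrow> real" and \<nu> \<G> T \<beta> F G h k \<gamma> x0 X +
  fixes \<delta> :: real and L :: nat and V :: "real \<Rightarrow> 'a \<Rightarrow> real"
  assumes dt: "0 < \<delta>" "\<delta> < 1"
    and V: "ito_taylor_approx M \<G> B D E T F G x0 \<gamma> \<delta> V"
begin

definition xi :: "nat \<Rightarrow> nat \<Rightarrow> 'a \<Rightarrow> real" where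
  "xi p l \<omega> = B (real (Suc l) * (\<delta> / 2 ^ p)) \<omega> - B (real l * (\<delta> / 2 ^ p)) \<omega>"

definition Fp :: "nat \<Rightarrow> nat \<Rightarrow> 'a measure" where "Fp p l = \<F> (real l * (\<delta> / 2 ^ p))"

sublocale S: taylor_seq M Fp xi \<delta> f A R L g x0 "hb (real L * \<delta>)" "kb (real L * \<delta>)" kap
  using taylor_seq[OF dt, of L] unfolding xi_def[abs_def] Fp_def[abs_def] .

abbreviation "u p i \<equiv> real i * S.ep p"

lemma u_nonneg [simp]: "0 \<le> u p i" using dt by simp

lemma tw_meas: "S.time p l = u p l"
proof -
  interpret T: taylor_walk M "Fp p" "xi p" "S.ep p" f A R "2 ^ p" L g x0 "hb (real L * \<delta>)" "kb (real L * \<delta>)" kap "real L * \<delta>" by (rule S.tw)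
  show ?thesis by (simp add: T.tm_def)
qed

lemma AE_RS:
  assumes SI: "stoch_integral M \<G> T (driver B E j) H Y"
    and K: "\<And>u. 0 \<le> u \<Longrightarrow> K u \<in> borel_measurable (\<F> u)"
    and app: "AE \<omega> in M. \<forall>\<eta>>0. \<exists>p0. \<forall>p\<ge>p0. \<forall>l. \<forall>t\<in>{0<..T}. D (u p l) \<omega> < t \<longrightarrow> t \<le> D (u p (Suc l)) \<omega> \<longrightarrow> \<bar>H t \<omega> - K (u p l) \<omega>\<bar> \<le> \<eta>"
  shows "usmall M (\<lambda>p \<omega>. {i\<in>{..S.N p}. alive (u p i) \<omega>})
    (\<lambda>p i \<omega>. (\<Sum>l<i. K (u p l) \<omega> * S.inc p \<omega> j l) - Y (D (u p i) \<omega>) \<omega>)"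
proof (rule usmall_mono[OF riemann_sums[OF dt(1) SI K app, of L]])
  fix p \<omega> i assume i: "i \<in> {i\<in>{..S.N p}. alive (u p i) \<omega>}"
  have "S.inc p \<omega> j l = (if j = 0 then S.ep p else B (real (Suc l) * (\<delta> / 2 ^ p)) \<omega> - B (real l * (\<delta> / 2 ^ p)) \<omega>)" for l
    unfolding gaussian_walk.incr_def[OF S.gw] xi_def by simp
  then show "\<exists>ia\<in>{i. i \<le> L * 2 ^ p \<and> D (real i * (\<delta> / 2 ^ p)) \<omega> < T}.
      \<bar>(\<Sum>l<i. K (u p l) \<omega> * S.inc p \<omega> j l) - Y (D (u p i) \<omega>) \<omega>\<bar>
       \<le> \<bar>(\<Sum>l<ia. K (real l * (\<delta> / 2 ^ p)) \<omega> * (if j = 0 then \<delta> / 2 ^ p else B (real (Suc l) * (\<delta> / 2 ^ p)) \<omega> - B (real l * (\<delta> / 2 ^ p)) \<omega>)) - Y (D (real ia * (\<delta> / 2 ^ p)) \<omega>) \<omega>\<bar>"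
    using i by (intro bexI[of _ i]) (auto simp: alive_def)
qed auto

text \<open>As E (D u) = u, the Riemann sums of the two integrals are Euler sums in X (D u), with
  the coefficients taken at time u. So X (D u) satisfies the Euler recursion up to a small defect,
  and \<open>euler_limit\<close> applies.\<close>

lemma X_limit:
  "usmall M (\<lambda>p \<omega>. {i\<in>{..S.N p}. alive (u p i) \<omega>}) (\<lambda>p i \<omega>. X (D (u p i) \<omega>) \<omega> - S.eul p i \<omega>)"
proof -
  obtain I0 I1 where I: "stoch_integral M \<G> T (driver B E 0) (\<lambda>r \<omega>. F (E r \<omega>) (X r \<omega>)) I0"
    "stoch_integral M \<G> T (driver B E 1) (\<lambda>r \<omega>. G (E r \<omega>) (X r \<omega>)) I1"
    "AE \<omega> in M. \<forall>t\<in>{0..T}. X t \<omega> = x0 + I0 t \<omega> + I1 t \<omega>"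
    and Xad: "adapted_on {0..T} \<G> X" using X unfolding solves_SDE_def by blast
  define xs where "xs v \<omega> = (if alive v \<omega> then X (D v \<omega>) \<omega> else 0)" for v \<omega>
  have xsm: "xs v \<in> borel_measurable (\<F> v)" if "0 \<le> v" for v
    unfolding xs_def
  proof (rule alive_limit_F[OF _ that])
    show "adapted_on {0<..T} \<G> X" using Xad by (auto simp: adapted_on_def)
    show "AE \<omega> in M. alive v \<omega> \<longrightarrow> ((\<lambda>r. X r \<omega>) \<longlongrightarrow> X (D v \<omega>) \<omega>) (at_right (D v \<omega>))"
      using X_path by eventually_elim (use that n_D_nonneg in \<open>auto simp: alive_def intro!: right_continuous_path\<close>)
  qed
  \<comment> \<open>The integrand on the scale of \<open>\<F>\<close>, set to 0 once D v has reached
    \<open>T\<close>, where the equation says nothing.\<close>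
  define K where "K j v \<omega> = (if alive v \<omega> then f [j] v (xs v \<omega>) else 0)" for j v \<omega>
  have Km: "K j v \<in> borel_measurable (\<F> v)" if "0 \<le> v" "j = 0 \<or> j = 1" for j v
  proof -
    have "f [j] v \<in> borel_measurable borel" using that A_base by (intro f_meas) auto
    from measurable_compose[OF xsm[OF that(1)] this] show ?thesis
      unfolding K_def using alive_F[OF that(1)] by (intro measurable_If) (auto simp: pred_def)
  qed
  have app: "AE \<omega> in M. \<forall>\<eta>>0. \<exists>p0. \<forall>p\<ge>p0. \<forall>l. \<forall>t\<in>{0<..T}. D (u p l) \<omega> < t \<longrightarrow> t \<le> D (u p (Suc l)) \<omega> \<longrightarrow> \<bar>f [j] (E t \<omega>) (X t \<omega>) - K j (u p l) \<omega>\<bar> \<le> \<eta>"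
    if j: "j = 0 \<or> j = 1" for j
    using AE_nice X_path
  proof eventually_elim
    case (elim \<omega>)
    let ?y = "\<lambda>t. f [j] (E t \<omega>) (X t \<omega>)"
    have jc: "continuous_on ({0..} \<times> UNIV) (\<lambda>(u, x). f [j] u x)" using FG_cont j by (auto simp: jointly_continuous_def)
    have Ec: "continuous_on {0..T} (\<lambda>t. E t \<omega>)" using n_E_cont[OF elim(1)] by (rule continuous_on_subset) auto
    have "continuous_on {0..T} (\<lambda>t. (\<lambda>(u, x). f [j] u x) (E t \<omega>, X t \<omega>))"
    proof (rule continuous_on_compose2[OF jc])
      show "continuous_on {0..T} (\<lambda>t. (E t \<omega>, X t \<omega>))" using elim(2) Ec by (intro continuous_on_Pair) auto
    qed (use n_E_nonneg[OF elim(1)] in auto)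
    then have yc: "continuous_on {0..T} ?y" by simp
    show ?case
    proof (intro allI impI)
      fix \<eta> :: real assume "0 < \<eta>"
      have "?y s = ?y t" if "s \<in> {0..T}" "t \<in> {0..T}" "E s \<omega> = E t \<omega>" for s t
      proof -
        have "X s \<omega> = X t \<omega>" using elim that by blast
        then show ?thesis using that by simp
      qed
      from grid_app[OF elim(1) dt(1) yc this \<open>0 < \<eta>\<close>]
      obtain p0 where p0: "\<And>p l t. p \<ge> p0 \<Longrightarrow> t \<in> {0<..T} \<Longrightarrow> D (u p l) \<omega> < t \<Longrightarrow> t \<le> D (u p (Suc l)) \<omega> \<Longrightarrow> \<bar>?y t - ?y (D (u p l) \<omega>)\<bar> \<le> \<eta>"
        by blast
      show "\<exists>p0. \<forall>p\<ge>p0. \<forall>l. \<forall>t\<in>{0<..T}. D (u p l) \<omega> < t \<longrightarrow> t \<le> D (u p (Suc l)) \<omega> \<longrightarrow> \<bar>?y t - K j (u p l) \<omega>\<bar> \<le> \<eta>"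
      proof (intro exI[of _ p0] allI ballI impI)
        fix p l t assume a: "p0 \<le> p" "t \<in> {0<..T}" "D (u p l) \<omega> < t" "t \<le> D (u p (Suc l)) \<omega>"
        then have al: "alive (u p l) \<omega>" using elim(1) by (auto simp: alive_def)
        have "K j (u p l) \<omega> = ?y (D (u p l) \<omega>)" using al n_E_D[OF elim(1) u_nonneg] by (simp add: K_def xs_def)
        then show "\<bar>?y t - K j (u p l) \<omega>\<bar> \<le> \<eta>" using p0[OF a] by simp
      qed
    qed
  qed
  have app0: "AE \<omega> in M. \<forall>\<eta>>0. \<exists>p0. \<forall>p\<ge>p0. \<forall>l. \<forall>t\<in>{0<..T}. D (u p l) \<omega> < t \<longrightarrow> t \<le> D (u p (Suc l)) \<omega> \<longrightarrow> \<bar>F (E t \<omega>) (X t \<omega>) - K 0 (u p l) \<omega>\<bar> \<le> \<eta>"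
    and app1: "AE \<omega> in M. \<forall>\<eta>>0. \<exists>p0. \<forall>p\<ge>p0. \<forall>l. \<forall>t\<in>{0<..T}. D (u p l) \<omega> < t \<longrightarrow> t \<le> D (u p (Suc l)) \<omega> \<longrightarrow> \<bar>G (E t \<omega>) (X t \<omega>) - K 1 (u p l) \<omega>\<bar> \<le> \<eta>"
    using app[of 0] app[of 1] unfolding f_01 by auto
  have r: "usmall M (\<lambda>p \<omega>. {i\<in>{..S.N p}. alive (u p i) \<omega>})
    (\<lambda>p i \<omega>. ((\<Sum>l<i. K 0 (u p l) \<omega> * S.inc p \<omega> 0 l) - I0 (D (u p i) \<omega>) \<omega>) + ((\<Sum>l<i. K 1 (u p l) \<omega> * S.inc p \<omega> 1 l) - I1 (D (u p i) \<omega>) \<omega>))"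
    using Km by (intro usmall_add AE_RS[OF I(1) _ app0] AE_RS[OF I(2) _ app1]) auto
  have "usmall M (\<lambda>p \<omega>. {i\<in>{..S.N p}. alive (u p i) \<omega>}) (\<lambda>p i \<omega>. xs (u p i) \<omega> - S.eul p i \<omega>)"
  proof (rule S.euler_limit)
    show "xs (u p l) \<in> borel_measurable (Fp p l)" for p l unfolding Fp_def by (rule xsm[OF u_nonneg])
    show "Measurable.pred (Fp p l) (alive (u p l))" for p l unfolding Fp_def by (rule alive_F[OF u_nonneg])
    show "alive (u p l) \<omega>" if "alive (u p (Suc l)) \<omega>" for p l \<omega>
    proof (rule alive_mono[OF that])
      show "u p l \<le> u p (Suc l)" by (rule mult_right_mono) (use dt in auto)
    qed (rule u_nonneg)
    show "usmall M (\<lambda>p \<omega>. {i\<in>{..S.N p}. alive (u p i) \<omega>})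
      (\<lambda>p i \<omega>. xs (u p i) \<omega> - x0 - (\<Sum>l<i. f [0] (S.time p l) (xs (u p l) \<omega>) * S.ep p) - (\<Sum>l<i. f [1] (S.time p l) (xs (u p l) \<omega>) * xi p l \<omega>))"
    proof (rule usmall_AE_mono[OF r, where C=1 and ?p1.0=0])
      fix p
      show "AE \<omega> in M. \<forall>i\<in>{i\<in>{..S.N p}. alive (u p i) \<omega>}. \<exists>j\<in>{i\<in>{..S.N p}. alive (u p i) \<omega>}.
        \<bar>xs (u p i) \<omega> - x0 - (\<Sum>l<i. f [0] (S.time p l) (xs (u p l) \<omega>) * S.ep p) - (\<Sum>l<i. f [1] (S.time p l) (xs (u p l) \<omega>) * xi p l \<omega>)\<bar>
        \<le> 1 * \<bar>((\<Sum>l<j. K 0 (u p l) \<omega> * S.inc p \<omega> 0 l) - I0 (D (u p j) \<omega>) \<omega>) + ((\<Sum>l<j. K 1 (u p l) \<omega> * S.inc p \<omega> 1 l) - I1 (D (u p j) \<omega>) \<omega>)\<bar>"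
        using I(3)
      proof eventually_elim
        case (elim \<omega>)
        show ?case
        proof (intro ballI, rule bexI)
          fix i assume i: "i \<in> {i\<in>{..S.N p}. alive (u p i) \<omega>}"
          have al: "alive (u p l) \<omega>" if "l \<le> i" for l
          proof (rule alive_mono[of "u p i"])
            show "u p l \<le> u p i" by (rule mult_right_mono) (use that dt in auto)
            show "alive (u p i) \<omega>" using i by simp
          qed (rule u_nonneg)
          have Keq: "(\<Sum>l<i. K j (u p l) \<omega> * S.inc p \<omega> j l) = (\<Sum>l<i. f [j] (S.time p l) (xs (u p l) \<omega>) * (if j = 0 then S.ep p else xi p l \<omega>))" for j
            using al unfolding gaussian_walk.incr_def[OF S.gw] tw_meas by (intro sum.cong) (auto simp: K_def)
          have "D (u p i) \<omega> \<in> {0..T}"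
            using al[OF order_refl] n_D_nonneg[of \<omega> "u p i", OF _ u_nonneg] unfolding alive_def by auto
          then have "X (D (u p i) \<omega>) \<omega> = x0 + I0 (D (u p i) \<omega>) \<omega> + I1 (D (u p i) \<omega>) \<omega>"
            using elim by blast
          moreover have "xs (u p i) \<omega> = X (D (u p i) \<omega>) \<omega>" using al[of i] by (simp add: xs_def)
          ultimately show "\<bar>xs (u p i) \<omega> - x0 - (\<Sum>l<i. f [0] (S.time p l) (xs (u p l) \<omega>) * S.ep p) - (\<Sum>l<i. f [1] (S.time p l) (xs (u p l) \<omega>) * xi p l \<omega>)\<bar>
        \<le> 1 * \<bar>((\<Sum>l<i. K 0 (u p l) \<omega> * S.inc p \<omega> 0 l) - I0 (D (u p i) \<omega>) \<omega>) + ((\<Sum>l<i. K 1 (u p l) \<omega> * S.inc p \<omega> 1 l) - I1 (D (u p i) \<omega>) \<omega>)\<bar>"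
            unfolding Keq by simp
        qed auto
      qed
    qed simp
  qed
  then show ?thesis
    by (rule usmall_mono) (auto intro!: bexI simp: xs_def)
qed

end

context scheme_step
begin

abbreviation "sch p \<equiv> taylor_walk.scheme (xi p) (S.ep p) f A (2 ^ p) x0"
abbreviation "schin p \<equiv> taylor_walk.scheme_in (xi p) (S.ep p) f A (2 ^ p) x0"

lemma u_cell: "u p (n * 2 ^ p) = real n * \<delta>" by simp

lemma u_cell_end: "u p (n * 2 ^ p + 2 ^ p) = real (Suc n) * \<delta>"
proof -
  have "n * 2 ^ p + 2 ^ p = Suc n * 2 ^ p" by simp
  then show ?thesis by (simp only: u_cell)
qed

lemma u_mono: "i \<le> j \<Longrightarrow> u p i \<le> u p j"
  by (rule mult_right_mono) (use dt in auto)

lemma u_less_iff: "u p i < u p j \<longleftrightarrow> i < j"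
  using S.ep_pos[of p] by (simp only: mult_less_cancel_right_pos of_nat_less_iff)

lemma n_delta_nonneg: "0 \<le> real n * \<delta>" using dt by simp

lemma last_cell:
  assumes "nice \<omega>"
  shows "\<exists>N::nat. D (real N * \<delta>) \<omega> \<le> T \<and> T < D (real (Suc N) * \<delta>) \<omega>"
proof -
  obtain v where v: "0 \<le> v" "T < D v \<omega>" using clock_path.unb[OF nice_clock[OF assms]] by blast
  obtain m0 :: nat where "v / \<delta> < real m0" using reals_Archimedean2 by blast
  then have "v \<le> real m0 * \<delta>" using dt by (simp add: field_simps)
  then have m0: "T < D (real m0 * \<delta>) \<omega>" using n_d_le[OF assms v(1)] v(2) by fastforce
  define m where "m = (LEAST m. T < D (real m * \<delta>) \<omega>)"
  have m: "T < D (real m * \<delta>) \<omega>" unfolding m_def using m0 by (rule LeastI)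
  have "m \<noteq> 0" using m n_d0[OF assms] T_pos by (cases m) auto
  then obtain N where N: "m = Suc N" by (cases m) auto
  have "\<not> T < D (real N * \<delta>) \<omega>" using not_less_Least[of N "\<lambda>m. T < D (real m * \<delta>) \<omega>"] N unfolding m_def by auto
  then show ?thesis using m N by (intro exI[of _ N]) auto
qed

text \<open>The defining formulas treat end points of cells and half-open cells separately and stop
  at the cell containing T; together they hold on every closed cell as far as T.\<close>

lemma scheme_path:
  assumes ni: "nice \<omega>"
    and J: "\<forall>N. T \<in> {D (real N * \<delta>) \<omega>..<D (real (Suc N) * \<delta>) \<omega>} \<longrightarrow>
           (\<forall>n<N. V (D (real (Suc n) * \<delta>) \<omega>) \<omega> =
              V (D (real n * \<delta>) \<omega>) \<omega> + (\<Sum>\<alpha>\<in>A - {[]}. J n \<alpha> (D (real (Suc n) * \<delta>) \<omega>) \<omega>)) \<and>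
           (\<forall>n\<le>N. \<forall>s\<in>{D (real n * \<delta>) \<omega>..<D (real (Suc n) * \<delta>) \<omega>} \<inter> {0..T}. V s \<omega> =
              V (D (real n * \<delta>) \<omega>) \<omega> + (\<Sum>\<alpha>\<in>A - {[]}. J n \<alpha> s \<omega>))"
    and s: "D (real n * \<delta>) \<omega> \<le> s" "s \<le> D (real (Suc n) * \<delta>) \<omega>" "s \<le> T"
  shows "V s \<omega> = V (D (real n * \<delta>) \<omega>) \<omega> + (\<Sum>\<alpha>\<in>A - {[]}. J n \<alpha> s \<omega>)"
proof -
  obtain N :: nat where N: "D (real N * \<delta>) \<omega> \<le> T" "T < D (real (Suc N) * \<delta>) \<omega>" using last_cell[OF ni] by blast
  have J': "\<And>n. n < N \<Longrightarrow> V (D (real (Suc n) * \<delta>) \<omega>) \<omega> = V (D (real n * \<delta>) \<omega>) \<omega> + (\<Sum>\<alpha>\<in>A - {[]}. J n \<alpha> (D (real (Suc n) * \<delta>) \<omega>) \<omega>)"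
    "\<And>n s. n \<le> N \<Longrightarrow> s \<in> {D (real n * \<delta>) \<omega>..<D (real (Suc n) * \<delta>) \<omega>} \<inter> {0..T} \<Longrightarrow> V s \<omega> = V (D (real n * \<delta>) \<omega>) \<omega> + (\<Sum>\<alpha>\<in>A - {[]}. J n \<alpha> s \<omega>)"
    using J N by (meson atLeastLessThan_iff)+
  have lt: "n < n'" if "D (real n * \<delta>) \<omega> < D (real n' * \<delta>) \<omega>" for n n' :: nat
  proof (rule ccontr)
    assume "\<not> n < n'"
    then have "real n' * \<delta> \<le> real n * \<delta>" using dt by simp
    from n_d_le[OF ni n_delta_nonneg this] that show False by simp
  qed
  show ?thesis
  proof (cases "s = D (real (Suc n) * \<delta>) \<omega>")
    case True
    then have "Suc n < Suc N" using N s by (intro lt) simp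
    then show ?thesis using J'(1)[of n] True by simp
  next
    case False
    have "n < Suc N" using N s by (intro lt) linarith
    then show ?thesis using J'(2)[of n s] False s n_D_nonneg[OF ni n_delta_nonneg, of n] by simp
  qed
qed

definition cell :: "nat \<Rightarrow> nat \<Rightarrow> 'a \<Rightarrow> nat set" where
  "cell n p \<omega> = {i\<in>{n * 2 ^ p..n * 2 ^ p + 2 ^ p}. alive (u p i) \<omega>}"

lemma cell_le: "n < L \<Longrightarrow> n * 2 ^ p + 2 ^ p \<le> S.N p"
  using mult_le_mono1[of "Suc n" L "2 ^ p"] by simp

lemma cell_start_alive: "i \<in> cell n p \<omega> \<Longrightarrow> alive (real n * \<delta>) \<omega>"
proof -
  assume i: "i \<in> cell n p \<omega>"
  show "alive (real n * \<delta>) \<omega>"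
  proof (rule alive_mono)
    show "alive (u p i) \<omega>" using i by (simp add: cell_def)
    show "real n * \<delta> \<le> u p i" using u_mono[of "n * 2 ^ p" i p] i unfolding u_cell by (simp add: cell_def)
  qed (rule n_delta_nonneg)
qed

text \<open>Induction over the layers from inside out: each integral is compared with its Riemann
  sum, and the Riemann sum with the discrete multiple sum by \<open>usmall_step\<close>. Continuity
  and constancy where \<open>E\<close> is constant are carried along, because the next layer needs
  them for its own Riemann sums. The one-element index set turns a single random variable into a
  family.\<close>

lemma multiple_integral_limit:
  assumes n: "n < L" and \<alpha>: "\<alpha> \<in> A - {[]}"
    and start: "usmall M (\<lambda>p \<omega>. if alive (real n * \<delta>) \<omega> then {()} else {}) (\<lambda>p _ \<omega>. V (D (real n * \<delta>) \<omega>) \<omega> - sch p n \<omega>)"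
    and MI: "multiple_integral M \<G> T (driver B E) (D (real n * \<delta>)) \<mu>
             (\<lambda>r \<omega>. f \<alpha> (E (D (real n * \<delta>) \<omega>) \<omega>) (V (D (real n * \<delta>) \<omega>) \<omega>)) Y"
  shows "usmall M (cell n) (\<lambda>p i \<omega>. Y (D (u p i) \<omega>) \<omega> - mis (S.inc p \<omega>) (n * 2 ^ p) (rev \<mu>) (\<lambda>_. f \<alpha> (real n * \<delta>) (sch p n \<omega>)) i)
    \<and> (AE \<omega> in M. continuous_on {0..T} (\<lambda>t. Y t \<omega>) \<and> (\<forall>s\<in>{0..T}. \<forall>t\<in>{0..T}. E s \<omega> = E t \<omega> \<longrightarrow> Y s \<omega> = Y t \<omega>))"
  using MI
proof (induction \<mu> "\<lambda>(r::real) \<omega>. f \<alpha> (E (D (real n * \<delta>) \<omega>) \<omega>) (V (D (real n * \<delta>) \<omega>) \<omega>)" Y rule: multiple_integral.induct)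
  case empty
  have U: "real n * \<delta> \<le> real L * \<delta>" using n dt by simp
  have H: "0 \<le> hb (real L * \<delta>)" using dt by (intro hb_nonneg) simp
  have "usmall M (cell n) (\<lambda>p i \<omega>. f \<alpha> (E (D (real n * \<delta>) \<omega>) \<omega>) (V (D (real n * \<delta>) \<omega>) \<omega>) - f \<alpha> (real n * \<delta>) (sch p n \<omega>))"
  proof (rule usmall_AE_mono[OF start, where C="hb (real L * \<delta>) + 1" and ?p1.0=0])
    fix p
    show "AE \<omega> in M. \<forall>i\<in>cell n p \<omega>. \<exists>j\<in>if alive (real n * \<delta>) \<omega> then {()} else {}.
        \<bar>f \<alpha> (E (D (real n * \<delta>) \<omega>) \<omega>) (V (D (real n * \<delta>) \<omega>) \<omega>) - f \<alpha> (real n * \<delta>) (sch p n \<omega>)\<bar> \<le> (hb (real L * \<delta>) + 1) * \<bar>V (D (real n * \<delta>) \<omega>) \<omega> - sch p n \<omega>\<bar>"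
    proof (rule AE_I2, rule ballI)
      fix \<omega> i assume i: "i \<in> cell n p \<omega>"
      have al: "alive (real n * \<delta>) \<omega>" using cell_start_alive[OF i] .
      then have e: "E (D (real n * \<delta>) \<omega>) \<omega> = real n * \<delta>" using n_E_D[OF _ n_delta_nonneg] by (simp add: alive_def)
      have "\<bar>f \<alpha> (real n * \<delta>) (V (D (real n * \<delta>) \<omega>) \<omega>) - f \<alpha> (real n * \<delta>) (sch p n \<omega>)\<bar>
        \<le> h \<alpha> (real n * \<delta>) * \<bar>V (D (real n * \<delta>) \<omega>) \<omega> - sch p n \<omega>\<bar>"
        using bounds \<alpha> n_delta_nonneg[of n] unfolding coefficient_bounds_def by blast
      also have "\<dots> \<le> (hb (real L * \<delta>) + 1) * \<bar>V (D (real n * \<delta>) \<omega>) \<omega> - sch p n \<omega>\<bar>"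
        using h_le[OF \<alpha> n_delta_nonneg U] by (intro mult_right_mono) auto
      finally show "\<exists>j\<in>if alive (real n * \<delta>) \<omega> then {()} else {}.
        \<bar>f \<alpha> (E (D (real n * \<delta>) \<omega>) \<omega>) (V (D (real n * \<delta>) \<omega>) \<omega>) - f \<alpha> (real n * \<delta>) (sch p n \<omega>)\<bar> \<le> (hb (real L * \<delta>) + 1) * \<bar>V (D (real n * \<delta>) \<omega>) \<omega> - sch p n \<omega>\<bar>"
        using al unfolding e by simp
    qed
  qed (use H in simp)
  then show ?case by simp
next
  case (snoc \<mu> Y j Y')
  then have IH: "usmall M (cell n) (\<lambda>p i \<omega>. Y (D (u p i) \<omega>) \<omega> - mis (S.inc p \<omega>) (n * 2 ^ p) (rev \<mu>) (\<lambda>_. f \<alpha> (real n * \<delta>) (sch p n \<omega>)) i)"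
    and Ypath: "AE \<omega> in M. continuous_on {0..T} (\<lambda>t. Y t \<omega>) \<and> (\<forall>s\<in>{0..T}. \<forall>t\<in>{0..T}. E s \<omega> = E t \<omega> \<longrightarrow> Y s \<omega> = Y t \<omega>)"
    and SI: "stoch_integral M \<G> T (driver B E j) (\<lambda>r \<omega>. indicator {D (real n * \<delta>) \<omega><..} r * Y r \<omega>) Y'" by auto
  define m where "m p \<omega> l = mis (S.inc p \<omega>) (n * 2 ^ p) (rev \<mu>) (\<lambda>_. f \<alpha> (real n * \<delta>) (sch p n \<omega>)) l" for p \<omega> l
  \<comment> \<open>The right limit of the integrand at D v: just after the start of the cell the
    indicator is 1, although it is 0 at the start itself.\<close>
  define K where "K v \<omega> = (if alive v \<omega> then (if real n * \<delta> \<le> v then Y (D v \<omega>) \<omega> else 0) else 0)" for v \<omega>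
  have Km: "K v \<in> borel_measurable (\<F> v)" if v: "0 \<le> v" for v
    unfolding K_def
  proof (rule alive_limit_F[OF _ v])
    show "adapted_on {0<..T} \<G> (\<lambda>r \<omega>. indicator {D (real n * \<delta>) \<omega><..} r * Y r \<omega>)" using SI by (simp add: stoch_integral_def)
    show "AE \<omega> in M. alive v \<omega> \<longrightarrow> ((\<lambda>r. indicator {D (real n * \<delta>) \<omega><..} r * Y r \<omega>) \<longlongrightarrow> (if real n * \<delta> \<le> v then Y (D v \<omega>) \<omega> else 0)) (at_right (D v \<omega>))"
      using Ypath
    proof eventually_elim
      case (elim \<omega>)
      show ?case
      proof
        assume al: "alive v \<omega>"
        then have ni: "nice \<omega>" "D v \<omega> < T" by (auto simp: alive_def)
        show "((\<lambda>r. indicator {D (real n * \<delta>) \<omega><..} r * Y r \<omega>) \<longlongrightarrow> (if real n * \<delta> \<le> v then Y (D v \<omega>) \<omega> else 0)) (at_right (D v \<omega>))"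
        proof (cases "real n * \<delta> \<le> v")
          case True
          have le: "D (real n * \<delta>) \<omega> \<le> D v \<omega>" using n_d_le[OF ni(1) n_delta_nonneg True] .
          have "\<forall>\<^sub>F r in at_right (D v \<omega>). Y r \<omega> = indicator {D (real n * \<delta>) \<omega><..} r * Y r \<omega>"
            using eventually_at_right_less[of "D v \<omega>"] by eventually_elim (use le in auto)
          moreover have "((\<lambda>r. Y r \<omega>) \<longlongrightarrow> Y (D v \<omega>) \<omega>) (at_right (D v \<omega>))"
            using elim ni n_D_nonneg[OF ni(1) v] by (intro right_continuous_path) auto
          ultimately show ?thesis using True by (simp add: Lim_transform_eventually)
        next
          case False
          have "D v \<omega> < D (real n * \<delta>) \<omega>" using n_d_less[OF ni(1) v] False by simp
          from order_tendstoD(2)[OF tendsto_ident_at this, of "{D v \<omega><..}"]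
          have "\<forall>\<^sub>F r in at_right (D v \<omega>). 0 = indicator {D (real n * \<delta>) \<omega><..} r * Y r \<omega>"
            by eventually_elim auto
          then show ?thesis using False by (simp add: Lim_transform_eventually[OF tendsto_const])
        qed
      qed
    qed
  qed
  have app: "AE \<omega> in M. \<forall>\<eta>>0. \<exists>p0. \<forall>p\<ge>p0. \<forall>l. \<forall>t\<in>{0<..T}. D (u p l) \<omega> < t \<longrightarrow> t \<le> D (u p (Suc l)) \<omega>
      \<longrightarrow> \<bar>indicator {D (real n * \<delta>) \<omega><..} t * Y t \<omega> - K (u p l) \<omega>\<bar> \<le> \<eta>"
    using AE_nice Ypath
  proof eventually_elim
    case (elim \<omega>)
    show ?case
    proof (intro allI impI)
      fix \<eta> :: real assume \<eta>: "0 < \<eta>"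
      have fl: "Y s \<omega> = Y t \<omega>" if "s \<in> {0..T}" "t \<in> {0..T}" "E s \<omega> = E t \<omega>" for s t using elim that by blast
      from grid_app[OF elim(1) dt(1) conjunct1[OF elim(2)] fl \<eta>]
      obtain p0 where p0: "\<And>p l t. p \<ge> p0 \<Longrightarrow> t \<in> {0<..T} \<Longrightarrow> D (u p l) \<omega> < t \<Longrightarrow> t \<le> D (u p (Suc l)) \<omega> \<Longrightarrow> \<bar>Y t \<omega> - Y (D (u p l) \<omega>) \<omega>\<bar> \<le> \<eta>"
        by blast
      show "\<exists>p0. \<forall>p\<ge>p0. \<forall>l. \<forall>t\<in>{0<..T}. D (u p l) \<omega> < t \<longrightarrow> t \<le> D (u p (Suc l)) \<omega>
          \<longrightarrow> \<bar>indicator {D (real n * \<delta>) \<omega><..} t * Y t \<omega> - K (u p l) \<omega>\<bar> \<le> \<eta>"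
      proof (intro exI[of _ p0] allI ballI impI)
        fix p l t assume a: "p0 \<le> p" "t \<in> {0<..T}" "D (u p l) \<omega> < t" "t \<le> D (u p (Suc l)) \<omega>"
        then have al: "alive (u p l) \<omega>" using elim(1) by (auto simp: alive_def)
        show "\<bar>indicator {D (real n * \<delta>) \<omega><..} t * Y t \<omega> - K (u p l) \<omega>\<bar> \<le> \<eta>"
        proof (cases "real n * \<delta> \<le> u p l")
          case True
          have "D (real n * \<delta>) \<omega> < t" using n_d_le[OF elim(1) n_delta_nonneg True] a(3) by simp
          moreover have "K (u p l) \<omega> = Y (D (u p l) \<omega>) \<omega>" using True al unfolding K_def by (simp only: if_True)
          ultimately show ?thesis using p0[OF a] by simp
        next
          \<comment> \<open>The next grid point is at most n \<delta>, so t does not lie beyond the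
            start of the cell and both terms are 0.\<close>
          case False
          then have "u p l < u p (n * 2 ^ p)" unfolding u_cell by (simp only: not_le)
          then have "Suc l \<le> n * 2 ^ p" unfolding u_less_iff by simp
          from u_mono[OF this, of p] have "D (u p (Suc l)) \<omega> \<le> D (real n * \<delta>) \<omega>" unfolding u_cell by (intro n_d_le[OF elim(1) u_nonneg])
          then have "\<not> D (real n * \<delta>) \<omega> < t" using a(4) by linarith
          moreover have "K (u p l) \<omega> = 0" using False unfolding K_def by (simp only: if_False if_cancel)
          ultimately show ?thesis using \<eta> by simp
        qed
      qed
    qed
  qed
  have r: "usmall M (cell n) (\<lambda>p i \<omega>. (\<Sum>l<i. K (u p l) \<omega> * S.inc p \<omega> j l) - Y' (D (u p i) \<omega>) \<omega>)"
  proof (rule usmall_mono[OF AE_RS[OF SI Km app]])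
    fix p \<omega> i assume "i \<in> cell n p \<omega>"
    then show "\<exists>j'\<in>{i\<in>{..S.N p}. alive (u p i) \<omega>}. \<bar>(\<Sum>l<i. K (u p l) \<omega> * S.inc p \<omega> j l) - Y' (D (u p i) \<omega>) \<omega>\<bar>
        \<le> \<bar>(\<Sum>l<j'. K (u p l) \<omega> * S.inc p \<omega> j l) - Y' (D (u p j') \<omega>) \<omega>\<bar>"
      using cell_le[OF n, of p] by (intro bexI[of _ i]) (auto simp: cell_def)
  qed auto
  have Kcell: "K (u p i) \<omega> = Y (D (u p i) \<omega>) \<omega>" if "i \<in> cell n p \<omega>" for p i \<omega>
  proof -
    have "real n * \<delta> \<le> u p i" using u_mono[of "n * 2 ^ p" i p] that unfolding u_cell by (simp add: cell_def)
    moreover have "alive (u p i) \<omega>" using that by (simp add: cell_def)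
    ultimately show ?thesis unfolding K_def by (simp only: if_True)
  qed
  have "usmall M (\<lambda>p \<omega>. {i\<in>{n * 2 ^ p..n * 2 ^ p + 2 ^ p}. alive (u p i) \<omega>})
      (\<lambda>p i \<omega>. \<Sum>l\<in>{n * 2 ^ p..<i}. (K (u p l) \<omega> - m p \<omega> l) * S.inc p \<omega> j l)"
  proof (rule usmall_step[OF S.gw, where P="\<lambda>p l. alive (u p l)" and U=\<delta>])
    fix p l assume l: "n * 2 ^ p \<le> l"
    show "Measurable.pred (Fp p l) (alive (u p l))" unfolding Fp_def by (rule alive_F[OF u_nonneg])
    interpret T: taylor_walk M "Fp p" "xi p" "S.ep p" f A R "2 ^ p" L g x0 "hb (real L * \<delta>)" "kb (real L * \<delta>)" kap "real L * \<delta>" by (rule S.tw)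
    have t: "T.tm (n * 2 ^ p) = real n * \<delta>" by (simp add: T.tm_def)
    have "\<alpha> \<in> A \<union> R" using \<alpha> by simp
    from T.f_comp_meas[OF T.scheme_meas this n_delta_nonneg[of n], of n]
    have "(\<lambda>\<omega>. f \<alpha> (real n * \<delta>) (sch p n \<omega>)) \<in> borel_measurable (Fp p l')" if "n * 2 ^ p \<le> l'" for l'
      using that by (rule T.H_meas_mono)
    from T.ms_meas[OF this l order_refl]
    have "(\<lambda>\<omega>. m p \<omega> l) \<in> borel_measurable (Fp p l)" unfolding m_def .
    moreover have "K (u p l) \<in> borel_measurable (Fp p l)" unfolding Fp_def by (rule Km[OF u_nonneg])
    ultimately show "(\<lambda>\<omega>. K (u p l) \<omega> - m p \<omega> l) \<in> borel_measurable (Fp p l)" by (rule borel_measurable_diff[rotated])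
  next
    show "alive (u p l) \<omega>" if "alive (u p (Suc l)) \<omega>" for p l \<omega>
      by (rule alive_mono[OF that u_nonneg u_mono]) simp
    show "usmall M (\<lambda>p \<omega>. {i\<in>{n * 2 ^ p..n * 2 ^ p + 2 ^ p}. alive (u p i) \<omega>}) (\<lambda>p l \<omega>. K (u p l) \<omega> - m p \<omega> l)"
    proof (rule usmall_mono[OF IH])
      fix p \<omega> i assume "i \<in> {i\<in>{n * 2 ^ p..n * 2 ^ p + 2 ^ p}. alive (u p i) \<omega>}"
      then have i: "i \<in> cell n p \<omega>" by (simp add: cell_def)
      show "\<exists>j\<in>cell n p \<omega>. \<bar>K (u p i) \<omega> - m p \<omega> i\<bar> \<le> \<bar>Y (D (u p j) \<omega>) \<omega> - mis (S.inc p \<omega>) (n * 2 ^ p) (rev \<mu>) (\<lambda>_. f \<alpha> (real n * \<delta>) (sch p n \<omega>)) j\<bar>"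
        by (rule bexI[OF _ i]) (simp only: Kcell[OF i] m_def order_refl)
    qed
  qed auto
  then have "usmall M (cell n) (\<lambda>p i \<omega>. \<Sum>l\<in>{n * 2 ^ p..<i}. (K (u p l) \<omega> - m p \<omega> l) * S.inc p \<omega> j l)" unfolding cell_def .
  from usmall_diff[OF this r]
  have "usmall M (cell n) (\<lambda>p i \<omega>. Y' (D (u p i) \<omega>) \<omega> - mis (S.inc p \<omega>) (n * 2 ^ p) (rev (\<mu> @ [j])) (\<lambda>_. f \<alpha> (real n * \<delta>) (sch p n \<omega>)) i)"
  proof (rule usmall_mono)
    fix p \<omega> i assume i: "i \<in> cell n p \<omega>"
    \<comment> \<open>Riemann sums start at 0, discrete multiple sums at the start of the cell; the
      terms in between vanish.\<close>
    have z: "K (u p l) \<omega> = 0" if "l < n * 2 ^ p" for l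
    proof -
      have "\<not> real n * \<delta> \<le> u p l" using u_less_iff[where p=p and i=l and j="n * 2 ^ p"] that unfolding u_cell by (simp only: not_le)
      then show ?thesis unfolding K_def by (simp only: if_False if_cancel)
    qed
    have "(\<Sum>l<i. K (u p l) \<omega> * S.inc p \<omega> j l) = (\<Sum>l\<in>{n * 2 ^ p..<i}. K (u p l) \<omega> * S.inc p \<omega> j l)"
    proof (rule sum.mono_neutral_right)
      show "\<forall>l\<in>{..<i} - {n * 2 ^ p..<i}. K (u p l) \<omega> * S.inc p \<omega> j l = 0"
      proof
        fix l assume "l \<in> {..<i} - {n * 2 ^ p..<i}"
        then have "l < n * 2 ^ p" by auto
        from z[OF this] show "K (u p l) \<omega> * S.inc p \<omega> j l = 0" by (simp only: mult_zero_left)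
      qed
    qed auto
    then have "(\<Sum>l\<in>{n * 2 ^ p..<i}. (K (u p l) \<omega> - m p \<omega> l) * S.inc p \<omega> j l) - ((\<Sum>l<i. K (u p l) \<omega> * S.inc p \<omega> j l) - Y' (D (u p i) \<omega>) \<omega>)
       = Y' (D (u p i) \<omega>) \<omega> - (\<Sum>l\<in>{n * 2 ^ p..<i}. m p \<omega> l * S.inc p \<omega> j l)"
      by (simp only: left_diff_distrib sum_subtractf)
    then have "Y' (D (u p i) \<omega>) \<omega> - mis (S.inc p \<omega>) (n * 2 ^ p) (rev (\<mu> @ [j])) (\<lambda>_. f \<alpha> (real n * \<delta>) (sch p n \<omega>)) i
       = (\<Sum>l\<in>{n * 2 ^ p..<i}. (K (u p l) \<omega> - m p \<omega> l) * S.inc p \<omega> j l) - ((\<Sum>l<i. K (u p l) \<omega> * S.inc p \<omega> j l) - Y' (D (u p i) \<omega>) \<omega>)"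
      unfolding rev_append rev.simps append.simps mis.simps m_def by (simp only: append_Nil append_Cons mis.simps)
    then show "\<exists>j'\<in>cell n p \<omega>. \<bar>Y' (D (u p i) \<omega>) \<omega> - mis (S.inc p \<omega>) (n * 2 ^ p) (rev (\<mu> @ [j])) (\<lambda>_. f \<alpha> (real n * \<delta>) (sch p n \<omega>)) i\<bar>
       \<le> \<bar>(\<Sum>l\<in>{n * 2 ^ p..<j'}. (K (u p l) \<omega> - m p \<omega> l) * S.inc p \<omega> j l) - ((\<Sum>l<j'. K (u p l) \<omega> * S.inc p \<omega> j l) - Y' (D (u p j') \<omega>) \<omega>)\<bar>"
      by (intro bexI[OF _ i]) (simp only: order_refl)
  qed
  moreover have "AE \<omega> in M. continuous_on {0..T} (\<lambda>t. Y' t \<omega>)" using SI by (simp add: stoch_integral_def)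
  with integral_flat[OF SI] have "AE \<omega> in M. continuous_on {0..T} (\<lambda>t. Y' t \<omega>) \<and> (\<forall>s\<in>{0..T}. \<forall>t\<in>{0..T}. E s \<omega> = E t \<omega> \<longrightarrow> Y' s \<omega> = Y' t \<omega>)"
    by eventually_elim blast
  ultimately show ?case by blast
qed

text \<open>Induction over the cells: the end of one is the start of the next, so smallness of the
  error is handed on. The integrals \<open>J\<close> are returned because they describe the
  approximation on closed cells by continuous paths.\<close>

lemma scheme_limit:
  obtains J where
    "\<And>n. n < L \<Longrightarrow> usmall M (cell n) (\<lambda>p i \<omega>. V (D (u p i) \<omega>) \<omega> - schin p n i \<omega>)"
    "AE \<omega> in M. \<forall>n<L. \<forall>s. D (real n * \<delta>) \<omega> \<le> s \<longrightarrow> s \<le> D (real (Suc n) * \<delta>) \<omega> \<longrightarrow> s \<le> T \<longrightarrow>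
       V s \<omega> = V (D (real n * \<delta>) \<omega>) \<omega> + (\<Sum>\<alpha>\<in>A - {[]}. J n \<alpha> s \<omega>)"
    "AE \<omega> in M. \<forall>n<L. \<forall>\<alpha>\<in>A - {[]}. continuous_on {0..T} (\<lambda>t. J n \<alpha> t \<omega>) \<and> (\<forall>s\<in>{0..T}. \<forall>t\<in>{0..T}. E s \<omega> = E t \<omega> \<longrightarrow> J n \<alpha> s \<omega> = J n \<alpha> t \<omega>)"
proof -
  obtain J where V0: "AE \<omega> in M. V 0 \<omega> = x0"
    and J1: "\<And>n \<alpha>. \<alpha> \<in> A - {[]} \<Longrightarrow> multiple_integral M \<G> T (driver B E) (D (real n * \<delta>)) \<alpha> (\<lambda>r \<omega>. f \<alpha> (E (D (real n * \<delta>) \<omega>) \<omega>) (V (D (real n * \<delta>) \<omega>) \<omega>)) (J n \<alpha>)"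
    and J2: "AE \<omega> in M. \<forall>N. T \<in> {D (real N * \<delta>) \<omega>..<D (real (Suc N) * \<delta>) \<omega>} \<longrightarrow>
           (\<forall>n<N. V (D (real (Suc n) * \<delta>) \<omega>) \<omega> =
              V (D (real n * \<delta>) \<omega>) \<omega> + (\<Sum>\<alpha>\<in>A - {[]}. J n \<alpha> (D (real (Suc n) * \<delta>) \<omega>) \<omega>)) \<and>
           (\<forall>n\<le>N. \<forall>s\<in>{D (real n * \<delta>) \<omega>..<D (real (Suc n) * \<delta>) \<omega>} \<inter> {0..T}. V s \<omega> =
              V (D (real n * \<delta>) \<omega>) \<omega> + (\<Sum>\<alpha>\<in>A - {[]}. J n \<alpha> s \<omega>))"
    using V unfolding ito_taylor_approx_def Let_def by blast
  have path: "AE \<omega> in M. \<forall>n s. D (real n * \<delta>) \<omega> \<le> s \<longrightarrow> s \<le> D (real (Suc n) * \<delta>) \<omega> \<longrightarrow> s \<le> T \<longrightarrow>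
       V s \<omega> = V (D (real n * \<delta>) \<omega>) \<omega> + (\<Sum>\<alpha>\<in>A - {[]}. J n \<alpha> s \<omega>)"
    using AE_nice J2 by eventually_elim (blast intro: scheme_path)
  let ?start = "\<lambda>n. usmall M (\<lambda>p \<omega>. if alive (real n * \<delta>) \<omega> then {()} else {}) (\<lambda>p _ \<omega>. V (D (real n * \<delta>) \<omega>) \<omega> - sch p n \<omega>)"
  have step: "usmall M (cell n) (\<lambda>p i \<omega>. V (D (u p i) \<omega>) \<omega> - schin p n i \<omega>)" if n: "n < L" and st: "?start n" for n
  proof -
    have s1: "usmall M (cell n) (\<lambda>p i \<omega>. V (D (real n * \<delta>) \<omega>) \<omega> - sch p n \<omega>)"
      by (rule usmall_mono[OF st]) (use cell_start_alive in fastforce)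
    have s2: "usmall M (cell n) (\<lambda>p i \<omega>. \<Sum>\<alpha>\<in>A - {[]}. J n \<alpha> (D (u p i) \<omega>) \<omega> - mis (S.inc p \<omega>) (n * 2 ^ p) (rev \<alpha>) (\<lambda>_. f \<alpha> (real n * \<delta>) (sch p n \<omega>)) i)"
      using finite_A_set by (intro usmall_sum conjunct1[OF multiple_integral_limit[OF n _ st J1]]) auto
    show ?thesis
    proof (rule usmall_AE_mono[OF usmall_add[OF s1 s2], where C=1 and ?p1.0=0])
      fix p
      interpret T: taylor_walk M "Fp p" "xi p" "S.ep p" f A R "2 ^ p" L g x0 "hb (real L * \<delta>)" "kb (real L * \<delta>)" kap "real L * \<delta>" by (rule S.tw)
      have t: "T.tm (n * 2 ^ p) = real n * \<delta>" by (simp add: T.tm_def)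
      show "AE \<omega> in M. \<forall>i\<in>cell n p \<omega>. \<exists>j\<in>cell n p \<omega>. \<bar>V (D (u p i) \<omega>) \<omega> - schin p n i \<omega>\<bar> \<le> 1 * \<bar>(V (D (real n * \<delta>) \<omega>) \<omega> - sch p n \<omega>)
          + (\<Sum>\<alpha>\<in>A - {[]}. J n \<alpha> (D (u p j) \<omega>) \<omega> - mis (S.inc p \<omega>) (n * 2 ^ p) (rev \<alpha>) (\<lambda>_. f \<alpha> (real n * \<delta>) (sch p n \<omega>)) j)\<bar>"
        using path
      proof eventually_elim
        case (elim \<omega>)
        show ?case
        proof (rule ballI, rule bexI)
          fix i assume i: "i \<in> cell n p \<omega>"
          then have ni: "nice \<omega>" and lt: "D (u p i) \<omega> < T" and ii: "n * 2 ^ p \<le> i" "i \<le> n * 2 ^ p + 2 ^ p" by (auto simp: cell_def alive_def)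
          have "D (real n * \<delta>) \<omega> \<le> D (u p i) \<omega>" using n_d_le[OF ni u_nonneg u_mono[OF ii(1), of p]] unfolding u_cell .
          moreover have "D (u p i) \<omega> \<le> D (real (Suc n) * \<delta>) \<omega>" using n_d_le[OF ni u_nonneg u_mono[OF ii(2), of p]] unfolding u_cell_end .
          ultimately have "V (D (u p i) \<omega>) \<omega> = V (D (real n * \<delta>) \<omega>) \<omega> + (\<Sum>\<alpha>\<in>A - {[]}. J n \<alpha> (D (u p i) \<omega>) \<omega>)" using elim lt less_imp_le by blast
          then show "\<bar>V (D (u p i) \<omega>) \<omega> - schin p n i \<omega>\<bar> \<le> 1 * \<bar>(V (D (real n * \<delta>) \<omega>) \<omega> - sch p n \<omega>)
          + (\<Sum>\<alpha>\<in>A - {[]}. J n \<alpha> (D (u p i) \<omega>) \<omega> - mis (S.inc p \<omega>) (n * 2 ^ p) (rev \<alpha>) (\<lambda>_. f \<alpha> (real n * \<delta>) (sch p n \<omega>)) i)\<bar>"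
            unfolding T.scheme_in_def t sum_subtractf by simp
        qed auto
      qed
    qed simp
  qed
  have start: "?start n" if "n \<le> L" for n
    using that
  proof (induction n)
    case 0
    show ?case
    proof (rule usmall_AE_mono[OF usmall_zero, where C=1 and ?p1.0=0])
      fix p
      interpret T: taylor_walk M "Fp p" "xi p" "S.ep p" f A R "2 ^ p" L g x0 "hb (real L * \<delta>)" "kb (real L * \<delta>)" kap "real L * \<delta>" by (rule S.tw)
      show "AE \<omega> in M. \<forall>i\<in>if alive (real 0 * \<delta>) \<omega> then {()} else {}. \<exists>j\<in>{()}. \<bar>V (D (real 0 * \<delta>) \<omega>) \<omega> - sch p 0 \<omega>\<bar> \<le> 1 * \<bar>0::real\<bar>"
        using V0 AE_D_0 by eventually_elim auto
    qed simp
  next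
    case (Suc n)
    then have n: "n < L" by simp
    show ?case
    proof (rule usmall_mono[OF step[OF n Suc.IH]])
      fix p \<omega> i assume "i \<in> (if alive (real (Suc n) * \<delta>) \<omega> then {()} else {})"
      then have al: "alive (real (Suc n) * \<delta>) \<omega>" by (simp split: if_splits)
      interpret T: taylor_walk M "Fp p" "xi p" "S.ep p" f A R "2 ^ p" L g x0 "hb (real L * \<delta>)" "kb (real L * \<delta>)" kap "real L * \<delta>" by (rule S.tw)
      have c: "n * 2 ^ p + 2 ^ p \<in> cell n p \<omega>" unfolding cell_def mem_Collect_eq u_cell_end using al by simp
      show "\<exists>j\<in>cell n p \<omega>. \<bar>V (D (real (Suc n) * \<delta>) \<omega>) \<omega> - sch p (Suc n) \<omega>\<bar> \<le> \<bar>V (D (u p j) \<omega>) \<omega> - schin p n j \<omega>\<bar>"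
        by (rule bexI[OF _ c]) (simp only: T.scheme_in_end u_cell_end order_refl)
    qed (use n in simp)
  qed
  have "AE \<omega> in M. \<forall>n\<in>{..<L}. \<forall>\<alpha>\<in>A - {[]}. continuous_on {0..T} (\<lambda>t. J n \<alpha> t \<omega>) \<and> (\<forall>s\<in>{0..T}. \<forall>t\<in>{0..T}. E s \<omega> = E t \<omega> \<longrightarrow> J n \<alpha> s \<omega> = J n \<alpha> t \<omega>)"
    using finite_A_set start multiple_integral_limit[OF _ _ _ J1]
    by (intro AE_finite_allI) auto
  then have "AE \<omega> in M. \<forall>n<L. \<forall>\<alpha>\<in>A - {[]}. continuous_on {0..T} (\<lambda>t. J n \<alpha> t \<omega>) \<and> (\<forall>s\<in>{0..T}. \<forall>t\<in>{0..T}. E s \<omega> = E t \<omega> \<longrightarrow> J n \<alpha> s \<omega> = J n \<alpha> t \<omega>)"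
    by eventually_elim blast
  moreover have "AE \<omega> in M. \<forall>n<L. \<forall>s. D (real n * \<delta>) \<omega> \<le> s \<longrightarrow> s \<le> D (real (Suc n) * \<delta>) \<omega> \<longrightarrow> s \<le> T \<longrightarrow>
       V s \<omega> = V (D (real n * \<delta>) \<omega>) \<omega> + (\<Sum>\<alpha>\<in>A - {[]}. J n \<alpha> s \<omega>)"
    using path by eventually_elim blast
  moreover have "usmall M (cell n) (\<lambda>p i \<omega>. V (D (u p i) \<omega>) \<omega> - schin p n i \<omega>)" if "n < L" for n
    using step[OF that start] that by simp
  ultimately show ?thesis using that by blast
qed

end

section \<open>Error constants and the limit along the grids\<close>

context scheme_setting
begin

text \<open>\<open>core\<close> and \<open>growth\<close> are the two factors of the bound in
  \<open>scheme_error\<close> as functions of the horizon, without the power of the step size and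
  the tolerance \<eta>.\<close>

definition core :: "real \<Rightarrow> real" where
  "core U = 8 * kap * (U + 1) * U * (kb U)\<^sup>2 * ((1 + 2 * x0\<^sup>2) * exp (8 * (U + 8) * (hb U)\<^sup>2 * U))"

definition growth :: "real \<Rightarrow> real" where
  "growth U = exp (2 * kap * (U + 1) * (hb U)\<^sup>2 * U)"

end

context scheme_step
begin

abbreviation "good p \<eta> \<equiv> taylor_walk.good (xi p) (S.ep p) f A (2 ^ p) x0 \<eta> L"

text \<open>The true error X - V at a grid point minus the discrete error, Euler process minus
  scheme.\<close>

definition gap :: "nat \<Rightarrow> nat \<Rightarrow> nat \<Rightarrow> 'a \<Rightarrow> real" where
  "gap p n i \<omega> = X (D (u p i) \<omega>) \<omega> - S.eul p i \<omega> - (V (D (u p i) \<omega>) \<omega> - schin p n i \<omega>)"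

lemma good_grids:
  assumes "0 < \<eta>" "0 < \<kappa>"
  shows "\<exists>p0. \<forall>p\<ge>p0. \<exists>B\<in>sets M. measure M B < \<kappa> \<and> (\<forall>\<omega>\<in>space M - B.
    good p \<eta> \<omega> \<and>
    (\<forall>n<L. \<forall>i\<in>cell n p \<omega>. \<bar>gap p n i \<omega>\<bar> \<le> 2 * \<eta>))"
proof -
  obtain J where J: "\<And>n. n < L \<Longrightarrow> usmall M (cell n) (\<lambda>p i \<omega>. V (D (u p i) \<omega>) \<omega> - schin p n i \<omega>)"
    by (rule scheme_limit) blast
  \<comment> \<open>L + 1 exceptional sets will be united: one for the Ito defects and one for each
    cell.\<close>
  define \<kappa>' where "\<kappa>' = \<kappa> / (L + 1)"
  have \<kappa>': "0 < \<kappa>'" using assms by (simp add: \<kappa>'_def)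
  have n: "usmall M (cell n) (\<lambda>p i \<omega>. gap p n i \<omega>)" if n: "n < L" for n
    unfolding gap_def
  proof (rule usmall_diff[OF usmall_mono[OF X_limit] J[OF n]])
    fix p \<omega> i assume "i \<in> cell n p \<omega>"
    then show "\<exists>j\<in>{i \<in> {..S.N p}. alive (u p i) \<omega>}. \<bar>X (D (u p i) \<omega>) \<omega> - S.eul p i \<omega>\<bar> \<le> \<bar>X (D (u p j) \<omega>) \<omega> - S.eul p j \<omega>\<bar>"
      using cell_le[OF n, of p] by (intro bexI[of _ i]) (auto simp: cell_def)
  qed
  have "\<forall>n\<in>{..<L}. \<exists>p0. \<forall>p\<ge>p0. \<exists>B\<in>sets M. measure M B < \<kappa>' \<and> (\<forall>\<omega>\<in>space M - B.
      \<forall>i\<in>cell n p \<omega>. \<bar>gap p n i \<omega>\<bar> \<le> 2 * \<eta>)"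
    using n assms \<kappa>' unfolding usmall_def by (metis lessThan_iff mult_pos_pos zero_less_numeral)
  then obtain q where q: "\<And>n p. n < L \<Longrightarrow> q n \<le> p \<Longrightarrow> \<exists>B\<in>sets M. measure M B < \<kappa>' \<and> (\<forall>\<omega>\<in>space M - B.
      \<forall>i\<in>cell n p \<omega>. \<bar>gap p n i \<omega>\<bar> \<le> 2 * \<eta>)"
    unfolding bchoice_iff by (metis lessThan_iff)
  obtain p1 where p1: "\<And>p. p1 \<le> p \<Longrightarrow> \<exists>B\<in>sets M. measure M B < \<kappa>' \<and> (\<forall>\<omega>\<in>space M - B. good p \<eta> \<omega>)"
    using S.good_event[OF assms(1) \<kappa>'] by blast
  show ?thesis
  proof (intro exI[of _ "p1 + (\<Sum>n<L. q n)"] allI impI)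
    fix p assume p: "p1 + (\<Sum>n<L. q n) \<le> p"
    have qp: "q n \<le> p" if "n < L" for n
      using member_le_sum[of n "{..<L}" q] that p by simp
    obtain B0 where B0: "B0 \<in> sets M" "measure M B0 < \<kappa>'" "\<forall>\<omega>\<in>space M - B0. good p \<eta> \<omega>"
      using p1[of p] p by auto
    have "\<forall>n\<in>{..<L}. \<exists>B. B \<in> sets M \<and> measure M B < \<kappa>' \<and> (\<forall>\<omega>\<in>space M - B.
      \<forall>i\<in>cell n p \<omega>. \<bar>gap p n i \<omega>\<bar> \<le> 2 * \<eta>)"
      using q qp by (metis lessThan_iff)
    then obtain Bn where Bn: "\<And>n. n < L \<Longrightarrow> Bn n \<in> sets M" "\<And>n. n < L \<Longrightarrow> measure M (Bn n) < \<kappa>'"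
      "\<And>n \<omega> i. n < L \<Longrightarrow> \<omega> \<in> space M - Bn n \<Longrightarrow> i \<in> cell n p \<omega> \<Longrightarrow>
         \<bar>gap p n i \<omega>\<bar> \<le> 2 * \<eta>"
      unfolding bchoice_iff by (metis lessThan_iff)
    define C where "C = B0 \<union> (\<Union>n<L. Bn n)"
    have "measure M C \<le> measure M B0 + measure M (\<Union>n<L. Bn n)"
      unfolding C_def using B0 Bn by (intro measure_Un_le) auto
    also have "measure M (\<Union>n<L. Bn n) \<le> (\<Sum>n<L. measure M (Bn n))"
      using Bn by (intro finite_measure_subadditive_finite) auto
    also have "\<dots> \<le> (\<Sum>n<L. \<kappa>')" using Bn(2) by (intro sum_mono) (auto intro: less_imp_le)
    finally have "measure M C < \<kappa>' + L * \<kappa>'" using B0(2) by simp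
    also have "\<dots> = (L + 1) * \<kappa>'" by (simp add: algebra_simps)
    also have "\<dots> = \<kappa>" by (simp add: \<kappa>'_def)
    finally have "measure M C < \<kappa>" .
    moreover have "C \<in> sets M" using B0(1) Bn(1) by (auto simp: C_def)
    ultimately show "\<exists>B\<in>sets M. measure M B < \<kappa> \<and> (\<forall>\<omega>\<in>space M - B.
    good p \<eta> \<omega> \<and>
    (\<forall>n<L. \<forall>i\<in>cell n p \<omega>. \<bar>gap p n i \<omega>\<bar> \<le> 2 * \<eta>))"
    proof (intro bexI[of _ C] conjI ballI allI impI)
      fix \<omega> assume w: "\<omega> \<in> space M - C"
      show "good p \<eta> \<omega>" using B0(3) w by (auto simp: C_def)
      fix n i assume "n < L" "i \<in> cell n p \<omega>"
      moreover from this w have "\<omega> \<in> space M - Bn n" by (auto simp: C_def)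
      ultimately show "\<bar>gap p n i \<omega>\<bar> \<le> 2 * \<eta>" by (intro Bn(3))
    qed
  qed
qed

lemma grid_refine: "q \<le> p \<Longrightarrow> u q i = u p (i * 2 ^ (p - q))"
proof -
  assume "q \<le> p"
  then have "(2::real) ^ p = 2 ^ (p - q) * 2 ^ q" by (simp flip: power_add)
  then show ?thesis by simp
qed

lemma in_some_cell:
  assumes L: "0 < L" and i: "i \<le> S.N p" and al: "alive (u p i) \<omega>"
  shows "\<exists>n<L. i \<in> cell n p \<omega>"
proof (cases "i = S.N p")
  case True
  \<comment> \<open>The last grid point starts no cell; it is the right end of the last one.\<close>
  then have "i = (L - 1) * 2 ^ p + 2 ^ p" using L by (cases L) auto
  then show ?thesis using al L by (intro exI[of _ "L - 1"]) (auto simp only: cell_def, auto)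
next
  case False
  then have "i div 2 ^ p < L" using i by (simp add: less_mult_imp_div_less)
  moreover have "i div 2 ^ p * 2 ^ p \<le> i" "i \<le> i div 2 ^ p * 2 ^ p + 2 ^ p"
    using div_mult_mod_eq[of i "2 ^ p"] mod_less_divisor[of "2 ^ p" i, OF zero_less_power[OF pos2]] by linarith+
  ultimately show ?thesis using al by (intro exI[of _ "i div 2 ^ p"]) (simp only: cell_def mem_Collect_eq atLeastAtMost_iff simp_thms)
qed

text \<open>Fatou's lemma along good events whose complements are summable; the measurable majorant \<open>W\<close>
  makes measurability of \<open>V\<close> irrelevant.\<close>

lemma grid_error:
  assumes L: "0 < L"
  obtains W where "W \<in> borel_measurable M"
    and "(\<integral>\<^sup>+\<omega>. W \<omega> \<partial>M) \<le> ennreal (2 * (core (real L * \<delta>) * growth (real L * \<delta>)) * \<delta> ^ g)"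
    and "AE \<omega> in M. \<forall>p. \<forall>i\<le>S.N p. alive (u p i) \<omega> \<longrightarrow> ennreal ((X (D (u p i) \<omega>) \<omega> - V (D (u p i) \<omega>) \<omega>)\<^sup>2) \<le> W \<omega>"
proof -
  define U where "U = real L * \<delta>"
  \<comment> \<open>Tolerance and exceptional probability at once; its summability is for
    Borel-Cantelli.\<close>
  define eta where "eta m = (1 / 2 :: real) ^ m" for m
  have eta: "0 < eta m" for m by (simp add: eta_def)
  \<comment> \<open>Asking m <= p makes every fixed dyadic grid a part of the m-th chosen grid for
    large m.\<close>
  let ?Q = "\<lambda>m p B. m \<le> p \<and> B \<in> sets M \<and> measure M B < eta m \<and> (\<forall>\<omega>\<in>space M - B.
    good p (eta m) \<omega> \<and>
    (\<forall>n<L. \<forall>i\<in>cell n p \<omega>. \<bar>gap p n i \<omega>\<bar> \<le> 2 * eta m))"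
  have "\<exists>p B. ?Q m p B" for m
  proof -
    from good_grids[OF eta[of m] eta[of m]] obtain p0 where
      p0: "\<forall>p\<ge>p0. \<exists>B\<in>sets M. measure M B < eta m \<and> (\<forall>\<omega>\<in>space M - B.
      good p (eta m) \<omega> \<and>
      (\<forall>n<L. \<forall>i\<in>cell n p \<omega>. \<bar>gap p n i \<omega>\<bar> \<le> 2 * eta m))" by blast
    show ?thesis using p0[rule_format, of "max m p0"] by (intro exI[of _ "max m p0"]) auto
  qed
  then obtain p B where Q: "\<And>m. ?Q m (p m) (B m)" by metis
  define Z where "Z m = (\<lambda>(n, i) \<omega>. of_bool (good (p m) (eta m) \<omega>) * (S.eul (p m) i \<omega> - schin (p m) n i \<omega>))" for m
  define S where "S m \<omega> = (SUP q\<in>cells (2 ^ p m) L. ennreal ((Z m q \<omega>)\<^sup>2))" for m \<omega>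
  have Sm: "S m \<in> borel_measurable M" and Sb: "(\<integral>\<^sup>+\<omega>. S m \<omega> \<partial>M) \<le> ennreal ((core U * \<delta> ^ g + 4 * (eta m)\<^sup>2) * growth U)" for m
  proof -
    interpret W: taylor_walk M "Fp (p m)" "xi (p m)" "S.ep (p m)" f A R "2 ^ p m" L g x0 "hb (real L * \<delta>)" "kb (real L * \<delta>)" kap "real L * \<delta>" by (rule S.tw)
    have "Z m q \<in> borel_measurable M" if q: "q \<in> cells (2 ^ p m) L" for q
    proof -
      obtain n i where q': "q = (n, i)" "n * 2 ^ p m \<le> i" using q by (auto simp: cells_def)
      note [measurable] = W.H_meas_M[OF W.euler_meas[of i]] W.H_meas_M[OF W.scheme_in_meas[OF q'(2)]]
      have "Measurable.pred M (W.good (eta m) L)"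
        using W.good_meas[of "eta m" L] W.sub[of "L * 2 ^ p m"] by (meson measurable_from_subalg)
      note [measurable] = this
      show ?thesis unfolding Z_def q'(1) prod.case by measurable
    qed
    then show "S m \<in> borel_measurable M" unfolding S_def by (intro measurable_sup2) (auto simp: cells_def intro: countable_finite)
    have e: "real (2 ^ p m) * S.ep (p m) = \<delta>" by simp
    show "(\<integral>\<^sup>+\<omega>. S m \<omega> \<partial>M) \<le> ennreal ((core U * \<delta> ^ g + 4 * (eta m)\<^sup>2) * growth U)"
      using W.scheme_error[of "eta m"] eta[of m]
      unfolding sup2_def S_def Z_def e core_def growth_def U_def by simp
  qed
  have Qx: "AE \<omega> in M. eventually (\<lambda>m. \<omega> \<in> space M - B m) sequentially"
  proof (rule borel_cantelli_AE1)
    show "B m \<in> sets M" for m using Q by blast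
    show "emeasure M (B m) < \<infinity>" for m by (simp add: emeasure_eq_measure less_top[symmetric])
    show "summable (\<lambda>m. measure M (B m))"
    proof (rule summable_comparison_test')
      show "summable eta" unfolding eta_def by (intro summable_geometric) simp
      show "norm (measure M (B m)) \<le> eta m" for m using Q[of m] by simp
    qed
  qed
  \<comment> \<open>From (a + b)^2 <= 2 a^2 + 2 b^2 with |b| <= 2 \<open>eta m\<close>.
    \<open>S\<close> is a supremum over discrete processes, so this majorant is measurable.\<close>
  define W where "W \<omega> = liminf (\<lambda>m. 2 * S m \<omega> + ennreal (8 * (eta m)\<^sup>2))" for \<omega>
  have Sm': "(\<lambda>\<omega>. 2 * S m \<omega> + ennreal (8 * (eta m)\<^sup>2)) \<in> borel_measurable M" for m using Sm by simp
  have Wm: "W \<in> borel_measurable M" unfolding W_def using Sm' by (rule borel_measurable_liminf)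
  have eta0: "eta \<longlonglongrightarrow> 0" unfolding eta_def by (intro LIMSEQ_realpow_zero) auto
  define c where "c m = 2 * ((core U * \<delta> ^ g + 4 * (eta m)\<^sup>2) * growth U) + 8 * (eta m)\<^sup>2" for m
  have U0: "0 \<le> U" using dt by (simp add: U_def)
  have nn: "0 \<le> core U" "0 \<le> growth U" using U0 kap_nonneg by (auto simp: core_def growth_def)
  have intb: "(\<integral>\<^sup>+\<omega>. 2 * S m \<omega> + ennreal (8 * (eta m)\<^sup>2) \<partial>M) \<le> ennreal (c m)" for m
  proof -
    have "(\<integral>\<^sup>+\<omega>. 2 * S m \<omega> + ennreal (8 * (eta m)\<^sup>2) \<partial>M) = 2 * (\<integral>\<^sup>+\<omega>. S m \<omega> \<partial>M) + ennreal (8 * (eta m)\<^sup>2)"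
      using Sm by (simp add: nn_integral_add nn_integral_cmult emeasure_space_1)
    also have "\<dots> \<le> 2 * ennreal ((core U * \<delta> ^ g + 4 * (eta m)\<^sup>2) * growth U) + ennreal (8 * (eta m)\<^sup>2)"
      by (intro add_right_mono mult_left_mono Sb) auto
    also have "\<dots> = ennreal (c m)" unfolding c_def using nn dt
      by (subst ennreal_plus) (auto simp: ennreal_mult intro!: mult_nonneg_nonneg add_nonneg_nonneg)
    finally show ?thesis .
  qed
  have "c \<longlonglongrightarrow> 2 * ((core U * \<delta> ^ g + 4 * 0\<^sup>2) * growth U) + 8 * 0\<^sup>2"
    unfolding c_def by (intro tendsto_intros eta0)
  then have c: "(\<lambda>m. ennreal (c m)) \<longlonglongrightarrow> ennreal (2 * (core U * growth U) * \<delta> ^ g)"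
    by (intro tendsto_ennrealI) (simp add: mult_ac)
  have Wi: "(\<integral>\<^sup>+\<omega>. W \<omega> \<partial>M) \<le> ennreal (2 * (core U * growth U) * \<delta> ^ g)"
  proof -
    have "(\<integral>\<^sup>+\<omega>. W \<omega> \<partial>M) \<le> liminf (\<lambda>m. \<integral>\<^sup>+\<omega>. 2 * S m \<omega> + ennreal (8 * (eta m)\<^sup>2) \<partial>M)"
      unfolding W_def using Sm' by (rule nn_integral_liminf)
    also have "\<dots> \<le> liminf (\<lambda>m. ennreal (c m))" by (intro Liminf_mono always_eventually allI intb)
    also have "\<dots> = ennreal (2 * (core U * growth U) * \<delta> ^ g)" using c by (intro lim_imp_Liminf) auto
    finally show ?thesis .
  qed
  have "AE \<omega> in M. \<forall>q. \<forall>i\<le>S.N q. alive (u q i) \<omega> \<longrightarrow> ennreal ((X (D (u q i) \<omega>) \<omega> - V (D (u q i) \<omega>) \<omega>)\<^sup>2) \<le> W \<omega>"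
    using Qx
  proof eventually_elim
    case (elim \<omega>)
    show ?case
    proof (intro allI impI)
      fix q i assume i: "i \<le> S.N q" and al: "alive (u q i) \<omega>"
      show "ennreal ((X (D (u q i) \<omega>) \<omega> - V (D (u q i) \<omega>) \<omega>)\<^sup>2) \<le> W \<omega>"
        unfolding W_def
      proof (rule Liminf_bounded)
        show "\<forall>\<^sub>F m in sequentially. ennreal ((X (D (u q i) \<omega>) \<omega> - V (D (u q i) \<omega>) \<omega>)\<^sup>2) \<le> 2 * S m \<omega> + ennreal (8 * (eta m)\<^sup>2)"
          using elim eventually_ge_at_top[of q]
        proof eventually_elim
          case (elim m)
          \<comment> \<open>The same grid point on the finer grid \<open>p m\<close>.\<close>
          define j where "j = i * 2 ^ (p m - q)"
          have qp: "q \<le> p m" using Q[of m] elim(2) by linarith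
          have uj: "u q i = u (p m) j" unfolding j_def by (rule grid_refine[OF qp])
          have "j \<le> L * 2 ^ q * 2 ^ (p m - q)" unfolding j_def using i by (intro mult_right_mono) auto
          also have "\<dots> = S.N (p m)" using qp by (simp add: mult.assoc flip: power_add)
          finally have "j \<le> S.N (p m)" .
          from in_some_cell[OF L this] al obtain n where n: "n < L" "j \<in> cell n (p m) \<omega>" unfolding uj by blast
          define a b where "a = S.eul (p m) j \<omega> - schin (p m) n j \<omega>"
            and "b = gap (p m) n j \<omega>"
          have gd: "good (p m) (eta m) \<omega>" and b: "\<bar>b\<bar> \<le> 2 * eta m"
            using Q[of m] elim(1) n unfolding b_def by blast+
          have "b\<^sup>2 \<le> (2 * eta m)\<^sup>2" using power_mono[OF b, of 2] by simp
          moreover have "(a + b)\<^sup>2 \<le> 2 * a\<^sup>2 + 2 * b\<^sup>2" using sum_squares_bound[of a b] by (simp add: power2_sum)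
          ultimately have "(a + b)\<^sup>2 \<le> 2 * a\<^sup>2 + 8 * (eta m)\<^sup>2" by (simp add: power_mult_distrib)
          then have "ennreal ((a + b)\<^sup>2) \<le> ennreal (2 * a\<^sup>2 + 8 * (eta m)\<^sup>2)" by (rule ennreal_leI)
          also have "\<dots> = 2 * ennreal (a\<^sup>2) + ennreal (8 * (eta m)\<^sup>2)" by (simp add: ennreal_plus ennreal_mult)
          also have "\<dots> \<le> 2 * S m \<omega> + ennreal (8 * (eta m)\<^sup>2)"
          proof (intro add_right_mono mult_left_mono)
            have "(n, j) \<in> cells (2 ^ p m) L" using n by (simp add: cells_def cell_def)
            moreover have "a = Z m (n, j) \<omega>" using gd by (simp add: Z_def a_def)
            ultimately show "ennreal (a\<^sup>2) \<le> S m \<omega>" unfolding S_def by (intro SUP_upper2[of "(n, j)"]) auto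
          qed simp
          finally have "ennreal ((a + b)\<^sup>2) \<le> 2 * S m \<omega> + ennreal (8 * (eta m)\<^sup>2)" .
          moreover have "a + b = X (D (u q i) \<omega>) \<omega> - V (D (u q i) \<omega>) \<omega>" unfolding uj a_def b_def gap_def by simp
          ultimately show ?case by simp
        qed
      qed
    qed
  qed
  with Wm Wi show ?thesis unfolding U_def by (rule that)
qed

section \<open>From grid points to all times\<close>

lemma n_le_D_E: "nice \<omega> \<Longrightarrow> t \<le> D (E t \<omega>) \<omega>"
proof (rule ccontr)
  assume ni: "nice \<omega>" and "\<not> t \<le> D (E t \<omega>) \<omega>"
  then have "D (E t \<omega>) \<omega> < t" by simp
  moreover have "((\<lambda>u. D u \<omega>) \<longlongrightarrow> D (E t \<omega>) \<omega>) (at_right (E t \<omega>))"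
    using clock_path.rc[OF nice_clock[OF ni] n_E_nonneg[OF ni]] by (simp add: continuous_within)
  ultimately have "\<forall>\<^sub>F v in at_right (E t \<omega>). D v \<omega> < t" by (intro order_tendstoD)
  moreover have "\<forall>\<^sub>F v in at_right (E t \<omega>). t < D v \<omega>"
    using eventually_at_right_less by eventually_elim (rule n_less_D[OF ni])
  ultimately have "\<forall>\<^sub>F v in at_right (E t \<omega>). False" by eventually_elim simp
  then show False by (simp add: trivial_limit_at_right_real)
qed

lemma dyadic_between:
  fixes a b :: real
  assumes "0 \<le> a" "a < b"
  shows "\<exists>p i. a < u p i \<and> u p i < b"
proof -
  obtain p where p: "S.ep p \<le> (b - a) / 2" using S.ep_eventually_le[of "(b - a) / 2"] assms by auto
  define i where "i = nat (\<lfloor>a / S.ep p\<rfloor> + 1)"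
  have e: "0 < S.ep p" by (rule S.ep_pos)
  have "0 \<le> \<lfloor>a / S.ep p\<rfloor>" using assms e by (simp only: zero_le_floor divide_nonneg_pos)
  then have r: "real i = of_int \<lfloor>a / S.ep p\<rfloor> + 1" unfolding i_def by linarith
  have "a / S.ep p < real i" "real i \<le> a / S.ep p + 1" unfolding r by linarith+
  then have "a < real i * S.ep p" "real i * S.ep p \<le> (a / S.ep p + 1) * S.ep p"
    using e by (simp_all only: pos_divide_less_eq) (intro mult_right_mono, auto)
  moreover have "(a / S.ep p + 1) * S.ep p = a + S.ep p"
    using dt by (simp add: field_simps)
  ultimately have "a < u p i" "u p i \<le> a + S.ep p" by (simp_all only:)
  moreover have "a + S.ep p < b"
  proof -
    have "a + w < b" if "w \<le> (b - a) / 2" for w :: real using that assms by (simp add: field_simps)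
    from this[OF p] show ?thesis .
  qed
  ultimately have "a < u p i" "u p i < b" by (blast intro: le_less_trans)+
  then show ?thesis by blast
qed

text \<open>If E t > 0, then E t is approached from below by a dyadic point of the same coarse cell.
  There X - V is continuous and a function of \<open>E\<close>, so it hardly differs between t and
  the grid time.\<close>

lemma path_error:
  "AE \<omega> in M. E T \<omega> \<le> real L * \<delta> \<longrightarrow> (\<forall>t\<in>{0..T}. \<forall>\<eta>>0. \<exists>p. \<exists>i\<le>S.N p. alive (u p i) \<omega> \<and>
     \<bar>X t \<omega> - V t \<omega>\<bar> \<le> \<bar>X (D (u p i) \<omega>) \<omega> - V (D (u p i) \<omega>) \<omega>\<bar> + \<eta>)"
proof -
  obtain J where J: "AE \<omega> in M. \<forall>n<L. \<forall>s. D (real n * \<delta>) \<omega> \<le> s \<longrightarrow> s \<le> D (real (Suc n) * \<delta>) \<omega> \<longrightarrow> s \<le> T \<longrightarrow>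
       V s \<omega> = V (D (real n * \<delta>) \<omega>) \<omega> + (\<Sum>\<alpha>\<in>A - {[]}. J n \<alpha> s \<omega>)"
    "AE \<omega> in M. \<forall>n<L. \<forall>\<alpha>\<in>A - {[]}. continuous_on {0..T} (\<lambda>t. J n \<alpha> t \<omega>) \<and> (\<forall>s\<in>{0..T}. \<forall>t\<in>{0..T}. E s \<omega> = E t \<omega> \<longrightarrow> J n \<alpha> s \<omega> = J n \<alpha> t \<omega>)"
    by (rule scheme_limit) blast
  show ?thesis using AE_nice X_path J
  proof eventually_elim
    case (elim \<omega>)
    note ni = elim(1)
    show ?case
    proof (intro impI ballI allI)
      fix t \<eta> :: real assume ET: "E T \<omega> \<le> real L * \<delta>" and t: "t \<in> {0..T}" and \<eta>: "0 < \<eta>"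
      have e0: "0 \<le> E t \<omega>" by (rule n_E_nonneg[OF ni])
      show "\<exists>p. \<exists>i\<le>S.N p. alive (u p i) \<omega> \<and> \<bar>X t \<omega> - V t \<omega>\<bar> \<le> \<bar>X (D (u p i) \<omega>) \<omega> - V (D (u p i) \<omega>) \<omega>\<bar> + \<eta>"
      proof (cases "E t \<omega> = 0")
        case True
        \<comment> \<open>t <= D (E t) forces t = 0, and 0 is a grid point.\<close>
        then have "t = 0" using n_le_D_E[OF ni, of t] n_d0[OF ni] t by simp
        then show ?thesis using n_d0[OF ni] ni T_pos \<eta> by (intro exI[of _ 0]) (simp add: alive_def)
      next
        case False
        then have Et: "0 < E t \<omega>" using e0 by simp
        \<comment> \<open>Ceiling minus one: n \<delta> < E t <= (n + 1) \<delta>, strict on the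
          left so that there are grid points below E t inside the cell.\<close>
        define n where "n = nat (\<lceil>E t \<omega> / \<delta>\<rceil> - 1)"
        have "0 < E t \<omega> / \<delta>" using Et dt by simp
        then have rn: "real n = of_int \<lceil>E t \<omega> / \<delta>\<rceil> - 1" by (simp add: n_def)
        have "real n < E t \<omega> / \<delta>" "E t \<omega> / \<delta> \<le> real (Suc n)" unfolding of_nat_Suc rn by linarith+
        then have n: "real n * \<delta> < E t \<omega>" "E t \<omega> \<le> real (Suc n) * \<delta>" using dt by (simp_all only: pos_less_divide_eq pos_divide_le_eq)
        have "E t \<omega> \<le> real L * \<delta>" using n_E_mono[OF ni, of t T] t ET by simp
        with n(1) have "real n * \<delta> < real L * \<delta>" by linarith
        then have nL: "n < L" using dt by simp
        \<comment> \<open>X - V on the closed cell, extended to all of [0, T] through the integrals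
          \<open>J\<close>, since the uniform continuity in \<open>E\<close> is stated for paths on
          [0, T].\<close>
        define y where "y s = X s \<omega> - (V (D (real n * \<delta>) \<omega>) \<omega> + (\<Sum>\<alpha>\<in>A - {[]}. J n \<alpha> s \<omega>))" for s
        have yc: "continuous_on {0..T} y" unfolding y_def using elim(2,4) nL by (intro continuous_intros) auto
        have fl: "y s = y t" if "s \<in> {0..T}" "t \<in> {0..T}" "E s \<omega> = E t \<omega>" for s t
        proof -
          have "(\<Sum>\<alpha>\<in>A - {[]}. J n \<alpha> s \<omega>) = (\<Sum>\<alpha>\<in>A - {[]}. J n \<alpha> t \<omega>)"
            using elim(4) nL that by (intro sum.cong) blast+
          moreover have "X s \<omega> = X t \<omega>" using elim(2) that by blast
          ultimately show ?thesis by (simp add: y_def)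
        qed
        have yV: "y s = X s \<omega> - V s \<omega>" if "D (real n * \<delta>) \<omega> \<le> s" "s \<le> D (real (Suc n) * \<delta>) \<omega>" "s \<le> T" for s
          unfolding y_def using elim(3)[rule_format, OF nL that] by (simp only:)
        have Dn: "D (real n * \<delta>) \<omega> < t" using n_D_less[OF ni n_delta_nonneg n(1)] .
        have "D (E t \<omega>) \<omega> \<le> D (real (Suc n) * \<delta>) \<omega>" using n_d_le[OF ni e0 n(2)] .
        then have tn: "t \<le> D (real (Suc n) * \<delta>) \<omega>" using n_le_D_E[OF ni, of t] by linarith
        obtain \<zeta> where \<zeta>: "0 < \<zeta>" "\<And>s t. s \<in> {0..T} \<Longrightarrow> t \<in> {0..T} \<Longrightarrow> \<bar>E s \<omega> - E t \<omega>\<bar> \<le> \<zeta> \<Longrightarrow> \<bar>y s - y t\<bar> \<le> \<eta>"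
          using n_E_uniform[OF ni yc fl \<eta>] by blast
        obtain p i where pi: "max (real n * \<delta>) (E t \<omega> - \<zeta>) < u p i" "u p i < E t \<omega>"
          using dyadic_between[of "max (real n * \<delta>) (E t \<omega> - \<zeta>)" "E t \<omega>"] n(1) \<zeta>(1) n_delta_nonneg[of n] by (auto simp only: max_less_iff_conj le_max_iff_disj diff_less_eq less_add_same_cancel1)
        define s where "s = D (u p i) \<omega>"
        have st: "s < t" unfolding s_def by (rule n_D_less[OF ni u_nonneg pi(2)])
        have s0: "0 \<le> s" unfolding s_def by (rule n_D_nonneg[OF ni u_nonneg])
        have Es: "E s \<omega> = u p i" unfolding s_def by (rule n_E_D[OF ni u_nonneg])
        have sn: "D (real n * \<delta>) \<omega> \<le> s" unfolding s_def using pi(1) by (intro n_d_le[OF ni n_delta_nonneg]) linarith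
        have "\<bar>E t \<omega> - E s \<omega>\<bar> \<le> \<zeta>" unfolding Es using pi by linarith
        then have "\<bar>y t - y s\<bar> \<le> \<eta>" using st s0 t by (intro \<zeta>(2)) auto
        moreover have "y t = X t \<omega> - V t \<omega>" using Dn tn t by (intro yV) auto
        moreover have "y s = X s \<omega> - V s \<omega>" using sn st tn t by (intro yV) auto
        ultimately have "\<bar>X t \<omega> - V t \<omega>\<bar> \<le> \<bar>X s \<omega> - V s \<omega>\<bar> + \<eta>" by linarith
        moreover have "alive (u p i) \<omega>" using st t ni unfolding s_def by (simp add: alive_def)
        moreover have "i \<le> S.N p"
        proof -
          have "u p i < u p (S.N p)" using pi(2) \<open>E t \<omega> \<le> real L * \<delta>\<close> unfolding S.N_ep by linarith
          then show ?thesis unfolding u_less_iff by simp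
        qed
        ultimately show ?thesis unfolding s_def by blast
      qed
    qed
  qed
qed

end

section \<open>Summation over the values of the inverse subordinator\<close>

context clock_setting
begin

text \<open>Chernoff at s = (w n)^p with p = 1/(1 - b) and w = c / (2 T): then n \<psi>(s) >= n c
  s^b = 2 T s, so the exponent s T - n \<psi>(s) is at most - T s, a negative multiple of
  n^p.\<close>

lemma D_tail:
  assumes b: "0 \<le> b" "b < \<beta>" "b < 1"
  shows "\<exists>c>0. \<forall>\<^sub>F n in sequentially. measure M {\<omega>\<in>space M. D (real n) \<omega> \<le> T} \<le> exp (- c * real n powr (1 / (1 - b)))"
proof -
  obtain c s0 where c: "0 < c" "0 < s0" "\<And>s. s \<ge> s0 \<Longrightarrow> c * s powr b \<le> \<psi> s" using psi_lower[OF b(1,2)] by blast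
  define p where "p = 1 / (1 - b)"
  define w where "w = c / (2 * T)"
  have p: "0 < p" "p * (1 - b) = 1" and w: "0 < w" using b T_pos c by (auto simp: p_def w_def)
  have "filterlim (\<lambda>n. w * real n) at_top sequentially"
    by (intro filterlim_tendsto_pos_mult_at_top[OF tendsto_const w] filterlim_real_sequentially)
  then have "\<forall>\<^sub>F n in sequentially. s0 powr (1 / p) \<le> w * real n" by (simp add: filterlim_at_top)
  then have "\<forall>\<^sub>F n in sequentially. s0 \<le> (w * real n) powr p"
  proof eventually_elim
    case (elim n)
    have "(s0 powr (1 / p)) powr p \<le> (w * real n) powr p" using elim p by (intro powr_mono2) auto
    then show ?case using p c(2) by (simp add: powr_powr)
  qed
  then have "\<forall>\<^sub>F n in sequentially. measure M {\<omega>\<in>space M. D (real n) \<omega> \<le> T} \<le> exp (- (T * w powr p) * real n powr p)"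
    using eventually_gt_at_top[of 0]
  proof eventually_elim
    case (elim n)
    define s where "s = (w * real n) powr p"
    have n: "0 < real n" using elim by simp
    have s: "s0 \<le> s" "0 < s" using elim w c(2) by (auto simp: s_def)
    have "s powr (1 - b) = w * real n" using w n p by (simp add: s_def powr_powr)
    then have "s = w * real n * s powr b" using s powr_add[of s "1 - b" b] by simp
    moreover have "real n * (c * s powr b) \<le> real n * \<psi> s" using c(3)[OF s(1)] n by (intro mult_left_mono) auto
    moreover have "2 * T * w = c" using T_pos by (simp add: w_def)
    ultimately have "2 * T * s \<le> real n * \<psi> s" by (metis (no_types, opaque_lifting) mult.assoc mult.commute)
    then have "s * T - real n * \<psi> s \<le> - (T * s)" unfolding mult.commute[of s T] by linarith
    also have "T * s = T * w powr p * real n powr p" using w n by (simp add: s_def powr_mult)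
    finally have le: "exp (s * T - real n * \<psi> s) \<le> exp (- (T * w powr p) * real n powr p)" by simp
    show ?case by (rule order_trans[OF tail_bound[OF s(2)] le]) simp
  qed
  then show ?thesis unfolding p_def using T_pos w by (intro exI[of _ "T * w powr (1 / (1 - b))"]) auto
qed

end

context scheme_setting
begin

text \<open>The horizon n + 2 covers n + 1 + \<delta> for every step size below 1, so the constant
  does not depend on \<delta>.\<close>

definition step_const :: "nat \<Rightarrow> real" where
  "step_const n = core (real n + 2) * growth (real n + 2)"

lemma hb_mono: "0 \<le> U \<Longrightarrow> U \<le> U' \<Longrightarrow> hb U \<le> hb U'" and kb_mono: "0 \<le> U \<Longrightarrow> U \<le> U' \<Longrightarrow> kb U \<le> kb U'"
  unfolding hb_def kb_def using bounds unfolding coefficient_bounds_def mono_on_def by (intro sum_mono; simp)+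

lemma core_nonneg: "0 \<le> U \<Longrightarrow> 0 \<le> core U"
  using kap_nonneg by (simp add: core_def)

lemma core_growth_mono:
  assumes U: "0 \<le> U" "U \<le> U'"
  shows "core U * growth U \<le> core U' * growth U'"
proof -
  have hk: "(hb U)\<^sup>2 \<le> (hb U')\<^sup>2" "(kb U)\<^sup>2 \<le> (kb U')\<^sup>2"
    using hb_mono[OF U] kb_mono[OF U] hb_nonneg kb_nonneg U by (auto intro!: power_mono)
  have "core U \<le> core U'" unfolding core_def using U hk kap_nonneg
    by (intro mult_mono mult_nonneg_nonneg iffD2[OF exp_le_cancel_iff]) auto
  moreover have "growth U \<le> growth U'" unfolding growth_def using U hk kap_nonneg
    by (intro iffD2[OF exp_le_cancel_iff] mult_mono mult_nonneg_nonneg) auto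
  ultimately show ?thesis using U by (intro mult_mono core_nonneg) (auto simp: growth_def)
qed

lemma delta_power: "0 < \<delta> \<Longrightarrow> \<delta> ^ g = (\<delta> powr \<gamma>)\<^sup>2"
  using g_eq by (simp add: powr_powr mult.commute flip: powr_realpow powr_numeral)

text \<open>\<open>L\<close> is the least number of cells with L \<delta> >= n + 1. AM-GM in the
  form z <= a/2 + z^2/(2 a) holds for every weight a with the same \<open>W\<close>, so the weight
  can be chosen afterwards.\<close>

lemma step_bound:
  assumes \<delta>: "0 < \<delta>" "\<delta> < 1" and V: "ito_taylor_approx M \<G> B D E T F G x0 \<gamma> \<delta> V"
  obtains W where "W \<in> borel_measurable M" "(\<integral>\<^sup>+\<omega>. W \<omega> \<partial>M) \<le> ennreal (2 * step_const n * (\<delta> powr \<gamma>)\<^sup>2)"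
    "AE \<omega> in M. E T \<omega> \<le> real n + 1 \<longrightarrow> (\<forall>a>0. (SUP t\<in>{0..T}. ennreal \<bar>X t \<omega> - V t \<omega>\<bar>) \<le> ennreal (a / 2) + ennreal (1 / (2 * a)) * W \<omega>)"
proof -
  define L where "L = nat \<lceil>(real n + 1) / \<delta>\<rceil>"
  have "0 < (real n + 1) / \<delta>" using \<delta> by simp
  then have "(real n + 1) / \<delta> \<le> real L" "real L \<le> (real n + 1) / \<delta> + 1" "0 < L" unfolding L_def by linarith+
  then have L: "real n + 1 \<le> real L * \<delta>" "real L * \<delta> \<le> real n + 1 + \<delta>" "0 < L"
    using \<delta> by (simp_all add: field_simps)
  interpret P: scheme_step M \<F> B D E \<nu> \<G> T \<beta> F G h k \<gamma> x0 X \<delta> L V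
    by unfold_locales (use \<delta> V in auto)
  obtain W where W: "W \<in> borel_measurable M"
    "(\<integral>\<^sup>+\<omega>. W \<omega> \<partial>M) \<le> ennreal (2 * (core (real L * \<delta>) * growth (real L * \<delta>)) * \<delta> ^ g)"
    "AE \<omega> in M. \<forall>p. \<forall>i\<le>P.S.N p. alive (P.u p i) \<omega> \<longrightarrow> ennreal ((X (D (P.u p i) \<omega>) \<omega> - V (D (P.u p i) \<omega>) \<omega>)\<^sup>2) \<le> W \<omega>"
    using P.grid_error[OF L(3)] by blast
  show ?thesis
  proof (rule that[OF W(1)])
    have "core (real L * \<delta>) * growth (real L * \<delta>) \<le> step_const n"
      unfolding step_const_def using L \<delta> by (intro core_growth_mono) auto
    then have "2 * (core (real L * \<delta>) * growth (real L * \<delta>)) * \<delta> ^ g \<le> 2 * step_const n * (\<delta> powr \<gamma>)\<^sup>2"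
      unfolding delta_power[OF \<delta>(1)] by (intro mult_right_mono) auto
    with W(2) show "(\<integral>\<^sup>+\<omega>. W \<omega> \<partial>M) \<le> ennreal (2 * step_const n * (\<delta> powr \<gamma>)\<^sup>2)"
      by (rule order_trans[OF _ ennreal_leI])
    show "AE \<omega> in M. E T \<omega> \<le> real n + 1 \<longrightarrow> (\<forall>a>0. (SUP t\<in>{0..T}. ennreal \<bar>X t \<omega> - V t \<omega>\<bar>) \<le> ennreal (a / 2) + ennreal (1 / (2 * a)) * W \<omega>)"
      using W(3) P.path_error
    proof eventually_elim
      case (elim \<omega>)
      show ?case
      proof (intro impI allI SUP_least)
        fix a t :: real assume e: "E T \<omega> \<le> real n + 1" and a: "0 < a" and t: "t \<in> {0..T}"
        have e': "E T \<omega> \<le> real L * \<delta>" using e L by linarith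
        show "ennreal \<bar>X t \<omega> - V t \<omega>\<bar> \<le> ennreal (a / 2) + ennreal (1 / (2 * a)) * W \<omega>"
        proof (rule ennreal_le_epsilon)
          fix \<eta> :: real assume "0 < \<eta>"
          with elim(2) e' t obtain p i where i: "i \<le> P.S.N p" "alive (P.u p i) \<omega>"
            and le: "\<bar>X t \<omega> - V t \<omega>\<bar> \<le> \<bar>X (D (P.u p i) \<omega>) \<omega> - V (D (P.u p i) \<omega>) \<omega>\<bar> + \<eta>" by blast
          define z where "z = \<bar>X (D (P.u p i) \<omega>) \<omega> - V (D (P.u p i) \<omega>) \<omega>\<bar>"
          have z: "ennreal (z\<^sup>2) \<le> W \<omega>" using elim(1) i unfolding z_def power2_abs by blast
          have "z * (2 * a) \<le> a\<^sup>2 + z\<^sup>2" using sum_squares_bound[of a z] by (simp add: mult_ac)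
          then have "z \<le> a / 2 + 1 / (2 * a) * z\<^sup>2" using a by (simp add: field_simps power2_eq_square)
          with le have "\<bar>X t \<omega> - V t \<omega>\<bar> \<le> a / 2 + 1 / (2 * a) * z\<^sup>2 + \<eta>" unfolding z_def by linarith
          then have "ennreal \<bar>X t \<omega> - V t \<omega>\<bar> \<le> ennreal (a / 2 + 1 / (2 * a) * z\<^sup>2 + \<eta>)" by (rule ennreal_leI)
          also have "\<dots> = ennreal (a / 2) + ennreal (1 / (2 * a)) * ennreal (z\<^sup>2) + ennreal \<eta>"
            using a \<open>0 < \<eta>\<close> by (simp add: ennreal_plus flip: ennreal_mult)
          also have "\<dots> \<le> ennreal (a / 2) + ennreal (1 / (2 * a)) * W \<omega> + ennreal \<eta>"
            by (intro add_mono mult_left_mono z order_refl) auto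
          finally show "ennreal \<bar>X t \<omega> - V t \<omega>\<bar> \<le> ennreal (a / 2) + ennreal (1 / (2 * a)) * W \<omega> + ennreal \<eta>" .
        qed
      qed
    qed
  qed
qed

text \<open>The value of E T selects an n with D n <= T, and the majorant of this n bounds the
  supremum. Bounding it further by the sum of all majorants lets the expectation be taken term by
  term.\<close>

lemma strong_error_sum:
  assumes \<delta>: "0 < \<delta>" "\<delta> < 1" and V: "ito_taylor_approx M \<G> B D E T F G x0 \<gamma> \<delta> V"
    and a: "\<And>n. 0 < a n"
    and sm: "summable (\<lambda>n. a n / 2 * measure M {\<omega>\<in>space M. D (real n) \<omega> \<le> T} + step_const n / a n)"
  shows "strong_error M T X V \<le> ennreal ((\<Sum>n. a n / 2 * measure M {\<omega>\<in>space M. D (real n) \<omega> \<le> T} + step_const n / a n) * \<delta> powr \<gamma>)"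
proof -
  define S where "S n = {\<omega>\<in>space M. D (real n) \<omega> \<le> T}" for n
  define b where "b n = a n / 2 * measure M (S n) + step_const n / a n" for n
  have Sm: "S n \<in> sets M" for n unfolding S_def by simp
  have sc: "0 \<le> step_const n" for n by (simp add: step_const_def core_nonneg growth_def)
  have b0: "0 \<le> b n" for n unfolding b_def using a[of n] sc by (intro add_nonneg_nonneg mult_nonneg_nonneg divide_nonneg_pos) auto
  \<comment> \<open>The weight carries the factor \<delta>^\<gamma>, so that c/2 and \<delta>^(2
    \<gamma>) / c both become multiples of \<delta>^\<gamma>.\<close>
  define c where "c n = a n * \<delta> powr \<gamma>" for n
  have c0: "0 < c n" for n using a \<delta> by (simp add: c_def)
  have "\<exists>W. W \<in> borel_measurable M \<and> (\<integral>\<^sup>+\<omega>. W \<omega> \<partial>M) \<le> ennreal (2 * step_const n * (\<delta> powr \<gamma>)\<^sup>2) \<and>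
    (AE \<omega> in M. E T \<omega> \<le> real n + 1 \<longrightarrow> (\<forall>a>0. (SUP t\<in>{0..T}. ennreal \<bar>X t \<omega> - V t \<omega>\<bar>) \<le> ennreal (a / 2) + ennreal (1 / (2 * a)) * W \<omega>))" for n
    by (rule step_bound[OF \<delta> V, of n]) blast
  then have "\<forall>n. \<exists>W. W \<in> borel_measurable M \<and> (\<integral>\<^sup>+\<omega>. W \<omega> \<partial>M) \<le> ennreal (2 * step_const n * (\<delta> powr \<gamma>)\<^sup>2) \<and>
    (AE \<omega> in M. E T \<omega> \<le> real n + 1 \<longrightarrow> (\<forall>a>0. (SUP t\<in>{0..T}. ennreal \<bar>X t \<omega> - V t \<omega>\<bar>) \<le> ennreal (a / 2) + ennreal (1 / (2 * a)) * W \<omega>))"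
    by (rule allI)
  from choice[OF this] obtain W where W: "\<And>n. W n \<in> borel_measurable M" "\<And>n. (\<integral>\<^sup>+\<omega>. W n \<omega> \<partial>M) \<le> ennreal (2 * step_const n * (\<delta> powr \<gamma>)\<^sup>2)"
    "\<And>n. AE \<omega> in M. E T \<omega> \<le> real n + 1 \<longrightarrow> (\<forall>a>0. (SUP t\<in>{0..T}. ennreal \<bar>X t \<omega> - V t \<omega>\<bar>) \<le> ennreal (a / 2) + ennreal (1 / (2 * a)) * W n \<omega>)"
    by blast
  define Z where "Z n \<omega> = ennreal (c n / 2) * indicator (S n) \<omega> + ennreal (1 / (2 * c n)) * W n \<omega>" for n \<omega>
  have Zm: "Z n \<in> borel_measurable M" for n unfolding Z_def using Sm W(1) by measurable
  have Zi: "(\<integral>\<^sup>+\<omega>. Z n \<omega> \<partial>M) \<le> ennreal (b n * \<delta> powr \<gamma>)" for n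
  proof -
    have "(\<integral>\<^sup>+\<omega>. Z n \<omega> \<partial>M) = ennreal (c n / 2) * emeasure M (S n) + ennreal (1 / (2 * c n)) * (\<integral>\<^sup>+\<omega>. W n \<omega> \<partial>M)"
      unfolding Z_def using Sm W(1) by (simp add: nn_integral_add nn_integral_cmult)
    also have "\<dots> \<le> ennreal (c n / 2) * ennreal (measure M (S n)) + ennreal (1 / (2 * c n)) * ennreal (2 * step_const n * (\<delta> powr \<gamma>)\<^sup>2)"
      by (intro add_mono mult_left_mono W(2)) (auto simp: emeasure_eq_measure)
    also have "\<dots> = ennreal (c n / 2 * measure M (S n) + 1 / (2 * c n) * (2 * step_const n * (\<delta> powr \<gamma>)\<^sup>2))"
      using c0[of n] sc by (simp add: ennreal_plus flip: ennreal_mult)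
    also have "c n / 2 * measure M (S n) + 1 / (2 * c n) * (2 * step_const n * (\<delta> powr \<gamma>)\<^sup>2) = b n * \<delta> powr \<gamma>"
      using a[of n] \<delta> unfolding b_def c_def by (simp add: field_simps power2_eq_square)
    finally show ?thesis .
  qed
  have "strong_error M T X V \<le> (\<integral>\<^sup>+\<omega>. (\<Sum>n. Z n \<omega>) \<partial>M)"
    unfolding strong_error_def
  proof (rule nn_integral_mono_AE)
    have "AE \<omega> in M. \<forall>n. E T \<omega> \<le> real n + 1 \<longrightarrow> (\<forall>a>0. (SUP t\<in>{0..T}. ennreal \<bar>X t \<omega> - V t \<omega>\<bar>) \<le> ennreal (a / 2) + ennreal (1 / (2 * a)) * W n \<omega>)"
      using W(3) by (simp add: AE_all_countable)
    with AE_nice AE_space show "AE \<omega> in M. (SUP t\<in>{0..T}. ennreal \<bar>X t \<omega> - V t \<omega>\<bar>) \<le> (\<Sum>n. Z n \<omega>)"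
    proof eventually_elim
      case (elim \<omega>)
      \<comment> \<open>n < E T <= n + 1 if E T > 0; for E T = 0 the truncation in
        \<open>nat\<close> gives n = 0, where D 0 = 0 <= T.\<close>
      define n where "n = nat (\<lceil>E T \<omega>\<rceil> - 1)"
      have e0: "0 \<le> E T \<omega>" by (rule n_E_nonneg[OF elim(1)])
      have "D (real n) \<omega> \<le> T"
      proof (cases "E T \<omega> = 0")
        case True
        then show ?thesis using n_d0[OF elim(1)] T_pos by (simp add: n_def)
      next
        case False
        then have "real n < E T \<omega>" using e0 unfolding n_def by linarith
        from n_D_less[OF elim(1) _ this] show ?thesis by simp
      qed
      then have "\<omega> \<in> S n" using elim by (simp add: S_def)
      moreover have "E T \<omega> \<le> real n + 1" unfolding n_def by linarith
      ultimately have "(SUP t\<in>{0..T}. ennreal \<bar>X t \<omega> - V t \<omega>\<bar>) \<le> Z n \<omega>"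
        using elim(3) c0[of n] by (simp add: Z_def)
      also have "\<dots> = (\<Sum>i\<in>{n}. Z i \<omega>)" by simp
      also have "\<dots> \<le> (\<Sum>i. Z i \<omega>)" by (rule sum_le_suminf) auto
      finally show ?case .
    qed
  qed
  also have "\<dots> = (\<Sum>n. \<integral>\<^sup>+\<omega>. Z n \<omega> \<partial>M)" using Zm by (rule nn_integral_suminf)
  also have "\<dots> \<le> (\<Sum>n. ennreal (b n * \<delta> powr \<gamma>))" by (intro suminf_le Zi) auto
  also have "\<dots> = ennreal (\<Sum>n. b n * \<delta> powr \<gamma>)"
    using sm b0 \<delta> unfolding b_def S_def by (intro suminf_ennreal2 summable_mult2) auto
  also have "(\<Sum>n. b n * \<delta> powr \<gamma>) = (\<Sum>n. b n) * \<delta> powr \<gamma>"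
    using sm unfolding b_def S_def by (intro suminf_mult2[symmetric])
  finally show ?thesis unfolding b_def S_def .
qed

text \<open>The exponents are such that h^2 u^2 and log k are both of order u^r; these are the
  quantities that decide the growth of the error constants.\<close>

definition bounded_order :: "real \<Rightarrow> bool" where
  "bounded_order r \<longleftrightarrow> (\<forall>\<alpha>\<in>A - {[]}. \<exists>c. \<forall>u\<ge>1. h \<alpha> u \<le> c * u powr ((r - 2) / 2)) \<and>
     (\<forall>\<alpha>\<in>R. \<exists>c. \<forall>u\<ge>1. ln (k \<alpha> u) \<le> c * u powr r)"

section \<open>Growth of the error constants and choice of the weights\<close>

lemma hb_kb_order:
  assumes r: "2 \<le> r" "bounded_order r"
  obtains c where "0 \<le> c" "\<And>u. 1 \<le> u \<Longrightarrow> (hb u)\<^sup>2 * u\<^sup>2 \<le> c * u powr r" "\<And>u. 1 \<le> u \<Longrightarrow> kb u \<le> c * exp (c * u powr r)"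
proof -
  obtain H where H: "\<And>\<alpha> u. \<alpha> \<in> A - {[]} \<Longrightarrow> 1 \<le> u \<Longrightarrow> h \<alpha> u \<le> H \<alpha> * u powr ((r - 2) / 2)"
    using r(2) unfolding bounded_order_def bchoice_iff by blast
  obtain K where K: "\<And>\<alpha> u. \<alpha> \<in> R \<Longrightarrow> 1 \<le> u \<Longrightarrow> ln (k \<alpha> u) \<le> K \<alpha> * u powr r"
    using r(2) unfolding bounded_order_def bchoice_iff by blast
  define H' where "H' = (\<Sum>\<alpha>\<in>A - {[]}. H \<alpha>)"
  define K' where "K' = (\<Sum>\<alpha>\<in>R. \<bar>K \<alpha>\<bar>)"
  have K'0: "0 \<le> K'" unfolding K'_def by (intro sum_nonneg) auto
  have h: "(hb u)\<^sup>2 * u\<^sup>2 \<le> H'\<^sup>2 * u powr r" if u: "1 \<le> u" for u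
  proof -
    have "hb u \<le> H' * u powr ((r - 2) / 2)"
      unfolding hb_def H'_def sum_distrib_right using H u by (intro sum_mono) auto
    then have "(hb u)\<^sup>2 \<le> (H' * u powr ((r - 2) / 2))\<^sup>2" using hb_nonneg[of u] u by (intro power_mono) auto
    also have "\<dots> = H'\<^sup>2 * u powr (r - 2)" using u powr_power[of u "(r - 2) / 2" 2] by (simp add: power_mult_distrib diff_divide_distrib)
    finally have "(hb u)\<^sup>2 * u\<^sup>2 \<le> H'\<^sup>2 * u powr (r - 2) * u\<^sup>2" by (intro mult_right_mono) auto
    also have "\<dots> = H'\<^sup>2 * u powr r" using u powr_add[of u "r - 2" 2] by simp
    finally show ?thesis .
  qed
  have k: "kb u \<le> card R * exp (K' * u powr r)" if u: "1 \<le> u" for u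
  proof -
    have "k \<alpha> u \<le> exp (K' * u powr r)" if a: "\<alpha> \<in> R" for \<alpha>
    proof -
      have "0 < k \<alpha> u" using bounds a u unfolding coefficient_bounds_def by simp
      then have "k \<alpha> u = exp (ln (k \<alpha> u))" by simp
      moreover have "ln (k \<alpha> u) \<le> K' * u powr r"
      proof (rule order_trans[OF K[OF a u]], rule mult_right_mono)
        have "\<bar>K \<alpha>\<bar> \<le> K'" unfolding K'_def using a finite_R by (intro member_le_sum) auto
        then show "K \<alpha> \<le> K'" by simp
      qed simp
      ultimately show ?thesis by (metis exp_le_cancel_iff)
    qed
    then have "kb u \<le> (\<Sum>\<alpha>\<in>R. exp (K' * u powr r))" unfolding kb_def by (rule sum_mono)
    then show ?thesis by simp
  qed
  define c where "c = H'\<^sup>2 + card R + K'"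
  show ?thesis
  proof (rule that[of c])
    show "0 \<le> c" using K'0 by (simp add: c_def)
    fix u :: real assume u: "1 \<le> u"
    have "H'\<^sup>2 * u powr r \<le> c * u powr r" unfolding c_def using K'0 by (intro mult_right_mono) auto
    then show "(hb u)\<^sup>2 * u\<^sup>2 \<le> c * u powr r" using h[OF u] by linarith
    have "card R * exp (K' * u powr r) \<le> c * exp (c * u powr r)"
      unfolding c_def using K'0 by (intro mult_mono iffD2[OF exp_le_cancel_iff] mult_right_mono) auto
    then show "kb u \<le> c * exp (c * u powr r)" using k[OF u] by linarith
  qed
qed

lemma step_const_order:
  assumes r: "2 \<le> r" "bounded_order r"
  obtains C where "0 \<le> C" "\<And>n. step_const n \<le> C * exp (C * (real n + 2) powr r)"
proof -
  obtain c where c: "0 \<le> c" "\<And>u. 1 \<le> u \<Longrightarrow> (hb u)\<^sup>2 * u\<^sup>2 \<le> c * u powr r" "\<And>u. 1 \<le> u \<Longrightarrow> kb u \<le> c * exp (c * u powr r)"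
    by (rule hb_kb_order[OF r]) blast
  \<comment> \<open>One summand of the exponent for each exponential below: 2 from (u + 1) u, 2 c
    from the square of \<open>kb\<close>, 72 c from the moment of the Euler process, 4
    \<open>kap\<close> c from the Gronwall factor. The power u^r dominates u^2 because r >=
    2.\<close>
  define C where "C = 16 * kap * c\<^sup>2 * (1 + 2 * x0\<^sup>2) + (2 + 2 * c + 72 * c + 4 * kap * c)"
  have k0: "0 \<le> kap" by (rule kap_nonneg)
  have le: "core u * growth u \<le> C * exp (C * u powr r)" if u: "1 \<le> u" for u
  proof -
    define w where "w = u powr r"
    have u2w: "u\<^sup>2 \<le> w" using u r powr_mono[of 2 r u] by (simp add: w_def)
    have w1: "1 \<le> w" using u2w one_le_power[OF u, of 2] by linarith
    have hu: "(hb u)\<^sup>2 * u\<^sup>2 \<le> c * w" using c(2)[OF u] by (simp add: w_def)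
    have "u * 1 \<le> u * u" using u by (intro mult_left_mono) auto
    then have uu: "u \<le> u\<^sup>2" by (simp add: power2_eq_square)
    have "8 * (u + 8) * (hb u)\<^sup>2 * u = (8 * u\<^sup>2 + 64 * u) * (hb u)\<^sup>2" by (simp add: algebra_simps power2_eq_square)
    also have "\<dots> \<le> (72 * u\<^sup>2) * (hb u)\<^sup>2" using uu by (intro mult_right_mono) auto
    also have "\<dots> = 72 * ((hb u)\<^sup>2 * u\<^sup>2)" by simp
    also have "\<dots> \<le> 72 * (c * w)" using hu by simp
    finally have e1: "8 * (u + 8) * (hb u)\<^sup>2 * u \<le> 72 * c * w" by simp
    have "2 * kap * (u + 1) * (hb u)\<^sup>2 * u = (2 * kap) * ((u\<^sup>2 + u) * (hb u)\<^sup>2)" by (simp add: algebra_simps power2_eq_square)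
    also have "\<dots> \<le> (2 * kap) * (2 * (c * w))"
    proof (intro mult_left_mono)
      have "(u\<^sup>2 + u) * (hb u)\<^sup>2 \<le> (2 * u\<^sup>2) * (hb u)\<^sup>2" using uu by (intro mult_right_mono) auto
      also have "\<dots> = 2 * ((hb u)\<^sup>2 * u\<^sup>2)" by simp
      finally show "(u\<^sup>2 + u) * (hb u)\<^sup>2 \<le> 2 * (c * w)" using hu by simp
    qed (use k0 in auto)
    finally have e2: "2 * kap * (u + 1) * (hb u)\<^sup>2 * u \<le> 4 * kap * c * w" by simp
    have "(kb u)\<^sup>2 \<le> (c * exp (c * w))\<^sup>2" using c(3)[OF u] kb_nonneg[of u] u by (intro power_mono) (auto simp: w_def)
    also have "\<dots> = c\<^sup>2 * exp (2 * c * w)" by (simp add: power_mult_distrib mult.assoc flip: exp_double)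
    finally have e3: "(kb u)\<^sup>2 \<le> c\<^sup>2 * exp (2 * c * w)" .
    have "(u + 1) * u = u\<^sup>2 + u" by (simp add: algebra_simps power2_eq_square)
    then have "(u + 1) * u \<le> 2 * w" using uu u2w by linarith
    also have "\<dots> \<le> 2 * exp (2 * w)" using exp_ge_add_one_self[of w] exp_le_cancel_iff[of w "2 * w"] w1 by linarith
    finally have e4: "(u + 1) * u \<le> 2 * exp (2 * w)" .
    have "core u = 8 * kap * ((u + 1) * u) * (kb u)\<^sup>2 * ((1 + 2 * x0\<^sup>2) * exp (8 * (u + 8) * (hb u)\<^sup>2 * u))"
      by (simp add: core_def mult.assoc)
    also have "\<dots> \<le> 8 * kap * (2 * exp (2 * w)) * (c\<^sup>2 * exp (2 * c * w)) * ((1 + 2 * x0\<^sup>2) * exp (72 * c * w))"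
      by (rule mult_mono[OF mult_mono[OF mult_left_mono[OF e4] e3] mult_left_mono[OF iffD2[OF exp_le_cancel_iff e1]]])
        (use k0 in \<open>auto intro!: mult_nonneg_nonneg\<close>)
    finally have "core u * growth u \<le> (8 * kap * (2 * exp (2 * w)) * (c\<^sup>2 * exp (2 * c * w)) * ((1 + 2 * x0\<^sup>2) * exp (72 * c * w))) * exp (4 * kap * c * w)"
      unfolding growth_def using e2 k0 by (intro mult_mono mult_nonneg_nonneg) auto
    also have "\<dots> = (16 * kap * c\<^sup>2 * (1 + 2 * x0\<^sup>2)) * exp ((2 + 2 * c + 72 * c + 4 * kap * c) * w)"
    proof -
      have "exp ((2 + 2 * c + 72 * c + 4 * kap * c) * w) = exp (2 * w) * exp (2 * c * w) * exp (72 * c * w) * exp (4 * kap * c * w)"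
        by (simp only: distrib_right exp_add)
      then show ?thesis by (simp only:) simp
    qed
    also have "\<dots> \<le> C * exp (C * w)"
      unfolding C_def using k0 c(1) w1 by (intro mult_mono iffD2[OF exp_le_cancel_iff]) auto
    finally show ?thesis unfolding w_def .
  qed
  show ?thesis
  proof (rule that[of C])
    show "0 \<le> C" using k0 c(1) by (simp add: C_def)
    show "step_const n \<le> C * exp (C * (real n + 2) powr r)" for n
      unfolding step_const_def by (rule le) simp
  qed
qed

text \<open>Divide by n^p: (n + 2)^r <= (3 n)^r for n >= 1, and the powers r - p and 1 - p are
  negative. The extra summand n will produce a geometric series.\<close>

lemma powr_dominates:
  assumes "1 < p" "0 \<le> r" "r < p" "0 < c"
  shows "\<forall>\<^sub>F n in sequentially. C * (real n + 2) powr r + real n \<le> c * real n powr p"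
proof -
  have lim: "((\<lambda>x. \<bar>C\<bar> * 3 powr r * x powr (r - p) + x powr (1 - p)) \<longlongrightarrow> \<bar>C\<bar> * 3 powr r * 0 + 0) at_top"
    using assms by (intro tendsto_intros tendsto_neg_powr filterlim_ident) auto
  have "\<forall>\<^sub>F x in at_top. \<bar>C\<bar> * 3 powr r * x powr (r - p) + x powr (1 - p) < c"
    using order_tendstoD(2)[OF lim, of c] assms by simp
  from eventually_compose_filterlim[OF this filterlim_real_sequentially]
  show ?thesis using eventually_gt_at_top[of 0]
  proof eventually_elim
    case (elim n)
    define x where "x = real n"
    have x: "1 \<le> x" using elim by (simp add: x_def)
    have "C * (x + 2) powr r \<le> \<bar>C\<bar> * (3 * x) powr r"
      using x assms by (intro mult_mono powr_mono2) auto
    also have "\<dots> = \<bar>C\<bar> * 3 powr r * x powr (r - p) * x powr p" using x by (simp add: powr_mult flip: powr_add)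
    finally have "C * (x + 2) powr r + x \<le> (\<bar>C\<bar> * 3 powr r * x powr (r - p) + x powr (1 - p)) * x powr p"
      using x by (simp add: distrib_right flip: powr_add)
    also have "\<dots> \<le> c * x powr p" using elim by (intro mult_right_mono) (auto simp: x_def)
    finally show ?case by (simp add: x_def)
  qed
qed

text \<open>r (1 - \<beta>) < 1 leaves room for some b < \<beta> with p = 1/(1 - b) > r. The weight
  uses half of the tail exponent: the tail probability still beats the weight, and the weight beats
  the growth of the constants because r < p.\<close>

lemma strong_rate:
  assumes r: "2 \<le> r" "bounded_order r" "r * (1 - \<beta>) < 1" "\<beta> < 1"
  obtains K where "0 < K" "\<And>\<delta> V. 0 < \<delta> \<Longrightarrow> \<delta> < 1 \<Longrightarrow> ito_taylor_approx M \<G> B D E T F G x0 \<gamma> \<delta> V \<Longrightarrow>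
    strong_error M T X V \<le> ennreal (K * \<delta> powr \<gamma>)"
proof -
  obtain C where C: "0 \<le> C" "\<And>n. step_const n \<le> C * exp (C * (real n + 2) powr r)" by (rule step_const_order[OF r(1,2)]) blast
  have "1 - 1 / r < \<beta>" using r by (simp add: field_simps)
  moreover have "0 \<le> 1 - 1 / r" using r by simp
  ultimately obtain b where b: "1 - 1 / r < b" "b < \<beta>" "0 \<le> b" using dense[of "1 - 1 / r" \<beta>] by fastforce
  define p where "p = 1 / (1 - b)"
  have "1 - b < 1 / r" using b by simp
  then have rp: "r < p" unfolding p_def using b r by (simp add: field_simps)
  obtain c where c: "0 < c" "\<forall>\<^sub>F n in sequentially. measure M {\<omega>\<in>space M. D (real n) \<omega> \<le> T} \<le> exp (- c * real n powr p)"
    using D_tail[OF b(3,2)] b(2) r(4) unfolding p_def by auto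
  define a where "a n = exp (c / 2 * real n powr p)" for n :: nat
  define t where "t n = a n / 2 * measure M {\<omega>\<in>space M. D (real n) \<omega> \<le> T} + step_const n / a n" for n
  have sc: "0 \<le> step_const n" for n by (simp add: step_const_def core_nonneg growth_def)
  have t0: "0 \<le> t n" for n unfolding t_def using sc by (intro add_nonneg_nonneg mult_nonneg_nonneg divide_nonneg_pos) (auto simp: a_def)
  have "\<forall>\<^sub>F n in sequentially. C * (real n + 2) powr r + real n \<le> c / 2 * real n powr p"
    using rp r c by (intro powr_dominates) auto
  with c(2) have "\<forall>\<^sub>F n in sequentially. norm (t n) \<le> (1 + C) * exp (- 1) ^ n"
  proof eventually_elim
    case (elim n)
    have en: "exp (- 1) ^ n = exp (- real n)" by (simp flip: exp_of_nat_mult)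
    have "a n / 2 * measure M {\<omega>\<in>space M. D (real n) \<omega> \<le> T} \<le> a n / 2 * exp (- c * real n powr p)"
      using elim(1) by (intro mult_left_mono) (auto simp: a_def)
    also have "\<dots> = exp (- (c / 2 * real n powr p)) / 2" unfolding a_def by (simp flip: exp_add)
    also have "\<dots> \<le> exp (- real n)"
    proof -
      have "0 \<le> C * (real n + 2) powr r" using C(1) by simp
      then have "exp (- (c / 2 * real n powr p)) \<le> exp (- real n)" using elim(2) by simp
      then show ?thesis using exp_gt_zero[of "- (c / 2 * real n powr p)"] by linarith
    qed
    finally have 1: "a n / 2 * measure M {\<omega>\<in>space M. D (real n) \<omega> \<le> T} \<le> exp (- real n)" .
    have "step_const n / a n \<le> C * exp (C * (real n + 2) powr r) / a n" using C(2)[of n] by (intro divide_right_mono) (auto simp: a_def)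
    also have "\<dots> = C * exp (C * (real n + 2) powr r - c / 2 * real n powr p)" by (simp add: a_def exp_diff)
    also have "\<dots> \<le> C * exp (- real n)" using elim(2) C(1) by (intro mult_left_mono) auto
    finally show ?case using 1 t0[of n] unfolding en t_def by (simp add: distrib_right)
  qed
  moreover have "summable (\<lambda>n. (1 + C) * exp (- 1 :: real) ^ n)" by (intro summable_mult summable_geometric) simp
  ultimately have sm: "summable t" by (rule summable_comparison_test_ev)
  show ?thesis
  \<comment> \<open>Adding 1 makes the constant positive.\<close>
  proof (rule that[of "suminf t + 1"])
    show "0 < suminf t + 1" using suminf_nonneg[OF sm t0] by simp
    fix \<delta> V assume d: "0 < \<delta>" "\<delta> < 1" and V: "ito_taylor_approx M \<G> B D E T F G x0 \<gamma> \<delta> V"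
    have "strong_error M T X V \<le> ennreal (suminf t * \<delta> powr \<gamma>)"
      using strong_error_sum[OF d V, of a] sm unfolding t_def by (simp add: a_def)
    also have "\<dots> \<le> ennreal ((suminf t + 1) * \<delta> powr \<gamma>)" by (intro ennreal_leI mult_right_mono) auto
    finally show "strong_error M T X V \<le> ennreal ((suminf t + 1) * \<delta> powr \<gamma>)" .
  qed
qed

text \<open>A constant c is at most |c| u^s for u >= 1 and s >= 0, so every r >= 2 is
  admissible.\<close>

lemma bounded_order_const:
  assumes "2 \<le> r" "\<forall>\<alpha>\<in>A - {[]}. \<exists>c. \<forall>u\<ge>0. h \<alpha> u = c" "\<forall>\<alpha>\<in>R. \<exists>c. \<forall>u\<ge>0. k \<alpha> u = c"
  shows "bounded_order r"
proof -
  have p: "1 \<le> u powr s" if "1 \<le> u" "0 \<le> s" for u s :: real using that by (rule ge_one_powr_ge_zero)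
  have le: "c \<le> \<bar>c\<bar> * u powr s" if "1 \<le> u" "0 \<le> s" for c u s :: real
    using mult_left_mono[OF p[OF that], of "\<bar>c\<bar>"] by simp
  show ?thesis unfolding bounded_order_def
  proof (intro conjI ballI)
    fix \<alpha> assume "\<alpha> \<in> A - {[]}"
    then obtain c where "\<And>u. 0 \<le> u \<Longrightarrow> h \<alpha> u = c" using assms(2) by blast
    then show "\<exists>c. \<forall>u\<ge>1. h \<alpha> u \<le> c * u powr ((r - 2) / 2)" using le assms(1) by (intro exI[of _ "\<bar>c\<bar>"]) auto
  next
    fix \<alpha> assume "\<alpha> \<in> R"
    then obtain c where "\<And>u. 0 \<le> u \<Longrightarrow> k \<alpha> u = c" using assms(3) by blast
    then show "\<exists>c. \<forall>u\<ge>1. ln (k \<alpha> u) \<le> c * u powr r" using le[of _ r "ln c"] assms(1) by (intro exI[of _ "\<bar>ln c\<bar>"]) auto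
  qed
qed

text \<open>A monotone function of regular variation is dominated by any power above its index, and
  2 q + 2 < r means q < (r - 2)/2.\<close>

lemma bounded_order_rv:
  assumes h: "\<And>\<alpha>. \<alpha> \<in> A - {[]} \<Longrightarrow> regularly_varying (h \<alpha>) (q \<alpha>)" "\<And>\<alpha>. \<alpha> \<in> A - {[]} \<Longrightarrow> 2 * q \<alpha> + 2 < r"
    and k: "\<And>\<alpha>. \<alpha> \<in> R \<Longrightarrow> regularly_varying (\<lambda>u. ln (k \<alpha> u)) (q' \<alpha>)" "\<And>\<alpha>. \<alpha> \<in> R \<Longrightarrow> q' \<alpha> < r"
    and r: "2 \<le> r"
  shows "bounded_order r"
  unfolding bounded_order_def
proof (intro conjI ballI)
  fix \<alpha> assume a: "\<alpha> \<in> A - {[]}"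
  have "\<exists>c>0. \<forall>s\<ge>1. h \<alpha> s \<le> c * s powr ((r - 2) / 2)"
  proof (rule doubling_upper)
    show "((\<lambda>s. h \<alpha> (2 * s) / h \<alpha> s) \<longlongrightarrow> 2 powr q \<alpha>) at_top" "\<And>s. 0 < s \<Longrightarrow> 0 < h \<alpha> s" using h(1)[OF a] by (auto simp: regularly_varying_def)
    show "h \<alpha> s \<le> h \<alpha> t" if "0 < s" "s \<le> t" for s t
      using bounds a that unfolding coefficient_bounds_def by (auto simp: mono_on_def)
  qed (use h(2)[OF a] r in auto)
  then show "\<exists>c. \<forall>u\<ge>1. h \<alpha> u \<le> c * u powr ((r - 2) / 2)" by blast
next
  fix \<alpha> assume a: "\<alpha> \<in> R"
  have "\<exists>c>0. \<forall>s\<ge>1. ln (k \<alpha> s) \<le> c * s powr r"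
  proof (rule doubling_upper)
    show "((\<lambda>s. ln (k \<alpha> (2 * s)) / ln (k \<alpha> s)) \<longlongrightarrow> 2 powr q' \<alpha>) at_top" "\<And>s. 0 < s \<Longrightarrow> 0 < ln (k \<alpha> s)"
      using k(1)[OF a] by (auto simp: regularly_varying_def)
    show "ln (k \<alpha> s) \<le> ln (k \<alpha> t)" if "0 < s" "s \<le> t" for s t
    proof -
      have "k \<alpha> s \<le> k \<alpha> t" "0 < k \<alpha> s" using bounds a that unfolding coefficient_bounds_def by (auto simp: mono_on_def)
      then show ?thesis by simp
    qed
  qed (use k(2)[OF a] r in auto)
  then show "\<exists>c. \<forall>u\<ge>1. ln (k \<alpha> u) \<le> c * u powr r" by blast
qed

end

section \<open>The theorem on the completed product space\<close>

lemma driven_clock_setting: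
  assumes setting: "driven_setting MB MD M \<F> B D \<nu>"
    and "E = first_passage D" "\<G> = time_changed_filtration M \<F> E" "0 < T"
    and "0 < \<beta>" "regularly_varying (laplace_exponent \<nu>) \<beta>"
  shows "clock_setting M \<F> B D E \<nu> \<G> T \<beta>"
proof -
  have P: "prob_space MB" "prob_space MD" and M: "M = completion (MB \<Otimes>\<^sub>M MD)"
    using setting by (auto simp: driven_setting_def product_setting_def)
  have "prob_space (MB \<Otimes>\<^sub>M MD)" by (rule prob_space_pair[OF P])
  then have "prob_space M" unfolding M by (rule prob_space.prob_space_completion)
  moreover have "complete_measure M" unfolding M by (rule completion.complete_measure_axioms)
  ultimately show ?thesis
    using setting assms(2-)
    by (auto simp: clock_setting_def clock_setting_axioms_def driven_setting_def)
qed

theorem theorem5p2: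
  fixes MB :: "'b measure" and MD :: "'d measure" and M :: "('b \<times> 'd) measure"
    and \<F> \<G> :: "real \<Rightarrow> ('b \<times> 'd) measure"
    and B D E :: "real \<Rightarrow> 'b \<times> 'd \<Rightarrow> real"
    and \<nu> :: "real measure"
    and T x0 \<gamma> \<beta> :: real
    and F G :: "real \<Rightarrow> real \<Rightarrow> real"
    and h k :: "nat list \<Rightarrow> real \<Rightarrow> real"
    and X :: "real \<Rightarrow> 'b \<times> 'd \<Rightarrow> real"
    and Xd :: "real \<Rightarrow> real \<Rightarrow> 'b \<times> 'd \<Rightarrow> real"
  assumes setting: "driven_setting MB MD M \<F> B D \<nu>"
    and E: "E = first_passage D"
    and \<G>: "\<G> = time_changed_filtration M \<F> E"
    and T: "0 < T"
    and \<gamma>: "0 < \<gamma>" "2 * \<gamma> \<in> \<nat>"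
    and cont: "jointly_continuous F" "jointly_continuous G"
    and bounds: "coefficient_bounds \<gamma> F G h k"
    and X: "solves_SDE M \<G> B E T F G x0 X"
    and \<beta>: "0 < \<beta>" "\<beta> < 1" "regularly_varying (laplace_exponent \<nu>) \<beta>"
    and Xd: "\<And>\<delta>. 0 < \<delta> \<Longrightarrow> \<delta> < 1 \<Longrightarrow> ito_taylor_approx M \<G> B D E T F G x0 \<gamma> \<delta> (Xd \<delta>)"
  shows
    "(\<forall>q q'.
        (\<forall>\<alpha>\<in>A_set \<gamma> - {[]}. 0 \<le> q \<alpha> \<and> regularly_varying (h \<alpha>) (q \<alpha>)) \<longrightarrow>
        (\<forall>\<alpha>\<in>R_set \<gamma>. 0 \<le> q' \<alpha> \<and> regularly_varying (\<lambda>u. ln (k \<alpha> u)) (q' \<alpha>)) \<longrightarrow>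
        (q_star \<gamma> q q' - 1) / q_star \<gamma> q q' < \<beta> \<longrightarrow>
        (\<exists>C>0. \<forall>\<delta>\<in>{0<..<1}. strong_error M T X (Xd \<delta>) \<le> ennreal (C * \<delta> powr \<gamma>)) \<and>
        converges_strongly M T X Xd \<gamma>) \<and>
     ((\<forall>\<alpha>\<in>A_set \<gamma> - {[]}. \<exists>c. \<forall>u\<ge>0. h \<alpha> u = c) \<longrightarrow>
        (\<forall>\<alpha>\<in>R_set \<gamma>. \<exists>c. \<forall>u\<ge>0. k \<alpha> u = c) \<longrightarrow>
        1 / 2 < \<beta> \<longrightarrow>
        (\<exists>C>0. \<forall>\<delta>\<in>{0<..<1}. strong_error M T X (Xd \<delta>) \<le> ennreal (C * \<delta> powr \<gamma>)) \<and>
        converges_strongly M T X Xd \<gamma>)"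
proof -
  interpret clock_setting M \<F> B D E \<nu> \<G> T \<beta>
    by (rule driven_clock_setting[OF setting E \<G> T \<beta>(1,3)])
  interpret scheme_setting M \<F> B D E \<nu> \<G> T \<beta> F G h k \<gamma> x0 X
    by unfold_locales (use \<gamma> cont bounds X in auto)
  have rate: "(\<exists>C>0. \<forall>\<delta>\<in>{0<..<1}. strong_error M T X (Xd \<delta>) \<le> ennreal (C * \<delta> powr \<gamma>)) \<and> converges_strongly M T X Xd \<gamma>"
    if r: "2 \<le> r" "bounded_order r" "r * (1 - \<beta>) < 1" for r
  proof -
    obtain K where "0 < K" "\<And>\<delta> V. 0 < \<delta> \<Longrightarrow> \<delta> < 1 \<Longrightarrow> ito_taylor_approx M \<G> B D E T F G x0 \<gamma> \<delta> V \<Longrightarrow>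
      strong_error M T X V \<le> ennreal (K * \<delta> powr \<gamma>)" by (rule strong_rate[OF r \<beta>(2)]) blast
    then have K: "0 < K" "\<And>\<delta>. \<delta> \<in> {0<..<1} \<Longrightarrow> strong_error M T X (Xd \<delta>) \<le> ennreal (K * \<delta> powr \<gamma>)" using Xd by auto
    then show ?thesis unfolding converges_strongly_def using zero_less_one by blast
  qed
  show ?thesis
  proof (intro conjI[of "\<forall>q q'. _ q q'"] allI impI)
    fix q q'
    assume q: "\<forall>\<alpha>\<in>A_set \<gamma> - {[]}. 0 \<le> q \<alpha> \<and> regularly_varying (h \<alpha>) (q \<alpha>)"
      and q': "\<forall>\<alpha>\<in>R_set \<gamma>. 0 \<le> q' \<alpha> \<and> regularly_varying (\<lambda>u. ln (k \<alpha> u)) (q' \<alpha>)"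
      and qs: "(q_star \<gamma> q q' - 1) / q_star \<gamma> q q' < \<beta>"
    have qa: "2 * q \<alpha> + 2 \<le> q_star \<gamma> q q'" if "\<alpha> \<in> A_set \<gamma> - {[]}" for \<alpha>
      using that finite_A_set unfolding q_star_def by (intro max.coboundedI1 Max_ge) auto
    have qr: "q' \<alpha> \<le> q_star \<gamma> q q'" if "\<alpha> \<in> R_set \<gamma>" for \<alpha>
      using that finite_R unfolding q_star_def by (intro max.coboundedI2 Max_ge) auto
    \<comment> \<open>The index \<open>[0]\<close> is always in \<open>A\<close> and gives 2 q + 2
      >= 2, so \<open>q_star\<close> is positive and the condition on \<beta> can be solved for
      it.\<close>
    have q2: "2 \<le> q_star \<gamma> q q'" using qa[of "[0]"] q A_base by force
    then have "q_star \<gamma> q q' < 1 / (1 - \<beta>)" using qs \<beta> by (simp add: field_simps)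
    \<comment> \<open>The strict inequality leaves room for an exponent above \<open>q_star\<close>,
      as regular variation loses an arbitrarily small power.\<close>
    then obtain r where r: "q_star \<gamma> q q' < r" "r < 1 / (1 - \<beta>)" using dense by blast
    have "bounded_order r"
      using q q' qa qr r(1) q2 by (intro bounded_order_rv[of q r q']) (meson le_less_trans | simp)+
    then show "(\<exists>C>0. \<forall>\<delta>\<in>{0<..<1}. strong_error M T X (Xd \<delta>) \<le> ennreal (C * \<delta> powr \<gamma>)) \<and> converges_strongly M T X Xd \<gamma>"
      using r q2 \<beta> by (intro rate[of r]) (auto simp: field_simps)
  next
    assume "\<forall>\<alpha>\<in>A_set \<gamma> - {[]}. \<exists>c. \<forall>u\<ge>0. h \<alpha> u = c" "\<forall>\<alpha>\<in>R_set \<gamma>. \<exists>c. \<forall>u\<ge>0. k \<alpha> u = c" "1 / 2 < \<beta>"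
    \<comment> \<open>r = 2 turns r (1 - \<beta>) < 1 into \<beta> > 1/2.\<close>
    then show "(\<exists>C>0. \<forall>\<delta>\<in>{0<..<1}. strong_error M T X (Xd \<delta>) \<le> ennreal (C * \<delta> powr \<gamma>)) \<and> converges_strongly M T X Xd \<gamma>"
      by (intro rate[of 2] bounded_order_const) auto
  qed
qed

end
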